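(* Consider a simple arrangement and a generic direction $\hat{\mathbf r}$, let $G$ be a polynomial, let $\boldsymbol\sigma$ be a contributing point in the stratum of codimension $s$ defined by the vanishing of $\ell_{k_1},\dots,\ell_{k_s}$ (so $S(\boldsymbol\sigma)=\{k_1,\dots,k_s\}$), and let $\mathcal J(\boldsymbol\sigma)=\langle \ell_{k_1}^{p_{k_1}},\dots,\ell_{k_s}^{p_{k_s}}\rangle$ be its annihilating ideal in the polynomial ring $\mathbb C[z_1,\dots,z_d]$. (i) If $G\in\mathcal J(\boldsymbol\sigma)$ then $\Phi_{\boldsymbol\sigma}$ has neighbourhood exponential growth rate in direction $\hat{\mathbf r}$ strictly less than $h_{\hat{\mathbf r}}(\boldsymbol\sigma)$. Hence, if all other critical points $\boldsymbol\sigma'$ with $h_{\hat{\mathbf r}}(\boldsymbol\sigma')\ge h_{\hat{\mathbf r}}(\boldsymbol\sigma)$ are ruled out, then $\overline\beta(\hat{\mathbf r})<h_{\hat{\mathbf r}}(\boldsymbol\sigma)$. (ii) If $G\notin\mathcal J(\boldsymbol\sigma)$ then $\Phi_{\boldsymbol\sigma}$ has neighbourhood exponential growth rate in direction $\hat{\mathbf r}$ at least $h_{\hat{\mathbf r}}(\boldsymbol\sigma)$. In other words, if all critical points $\boldsymbol\sigma'$ with $h_{\hat{\mathbf r}}(\boldsymbol\sigma')>h_{\hat{\mathbf r}}(\boldsymbol\sigma)$ are ruled out, then $\overline\beta(\hat{\mathbf r})=h_{\hat{\mathbf r}}(\boldsymbol\sigma)$.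
   Context: Setting. $F=G/\prod_{j=1}^m\ell_j^{p_j}$ with power series coefficients $a_{\mathbf s}=[\mathbf z^{\mathbf s}]F$ at the origin, where $\ell_j(\mathbf z)=1-\sum_ib^{(j)}_iz_i$ are pairwise distinct, $\mathbf b^{(j)}\in\mathbb R^d\setminus\{0\}$, $p_j\ge1$ integers, and no $\ell_j$ divides $G$. For nonempty $S\subseteq\{1,\dots,m\}$, the flat $\mathcal V_S$ is $\{\mathbf z\in\mathbb C^d:\ell_k(\mathbf z)=0\ \forall k\in S\}$ when nonempty; the arrangement is simple if $(\mathbf b^{(k)})_{k\in S}$ is linearly independent whenever $\mathcal V_S\neq\emptyset$. $S(\boldsymbol\sigma)=\{j:\ell_j(\boldsymbol\sigma)=0\}$; the stratum of a flat is the flat minus its proper subflats. Critical points. $\hat{\mathbf r}\in\mathbb R_{>0}^d$ with $\sum\hat r_j=1$; $h_{\hat{\mathbf r}}(\mathbf z)=-\sum_j\hat r_j\log|z_j|$ on $(\mathbb C\setminus\{0\})^d$. A critical point of a flat is a point of the flat with nonzero coordinates at which the differential of $h_{\hat{\mathbf r}}$ restricted to the flat vanishes (zero-dimensional flats are trivially critical); all critical points are real. $\hat{\mathbf r}$ is generic if no point is a critical point of two distinct flats. A critical point $\boldsymbol\sigma$ is contributing if $(\hat r_1/\sigma_1,\dots,\hat r_d/\sigma_d)\in N(\boldsymbol\sigma)=\{\sum_{j\in S(\boldsymbol\sigma)}c_j\mathbf b^{(j)}:c_j>0\}$. A critical point $\boldsymbol\sigma'$ is ruled out if it is not contributing or if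 $G\in\mathcal J(\boldsymbol\sigma')$, where $\mathcal J(\boldsymbol\sigma')=\langle\ell_j^{p_j}:j\in S(\boldsymbol\sigma')\rangle$. Contribution $\Phi_{\boldsymbol\sigma}$. Let $\mathcal M_{\mathbb R}$ be the set of points of $\mathbb R^d$ with all coordinates nonzero and all $\ell_j\ne0$. For a connected component $B$ of $\mathcal M_{\mathbb R}$ and any $\mathbf x\in B$, let $\operatorname{sgn}(B)=\operatorname{sgn}(x_1\cdots x_d)$ and $\operatorname{sgn}_{\boldsymbol\sigma}(B)=\operatorname{sgn}\prod_{j\in S(\boldsymbol\sigma)}\ell_j(\mathbf x)$. For $\mathbf s\in\mathbb N^d$ with all coordinates sufficiently large, $$\Phi_{\boldsymbol\sigma}(\mathbf s)=\frac1{(2\pi i)^d}\sum_{B:\,\boldsymbol\sigma\in\overline B}\operatorname{sgn}(B)\operatorname{sgn}_{\boldsymbol\sigma}(B)\int_{\mathbf x_B+i\mathbb R^d}F(\mathbf z)\,\mathbf z^{-\mathbf s-\mathbf 1}\,d\mathbf z,$$ where $\mathbf x_B\in B$ is arbitrary and $\mathbf x_B+i\mathbb R^d$ has the standard orientation of $\mathbb R^d$; i.e. the Cauchy integral over the linking torus of $\boldsymbol\sigma$. Growth rates. The neighbourhood exponential rate of an array $(c_{\mathbf s})$ in direction $\hat{\mathbf r}$ is $\limsup_{\mathbf s\to\infty,\ \mathbf s/|\mathbf s|\to\hat{\mathbf r}}\frac1{|\mathbf s|}\log|c_{\mathbf s}|$ with $|\mathbf s|=s_1+\dots+s_d$, $\log0=-\infty$;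 $\overline\beta(\hat{\mathbf r})$ denotes that of $(a_{\mathbf s})$. *)

theory Defs
  imports "HOL-Analysis.Analysis" "HOL-Library.Poly_Mapping"
begin

text \<open>
  The dimension $d$ is the cardinality of the finite index type \<open>'n\<close>. An arrangement of $m$ hyperplanes
  is given by \<open>m :: nat\<close> and coefficient vectors \<open>b j :: real ^ 'n\<close> for \<open>j \<in> {1..m}\<close>, with exponents
  \<open>p j\<close>; values of \<open>b\<close> and \<open>p\<close> outside \<open>{1..m}\<close> are irrelevant.
\<close>

section \<open>Polynomials in the variables indexed by \<open>'n\<close>\<close>

type_synonym 'n cpoly = "('n \<Rightarrow>\<^sub>0 nat) \<Rightarrow>\<^sub>0 complex"

definition poly_eval :: "'n::finite cpoly \<Rightarrow> complex ^ 'n \<Rightarrow> complex" where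
  "poly_eval P z = (\<Sum>\<mu>\<in>Poly_Mapping.keys P. Poly_Mapping.lookup P \<mu> *
     (\<Prod>i\<in>UNIV. (z $ i) ^ Poly_Mapping.lookup \<mu> i))"

definition ell_poly :: "real ^ 'n \<Rightarrow> 'n::finite cpoly" where
  "ell_poly v = 1 - (\<Sum>i\<in>UNIV. Poly_Mapping.single (Poly_Mapping.single i 1) (complex_of_real (v $ i)))"

text \<open>The same linear form as a function; it is used both on real and on complex points.\<close>

definition ell :: "real ^ 'n \<Rightarrow> ('a::real_algebra_1) ^ 'n::finite \<Rightarrow> 'a" where
  "ell v z = 1 - (\<Sum>i\<in>UNIV. of_real (v $ i) * z $ i)"

definition power_ideal :: "(nat \<Rightarrow> real ^ 'n) \<Rightarrow> (nat \<Rightarrow> nat) \<Rightarrow> nat set \<Rightarrow> 'n::finite cpoly set" where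
  "power_ideal b p K = {\<Sum>j\<in>K. q j * ell_poly (b j) ^ p j | q. True}"

definition ratfun ::
    "nat \<Rightarrow> (nat \<Rightarrow> real ^ 'n) \<Rightarrow> (nat \<Rightarrow> nat) \<Rightarrow> 'n::finite cpoly \<Rightarrow> complex ^ 'n \<Rightarrow> complex" where
  "ratfun m b p G z = poly_eval G z / (\<Prod>j\<in>{1..m}. ell (b j) z ^ p j)"

text \<open>The array \<open>a\<close> of power series coefficients at the origin is determined by absolute (unordered)
  convergence of the series to \<open>F\<close> on some polydisc.\<close>

definition has_power_series_at_0 ::
    "(complex ^ 'n::finite \<Rightarrow> complex) \<Rightarrow> (nat ^ 'n \<Rightarrow> complex) \<Rightarrow> bool" where
  "has_power_series_at_0 F a \<longleftrightarrow>
     (\<exists>\<epsilon>>0. \<forall>z. (\<forall>i. cmod (z $ i) < \<epsilon>) \<longrightarrow>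
        ((\<lambda>s. a s * (\<Prod>i\<in>UNIV. (z $ i) ^ (s $ i))) has_sum F z) UNIV)"

section \<open>Flats and strata\<close>

definition flat :: "(nat \<Rightarrow> real ^ 'n) \<Rightarrow> nat set \<Rightarrow> (complex ^ 'n::finite) set" where
  "flat b S = {z. \<forall>k\<in>S. ell (b k) z = 0}"

definition flats :: "nat \<Rightarrow> (nat \<Rightarrow> real ^ 'n) \<Rightarrow> (complex ^ 'n::finite) set set" where
  "flats m b = {flat b S | S. S \<noteq> {} \<and> S \<subseteq> {1..m} \<and> flat b S \<noteq> {}}"

definition stratum :: "nat \<Rightarrow> (nat \<Rightarrow> real ^ 'n) \<Rightarrow> (complex ^ 'n::finite) set \<Rightarrow> (complex ^ 'n) set" where
  "stratum m b V = V - \<Union>{W \<in> flats m b. W \<subset> V}"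

text \<open>Injectivity on \<open>S\<close> makes this linear independence of the family rather than of its image set.\<close>

definition simple_arrangement :: "nat \<Rightarrow> (nat \<Rightarrow> real ^ 'n::finite) \<Rightarrow> bool" where
  "simple_arrangement m b \<longleftrightarrow>
     (\<forall>S. S \<noteq> {} \<and> S \<subseteq> {1..m} \<and> flat b S \<noteq> {} \<longrightarrow> inj_on b S \<and> independent (b ` S))"

definition active_set :: "nat \<Rightarrow> (nat \<Rightarrow> real ^ 'n) \<Rightarrow> complex ^ 'n::finite \<Rightarrow> nat set" where
  "active_set m b \<sigma> = {j \<in> {1..m}. ell (b j) \<sigma> = 0}"

section \<open>Critical points\<close>

definition height :: "real ^ 'n \<Rightarrow> complex ^ 'n::finite \<Rightarrow> real" where
  "height r z = - (\<Sum>i\<in>UNIV. r $ i * ln (cmod (z $ i)))"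

text \<open>The derivative is taken within the flat \<open>V\<close>. If \<open>V\<close> is a single point the filter
  \<open>at z within V\<close> is trivial, so zero-dimensional flats are critical automatically.\<close>

definition critical_on :: "real ^ 'n \<Rightarrow> (complex ^ 'n::finite) set \<Rightarrow> complex ^ 'n \<Rightarrow> bool" where
  "critical_on r V z \<longleftrightarrow>
     z \<in> V \<and> (\<forall>i. z $ i \<noteq> 0) \<and> (height r has_derivative (\<lambda>_. 0)) (at z within V)"

definition critical_point ::
    "nat \<Rightarrow> (nat \<Rightarrow> real ^ 'n) \<Rightarrow> real ^ 'n \<Rightarrow> complex ^ 'n::finite \<Rightarrow> bool" where
  "critical_point m b r z \<longleftrightarrow> (\<exists>V\<in>flats m b. critical_on r V z)"

definition generic_direction :: "nat \<Rightarrow> (nat \<Rightarrow> real ^ 'n) \<Rightarrow> real ^ 'n::finite \<Rightarrow> bool" where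
  "generic_direction m b r \<longleftrightarrow>
     \<not> (\<exists>z. \<exists>V\<in>flats m b. \<exists>W\<in>flats m b. V \<noteq> W \<and> critical_on r V z \<and> critical_on r W z)"

definition cvec :: "real ^ 'n \<Rightarrow> complex ^ 'n::finite" where
  "cvec x = (\<chi> i. complex_of_real (x $ i))"

definition normal_cone :: "nat \<Rightarrow> (nat \<Rightarrow> real ^ 'n) \<Rightarrow> complex ^ 'n::finite \<Rightarrow> (real ^ 'n) set" where
  "normal_cone m b \<sigma> =
     {\<Sum>j\<in>active_set m b \<sigma>. c j *\<^sub>R b j | c. \<forall>j\<in>active_set m b \<sigma>. c j > 0}"

definition contributing ::
    "nat \<Rightarrow> (nat \<Rightarrow> real ^ 'n) \<Rightarrow> real ^ 'n \<Rightarrow> complex ^ 'n::finite \<Rightarrow> bool" where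
  "contributing m b r \<sigma> \<longleftrightarrow> critical_point m b r \<sigma> \<and>
     (\<chi> i. complex_of_real (r $ i) / \<sigma> $ i) \<in> cvec ` normal_cone m b \<sigma>"

definition ruled_out ::
    "nat \<Rightarrow> (nat \<Rightarrow> real ^ 'n) \<Rightarrow> (nat \<Rightarrow> nat) \<Rightarrow> 'n::finite cpoly \<Rightarrow> real ^ 'n \<Rightarrow> complex ^ 'n \<Rightarrow> bool" where
  "ruled_out m b p G r \<sigma> \<longleftrightarrow>
     \<not> contributing m b r \<sigma> \<or> G \<in> power_ideal b p (active_set m b \<sigma>)"

section \<open>The contribution of a point\<close>

definition real_complement :: "nat \<Rightarrow> (nat \<Rightarrow> real ^ 'n) \<Rightarrow> (real ^ 'n::finite) set" where
  "real_complement m b = {x. (\<forall>i. x $ i \<noteq> 0) \<and> (\<forall>j\<in>{1..m}. ell (b j) x \<noteq> 0)}"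

text \<open>Integral of \<open>f(z) dz\<close> over \<open>x + i \<real>\<^sup>d\<close>, parametrised by $z = x + iy$ with
  $dz = i^d\,dy$. It is absolutely convergent for the integrands below once all coordinates of
  the exponent \<open>s\<close> are large.\<close>

definition imaginary_fibre_integral ::
    "real ^ 'n::finite \<Rightarrow> (complex ^ 'n \<Rightarrow> complex) \<Rightarrow> complex" where
  "imaginary_fibre_integral x f =
     \<i> ^ CARD('n) * (\<integral>y. f (\<chi> i. Complex (x $ i) (y $ i)) \<partial>(lborel :: (real ^ 'n) measure))"

text \<open>The function \<open>\<xi>\<close> chooses a base point $x_B$ in each connected component $B$ of the real complement.
  Components are sets of real vectors and \<open>\<sigma>\<close> is a complex vector, hence \<open>closure (cvec ` B)\<close>.\<close>

definition contribution ::
    "nat \<Rightarrow> (nat \<Rightarrow> real ^ 'n) \<Rightarrow> (nat \<Rightarrow> nat) \<Rightarrow> 'n::finite cpoly \<Rightarrow>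
     ((real ^ 'n) set \<Rightarrow> real ^ 'n) \<Rightarrow> complex ^ 'n \<Rightarrow> nat ^ 'n \<Rightarrow> complex" where
  "contribution m b p G \<xi> \<sigma> s =
     1 / (2 * complex_of_real pi * \<i>) ^ CARD('n) *
     (\<Sum>B\<in>{B \<in> components (real_complement m b). \<sigma> \<in> closure (cvec ` B)}.
        complex_of_real (sgn (\<Prod>i\<in>UNIV. \<xi> B $ i)) *
        complex_of_real (sgn (\<Prod>j\<in>active_set m b \<sigma>. ell (b j) (\<xi> B))) *
        imaginary_fibre_integral (\<xi> B)
          (\<lambda>z. ratfun m b p G z * (\<Prod>i\<in>UNIV. (z $ i) powi (- int (s $ i) - 1))))"

section \<open>Neighbourhood exponential rate\<close>

definition multi_size :: "nat ^ 'n::finite \<Rightarrow> nat" where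
  "multi_size s = (\<Sum>i\<in>UNIV. s $ i)"

text \<open>The filter of multi-indices with $|s| \to \infty$ and $s/|s| \to r$.\<close>

definition direction_filter :: "real ^ 'n \<Rightarrow> (nat ^ 'n::finite) filter" where
  "direction_filter r =
     inf (filtercomap multi_size at_top)
         (filtercomap (\<lambda>s. \<chi> i. real (s $ i) / real (multi_size s)) (nhds r))"

definition nbhd_rate :: "real ^ 'n \<Rightarrow> (nat ^ 'n::finite \<Rightarrow> complex) \<Rightarrow> ereal" where
  "nbhd_rate r c = Limsup (direction_filter r)
     (\<lambda>s. if c s = 0 then - \<infinity> else ereal (ln (cmod (c s)) / real (multi_size s)))"

end

theory Submission imports Defs begin

text \<open>
  The proof turns every object of the theorem into a finite sum of \<^emph>\<open>fibre integrals\<close>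
  $(2\pi)^{-d}\int_{x+i\mathbb{R}^d}\prod_j \ell_j^{-q_j}\,z^{-s-1}\,dy$ and evaluates these as real integrals.
  Each factor $\ell_j^{-q_j}$ is a Gamma integral in a variable $t_j$ that has the sign of $\ell_j(x)$. The exponent is
  then linear in $z$, the variables $z_i$ separate, and each of the remaining one-dimensional integrals is a Laplace
  inversion: it is zero unless $u_i x_i > 0$ and otherwise produces $u_i^{s_i}/s_i!$, where $u = \sum_j t_j b_j$
  (\<open>exp_kernel\<close>, \<open>fibre_eq_dual_integral\<close>). So a fibre integral depends only on the signs of the coordinates and of
  the forms at $x$, and it is $O(|x|^{-s})$. Expanding $e^{u\cdot z}$ in the Gamma integrals at the origin identifies the
  power series coefficients with a signed sum of fibre integrals, one for each orthant
  (\<open>coefficients_signed_fibres\<close>); the contribution of a point is such a sum by definition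
  (\<open>contribution_eq_fibres\<close>). The numerator acts on arrays by shifting the exponents.

  A rate below \<open>h\<close> amounts to an exponential bound with a smaller rate on a cone around the direction
  (\<open>nbhd_rate_less_iff_decays\<close>). Arrays with such a bound are preserved by the shifts and by the operators that
  represent partial derivatives.

  \<^emph>\<open>Numerators in the ideal.\<close> A multiple of $\ell_k^{p_k}$ cancels the form $\ell_k$ from the denominator. The fibre
  integrals on the two sides of that wall then agree, while they enter the contribution with opposite signs. Thus the
  contribution is eventually zero (\<open>star_vanishing\<close>).

  \<^emph>\<open>Numerators outside the ideal.\<close> Expand \<open>G\<close> in monomials of affine forms that extend the forms vanishing at
  the point. These monomials give simultaneous eigenvectors of Euler operators, so a decay of the array would pass to a
  single monomial outside the ideal and from there to the array with simple poles (\<open>decays_simple_poles\<close>). But that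
  array cannot decay: at even exponents the weighted real integrals are nonnegative, and one of them, restricted to a
  unit box at $n$ times the coefficients of $r/\sigma$ in the normal cone, already has the rate of the point
  (\<open>dual_integral_lower_bound\<close>). The same argument applies to the coefficients themselves.

  \<^emph>\<open>Upper bound for the coefficients.\<close> In a fixed orthant, Moebius inversion writes the fibre integral in the chamber
  where all forms are positive as a sum over index sets \<open>T\<close>. Attach to \<open>T\<close> the minimiser \<open>y\<close> of the height on the
  polyhedron where the forms in \<open>T\<close> are nonnegative, or of a slight perturbation if the height is unbounded below
  there. By the first order conditions, the sets with the same
  minimiser form an interval, and their terms collapse to an alternating sum over the chambers around \<open>y\<close> on the
  walls with positive multiplier (\<open>sum_moebius_part\<close>). Such a sum is small if \<open>y\<close> is low, since all chambers
  reach \<open>y\<close>. If \<open>y\<close> is high then, by genericity, \<open>y\<close> is a contributing point and its walls are exactly those with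
  positive multiplier (\<open>multipliers_contributing\<close>), so the sum vanishes when \<open>G\<close> lies in the ideal of \<open>y\<close>
  (\<open>fibre_decays_by_minimisers\<close>).
\<close>


section \<open>One-dimensional integrals\<close>

text \<open>The fundamental theorem on the whole line; this is how integration by parts enters below.\<close>

lemma integral_derivative_line:
  fixes F f :: "real \<Rightarrow> complex"
  assumes F: "\<And>y. (F has_vector_derivative f y) (at y)"
    and c: "\<And>y. isCont f y" and i: "integrable lborel f"
    and "(F \<longlongrightarrow> 0) at_top" "(F \<longlongrightarrow> 0) at_bot"
  shows "(\<integral>y. f y \<partial>lborel) = 0"
proof -
  have "(LBINT x=-\<infinity>..\<infinity>. f x) = 0 - 0"
    by (rule interval_integral_FTC_integrable[where F=F])
       (use assms in \<open>auto simp: ereal_tendsto_simps set_integrable_def\<close>)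
  then show ?thesis
    by (simp add: interval_lebesgue_integral_def set_lebesgue_integral_def)
qed

lemma integral_inverse_sq_plus:
  fixes x :: real
  assumes "x \<noteq> 0"
  shows "integrable lborel (\<lambda>y. 1 / (x^2 + y^2))"
    and "(\<integral>y. 1 / (x^2 + y^2) \<partial>lborel) = pi / \<bar>x\<bar>"
proof -
  let ?f = "\<lambda>y. 1 / (x^2 + y^2) :: real" and ?F = "\<lambda>y. arctan (y / \<bar>x\<bar>) / \<bar>x\<bar>"
  have pos: "x^2 + y^2 > 0" for y
    using assms by (simp add: add_pos_nonneg)
  have D: "DERIV ?F y :> ?f y" for y
  proof -
    define r where "r = \<bar>x\<bar>"
    have r: "r > 0" "x^2 = r^2" using assms by (auto simp: r_def)
    have "DERIV (\<lambda>y. arctan (y / r) / r) y :> (inverse (1 + (y / r)^2) * (1 / r)) / r"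
      using r by (auto intro!: derivative_eq_intros)
    moreover have "(inverse (1 + (y / r)^2) * (1 / r)) / r = 1 / (r^2 + y^2)"
    proof -
      have "inverse (1 + (y / r)^2) = r^2 / (r^2 + y^2)"
        using r(1) by (simp add: power_divide field_simps)
      then show ?thesis using r(1) by (simp add: power2_eq_square)
    qed
    ultimately show ?thesis unfolding r(2) by (simp add: r_def)
  qed
  have lim: "(?F \<longlongrightarrow> (pi/2) / \<bar>x\<bar>) at_top" "(?F \<longlongrightarrow> (-(pi/2)) / \<bar>x\<bar>) at_bot"
  proof -
    have "filterlim (\<lambda>y. inverse \<bar>x\<bar> * y) at_top at_top" "filterlim (\<lambda>y. inverse \<bar>x\<bar> * y) at_bot at_bot"
      using assms
      by (auto intro!: filterlim_ident filterlim_tendsto_pos_mult_at_bot[OF tendsto_const]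
           filterlim_tendsto_pos_mult_at_top[OF tendsto_const])
    then have "filterlim (\<lambda>y. y / \<bar>x\<bar>) at_top at_top" "filterlim (\<lambda>y. y / \<bar>x\<bar>) at_bot at_bot"
      by (simp_all add: divide_inverse mult.commute)
    then show "(?F \<longlongrightarrow> (pi/2) / \<bar>x\<bar>) at_top" "(?F \<longlongrightarrow> (-(pi/2)) / \<bar>x\<bar>) at_bot"
      using assms
      by (intro tendsto_divide filterlim_compose[OF tendsto_arctan_at_top]
        filterlim_compose[OF tendsto_arctan_at_bot] tendsto_const; simp)+
  qed
  have cont: "isCont ?f y" for y
    using pos[of y] by (auto intro!: continuous_intros)
  have 1: "set_integrable lborel (einterval (-\<infinity>) \<infinity>) ?f"
    by (rule interval_integral_FTC_nonneg(1)[where F="?F" and A="(-(pi/2)) / \<bar>x\<bar>" and B="(pi/2) / \<bar>x\<bar>"])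
       (use D cont lim pos in \<open>auto simp: ereal_tendsto_simps less_imp_le\<close>)
  have 2: "(LBINT x=-\<infinity>..\<infinity>. ?f x) = (pi/2) / \<bar>x\<bar> - (-(pi/2)) / \<bar>x\<bar>"
    by (rule interval_integral_FTC_nonneg(2)[where F="?F" and A="(-(pi/2)) / \<bar>x\<bar>" and B="(pi/2) / \<bar>x\<bar>"])
       (use D cont lim pos in \<open>auto simp: ereal_tendsto_simps less_imp_le\<close>)
  show "integrable lborel ?f"
    using 1 by (simp add: set_integrable_def)
  show "(\<integral>y. ?f y \<partial>lborel) = pi / \<bar>x\<bar>"
    using 2 by (simp add: interval_lebesgue_integral_def set_lebesgue_integral_def)
qed

lemma inverse_power_integrable:
  fixes x :: real
  assumes "x \<noteq> 0" "k \<ge> 2"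
  shows "integrable lborel (\<lambda>y. inverse (Complex x y) ^ k)"
    and "(\<integral>y. norm (inverse (Complex x y) ^ k) \<partial>lborel) \<le> pi * inverse \<bar>x\<bar> ^ (k - 1)"
proof -
  have nz: "Complex x y \<noteq> 0" for y
    using assms by (simp add: complex_eq_iff)
  have sq: "norm (Complex x y)^2 = x^2 + y^2" for y
    by (simp add: cmod_power2)
  have ge: "norm (Complex x y) \<ge> \<bar>x\<bar>" for y
    using abs_Re_le_cmod[of "Complex x y"] by simp
  have b: "norm (inverse (Complex x y) ^ k) \<le> inverse \<bar>x\<bar> ^ (k - 2) * (1 / (x^2+y^2))" for y
  proof -
    have "norm (inverse (Complex x y) ^ k) = inverse (norm (Complex x y)) ^ (k-2) * inverse (norm (Complex x y)) ^ 2"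
      using assms(2) by (metis norm_inverse norm_power power_add le_add_diff_inverse2)
    also have "inverse (norm (Complex x y)) ^ 2 = 1 / (x^2+y^2)"
      by (simp add: sq power_inverse inverse_eq_divide[symmetric] del: complex_norm)
    also have "inverse (norm (Complex x y)) ^ (k-2) * (1 / (x^2+y^2)) \<le> inverse \<bar>x\<bar> ^ (k-2) * (1 / (x^2+y^2))"
      using assms ge[of y] by (intro mult_right_mono power_mono le_imp_inverse_le) auto
    finally show ?thesis .
  qed
  have m: "(\<lambda>y. inverse (Complex x y) ^ k) \<in> borel_measurable lborel"
    unfolding measurable_lborel2
    by (intro borel_measurable_continuous_onI continuous_on_power continuous_on_inverse continuous_on_Complex
        continuous_on_const continuous_on_id ballI nz)
  have i: "integrable lborel (\<lambda>y. inverse \<bar>x\<bar> ^ (k - 2) * (1 / (x^2+y^2)))"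
    by (rule integrable_mult_right[OF integral_inverse_sq_plus(1)[OF assms(1)]])
  show int: "integrable lborel (\<lambda>y. inverse (Complex x y) ^ k)"
    by (rule Bochner_Integration.integrable_bound[OF i m])
       (use b in \<open>auto intro!: AE_I2 order_trans[OF b]\<close>)
  have "(\<integral>y. norm (inverse (Complex x y) ^ k) \<partial>lborel) \<le> (\<integral>y. inverse \<bar>x\<bar> ^ (k - 2) * (1 / (x^2+y^2)) \<partial>lborel)"
    using b int i by (intro integral_mono integrable_norm) auto
  also have "\<dots> = inverse \<bar>x\<bar> ^ (k - 2) * (pi / \<bar>x\<bar>)"
    using integral_inverse_sq_plus(2)[OF assms(1)] by (subst integral_mult_right_zero) simp
  also have "\<dots> = pi * inverse \<bar>x\<bar> ^ (k - 1)"
  proof -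
    have "k - 1 = Suc (k - 2)" using assms(2) by simp
    then show ?thesis by (simp add: divide_inverse)
  qed
  finally show "(\<integral>y. norm (inverse (Complex x y) ^ k) \<partial>lborel) \<le> pi * inverse \<bar>x\<bar> ^ (k - 1)" .
qed

lemma gamma_integral_pos_real:
  fixes c :: real assumes "c > 0"
  shows "integrable lborel (\<lambda>t. indicator {0<..} t * (t ^ n / fact n * exp (- c * t)))"
proof -
  let ?F = "\<lambda>t. - (exp (- c * t) * (\<Sum>k\<le>n. t^k / fact k * inverse c ^ (n + 1 - k)))"
  have D: "DERIV ?F t :> t ^ n / fact n * exp (- c * t)" for t
  proof (induction n)
    case 0
    show ?case using assms by (auto intro!: derivative_eq_intros simp: field_simps)
  next
    case (Suc n)
    let ?G = "\<lambda>t. - (exp (- c * t) * (\<Sum>k\<le>n. t^k / fact k * inverse c ^ (n + 1 - k)))"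
    have eq: "(\<lambda>t. - (exp (- c * t) * (\<Sum>k\<le>Suc n. t^k / fact k * inverse c ^ (Suc n + 1 - k)))) =
      (\<lambda>t. inverse c * ?G t - exp (- c * t) * (t ^ Suc n / fact (Suc n) * inverse c))"
      by (rule ext) (simp add: sum_distrib_left algebra_simps Suc_diff_le del: fact_Suc power_Suc cong: sum.cong
        , simp add: sum_distrib_left mult_ac Suc_diff_le)
    show ?case unfolding eq
      by (rule derivative_eq_intros Suc refl | simp)+ (use assms in \<open>simp add: field_simps\<close>)
  qed
  have lim: "(?F \<longlongrightarrow> 0) at_top"
  proof -
    have "((\<lambda>t. \<Sum>k\<le>n. inverse c ^ (n+1-k) / fact k / c^k * ((c*t)^k / exp (c*t))) \<longlongrightarrow> (\<Sum>k\<le>n. inverse c ^ (n+1-k) / fact k / c^k * 0)) at_top"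
      using assms
      by (intro tendsto_sum tendsto_mult tendsto_const filterlim_compose[OF tendsto_power_div_exp_0]
           filterlim_tendsto_pos_mult_at_top[OF tendsto_const] filterlim_ident) auto
    then have "((\<lambda>t. - (\<Sum>k\<le>n. inverse c ^ (n+1-k) / fact k / c^k * ((c*t)^k / exp (c*t)))) \<longlongrightarrow> 0) at_top"
      using tendsto_minus by fastforce
    also have "(\<lambda>t. - (\<Sum>k\<le>n. inverse c ^ (n+1-k) / fact k / c^k * ((c*t)^k / exp (c*t)))) = ?F"
      using assms by (auto simp: fun_eq_iff sum_distrib_left exp_minus field_simps intro!: sum.cong)
    finally show ?thesis .
  qed
  have lim0: "(?F \<longlongrightarrow> ?F 0) (at_right 0)"
  proof -
    have "isCont ?F 0" using D by (rule DERIV_isCont)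
    then show ?thesis unfolding isCont_def by (rule tendsto_within_subset) auto
  qed
  have "set_integrable lborel (einterval 0 \<infinity>) (\<lambda>t. t ^ n / fact n * exp (- c * t))"
    by (rule interval_integral_FTC_nonneg(1)[where F="?F" and A="?F 0" and B=0])
       (use D lim lim0 in \<open>auto simp: ereal_tendsto_simps zero_ereal_def intro!: AE_I2 continuous_intros\<close>)
  then show ?thesis by (simp add: set_integrable_def einterval_def zero_ereal_def greaterThan_def[symmetric])
qed

lemma gamma_integral_pos:
  fixes c :: complex assumes "Re c > 0"
  shows "integrable lborel (\<lambda>t. indicator {0<..} t *\<^sub>R ((of_real t) ^ n / fact n * exp (- c * of_real t)))"
    and "(\<integral>t. indicator {0<..} t *\<^sub>R ((of_real t) ^ n / fact n * exp (- c * of_real t)) \<partial>lborel) = inverse c ^ Suc n"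
proof -
  let ?f = "\<lambda>n t. (of_real t) ^ n / fact n * exp (- c * of_real t) :: complex"
  let ?g = "\<lambda>n t. indicator {0<..} t * (t ^ n / fact n * exp (- Re c * t)) :: real"
  have c0: "c \<noteq> 0" using assms by auto
  have norm_eq: "norm (indicator {0<..} t *\<^sub>R ?f n t) = ?g n t" for n t
    by (auto simp: norm_mult norm_divide norm_power indicator_def)
  have meas: "(\<lambda>t. indicator {0<..} t *\<^sub>R ?f n t) \<in> borel_measurable lborel" for n
    by measurable
  have int: "integrable lborel (\<lambda>t. indicator {0<..} t *\<^sub>R ?f n t)" for n
    by (rule Bochner_Integration.integrable_bound[OF gamma_integral_pos_real[OF assms, of n] meas])
       (auto intro!: AE_I2 simp only: norm_eq real_norm_def abs_ge_self)
  show "integrable lborel (\<lambda>t. indicator {0<..} t *\<^sub>R ?f n t)" by (rule int)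
  let ?I = "\<lambda>n. \<integral>t. indicator {0<..} t *\<^sub>R ?f n t \<partial>lborel"
  have lim: "((\<lambda>t. ?f n t) \<longlongrightarrow> 0) at_top" for n
  proof (rule tendsto_norm_zero_cancel)
    have "((\<lambda>t. inverse (fact n * Re c ^ n) * ((Re c * t)^n / exp (Re c * t))) \<longlongrightarrow> inverse (fact n * Re c ^ n) * 0) at_top"
      using assms by (intro tendsto_mult tendsto_const filterlim_compose[OF tendsto_power_div_exp_0]
           filterlim_tendsto_pos_mult_at_top[OF tendsto_const] filterlim_ident) auto
    moreover have "eventually (\<lambda>t. inverse (fact n * Re c ^ n) * ((Re c * t)^n / exp (Re c * t)) = norm (?f n t)) at_top"
      using eventually_gt_at_top[of "0::real"]
      by eventually_elim (use assms in \<open>auto simp: norm_mult norm_divide norm_power exp_minus field_simps\<close>)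
    ultimately show "((\<lambda>t. norm (?f n t)) \<longlongrightarrow> 0) at_top"
      by (auto elim: Lim_transform_eventually)
  qed
  have FTC: "(LBINT t=0..\<infinity>. h t) = - H 0"
    if "\<And>t. (H has_vector_derivative h t) (at t)" "\<And>t. isCont h t" "integrable lborel (\<lambda>t. indicator {0<..} t *\<^sub>R h t)" "(H \<longlongrightarrow> 0) at_top"
    for H h :: "real \<Rightarrow> complex"
  proof -
    have "isCont H 0" using that(1) by (rule has_vector_derivative_continuous)
    then have "(H \<longlongrightarrow> H 0) (at_right 0)" unfolding isCont_def by (rule tendsto_within_subset) auto
    then have "(LBINT t=0..\<infinity>. h t) = 0 - H 0"
      by (intro interval_integral_FTC_integrable[where F=H])
        (use that in \<open>auto simp: ereal_tendsto_simps zero_ereal_def set_integrable_def einterval_def greaterThan_def[symmetric]\<close>)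
    then show ?thesis by simp
  qed
  have conv: "(LBINT t=0..\<infinity>. h t) = (\<integral>t. indicator {0<..} t *\<^sub>R h t \<partial>lborel)" for h :: "real \<Rightarrow> complex"
    by (simp add: interval_lebesgue_integral_def set_lebesgue_integral_def einterval_def greaterThan_def[symmetric] zero_ereal_def)
  have D0: "((\<lambda>t. exp (- c * of_real t)) has_vector_derivative - c * exp (- c * of_real t)) (at t)" for t
    by (auto intro!: derivative_eq_intros has_vector_derivative_real_field)
  show "?I n = inverse c ^ Suc n"
  proof (induction n)
    case 0
    have "(LBINT t=0..\<infinity>. - c * ?f 0 t) = - (?f 0 0)"
      by (rule FTC) (use D0 int[of 0] lim[of 0] in \<open>auto intro!: continuous_intros integrable_mult_right simp flip: mult_scaleR_right\<close>)
    then have "- c * ?I 0 = - 1"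
      unfolding conv by (simp del: mult_minus_left flip: mult_scaleR_right)
    then show ?case using c0 by (simp add: field_simps)
  next
    case (Suc n)
    have D: "((\<lambda>t. ?f (Suc n) t) has_vector_derivative (?f n t - c * ?f (Suc n) t)) (at t)" for t
    proof -
      have "((\<lambda>z. z ^ Suc n / fact (Suc n) * exp (- c * z)) has_field_derivative
         (of_real t ^ n / fact n * exp (- c * of_real t) - c * (of_real t ^ Suc n / fact (Suc n) * exp (- c * of_real t)))) (at (of_real t))"
        by (rule derivative_eq_intros refl | simp add: field_simps del: of_nat_Suc)+
      from has_vector_derivative_real_field[OF this] show ?thesis by simp
    qed
    have eq: "indicator {0<..} t *\<^sub>R (?f n t - c * ?f (Suc n) t) =
      indicator {0<..} t *\<^sub>R ?f n t - c * (indicator {0<..} t *\<^sub>R ?f (Suc n) t)" for t :: real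
      by (simp only: scaleR_diff_right mult_scaleR_right)
    have "(LBINT t=0..\<infinity>. ?f n t - c * ?f (Suc n) t) = - (?f (Suc n) 0)"
    proof (rule FTC[OF D _ _ lim])
      show "integrable lborel (\<lambda>t. indicator {0<..} t *\<^sub>R (?f n t - c * ?f (Suc n) t))"
        unfolding eq by (intro Bochner_Integration.integrable_diff integrable_mult_right int)
    qed (auto intro!: continuous_intros simp del: fact_Suc)
    then have "?I n - c * ?I (Suc n) = 0"
      unfolding conv eq
      by (subst (asm) Bochner_Integration.integral_diff)
        (simp_all only: int integrable_mult_right[OF int] integral_mult_right_zero, simp del: fact_Suc)
    then show ?case using c0 Suc by (simp add: field_simps)
  qed
qed

text \<open>For a pole of either sign the ray of integration points to the side on which the exponential decays.\<close>

lemma gamma_integral_signed: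
  fixes c :: complex and \<eta> :: real assumes "\<eta> * Re c > 0"
  shows "integrable lborel (\<lambda>t. indicator {t. \<eta> * t > 0} t *\<^sub>R ((of_real t) ^ n / fact n * exp (- c * of_real t)))"
    and "(\<integral>t. indicator {t. \<eta> * t > 0} t *\<^sub>R ((of_real t) ^ n / fact n * exp (- c * of_real t)) \<partial>lborel) =
      of_real (sgn \<eta>) * inverse c ^ Suc n"
proof -
  let ?f = "\<lambda>t. indicator {t. \<eta> * t > 0} t *\<^sub>R ((of_real t) ^ n / fact n * exp (- c * of_real t)) :: complex"
  consider "\<eta> > 0" "Re c > 0" | "\<eta> < 0" "Re c < 0" using assms by (auto simp: zero_less_mult_iff)
  then have "integrable lborel ?f \<and> integral\<^sup>L lborel ?f = of_real (sgn \<eta>) * inverse c ^ Suc n"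
  proof cases
    case 1
    then have "{t. \<eta> * t > 0} = {0<..}" by (auto simp: zero_less_mult_iff)
    then show ?thesis using gamma_integral_pos[OF 1(2), of n] 1 by simp
  next
    case 2
    let ?g = "\<lambda>t. indicator {0<..} t *\<^sub>R ((of_real t) ^ n / fact n * exp (- (-c) * of_real t)) :: complex"
    have g: "integrable lborel ?g" "integral\<^sup>L lborel ?g = inverse (-c) ^ Suc n"
      using gamma_integral_pos[of "-c" n] 2 by auto
    have eq: "?f t = (-1) ^ n * ?g (0 + (-1) * t)" for t
    proof -
      have "(-1) ^ n * ((- of_real t) ^ n :: complex) = of_real t ^ n"
        by (simp flip: power_mult_distrib)
      then show ?thesis
        using 2 by (simp add: indicator_def zero_less_mult_iff mult.assoc[symmetric] times_divide_eq_right)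
    qed
    have i: "integrable lborel (\<lambda>t. ?g (0 + (-1) * t))"
      by (rule lborel_integrable_real_affine[OF g(1)]) simp
    have "integral\<^sup>L lborel (\<lambda>t. ?g (0 + (-1) * t)) = inverse (-c) ^ Suc n"
      using lborel_integral_real_affine[of "-1" ?g 0] g(2) by simp
    moreover have "(-1) ^ n * inverse (-c) ^ Suc n = - (inverse c ^ Suc n)"
    proof -
      have "(-1) ^ n * inverse (-c) ^ n = inverse c ^ n"
        by (simp flip: power_mult_distrib)
      moreover have "(-1) ^ n * inverse (-c) ^ Suc n = ((-1) ^ n * inverse (-c) ^ n) * inverse (-c)"
        by (simp only: power_Suc mult_ac)
      ultimately show ?thesis by simp
    qed
    ultimately show ?thesis
      unfolding eq using 2 by (simp only: integrable_mult_right[OF i] integral_mult_right_zero) simp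
  qed
  then show "integrable lborel ?f" "integral\<^sup>L lborel ?f = of_real (sgn \<eta>) * inverse c ^ Suc n" by auto
qed

lemma (in pair_sigma_finite) integrable_mult_pair:
  fixes f :: "'a \<Rightarrow> real" and g :: "'b \<Rightarrow> real"
  assumes f: "integrable M1 f" and g: "integrable M2 g"
  shows "integrable (M1 \<Otimes>\<^sub>M M2) (\<lambda>(x, y). f x * g y)"
proof (rule Fubini_integrable)
  note [measurable] = borel_measurable_integrable[OF f] borel_measurable_integrable[OF g]
  show "(\<lambda>(x, y). f x * g y) \<in> borel_measurable (M1 \<Otimes>\<^sub>M M2)" by measurable
  show "integrable M1 (\<lambda>x. \<integral>y. norm (case (x, y) of (x, y) \<Rightarrow> f x * g y) \<partial>M2)"
    using f by (simp add: abs_mult)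
  show "AE x in M1. integrable M2 (\<lambda>y. case (x, y) of (x, y) \<Rightarrow> f x * g y)"
    using g by simp
qed

lemma exp_kernel_integrable:
  assumes "x \<noteq> 0" "k \<ge> 2"
  shows "integrable lborel (\<lambda>y. exp (of_real u * Complex x y) * inverse (Complex x y) ^ k)"
    and "norm (\<integral>y. exp (of_real u * Complex x y) * inverse (Complex x y) ^ k \<partial>lborel) \<le> exp (u * x) * (pi * inverse \<bar>x\<bar> ^ (k - 1))"
proof -
  let ?h = "\<lambda>y. exp (of_real u * Complex x y) * inverse (Complex x y) ^ k"
  have n: "norm (?h y) = exp (u * x) * norm (inverse (Complex x y) ^ k)" for y
    by (simp add: norm_mult del: complex_norm)
  have nz: "Complex x y \<noteq> 0" for y using assms by (simp add: complex_eq_iff)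
  have m: "?h \<in> borel_measurable lborel"
    unfolding measurable_lborel2
    by (intro borel_measurable_continuous_onI continuous_intros continuous_on_Complex ballI nz)
  have i: "integrable lborel (\<lambda>y. exp (u * x) * norm (inverse (Complex x y) ^ k))"
    by (rule integrable_mult_right[OF integrable_norm[OF inverse_power_integrable(1)[OF assms]]])
  show "integrable lborel ?h"
    by (rule Bochner_Integration.integrable_bound[OF i m]) (simp only: n, simp)
  have "norm (\<integral>y. ?h y \<partial>lborel) \<le> (\<integral>y. norm (?h y) \<partial>lborel)" by (rule integral_norm_bound)
  also have "\<dots> = exp (u * x) * (\<integral>y. norm (inverse (Complex x y) ^ k) \<partial>lborel)"
    unfolding n by (rule integral_mult_right_zero)
  also have "\<dots> \<le> exp (u * x) * (pi * inverse \<bar>x\<bar> ^ (k - 1))"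
    using inverse_power_integrable(2)[OF assms] by (intro mult_left_mono) auto
  finally show "norm (\<integral>y. ?h y \<partial>lborel) \<le> exp (u * x) * (pi * inverse \<bar>x\<bar> ^ (k - 1))" .
qed

lemma exp_kernel_derivative:
  assumes "z \<noteq> 0"
  shows "((\<lambda>z. exp (u * z) * inverse z ^ k) has_field_derivative
    u * (exp (u * z) * inverse z ^ k) - of_nat k * (exp (u * z) * inverse z ^ Suc k)) (at (z::complex))"
proof (cases k)
  case 0
  show ?thesis unfolding 0 power_0 by (rule derivative_eq_intros refl | simp)+
next
  case (Suc n)
  show ?thesis unfolding Suc
    by (rule derivative_eq_intros refl assms | simp add: field_simps assms)+
qed

text \<open>The integrand with exponent \<open>k\<close> vanishes at both ends of the vertical line, so the integral of its
  derivative is zero. The relation allows all exponents to be reduced to \<open>k = 2\<close>, the smallest one with absolute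
  convergence.\<close>

lemma exp_kernel_recursion:
  assumes x: "x \<noteq> 0" and k: "k \<ge> 2"
  shows "of_real u * (\<integral>y. exp (of_real u * Complex x y) * inverse (Complex x y) ^ k \<partial>lborel) =
    of_nat k * (\<integral>y. exp (of_real u * Complex x y) * inverse (Complex x y) ^ Suc k \<partial>lborel)"
proof -
  let ?h = "\<lambda>k y. exp (of_real u * Complex x y) * inverse (Complex x y) ^ k"
  let ?f = "\<lambda>y. \<i> * (of_real u * ?h k y - of_nat k * ?h (Suc k) y)"
  have nz: "Complex x y \<noteq> 0" for y using x by (simp add: complex_eq_iff)
  have D: "(?h k has_vector_derivative ?f y) (at y)" for y
  proof -
    have "((\<lambda>y. Complex x y) has_vector_derivative \<i>) (at y)"
      unfolding Complex_eq by (auto intro!: derivative_eq_intros has_vector_derivative_of_real)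
    from field_vector_diff_chain_at[OF this exp_kernel_derivative[OF nz, of "of_real u" k]]
    show ?thesis by (simp add: o_def)
  qed
  have c: "isCont ?f y" for y
  proof -
    have "isCont (\<lambda>y. Complex x y) y"
      unfolding Complex_eq by (intro continuous_intros)
    then show ?thesis by (intro continuous_intros nz)
  qed
  have i: "integrable lborel ?f"
    by (intro integrable_mult_right Bochner_Integration.integrable_diff exp_kernel_integrable x) (use k in auto)
  have ge: "norm (?h k y) \<le> exp (u * x) * inverse \<bar>y\<bar>" if "\<bar>y\<bar> \<ge> 1" for y
  proof -
    have a: "\<bar>y\<bar> \<le> norm (Complex x y)" using abs_Im_le_cmod[of "Complex x y"] by simp
    have "norm (?h k y) = exp (u * x) * inverse (norm (Complex x y)) ^ k"
      by (simp add: norm_mult norm_power norm_inverse del: complex_norm)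
    also have "inverse (norm (Complex x y)) ^ k \<le> inverse \<bar>y\<bar> ^ k"
      using a that by (intro power_mono le_imp_inverse_le) auto
    also have "inverse \<bar>y\<bar> ^ k \<le> inverse \<bar>y\<bar> ^ 1"
      using that k by (intro power_decreasing) (auto simp: inverse_le_1_iff)
    finally show ?thesis by simp
  qed
  have "((\<lambda>y::real. inverse \<bar>y\<bar>) \<longlongrightarrow> 0) at_top" "((\<lambda>y::real. inverse \<bar>- y\<bar>) \<longlongrightarrow> 0) at_top"
    using tendsto_inverse_0_at_top[OF filterlim_abs_real] by simp_all
  then have t1: "((\<lambda>y. exp (u * x) * inverse \<bar>y\<bar>) \<longlongrightarrow> 0) at_top" "((\<lambda>y. exp (u * x) * inverse \<bar>y\<bar>) \<longlongrightarrow> 0) at_bot"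
    by (intro tendsto_mult_right_zero; simp add: filterlim_at_bot_mirror)+
  have "(?h k \<longlongrightarrow> 0) at_top"
    by (rule Lim_null_comparison[OF _ t1(1)])
      (rule eventually_mono[OF eventually_ge_at_top[of "1::real"]], rule ge, simp)
  moreover have "(?h k \<longlongrightarrow> 0) at_bot"
    by (rule Lim_null_comparison[OF _ t1(2)])
      (rule eventually_mono[OF eventually_le_at_bot[of "-1::real"]], rule ge, simp)
  ultimately have "(\<integral>y. ?f y \<partial>lborel) = 0"
    by (rule integral_derivative_line[OF D c i])
  then have "of_real u * (\<integral>y. ?h k y \<partial>lborel) - of_nat k * (\<integral>y. ?h (Suc k) y \<partial>lborel) = 0"
    by (simp only: integral_mult_right_zero mult_eq_0_iff, subst (asm) Bochner_Integration.integral_diff)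
       (auto simp only: integral_mult_right_zero complex_i_not_zero
          intro!: integrable_mult_right exp_kernel_integrable x le_SucI k)
  then show ?thesis by simp
qed

lemma integrable_lborel_pair_bound:
  fixes f :: "real \<times> real \<Rightarrow> complex"
  assumes "f \<in> borel_measurable (lborel \<Otimes>\<^sub>M lborel)" "integrable lborel h" "integrable lborel k"
    and "\<And>x y. norm (f (x, y)) \<le> h x * k y"
  shows "integrable (lborel \<Otimes>\<^sub>M lborel) f"
proof -
  have "norm (f z) \<le> norm (case z of (x, y) \<Rightarrow> h x * k y)" for z
    using order_trans[OF assms(4) abs_ge_self] by (cases z) simp
  then show ?thesis
    by (intro Bochner_Integration.integrable_bound[OF lborel_pair.integrable_mult_pair[OF assms(2,3)] assms(1)] AE_I2)
qed

text \<open>Moving the line of integration: the difference of the integrals over two vertical lines is a double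
  integral whose inner integral over the vertical direction vanishes.\<close>

lemma exp_kernel_shift:
  assumes x: "0 < x1" "x1 \<le> x2"
  shows "(\<integral>y. exp (of_real u * Complex x1 y) * inverse (Complex x1 y) ^ 2 \<partial>lborel) =
    (\<integral>y. exp (of_real u * Complex x2 y) * inverse (Complex x2 y) ^ 2 \<partial>lborel)"
proof -
  let ?h = "\<lambda>k x y. exp (of_real u * Complex x y) * inverse (Complex x y) ^ k"
  let ?g = "\<lambda>x y. of_real u * ?h 2 x y - 2 * ?h 3 x y"
  let ?f = "\<lambda>(x, y). indicator {x1..x2} x *\<^sub>R ?g x y"
  have in0: "(\<integral>y. ?g x y \<partial>lborel) = 0" if "x \<noteq> 0" for x
    using exp_kernel_recursion[OF that, of 2 u]
    by (subst Bochner_Integration.integral_diff)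
       (auto intro!: integrable_mult_right exp_kernel_integrable that simp only: integral_mult_right_zero numeral_3_eq_3 numeral_2_eq_2 of_nat_numeral, simp_all)
  have FT: "(\<integral>x. indicator {x1..x2} x *\<^sub>R ?g x y \<partial>lborel) = ?h 2 x2 y - ?h 2 x1 y" for y
  proof (rule integral_FTC_Icc[OF x(2)])
    fix x' assume "x1 \<le> x'" "x' \<le> x2"
    then have nz: "Complex x' y \<noteq> 0" using x by (simp add: complex_eq_iff)
    have "((\<lambda>x. Complex x y) has_vector_derivative 1) (at x' within {x1..x2})"
      unfolding Complex_eq by (auto intro!: derivative_eq_intros has_vector_derivative_of_real)
    from field_vector_diff_chain_within[OF this has_field_derivative_at_within[OF exp_kernel_derivative[OF nz, of "of_real u" 2]]]
    show "((\<lambda>x. ?h 2 x y) has_vector_derivative ?g x' y) (at x' within {x1..x2})"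
      by (simp add: o_def numeral_3_eq_3 numeral_2_eq_2)
  next
    have nz: "Complex x y \<noteq> 0" if "x \<in> {x1..x2}" for x using x that by (simp add: complex_eq_iff)
    have "continuous_on {x1..x2} (\<lambda>x. Complex x y)"
      unfolding Complex_eq by (intro continuous_intros)
    then show "continuous_on {x1..x2} (\<lambda>x. ?g x y)" by (intro continuous_intros ballI nz)
  qed
  have int: "integrable (lborel \<Otimes>\<^sub>M lborel) ?f"
  proof (rule integrable_lborel_pair_bound)
    have "(\<lambda>z::real\<times>real. Complex (fst z) (snd z)) \<in> borel_measurable (lborel \<Otimes>\<^sub>M lborel)"
      unfolding Complex_eq by measurable
    then show "?f \<in> borel_measurable (lborel \<Otimes>\<^sub>M lborel)"
      unfolding case_prod_beta by measurable
    show "integrable lborel (\<lambda>x. indicator {x1..x2} x *\<^sub>R (exp (\<bar>u\<bar> * x2) * (\<bar>u\<bar> + 2 * inverse x1)))"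
      by (rule integrable_scaleR_left) (auto intro!: integrable_real_indicator simp: emeasure_lborel_Icc_eq)
    show "integrable lborel (\<lambda>y. 1 / (x1^2 + y^2))" using x by (intro integral_inverse_sq_plus) simp
    fix x y
    show "norm (?f (x, y)) \<le> indicator {x1..x2} x *\<^sub>R (exp (\<bar>u\<bar> * x2) * (\<bar>u\<bar> + 2 * inverse x1)) * (1 / (x1^2 + y^2))"
    proof (cases "x \<in> {x1..x2}")
      case True
      then have xx: "x1 \<le> x" "x \<le> x2" "0 < x" using x by auto
      let ?r = "norm (Complex x y)"
      have r: "x1 \<le> ?r" using abs_Re_le_cmod[of "Complex x y"] xx by simp
      have r2: "inverse ?r ^ 2 \<le> 1 / (x1^2 + y^2)"
      proof -
        have "?r ^ 2 = x^2 + y^2" by (simp add: cmod_power2)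
        moreover have "x1^2 \<le> x^2" using x xx by (intro power_mono) auto
        moreover have "x1^2 > 0" using x by simp
        ultimately show ?thesis
          by (simp add: power_inverse inverse_eq_divide[symmetric] del: complex_norm add: add_pos_nonneg le_imp_inverse_le)
      qed
      have e: "exp (u * x) \<le> exp (\<bar>u\<bar> * x2)"
        using xx by (simp add: order_trans[OF mult_right_mono[OF abs_ge_self[of u], of x] mult_left_mono])
      have "norm (?g x y) \<le> norm (of_real u * ?h 2 x y) + norm (2 * ?h 3 x y)" by (rule norm_triangle_ineq4)
      also have "\<dots> = exp (u * x) * ((\<bar>u\<bar> + 2 * inverse ?r) * inverse ?r ^ 2)"
        by (simp add: norm_mult norm_power norm_inverse algebra_simps power2_eq_square power3_eq_cube del: complex_norm)
      also have "\<dots> \<le> exp (\<bar>u\<bar> * x2) * ((\<bar>u\<bar> + 2 * inverse x1) * (1 / (x1^2 + y^2)))"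
        using e r r2 x by (intro mult_mono add_mono le_imp_inverse_le) auto
      finally show ?thesis using True by simp
    qed (simp add: x)
  qed
  have "0 = (\<integral>x. (\<integral>y. ?f (x, y) \<partial>lborel) \<partial>lborel)"
  proof -
    have "(\<integral>y. ?f (x, y) \<partial>lborel) = 0" for x
      using in0[of x] x by (cases "x \<in> {x1..x2}") auto
    then show ?thesis by (simp only: integral_zero)
  qed
  also have "\<dots> = (\<integral>y. (\<integral>x. ?f (x, y) \<partial>lborel) \<partial>lborel)"
    using lborel_pair.Fubini_integral[of "\<lambda>x y. ?f (x, y)"] int by (simp add: case_prod_beta)
  also have "\<dots> = (\<integral>y. ?h 2 x2 y - ?h 2 x1 y \<partial>lborel)"
    unfolding prod.case FT ..
  also have "\<dots> = (\<integral>y. ?h 2 x2 y \<partial>lborel) - (\<integral>y. ?h 2 x1 y \<partial>lborel)"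
    using x by (intro Bochner_Integration.integral_diff exp_kernel_integrable) auto
  finally show ?thesis by simp
qed

text \<open>For nonpositive \<open>u\<close> the line can be moved to infinity on the right, where the integral tends to zero.\<close>

lemma exp_kernel_nonpos:
  assumes x: "x > 0" and u: "u \<le> 0"
  shows "(\<integral>y. exp (of_real u * Complex x y) * inverse (Complex x y) ^ 2 \<partial>lborel) = 0" (is "?I x = 0")
proof -
  have "norm (?I x) \<le> pi * inverse X" if "X \<ge> x" for X
  proof -
    have "?I x = ?I X" using exp_kernel_shift[OF x that] .
    also have "norm (?I X) \<le> exp (u * X) * (pi * inverse \<bar>X\<bar> ^ (2 - 1))"
      using x that by (intro exp_kernel_integrable) auto
    also have "\<dots> \<le> 1 * (pi * inverse \<bar>X\<bar> ^ (2 - 1))"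
      using x u that by (intro mult_right_mono) (auto simp: mult_nonpos_nonneg)
    finally show ?thesis using x that by simp
  qed
  then have "eventually (\<lambda>X. norm (?I x) \<le> pi * inverse X) at_top"
    by (rule eventually_mono[OF eventually_ge_at_top[of x]])
  moreover have "((\<lambda>X. pi * inverse X) \<longlongrightarrow> pi * 0) at_top"
    by (intro tendsto_mult tendsto_const tendsto_inverse_0_at_top filterlim_ident)
  ultimately have "norm (?I x) \<le> pi * 0"
    by (intro tendsto_lowerbound[where f="\<lambda>X. pi * inverse X" and F=at_top]) auto
  then show ?thesis by simp
qed

text \<open>By the substitution $z \mapsto uz$ and a move of the line back to real part one, only a constant is left to be found.\<close>

lemma exp_kernel_scale:
  assumes x: "x > 0" and u: "u > 0"
  shows "(\<integral>y. exp (of_real u * Complex x y) * inverse (Complex x y) ^ 2 \<partial>lborel) =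
    of_real u * (\<integral>y. exp (Complex 1 y) * inverse (Complex 1 y) ^ 2 \<partial>lborel)"
proof -
  let ?g = "\<lambda>x y. exp (Complex x y) * inverse (Complex x y) ^ 2"
  have e: "?g (u * x) (0 + u * y) = inverse (of_real u) ^ 2 * (exp (of_real u * Complex x y) * inverse (Complex x y) ^ 2)" for y
  proof -
    have "Complex (u * x) (0 + u * y) = of_real u * Complex x y"
      by (simp add: complex_eq_iff)
    then show ?thesis by (simp add: power_mult_distrib)
  qed
  have "(\<integral>y. ?g 1 y \<partial>lborel) = (\<integral>y. ?g (u * x) y \<partial>lborel)"
  proof (cases "1 \<le> u * x")
    case True
    then show ?thesis using exp_kernel_shift[of 1 "u * x" 1] by simp
  next
    case False
    then show ?thesis using exp_kernel_shift[of "u * x" 1 1] u x by simp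
  qed
  also have "\<dots> = \<bar>u\<bar> *\<^sub>R (\<integral>y. ?g (u * x) (0 + u * y) \<partial>lborel)"
    using u by (intro lborel_integral_real_affine) simp
  also have "\<dots> = inverse (of_real u) * (\<integral>y. exp (of_real u * Complex x y) * inverse (Complex x y) ^ 2 \<partial>lborel)"
    unfolding e integral_mult_right_zero using u
    by (simp add: scaleR_conv_of_real power2_eq_square)
  finally show ?thesis using u by (simp add: field_simps)
qed

text \<open>The constant is found by taking the Laplace transform in \<open>u\<close> at \<open>2\<close>, which leaves
  $\int z^{-2}(2-z)^{-1}\,dy$ on the line $\Re z = 1$, where $z(2-z) = 1+y^2$.\<close>

lemma exp_kernel_constant:
  "(\<integral>y. exp (Complex 1 y) * inverse (Complex 1 y) ^ 2 \<partial>lborel) = 2 * of_real pi"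
proof -
  let ?K = "\<integral>y. exp (Complex 1 y) * inverse (Complex 1 y) ^ 2 \<partial>lborel"
  let ?f = "\<lambda>(u, y). (indicator {0<..} u *\<^sub>R exp (- of_real (2 * u))) * (exp (of_real u * Complex 1 y) * inverse (Complex 1 y) ^ 2) :: complex"
  have nz: "Complex 1 y \<noteq> 0" "Complex 1 (- y) \<noteq> 0" for y by (simp_all add: complex_eq_iff)
  have int: "integrable (lborel \<Otimes>\<^sub>M lborel) ?f"
  proof (rule integrable_lborel_pair_bound)
    have "(\<lambda>z::real\<times>real. Complex 1 (snd z)) \<in> borel_measurable (lborel \<Otimes>\<^sub>M lborel)"
      unfolding Complex_eq by measurable
    then show "?f \<in> borel_measurable (lborel \<Otimes>\<^sub>M lborel)"
      unfolding case_prod_beta by measurable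
    show "integrable lborel (\<lambda>u::real. indicator {0<..} u * (u ^ 0 / fact 0 * exp (- 1 * u)))"
      by (rule gamma_integral_pos_real) simp
    show "integrable lborel (\<lambda>y. norm (inverse (Complex 1 y) ^ 2))"
      by (intro integrable_norm inverse_power_integrable) auto
    show "norm (?f (u, y)) \<le> (indicator {0<..} u * (u ^ 0 / fact 0 * exp (- 1 * u))) * norm (inverse (Complex 1 y) ^ 2)" for u y
    proof -
      have "norm (exp (- of_real (2 * u)) * exp (of_real u * Complex 1 y)) = exp (- 1 * u)"
        by (simp flip: exp_add)
      then have "norm (?f (u, y)) = indicator {0<..} u * exp (- 1 * u) * norm (inverse (Complex 1 y) ^ 2)"
        by (simp add: norm_mult mult_ac indicator_def del: norm_exp_eq_Re)
      then show ?thesis by (simp only: fact_0 power_0 div_by_1 mult_1_left)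
    qed
  qed
  have "(\<integral>u. (\<integral>y. ?f (u, y) \<partial>lborel) \<partial>lborel) = (\<integral>u. ?K * (indicator {0<..} u *\<^sub>R ((of_real u) ^ 1 / fact 1 * exp (- 2 * of_real u))) \<partial>lborel)"
  proof (rule Bochner_Integration.integral_cong[OF refl])
    fix u :: real
    show "(\<integral>y. ?f (u, y) \<partial>lborel) = ?K * (indicator {0<..} u *\<^sub>R ((of_real u) ^ 1 / fact 1 * exp (- 2 * of_real u)))"
      using exp_kernel_scale[of 1 u] unfolding prod.case integral_mult_right_zero by (cases "u > 0") auto
  qed
  also have "\<dots> = ?K / 4"
    unfolding integral_mult_right_zero by (subst gamma_integral_pos) (auto simp: power2_eq_square)
  finally have 1: "(\<integral>u. (\<integral>y. ?f (u, y) \<partial>lborel) \<partial>lborel) = ?K / 4" .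
  have "(\<integral>u. ?f (u, y) \<partial>lborel) = 1/2 * inverse (Complex 1 y) ^ 2 + 1/2 * of_real (1 / (1^2 + y^2))" for y
  proof -
    have "?f (u, y) = inverse (Complex 1 y) ^ 2 * (indicator {0<..} u *\<^sub>R ((of_real u) ^ 0 / fact 0 * exp (- Complex 1 (- y) * of_real u)))" for u
      by (auto simp: indicator_def Complex_eq algebra_simps simp flip: exp_add)
    then have "(\<integral>u. ?f (u, y) \<partial>lborel) = inverse (Complex 1 y) ^ 2 * inverse (Complex 1 (- y))"
      by (simp only: integral_mult_right_zero) (subst gamma_integral_pos, auto)
    also have "\<dots> = 1/2 * inverse (Complex 1 y) ^ 2 + 1/2 * (inverse (Complex 1 y) * inverse (Complex 1 (- y)))"
    proof -
      have "Complex 1 y + Complex 1 (- y) = 2" by (simp add: complex_eq_iff)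
      then have "inverse (Complex 1 y) * inverse (Complex 1 (-y)) * (Complex 1 y + Complex 1 (- y)) = 2 * inverse (Complex 1 y) * inverse (Complex 1 (-y))"
        by simp
      then have "inverse (Complex 1 y) + inverse (Complex 1 (-y)) = 2 * inverse (Complex 1 y) * inverse (Complex 1 (-y))"
        using nz[of y] by (simp add: field_simps)
      then have pq: "inverse (Complex 1 y) * inverse (Complex 1 (-y)) = (inverse (Complex 1 y) + inverse (Complex 1 (-y))) / 2"
        by (simp only: mult.assoc) simp
      have "inverse (Complex 1 y) ^ 2 * inverse (Complex 1 (-y)) = inverse (Complex 1 y) * (inverse (Complex 1 y) * inverse (Complex 1 (-y)))"
        by (simp only: power2_eq_square mult.assoc)
      also have "\<dots> = (inverse (Complex 1 y) ^ 2 + inverse (Complex 1 y) * inverse (Complex 1 (-y))) / 2"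
        by (subst pq) (simp only: power2_eq_square distrib_left times_divide_eq_right)
      finally show ?thesis by (simp add: add_divide_distrib)
    qed
    also have "inverse (Complex 1 y) * inverse (Complex 1 (- y)) = of_real (1 / (1^2 + y^2))"
    proof -
      have "Complex 1 y * Complex 1 (- y) = of_real (1^2 + y^2)"
        by (simp add: complex_eq_iff power2_eq_square)
      then show ?thesis by (metis inverse_mult_distrib of_real_inverse inverse_eq_divide)
    qed
    finally show ?thesis .
  qed
  then have "(\<integral>y. (\<integral>u. ?f (u, y) \<partial>lborel) \<partial>lborel) = (\<integral>y. 1/2 * inverse (Complex 1 y) ^ 2 + 1/2 * of_real (1 / (1^2 + y^2)) \<partial>lborel)"
    by simp
  also have "\<dots> = 1/2 * (\<integral>y. inverse (Complex 1 y) ^ 2 \<partial>lborel) + 1/2 * of_real (\<integral>y. 1 / (1^2 + y^2) \<partial>lborel)"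
  proof -
    have i: "integrable lborel (\<lambda>y. 1/2 * inverse (Complex 1 y) ^ 2)"
      "integrable lborel (\<lambda>y. 1/2 * complex_of_real (1 / (1^2 + y^2)))"
      by (intro integrable_mult_right inverse_power_integrable integrable_of_real integral_inverse_sq_plus; simp)+
    show ?thesis
      unfolding Bochner_Integration.integral_add[OF i] integral_mult_right_zero integral_complex_of_real ..
  qed
  also have "\<dots> = of_real pi / 2"
    using exp_kernel_nonpos[of 1 0] integral_inverse_sq_plus(2)[of 1] by simp
  finally have "(\<integral>y. (\<integral>u. ?f (u, y) \<partial>lborel) \<partial>lborel) = of_real pi / 2" .
  moreover have "(\<integral>y. (\<integral>u. ?f (u, y) \<partial>lborel) \<partial>lborel) = (\<integral>u. (\<integral>y. ?f (u, y) \<partial>lborel) \<partial>lborel)"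
    using lborel_pair.Fubini_integral[of "\<lambda>x y. ?f (x, y)"] int by (simp add: case_prod_beta)
  ultimately have "?K / 4 = of_real pi / 2" using 1 by (simp only:)
  then show ?thesis by (simp only: divide_eq_eq) simp
qed

lemma exp_kernel_pos:
  assumes x: "x > 0"
  shows "(\<integral>y. exp (of_real u * Complex x y) * inverse (Complex x y) ^ (k + 2) \<partial>lborel) =
    (if u > 0 then 2 * of_real pi * of_real u ^ Suc k / fact (Suc k) else 0)"
proof (induction k)
  case 0
  show ?case
  proof (cases "u > 0")
    case True
    then show ?thesis using exp_kernel_scale[OF x True] exp_kernel_constant by (simp add: power2_eq_square)
  next
    case False
    then show ?thesis using exp_kernel_nonpos[OF x, of u] by (simp add: power2_eq_square)
  qed
next
  case (Suc k)
  have "of_nat (k + 2) * (\<integral>y. exp (of_real u * Complex x y) * inverse (Complex x y) ^ Suc (k + 2) \<partial>lborel) =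
    of_real u * (if u > 0 then 2 * of_real pi * of_real u ^ Suc k / fact (Suc k) else 0)"
    using exp_kernel_recursion[of x "k + 2" u] x unfolding Suc by simp
  moreover have "of_real u * (if u > 0 then 2 * of_real pi * of_real u ^ Suc k / fact (Suc k) else 0) =
    of_nat (k + 2) * (if u > 0 then 2 * complex_of_real pi * of_real u ^ Suc (Suc k) / fact (Suc (Suc k)) else 0)"
  proof -
    have "fact (Suc (Suc k)) = (of_nat (k + 2) :: complex) * fact (Suc k)" by (simp only: fact_Suc) simp
    moreover have "(of_nat (k + 2) :: complex) \<noteq> 0" by (simp only: of_nat_eq_0_iff)
    ultimately show ?thesis by (simp del: fact_Suc of_nat_add)
  qed
  ultimately have eq: "of_nat (k + 2) * (\<integral>y. exp (of_real u * Complex x y) * inverse (Complex x y) ^ Suc (k + 2) \<partial>lborel) =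
    of_nat (k + 2) * (if u > 0 then 2 * complex_of_real pi * of_real u ^ Suc (Suc k) / fact (Suc (Suc k)) else 0)"
    by (rule trans)
  have nz: "(of_nat (k + 2) :: complex) \<noteq> 0" by (simp only: of_nat_eq_0_iff)
  show ?case unfolding add_Suc by (rule mult_left_cancel[OF nz, THEN iffD1, OF eq])
qed

text \<open>The Laplace inversion integral for powers: this is what turns an integral over an imaginary fibre
  into a real integral.\<close>

lemma exp_kernel:
  assumes x: "x \<noteq> 0" and k: "k \<ge> 1"
  shows "(\<integral>y. exp (of_real u * Complex x y) * inverse (Complex x y) ^ Suc k \<partial>lborel) =
    of_real (sgn x) * (if u * x > 0 then 2 * of_real pi * of_real u ^ k / fact k else 0)"
proof -
  obtain k' where k': "k = Suc k'" using k by (cases k) auto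
  show ?thesis
  proof (cases "x > 0")
    case True
    then show ?thesis using exp_kernel_pos[OF True, of u k'] by (simp add: k' zero_less_mult_iff)
  next
    case False
    let ?g = "\<lambda>y. exp (of_real (- u) * Complex (- x) y) * inverse (Complex (- x) y) ^ Suc k"
    have e: "exp (of_real u * Complex x y) * inverse (Complex x y) ^ Suc k = (-1) ^ Suc k * ?g (0 + (-1) * y)" for y
    proof -
      have "Complex x y = - Complex (- x) (0 + (-1) * y)" by (simp add: complex_eq_iff)
      then show ?thesis by (simp add: power_minus[of "inverse _"])
    qed
    have "(\<integral>y. exp (of_real u * Complex x y) * inverse (Complex x y) ^ Suc k \<partial>lborel) = (-1) ^ Suc k * (\<integral>y. ?g (0 + (-1) * y) \<partial>lborel)"
      unfolding e by (rule integral_mult_right_zero)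
    also have "(\<integral>y. ?g (0 + (-1) * y) \<partial>lborel) = (\<integral>y. ?g y \<partial>lborel)"
      using lborel_integral_real_affine[of "-1" ?g 0] by simp
    also have "\<dots> = (if u < 0 then 2 * of_real pi * of_real (- u) ^ k / fact k else 0)"
      using exp_kernel_pos[of "- x" "- u" k'] False x by (simp add: k')
    also have "(-1) ^ Suc k * \<dots> = of_real (sgn x) * (if u * x > 0 then 2 * of_real pi * of_real u ^ k / fact k else 0)"
    proof -
      have "(-1) ^ k * ((- of_real u) ^ k :: complex) = of_real u ^ k" by (simp flip: power_mult_distrib)
      then show ?thesis using False x by (simp add: zero_less_mult_iff mult.assoc[symmetric] times_divide_eq_right)
    qed
    finally show ?thesis .
  qed
qed

section \<open>Imaginary fibre integrals as real integrals\<close>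

definition cpt :: "real ^ 'n \<Rightarrow> real ^ 'n \<Rightarrow> complex ^ 'n::finite" where
  "cpt x y = (\<chi> i. Complex (x $ i) (y $ i))"

definition fibre_term ::
    "(nat \<Rightarrow> real ^ 'n) \<Rightarrow> nat set \<Rightarrow> (nat \<Rightarrow> nat) \<Rightarrow> int ^ 'n \<Rightarrow> complex ^ 'n::finite \<Rightarrow> complex" where
  "fibre_term b S q s z = (\<Prod>j\<in>S. inverse (ell (b j) z) ^ q j) * (\<Prod>i\<in>UNIV. z $ i powi (- (s $ i) - 1))"

text \<open>The normalisation $(2\pi)^{-d}$ is what remains of $i^d/(2\pi i)^d$ after parametrising the imaginary fibre.\<close>

definition fibre ::
    "(nat \<Rightarrow> real ^ 'n) \<Rightarrow> nat set \<Rightarrow> (nat \<Rightarrow> nat) \<Rightarrow> real ^ 'n \<Rightarrow> int ^ 'n::finite \<Rightarrow> complex" where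
  "fibre b S q x s = of_real (1 / (2 * pi) ^ CARD('n)) * (\<integral>y. fibre_term b S q s (cpt x y) \<partial>lborel)"

text \<open>The next four definitions describe the real side: \<open>t\<close> are the variables of the Gamma integrals and \<open>dual_sum\<close> is
  the vector $u$ that is paired with $z$ in the exponent. The region records that $t_j$ has the sign of the form $\ell_j$
  at the base point and $u_i$ the sign of its coordinates.\<close>

definition dual_sum :: "(nat \<Rightarrow> real ^ 'n) \<Rightarrow> nat set \<Rightarrow> (nat \<Rightarrow> real) \<Rightarrow> real ^ 'n::finite" where
  "dual_sum b S t = (\<Sum>j\<in>S. t j *\<^sub>R b j)"

definition dual_density ::
    "(nat \<Rightarrow> real ^ 'n) \<Rightarrow> nat set \<Rightarrow> (nat \<Rightarrow> nat) \<Rightarrow> int ^ 'n::finite \<Rightarrow> (nat \<Rightarrow> real) \<Rightarrow> real" where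
  "dual_density b S q s t = (\<Prod>j\<in>S. t j ^ (q j - 1) / fact (q j - 1) * exp (- t j)) *
     (\<Prod>i\<in>UNIV. dual_sum b S t $ i ^ nat (s $ i) / fact (nat (s $ i)))"

definition dual_region :: "(nat \<Rightarrow> real ^ 'n) \<Rightarrow> nat set \<Rightarrow> real ^ 'n::finite \<Rightarrow> (nat \<Rightarrow> real) set" where
  "dual_region b S x = {t. (\<forall>j\<in>S. ell (b j) x * t j > 0) \<and> (\<forall>i. dual_sum b S t $ i * x $ i > 0)}"

definition dual_integral ::
    "(nat \<Rightarrow> real ^ 'n) \<Rightarrow> nat set \<Rightarrow> (nat \<Rightarrow> nat) \<Rightarrow> real ^ 'n \<Rightarrow> int ^ 'n::finite \<Rightarrow> real" where
  "dual_integral b S q x s =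
     (\<integral>t. indicator (dual_region b S x) t * dual_density b S q s t \<partial>(\<Pi>\<^sub>M j\<in>S. lborel))"

interpretation lborel_PiM: product_sigma_finite "\<lambda>_::'a. lborel :: real measure" ..

text \<open>Fubini for products of functions of single coordinates, transported from functions on the index type to vectors.\<close>

lemma integral_vec_prod:
  fixes f :: "'n::finite \<Rightarrow> real \<Rightarrow> complex"
  assumes f: "\<And>i. integrable lborel (f i)"
  shows "integrable lborel (\<lambda>y::real ^ 'n. \<Prod>i\<in>UNIV. f i (y $ i))"
    and "(\<integral>y. (\<Prod>i\<in>UNIV. f i (y $ i)) \<partial>(lborel :: (real ^ 'n) measure)) = (\<Prod>i\<in>UNIV. integral\<^sup>L lborel (f i))"
proof -
  note [measurable] = borel_measurable_integrable[OF f]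
  define e where "e = (\<lambda>i::'n. axis i (1::real))"
  have inj: "inj e" by (auto simp: inj_on_def axis_eq_axis e_def)
  have B: "(Basis :: (real ^ 'n) set) = range e" by (auto simp: Basis_vec_def e_def)
  let ?g = "\<lambda>b. f (inv e b)"
  have g: "?g (e i) = f i" for i using inj by simp
  have eq: "(\<Prod>i\<in>UNIV. f i (y $ i)) = (\<Prod>b\<in>Basis. ?g b (y \<bullet> b))" for y :: "real ^ 'n"
    unfolding B by (subst prod.reindex[OF inj]) (simp add: g cart_eq_inner_axis inj e_def[symmetric] flip: fun_cong[OF e_def])
  have eq2: "(\<Prod>b\<in>Basis. integral\<^sup>L lborel (?g b)) = (\<Prod>i\<in>UNIV. integral\<^sup>L lborel (f i))"
    unfolding B by (subst prod.reindex[OF inj]) (simp add: g)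
  let ?T = "\<lambda>w. \<Sum>b\<in>(Basis :: (real ^ 'n) set). w b *\<^sub>R b"
  have T: "?T \<in> measurable (\<Pi>\<^sub>M b\<in>Basis. lborel) borel" by measurable
  have T': "?T w \<bullet> b = w b" if "b \<in> Basis" for b w
    using that by (simp add: inner_sum_left inner_Basis if_distrib sum.delta cong: if_cong)
  have m: "(\<lambda>y::real ^ 'n. \<Prod>i\<in>UNIV. f i (y $ i)) \<in> borel_measurable borel" by measurable
  have eq3: "(\<Prod>i\<in>UNIV. f i (?T w $ i)) = (\<Prod>b\<in>Basis. ?g b (w b))" for w
    unfolding eq by (intro prod.cong) (simp_all add: T')
  have i: "integrable (\<Pi>\<^sub>M b\<in>(Basis :: (real ^ 'n) set). lborel) (\<lambda>w. \<Prod>b\<in>Basis. ?g b (w b))"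
    by (rule lborel_PiM.product_integrable_prod) (simp_all add: f)
  show "integrable lborel (\<lambda>y::real ^ 'n. \<Prod>i\<in>UNIV. f i (y $ i))"
    by (subst lborel_eq) (simp only: integrable_distr_eq[OF T m] eq3 i)
  show "(\<integral>y. (\<Prod>i\<in>UNIV. f i (y $ i)) \<partial>(lborel :: (real ^ 'n) measure)) = (\<Prod>i\<in>UNIV. integral\<^sup>L lborel (f i))"
    by (subst lborel_eq) (simp only: integral_distr[OF T m] eq3 eq2[symmetric],
      rule lborel_PiM.product_integral_prod, simp_all add: f)
qed

lemma ell_eq_inner: "ell v x = 1 - v \<bullet> (x :: real ^ 'n::finite)"
  by (simp add: ell_def inner_vec_def)

lemma Re_ell_cpt: "Re (ell v (cpt x y)) = ell v x"
  by (simp add: ell_def cpt_def)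

lemma cpt_nth [simp]: "cpt x y $ i = Complex (x $ i) (y $ i)"
  by (simp add: cpt_def)

lemma exp_dual:
  fixes z :: "complex ^ 'n::finite"
  assumes "finite S"
  shows "(\<Prod>j\<in>S. exp (- (ell (b j) z) * of_real (t j))) =
    (\<Prod>j\<in>S. exp (- of_real (t j))) * (\<Prod>i\<in>UNIV. exp (of_real (dual_sum b S t $ i) * z $ i))"
proof -
  have "(\<Sum>j\<in>S. - ell (b j) z * of_real (t j)) = (\<Sum>j\<in>S. - of_real (t j)) + (\<Sum>j\<in>S. (\<Sum>i\<in>UNIV. of_real (b j $ i) * z $ i) * of_real (t j))"
    unfolding sum.distrib[symmetric] by (intro sum.cong) (auto simp: ell_def algebra_simps)
  also have "(\<Sum>j\<in>S. (\<Sum>i\<in>UNIV. of_real (b j $ i) * z $ i) * of_real (t j)) = (\<Sum>i\<in>UNIV. of_real (dual_sum b S t $ i) * z $ i)"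
    unfolding dual_sum_def sum_distrib_right
    by (subst sum.swap) (simp add: sum_distrib_left sum_distrib_right mult_ac)
  finally show ?thesis
    by (simp flip: exp_sum add: assms exp_add)
qed

lemma prod_of_bool:
  "finite S \<Longrightarrow> (\<Prod>j\<in>S. if P j then 1 else (0::real)) = (if \<forall>j\<in>S. P j then 1 else 0)"
  by (induction rule: finite_induct) auto

text \<open>The real parts of all exponents are positive, so the double integral over the fibre and over the
  Gamma variables converges absolutely and may be evaluated in either order.\<close>

theorem fibre_eq_dual_integral:
  fixes x :: "real ^ 'n::finite"
  assumes S: "finite S" and q: "\<And>j. j \<in> S \<Longrightarrow> q j \<ge> 1"
    and l: "\<And>j. j \<in> S \<Longrightarrow> ell (b j) x \<noteq> 0" and x: "\<And>i. x $ i \<noteq> 0" and s: "\<And>i. s $ i \<ge> 1"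
  shows "integrable (\<Pi>\<^sub>M j\<in>S. lborel) (\<lambda>t. indicator (dual_region b S x) t * dual_density b S q s t)"
    and "fibre b S q x s = of_real ((\<Prod>i\<in>UNIV. sgn (x $ i)) * (\<Prod>j\<in>S. sgn (ell (b j) x)) * dual_integral b S q x s)"
proof -
  interpret PS: finite_product_sigma_finite "\<lambda>_::nat. lborel :: real measure" S by standard (rule S)
  let ?N = "\<Pi>\<^sub>M j\<in>S. (lborel :: real measure)"
  interpret N: sigma_finite_measure ?N ..
  interpret P: pair_sigma_finite "lborel :: (real ^ 'n) measure" ?N ..
  let ?k = "\<lambda>i. nat (s $ i)"
  have k: "?k i \<ge> 1" for i using s[of i] by simp
  let ?J = "\<lambda>j. {t. ell (b j) x * t > 0} :: real set"
  let ?a = "\<lambda>j c t. indicator (?J j) t *\<^sub>R (of_real t ^ (q j - 1) / fact (q j - 1) * exp (- c * of_real t)) :: complex"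
  \<comment> \<open>integrating \<open>?\<Phi>\<close> over \<open>t\<close> first gives the fibre integrand, integrating over \<open>y\<close> first the real density\<close>
  let ?\<Phi> = "\<lambda>(y, t). (\<Prod>j\<in>S. ?a j (ell (b j) (cpt x y)) (t j)) * (\<Prod>i\<in>UNIV. inverse (cpt x y $ i) ^ Suc (?k i))"
  have gam: "integrable lborel (?a j c)" "integral\<^sup>L lborel (?a j c) = of_real (sgn (ell (b j) x)) * inverse c ^ q j"
    if "j \<in> S" "Re c = ell (b j) x" for j c
  proof -
    have "ell (b j) x * Re c > 0" using l[OF that(1)] unfolding that(2) by (cases "ell (b j) x > 0") (auto simp: zero_less_mult_iff)
    then show "integrable lborel (?a j c)" "integral\<^sup>L lborel (?a j c) = of_real (sgn (ell (b j) x)) * inverse c ^ q j"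
      using gamma_integral_signed[of "ell (b j) x" c "q j - 1"] q[OF that(1)] by auto
  qed
  have meas: "?\<Phi> \<in> borel_measurable (lborel \<Otimes>\<^sub>M ?N)"
  proof -
    have t: "(\<lambda>z. snd z j) \<in> borel_measurable (lborel \<Otimes>\<^sub>M ?N)" if "j \<in> S" for j
    proof -
      have "(\<lambda>z. snd z j) \<in> measurable (lborel \<Otimes>\<^sub>M ?N) lborel"
        by (rule measurable_compose[OF measurable_snd measurable_component_singleton[OF that]])
      then show ?thesis by simp
    qed
    have y: "(\<lambda>z. Complex (x $ i) (fst z $ i)) \<in> borel_measurable (lborel \<Otimes>\<^sub>M ?N)" for i
    proof -
      have "(\<lambda>y::real ^ 'n. Complex (x $ i) (y $ i)) \<in> borel_measurable lborel"
        unfolding measurable_lborel2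
        by (intro borel_measurable_continuous_onI continuous_on_Complex continuous_intros)
      then show ?thesis by (rule measurable_compose[OF measurable_fst])
    qed
    have J: "?J j \<in> sets borel" for j
      by (intro borel_open open_Collect_less continuous_intros)
    have I: "(\<lambda>z. indicator (?J j) (snd z j) :: real) \<in> borel_measurable (lborel \<Otimes>\<^sub>M ?N)" if "j \<in> S" for j
      by (rule measurable_compose[OF t[OF that]]) (intro borel_measurable_indicator J)
    have E: "(\<lambda>z. exp (- ell (b j) (cpt x (fst z)) * complex_of_real (snd z j))) \<in> borel_measurable (lborel \<Otimes>\<^sub>M ?N)" if "j \<in> S" for j
      unfolding ell_def cpt_nth
      by (rule measurable_compose[OF _ borel_measurable_exp])
        (intro borel_measurable_times borel_measurable_uminus borel_measurable_diff borel_measurable_const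
          borel_measurable_sum y measurable_compose[OF t[OF that] borel_measurable_of_real])
    show ?thesis unfolding case_prod_beta cpt_nth
      by (intro borel_measurable_times borel_measurable_prod borel_measurable_scaleR I E borel_measurable_divide
         borel_measurable_power borel_measurable_const borel_measurable_inverse y
         measurable_compose[OF t borel_measurable_of_real])
  qed
  let ?h = "\<lambda>y::real ^ 'n. \<Prod>i\<in>UNIV. inverse (Complex (x $ i) (y $ i)) ^ Suc (?k i)"
  let ?g = "\<lambda>t. \<Prod>j\<in>S. ?a j (of_real (ell (b j) x)) (t j)"
  have int: "integrable (lborel \<Otimes>\<^sub>M ?N) ?\<Phi>"
  proof (rule Bochner_Integration.integrable_bound[OF P.integrable_mult_pair meas])
    show "integrable lborel (\<lambda>y. norm (?h y))"
      by (intro integrable_norm integral_vec_prod inverse_power_integrable x) (use k in auto)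
    show "integrable ?N (\<lambda>t. norm (?g t))"
      by (intro integrable_norm lborel_PiM.product_integrable_prod S gam) auto
    have "norm (?a j (ell (b j) (cpt x y)) t) = norm (?a j (of_real (ell (b j) x)) t)" for j y t
      by (simp add: norm_mult norm_divide norm_power Re_ell_cpt)
    note N = this
    have "norm (\<Prod>j\<in>S. ?a j (ell (b j) (cpt x y)) (t j)) = norm (?g t)" for y t
      by (simp only: prod_norm[symmetric] N)
    then have eq: "norm (?\<Phi> (y, t)) = norm (?h y) * norm (?g t)" for y t
      unfolding prod.case norm_mult cpt_nth by (simp only: mult.commute[of "norm (?h y)"])
    show "AE z in lborel \<Otimes>\<^sub>M ?N. norm (?\<Phi> z) \<le> norm (case z of (y, t) \<Rightarrow> norm (?h y) * norm (?g t))"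
    proof (rule AE_I2)
      fix z :: "(real ^ 'n) \<times> (nat \<Rightarrow> real)"
      obtain y t where z: "z = (y, t)" by (cases z)
      show "norm (?\<Phi> z) \<le> norm (case z of (y, t) \<Rightarrow> norm (?h y) * norm (?g t))"
        unfolding z eq unfolding prod.case real_norm_def by (rule abs_ge_self)
    qed
  qed
  have A: "(\<integral>t. ?\<Phi> (y, t) \<partial>?N) = of_real (\<Prod>j\<in>S. sgn (ell (b j) x)) * fibre_term b S q s (cpt x y)" for y
  proof -
    have nz: "Complex (x $ i) (y $ i) \<noteq> 0" for i using x[of i] by (simp add: complex_eq_iff)
    have p: "z powi (- (s $ i) - 1) = inverse z ^ Suc (?k i)" for z :: complex and i
    proof -
      have "- (s $ i) - 1 = - int (Suc (?k i))" using s[of i] by simp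
      then show ?thesis by (simp only: power_int_minus power_int_of_nat power_inverse)
    qed
    have "(\<integral>t. (\<Prod>j\<in>S. ?a j (ell (b j) (cpt x y)) (t j)) \<partial>?N) = (\<Prod>j\<in>S. integral\<^sup>L lborel (?a j (ell (b j) (cpt x y))))"
      by (rule lborel_PiM.product_integral_prod[OF S gam(1)[OF _ Re_ell_cpt]])
    also have "\<dots> = (\<Prod>j\<in>S. of_real (sgn (ell (b j) x)) * inverse (ell (b j) (cpt x y)) ^ q j)"
      by (rule prod.cong[OF refl gam(2)[OF _ Re_ell_cpt]])
    finally show ?thesis
      unfolding prod.case integral_mult_left_zero fibre_term_def p by (simp only: prod.distrib of_real_prod mult.assoc)
  qed
  have B: "(\<integral>y. ?\<Phi> (y, t) \<partial>lborel) =
      of_real ((2 * pi) ^ CARD('n) * (\<Prod>i\<in>UNIV. sgn (x $ i)) * (indicator (dual_region b S x) t * dual_density b S q s t))" for t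
  proof -
    let ?u = "dual_sum b S t"
    have split: "?a j c (t j) = of_real (indicator (?J j) (t j) * (t j ^ (q j - 1) / fact (q j - 1))) * exp (- c * of_real (t j))" for j c
      by (simp add: scaleR_conv_of_real)
    have \<Phi>: "?\<Phi> (y, t) = of_real (\<Prod>j\<in>S. indicator (?J j) (t j) * (t j ^ (q j - 1) / fact (q j - 1)) * exp (- t j)) *
       (\<Prod>i\<in>UNIV. exp (of_real (?u $ i) * Complex (x $ i) (y $ i)) * inverse (Complex (x $ i) (y $ i)) ^ Suc (?k i))" for y
    proof -
      have e: "exp (- complex_of_real (t j)) = of_real (exp (- t j))" for j
        by (simp add: exp_of_real[symmetric])
      show ?thesis
        unfolding prod.case split prod.distrib exp_dual[OF S] e cpt_nth
        by (simp only: of_real_mult of_real_prod prod.distrib mult_ac)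
    qed
    have "(\<integral>y. ?\<Phi> (y, t) \<partial>lborel) = of_real (\<Prod>j\<in>S. indicator (?J j) (t j) * (t j ^ (q j - 1) / fact (q j - 1)) * exp (- t j)) *
       (\<Prod>i\<in>UNIV. \<integral>y. exp (of_real (?u $ i) * Complex (x $ i) y) * inverse (Complex (x $ i) y) ^ Suc (?k i) \<partial>lborel)"
    proof -
      have i: "integrable lborel (\<lambda>y. exp (of_real (?u $ i) * Complex (x $ i) y) * inverse (Complex (x $ i) y) ^ Suc (?k i))" for i
        by (intro exp_kernel_integrable x) (use k[of i] in simp)
      show ?thesis unfolding \<Phi> integral_mult_right_zero integral_vec_prod(2)[OF i] ..
    qed
    also have "(\<Prod>i\<in>UNIV. \<integral>y. exp (of_real (?u $ i) * Complex (x $ i) y) * inverse (Complex (x $ i) y) ^ Suc (?k i) \<partial>lborel) =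
       (\<Prod>i\<in>UNIV. of_real (2 * pi) * of_real (sgn (x $ i)) * of_real ((if ?u $ i * x $ i > 0 then 1 else 0) * (?u $ i ^ ?k i / fact (?k i))))"
      by (intro prod.cong refl) (subst exp_kernel[OF x k], simp)
    also have "\<dots> = of_real ((2 * pi) ^ CARD('n) * (\<Prod>i\<in>UNIV. sgn (x $ i)) *
       ((if \<forall>i. ?u $ i * x $ i > 0 then 1 else 0) * (\<Prod>i\<in>UNIV. ?u $ i ^ ?k i / fact (?k i))))"
    proof -
      have "(\<Prod>i\<in>UNIV. (if ?u $ i * x $ i > 0 then 1 else 0)) = (if \<forall>i. ?u $ i * x $ i > 0 then 1 else (0::real))"
        using prod_of_bool[of "UNIV :: 'n set" "\<lambda>i. ?u $ i * x $ i > 0"] by simp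
      then have "(\<Prod>i\<in>UNIV. (2 * pi) * sgn (x $ i) * ((if ?u $ i * x $ i > 0 then 1 else 0) * (?u $ i ^ ?k i / fact (?k i)))) =
        (2 * pi) ^ CARD('n) * (\<Prod>i\<in>UNIV. sgn (x $ i)) *
        ((if \<forall>i. ?u $ i * x $ i > 0 then 1 else 0) * (\<Prod>i\<in>UNIV. ?u $ i ^ ?k i / fact (?k i)))"
        by (simp only: prod.distrib prod_constant power_mult_distrib)
      then show ?thesis by (simp only: of_real_mult[symmetric] of_real_prod[symmetric])
    qed
    also have "(\<Prod>j\<in>S. indicator (?J j) (t j) * (t j ^ (q j - 1) / fact (q j - 1)) * exp (- t j)) =
       (if \<forall>j\<in>S. ell (b j) x * t j > 0 then 1 else 0) * (\<Prod>j\<in>S. t j ^ (q j - 1) / fact (q j - 1) * exp (- t j))"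
    proof -
      have "(\<Prod>j\<in>S. indicator (?J j) (t j)) = (if \<forall>j\<in>S. ell (b j) x * t j > 0 then 1 else (0::real))"
        unfolding prod_of_bool[OF S, symmetric] by (intro prod.cong) (auto simp: indicator_def)
      then show ?thesis by (simp only: prod.distrib mult.assoc)
    qed
    finally have eq: "(\<integral>y. ?\<Phi> (y, t) \<partial>lborel) =
      of_real (((if \<forall>j\<in>S. ell (b j) x * t j > 0 then 1 else 0) * (\<Prod>j\<in>S. t j ^ (q j - 1) / fact (q j - 1) * exp (- t j)))) *
      of_real ((2 * pi) ^ CARD('n) * (\<Prod>i\<in>UNIV. sgn (x $ i)) *
       ((if \<forall>i. ?u $ i * x $ i > 0 then 1 else 0) * (\<Prod>i\<in>UNIV. ?u $ i ^ ?k i / fact (?k i))))" .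
    have ind: "indicator (dual_region b S x) t =
      (if \<forall>j\<in>S. ell (b j) x * t j > 0 then 1 else 0) * (if \<forall>i. ?u $ i * x $ i > 0 then 1 else (0::real))"
      by (simp add: dual_region_def indicator_def)
    show ?thesis unfolding eq ind dual_density_def by (simp only: of_real_mult mult_ac)
  qed
  have "integrable ?N (\<lambda>t. \<integral>y. ?\<Phi> (y, t) \<partial>lborel)"
    using P.integrable_snd[of "\<lambda>y t. ?\<Phi> (y, t)"] int by (simp add: case_prod_beta)
  then have "integrable ?N (\<lambda>t. Re (\<integral>y. ?\<Phi> (y, t) \<partial>lborel))" by (rule integrable_Re)
  then have "integrable ?N (\<lambda>t. ((2 * pi) ^ CARD('n) * (\<Prod>i\<in>UNIV. sgn (x $ i))) * (indicator (dual_region b S x) t * dual_density b S q s t))"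
    unfolding B by (simp only: Re_complex_of_real)
  moreover have c: "(2 * pi) ^ CARD('n) * (\<Prod>i\<in>UNIV. sgn (x $ i)) \<noteq> 0"
    using x by (simp add: sgn_zero_iff)
  ultimately show "integrable ?N (\<lambda>t. indicator (dual_region b S x) t * dual_density b S q s t)"
    by (simp only: integrable_mult_left_iff simp_thms)
  have "of_real (\<Prod>j\<in>S. sgn (ell (b j) x)) * (\<integral>y. fibre_term b S q s (cpt x y) \<partial>lborel) =
     (\<integral>y. (\<integral>t. ?\<Phi> (y, t) \<partial>?N) \<partial>lborel)"
    unfolding A by (rule integral_mult_right_zero[symmetric])
  also have "\<dots> = (\<integral>t. (\<integral>y. ?\<Phi> (y, t) \<partial>lborel) \<partial>?N)"
    unfolding prod.case by (rule P.Fubini_integral[OF int, symmetric])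
  also have "\<dots> = of_real ((2 * pi) ^ CARD('n) * (\<Prod>i\<in>UNIV. sgn (x $ i)) * dual_integral b S q x s)"
    unfolding B integral_complex_of_real dual_integral_def integral_mult_right_zero ..
  finally have eq: "of_real (\<Prod>j\<in>S. sgn (ell (b j) x)) * (\<integral>y. fibre_term b S q s (cpt x y) \<partial>lborel) =
    complex_of_real ((2 * pi) ^ CARD('n) * (\<Prod>i\<in>UNIV. sgn (x $ i)) * dual_integral b S q x s)" .
  have sq: "(\<Prod>j\<in>S. sgn (ell (b j) x)) * (\<Prod>j\<in>S. sgn (ell (b j) x)) = 1"
    unfolding prod.distrib[symmetric] by (intro prod.neutral ballI) (simp add: l sgn_if)
  have "(\<integral>y. fibre_term b S q s (cpt x y) \<partial>lborel) = of_real ((\<Prod>j\<in>S. sgn (ell (b j) x)) * (\<Prod>j\<in>S. sgn (ell (b j) x))) * (\<integral>y. fibre_term b S q s (cpt x y) \<partial>lborel)"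
    by (simp only: sq of_real_1 mult_1_left)
  also have "\<dots> = of_real (\<Prod>j\<in>S. sgn (ell (b j) x)) * of_real ((2 * pi) ^ CARD('n) * (\<Prod>i\<in>UNIV. sgn (x $ i)) * dual_integral b S q x s)"
    unfolding eq[symmetric] by (simp only: of_real_mult mult.assoc)
  finally have eq2: "(\<integral>y. fibre_term b S q s (cpt x y) \<partial>lborel) =
    of_real (\<Prod>j\<in>S. sgn (ell (b j) x)) * of_real ((2 * pi) ^ CARD('n) * (\<Prod>i\<in>UNIV. sgn (x $ i)) * dual_integral b S q x s)" .
  have canc: "1 / c * (A * (c * P * D)) = P * A * D" if "c \<noteq> 0" for c A P D :: real
    using that by simp
  show "fibre b S q x s = of_real ((\<Prod>i\<in>UNIV. sgn (x $ i)) * (\<Prod>j\<in>S. sgn (ell (b j) x)) * dual_integral b S q x s)"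
    unfolding fibre_def eq2 of_real_mult[symmetric] of_real_eq_iff
    by (rule canc) simp
qed

section \<open>Exponential decay in a cone of directions\<close>

definition isum :: "int ^ 'n::finite \<Rightarrow> real" where
  "isum s = (\<Sum>i\<in>UNIV. real_of_int (s $ i))"

text \<open>A cone around the ray of \<open>r\<close>. The scale \<open>n\<close> is a real parameter that is only comparable to the size of \<open>s\<close>;
  this makes the cones stable under bounded shifts of \<open>s\<close>.\<close>

definition near :: "real ^ 'n \<Rightarrow> real \<Rightarrow> real \<Rightarrow> int ^ 'n::finite \<Rightarrow> bool" where
  "near r N \<delta> s \<longleftrightarrow> (\<exists>n\<ge>N. \<forall>i. \<bar>real_of_int (s $ i) - n * r $ i\<bar> \<le> \<delta> * n)"

text \<open>A rate strictly below \<open>h\<close>, on integer exponents so that shifts are always defined.\<close>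

definition decays :: "real ^ 'n \<Rightarrow> real \<Rightarrow> (int ^ 'n::finite \<Rightarrow> complex) \<Rightarrow> bool" where
  "decays r h c \<longleftrightarrow> (\<exists>N>0. \<exists>\<delta>>0. \<exists>h'<h. \<forall>s. near r N \<delta> s \<longrightarrow> cmod (c s) \<le> exp (h' * isum s))"

definition ivec :: "nat ^ 'n \<Rightarrow> int ^ 'n::finite" where
  "ivec s = (\<chi> i. int (s $ i))"

lemma ivec_nth [simp]: "ivec s $ i = int (s $ i)"
  by (simp add: ivec_def)

lemma isum_ivec: "isum (ivec s) = real (multi_size s)"
  by (simp add: isum_def multi_size_def)

lemma near_mono: "near r N' \<delta>' s \<Longrightarrow> 0 < N' \<Longrightarrow> N \<le> N' \<Longrightarrow> \<delta>' \<le> \<delta> \<Longrightarrow> near r N \<delta> s"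
  unfolding near_def by (meson dual_order.trans mult_right_mono less_le_trans less_imp_le)

locale direction =
  fixes r :: "real ^ 'n::finite"
  assumes r_pos: "\<And>i. r $ i > 0" and r_sum: "(\<Sum>i\<in>UNIV. r $ i) = 1"
begin

lemma isum_near:
  assumes "\<forall>i. \<bar>real_of_int (s $ i) - n * r $ i\<bar> \<le> \<delta> * n"
  shows "\<bar>isum s - n\<bar> \<le> real CARD('n) * \<delta> * n"
proof -
  have "isum s - n = (\<Sum>i\<in>UNIV. real_of_int (s $ i) - n * r $ i)"
    by (simp add: isum_def sum_subtractf r_sum flip: sum_distrib_left)
  also have "\<bar>\<dots>\<bar> \<le> (\<Sum>i\<in>(UNIV :: 'n set). \<delta> * n)"
    using assms by (intro order_trans[OF sum_abs] sum_mono) auto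
  finally show ?thesis by simp
qed

text \<open>All components of \<open>r\<close> are positive, so points far out in a narrow cone have large coordinates. For this reason
  the values of an array at exponents with a small coordinate never matter.\<close>

lemma near_large:
  obtains N0 \<delta>0 where "N0 > 0" "\<delta>0 > 0"
    "\<And>N \<delta> s. N0 \<le> N \<Longrightarrow> \<delta> \<le> \<delta>0 \<Longrightarrow> near r N \<delta> s \<Longrightarrow> (\<forall>i. s $ i \<ge> M) \<and> isum s \<ge> N / 2"
proof -
  define \<rho> where "\<rho> = Min (range (\<lambda>i. r $ i))"
  have \<rho>: "\<rho> > 0" "\<And>i. \<rho> \<le> r $ i" using r_pos by (auto simp: \<rho>_def)
  define \<delta>0 where "\<delta>0 = min (\<rho> / 2) (1 / (2 * real CARD('n)))"
  define N0 where "N0 = max 1 (2 * \<bar>real_of_int M\<bar> / \<rho>)"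
  show ?thesis
  proof (rule that[of N0 \<delta>0])
    show "N0 > 0" "\<delta>0 > 0" using \<rho> by (auto simp: N0_def \<delta>0_def)
    fix N \<delta> s assume *: "N0 \<le> N" "\<delta> \<le> \<delta>0" "near r N \<delta> s"
    then obtain n where n: "n \<ge> N" "\<forall>i. \<bar>real_of_int (s $ i) - n * r $ i\<bar> \<le> \<delta> * n" by (auto simp: near_def)
    have n1: "n \<ge> 1" "n \<ge> 2 * \<bar>real_of_int M\<bar> / \<rho>" using n * by (auto simp: N0_def)
    have "\<delta> * n \<le> \<rho> / 2 * n" using * n1 by (intro mult_right_mono) (auto simp: \<delta>0_def)
    moreover have "n * \<rho> \<le> n * r $ i" for i using \<rho>(2) n1 by (intro mult_left_mono) auto
    moreover have "\<bar>real_of_int M\<bar> \<le> \<rho> / 2 * n" using n1 \<rho> by (simp add: field_simps)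
    ultimately have "real_of_int M \<le> real_of_int (s $ i)" for i
      using n(2)[rule_format, of i] by (smt (verit) field_sum_of_halves left_diff_distrib mult.commute times_divide_eq_left)
    then have "\<forall>i. M \<le> s $ i" by simp
    moreover
    have "real CARD('n) * \<delta> * n \<le> 1 / 2 * n"
      using * n1 by (intro mult_right_mono) (auto simp: \<delta>0_def field_simps)
    then have "N / 2 \<le> isum s" using isum_near[OF n(2)] n by simp
    ultimately show "(\<forall>i. M \<le> s $ i) \<and> N / 2 \<le> isum s" by blast
  qed
qed

lemma decays_intro:
  "N > 0 \<Longrightarrow> \<delta> > 0 \<Longrightarrow> h' < h \<Longrightarrow> (\<And>s. near r N \<delta> s \<Longrightarrow> cmod (c s) \<le> exp (h' * isum s)) \<Longrightarrow> decays r h c"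
  unfolding decays_def by blast

text \<open>A polynomial factor is absorbed by a slight increase of the rate.\<close>

lemma decaysI:
  assumes "N > 0" "\<delta> > 0" "h' < h"
    and b: "\<And>s. near r N \<delta> s \<Longrightarrow> (\<forall>i. s $ i \<ge> M) \<Longrightarrow> cmod (c s) \<le> A * isum s ^ k * exp (h' * isum s)"
  shows "decays r h c"
proof -
  define h'' where "h'' = (h + h') / 2"
  have e: "h'' - h' > 0" using assms by (simp add: h''_def field_simps)
  have "((\<lambda>x. inverse ((h''-h')^k) * (((h''-h') * x) ^ k / exp ((h'' - h') * x))) \<longlongrightarrow> inverse ((h''-h')^k) * 0) at_top"
    using e by (intro tendsto_mult tendsto_const filterlim_compose[OF tendsto_power_div_exp_0]
         filterlim_tendsto_pos_mult_at_top[OF tendsto_const] filterlim_ident) auto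
  moreover have "inverse ((h''-h')^k) * (((h''-h') * x) ^ k / exp ((h'' - h') * x)) = x ^ k / exp ((h'' - h') * x)" for x
    using e by (simp add: power_mult_distrib)
  ultimately have "((\<lambda>x. x ^ k / exp ((h'' - h') * x)) \<longlongrightarrow> 0) at_top" by simp
  from tendsto_mult_right_zero[OF this] have "((\<lambda>x. A * (x ^ k / exp ((h'' - h') * x))) \<longlongrightarrow> 0) at_top" .
  then have "eventually (\<lambda>x. A * (x ^ k / exp ((h'' - h') * x)) < 1) at_top"
    by (rule order_tendstoD) simp
  then obtain X where X: "\<And>x. x \<ge> X \<Longrightarrow> A * (x ^ k / exp ((h'' - h') * x)) < 1"
    by (auto simp: eventually_at_top_linorder)
  obtain N0 \<delta>0 where N0: "N0 > 0" "\<delta>0 > 0"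
    "\<And>N \<delta> s. N0 \<le> N \<Longrightarrow> \<delta> \<le> \<delta>0 \<Longrightarrow> near r N \<delta> s \<Longrightarrow> (\<forall>i. s $ i \<ge> M) \<and> isum s \<ge> N / 2"
    by (rule near_large[of M]) blast
  define N1 where "N1 = max (max N N0) (2 * X)"
  define \<delta>1 where "\<delta>1 = min \<delta> \<delta>0"
  show ?thesis
  proof (rule decays_intro[of N1 \<delta>1 h''])
    show "N1 > 0" "\<delta>1 > 0" "h'' < h" using assms N0 by (auto simp: N1_def \<delta>1_def h''_def)
    fix s assume s: "near r N1 \<delta>1 s"
    have l: "\<forall>i. s $ i \<ge> M" "isum s \<ge> N1 / 2" using N0(3)[of N1 \<delta>1 s] s by (auto simp: N1_def \<delta>1_def)
    have x: "isum s \<ge> X" using l by (simp add: N1_def)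
    have "near r N \<delta> s" by (rule near_mono[OF s]) (use assms N0 in \<open>auto simp: N1_def \<delta>1_def\<close>)
    then have "cmod (c s) \<le> A * isum s ^ k * exp (h' * isum s)" using b l by blast
    also have "\<dots> \<le> exp ((h'' - h') * isum s) * exp (h' * isum s)"
    proof (rule mult_right_mono)
      show "A * isum s ^ k \<le> exp ((h'' - h') * isum s)"
        using X[OF x] by (simp add: field_simps)
    qed simp
    also have "\<dots> = exp (h'' * isum s)" by (simp flip: exp_add add: algebra_simps)
    finally show "cmod (c s) \<le> exp (h'' * isum s)" .
  qed
qed

lemma decays_eventually_eq:
  assumes "decays r h c" "\<And>s. (\<forall>i. s $ i \<ge> M) \<Longrightarrow> c' s = c s"
  shows "decays r h c'"
proof -
  obtain N \<delta> h' where *: "N > 0" "\<delta> > 0" "h' < h" "\<And>s. near r N \<delta> s \<Longrightarrow> cmod (c s) \<le> exp (h' * isum s)"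
    using assms(1) by (auto simp: decays_def)
  show ?thesis by (rule decaysI[where A=1 and k=0 and M=M, OF *(1-3)]) (use * assms(2) in auto)
qed

lemma decays_zero: "(\<And>s. (\<forall>i. s $ i \<ge> M) \<Longrightarrow> c s = 0) \<Longrightarrow> decays r h c"
  by (rule decaysI[where N=1 and \<delta>=1 and h'="h-1" and A=1 and k=0 and M=M]) auto

lemma decays_add:
  assumes "decays r h c" "decays r h c'"
  shows "decays r h (\<lambda>s. c s + c' s)"
proof -
  obtain N \<delta> h1 where *: "N > 0" "\<delta> > 0" "h1 < h" "\<And>s. near r N \<delta> s \<Longrightarrow> cmod (c s) \<le> exp (h1 * isum s)"
    using assms(1) by (auto simp: decays_def)
  obtain N' \<delta>' h1' where **: "N' > 0" "\<delta>' > 0" "h1' < h" "\<And>s. near r N' \<delta>' s \<Longrightarrow> cmod (c' s) \<le> exp (h1' * isum s)"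
    using assms(2) by (auto simp: decays_def)
  show ?thesis
  proof (rule decaysI[where A=2 and k=0 and M=0 and h'="max h1 h1'" and N="max N N'" and \<delta>="min \<delta> \<delta>'"])
    fix s :: "int ^ 'n" assume s: "near r (max N N') (min \<delta> \<delta>') s" "\<forall>i. s $ i \<ge> 0"
    have "isum s \<ge> 0" using s(2) by (simp add: isum_def sum_nonneg)
    then have e: "exp (h1 * isum s) \<le> exp (max h1 h1' * isum s)" "exp (h1' * isum s) \<le> exp (max h1 h1' * isum s)"
      by (auto intro: mult_right_mono)
    have "near r N \<delta> s" "near r N' \<delta>' s" by (rule near_mono[OF s(1)]; use * ** in simp)+
    then show "cmod (c s + c' s) \<le> 2 * isum s ^ 0 * exp (max h1 h1' * isum s)"
      using *(4)[of s] **(4)[of s] e norm_triangle_ineq[of "c s" "c' s"]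
      unfolding power_0 mult_1_right by linarith
  qed (use * ** in auto)
qed

lemma decays_cmult: assumes "decays r h c" shows "decays r h (\<lambda>s. a * c s)"
proof -
  obtain N \<delta> h1 where *: "N > 0" "\<delta> > 0" "h1 < h" "\<And>s. near r N \<delta> s \<Longrightarrow> cmod (c s) \<le> exp (h1 * isum s)"
    using assms(1) by (auto simp: decays_def)
  show ?thesis
    by (rule decaysI[where A="cmod a" and k=0 and M=0, OF *(1-3)]) (simp add: norm_mult mult_left_mono *(4))
qed

lemma decays_sum: "(\<And>k. k \<in> A \<Longrightarrow> decays r h (c k)) \<Longrightarrow> decays r h (\<lambda>s. \<Sum>k\<in>A. c k s)"
  by (induction A rule: infinite_finite_induct) (auto intro: decays_add decays_zero)

lemma decays_linear: assumes "decays r h c" shows "decays r h (\<lambda>s. of_int (s $ i + a) * c s)"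
proof -
  obtain N \<delta> h1 where *: "N > 0" "\<delta> > 0" "h1 < h" "\<And>s. near r N \<delta> s \<Longrightarrow> cmod (c s) \<le> exp (h1 * isum s)"
    using assms(1) by (auto simp: decays_def)
  show ?thesis
  proof (rule decaysI[where A="1 + \<bar>real_of_int a\<bar>" and k=1 and M=1, OF *(1-3)])
    fix s :: "int ^ 'n" assume s: "near r N \<delta> s" "\<forall>i. s $ i \<ge> 1"
    have "real_of_int (s $ i) \<le> isum s" unfolding isum_def
      using s(2) by (intro member_le_sum) (auto intro: order_trans[of 0 1])
    moreover have "real_of_int (s $ i) \<ge> 1" using s(2) by simp
    ultimately have 1: "isum s \<ge> 1" "\<bar>real_of_int (s $ i)\<bar> \<le> isum s" by auto
    have "cmod (of_int (s $ i + a)) = \<bar>real_of_int (s $ i + a)\<bar>" by (rule norm_of_int)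
    also have "\<dots> \<le> isum s + \<bar>real_of_int a\<bar> * 1" using 1 by simp
    also have "\<dots> \<le> isum s + \<bar>real_of_int a\<bar> * isum s" using 1 by (intro add_left_mono mult_left_mono) auto
    finally have "cmod (of_int (s $ i + a)) \<le> (1 + \<bar>real_of_int a\<bar>) * isum s ^ 1" by (simp add: algebra_simps)
    then show "cmod (of_int (s $ i + a) * c s) \<le> (1 + \<bar>real_of_int a\<bar>) * isum s ^ 1 * exp (h1 * isum s)"
      unfolding norm_mult using *(4)[OF s(1)] by (intro mult_mono) (use 1 in auto)
  qed
qed

lemma decays_shift: assumes "decays r h c" shows "decays r h (\<lambda>s. c (s - v))"
proof -
  obtain N \<delta> h1 where *: "N > 0" "\<delta> > 0" "h1 < h" "\<And>s. near r N \<delta> s \<Longrightarrow> cmod (c s) \<le> exp (h1 * isum s)"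
    using assms(1) by (auto simp: decays_def)
  define V where "V = (\<Sum>i\<in>UNIV. \<bar>real_of_int (v $ i)\<bar>)"
  have V: "\<bar>real_of_int (v $ i)\<bar> \<le> V" for i unfolding V_def by (intro member_le_sum) auto
  show ?thesis
  proof (rule decaysI[where A="exp (- h1 * isum v)" and k=0 and M=0 and N="max N (2 * V / \<delta>)" and \<delta>="\<delta>/2" and h'=h1])
    fix s assume "near r (max N (2 * V / \<delta>)) (\<delta>/2) s"
    then obtain n where n: "n \<ge> N" "n \<ge> 2 * V / \<delta>" "\<forall>i. \<bar>real_of_int (s $ i) - n * r $ i\<bar> \<le> \<delta>/2 * n" by (auto simp: near_def)
    have "V \<le> \<delta>/2 * n" using n(2) *(2) by (simp add: field_simps)
    then have "\<bar>real_of_int ((s - v) $ i) - n * r $ i\<bar> \<le> \<delta> * n" for i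
      using n(3)[rule_format, of i] V[of i] unfolding vector_minus_component of_int_diff by linarith
    then have "near r N \<delta> (s - v)" using n(1) by (auto simp: near_def)
    then have "cmod (c (s - v)) \<le> exp (h1 * isum (s - v))" by (rule *(4))
    also have "h1 * isum (s - v) = - h1 * isum v + h1 * isum s" by (simp add: isum_def sum_subtractf algebra_simps)
    finally show "cmod (c (s - v)) \<le> exp (- h1 * isum v) * isum s ^ 0 * exp (h1 * isum s)"
      by (simp only: exp_add power_0 mult_1_right)
  qed (use * in auto)
qed

text \<open>The exponent is linear in \<open>s\<close>, so on a narrow cone it is close to the size of \<open>s\<close> times its value at \<open>r\<close>.\<close>

lemma decays_of_point_bound:
  assumes b: "\<And>s. (\<forall>i. s $ i \<ge> M) \<Longrightarrow> cmod (c s) \<le> C * exp (- (\<Sum>i\<in>UNIV. real_of_int (s $ i) * L i))"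
    and h: "- (\<Sum>i\<in>UNIV. r $ i * L i) < h"
  shows "decays r h c"
proof -
  define H where "H = - (\<Sum>i\<in>UNIV. r $ i * L i)"
  define h' where "h' = (h + H) / 2"
  have h': "H < h'" "h' < h" using h by (auto simp: h'_def H_def)
  define \<Lambda> where "\<Lambda> = (\<Sum>i\<in>UNIV. \<bar>L i\<bar>) + \<bar>h'\<bar> * real CARD('n) + 1"
  have \<Lambda>: "\<Lambda> > 0" by (simp add: \<Lambda>_def sum_nonneg add_nonneg_pos)
  define \<delta> where "\<delta> = (h' - H) / \<Lambda>"
  have \<delta>: "\<delta> > 0" using h' \<Lambda> by (simp add: \<delta>_def)
  show ?thesis
  proof (rule decaysI[where A="\<bar>C\<bar>" and k=0 and M=M and N=1 and \<delta>=\<delta> and h'=h'])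
    fix s assume s: "near r 1 \<delta> s" "\<forall>i. s $ i \<ge> M"
    then obtain n where n: "n \<ge> 1" "\<forall>i. \<bar>real_of_int (s $ i) - n * r $ i\<bar> \<le> \<delta> * n" by (auto simp: near_def)
    have "- (\<Sum>i\<in>UNIV. real_of_int (s $ i) * L i) - n * H = - (\<Sum>i\<in>UNIV. (real_of_int (s $ i) - n * r $ i) * L i)"
      by (simp add: H_def algebra_simps sum_subtractf sum_distrib_left)
    also have "\<dots> \<le> (\<Sum>i\<in>UNIV. \<bar>(real_of_int (s $ i) - n * r $ i) * L i\<bar>)"
      using sum_abs[of "\<lambda>i. (real_of_int (s $ i) - n * r $ i) * L i" UNIV] by linarith
    also have "\<dots> \<le> (\<Sum>i\<in>UNIV. \<delta> * n * \<bar>L i\<bar>)"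
      unfolding abs_mult using n by (intro sum_mono mult_right_mono) auto
    finally have 1: "- (\<Sum>i\<in>UNIV. real_of_int (s $ i) * L i) \<le> n * H + \<delta> * n * (\<Sum>i\<in>UNIV. \<bar>L i\<bar>)"
      by (simp add: sum_distrib_left)
    have "\<bar>h' * (isum s - n)\<bar> \<le> \<bar>h'\<bar> * (real CARD('n) * \<delta> * n)"
      unfolding abs_mult using isum_near[OF n(2)] by (intro mult_left_mono) auto
    then have 2: "n * h' - \<bar>h'\<bar> * (real CARD('n) * \<delta> * n) \<le> h' * isum s" by (simp add: algebra_simps abs_le_iff)
    have "\<delta> * \<Lambda> = h' - H" using \<Lambda> by (simp add: \<delta>_def)
    then have "\<delta> * (\<Sum>i\<in>UNIV. \<bar>L i\<bar>) + \<bar>h'\<bar> * (real CARD('n) * \<delta>) \<le> h' - H"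
      using \<delta> by (simp add: \<Lambda>_def algebra_simps)
    then have "n * (\<delta> * (\<Sum>i\<in>UNIV. \<bar>L i\<bar>) + \<bar>h'\<bar> * (real CARD('n) * \<delta>)) \<le> n * (h' - H)"
      using n by (intro mult_left_mono) auto
    then have "- (\<Sum>i\<in>UNIV. real_of_int (s $ i) * L i) \<le> h' * isum s"
      using 1 2 by (simp add: algebra_simps)
    then have "C * exp (- (\<Sum>i\<in>UNIV. real_of_int (s $ i) * L i)) \<le> \<bar>C\<bar> * exp (h' * isum s)"
      by (intro mult_mono) auto
    then show "cmod (c s) \<le> \<bar>C\<bar> * isum s ^ 0 * exp (h' * isum s)" using b[OF s(2)] by simp
  qed (use \<delta> h' in auto)
qed

text \<open>The cones \<open>near\<close> and the conditions $|s|\to\infty$, $s/|s|\to r$ define the same notion of nearness: $|s|$ itself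
  is a possible scale, and any admissible scale is close to $|s|$ because the components of \<open>r\<close> add up to one.\<close>

lemma eventually_direction_filter:
  assumes "eventually P (direction_filter r)"
  obtains N \<delta> where "N > 0" "\<delta> > 0" "\<And>s. near r N \<delta> (ivec s) \<Longrightarrow> P s"
proof -
  obtain Q1 Q2 where Q: "eventually Q1 (filtercomap multi_size at_top)"
     "eventually Q2 (filtercomap (\<lambda>s. \<chi> i. real (s $ i) / real (multi_size s)) (nhds r))"
     "\<And>s. Q1 s \<Longrightarrow> Q2 s \<Longrightarrow> P s"
    using assms unfolding direction_filter_def eventually_inf by blast
  obtain N1 where N1: "\<And>s. multi_size s \<ge> N1 \<Longrightarrow> Q1 s"
    using Q(1) by (auto simp: eventually_filtercomap eventually_at_top_linorder)
  obtain e where e: "e > 0" "\<And>s. dist (\<chi> i. real (s $ i) / real (multi_size s)) r < e \<Longrightarrow> Q2 s"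
    using Q(2) by (auto simp: eventually_filtercomap eventually_nhds_metric)
  define d where "d = real CARD('n)"
  have d: "d \<ge> 1" by (simp add: d_def Suc_leI)
  define \<delta> where "\<delta> = min (1 / (2 * d)) (e / (4 * d * (1 + d)))"
  have "\<delta> \<le> 1 / (2 * d)" by (simp add: \<delta>_def)
  then have "d * \<delta> \<le> d * (1 / (2 * d))" using d by (intro mult_left_mono) auto
  moreover have "\<delta> > 0" "\<delta> \<le> e / (4 * d * (1 + d))" using d e by (auto simp: \<delta>_def)
  ultimately have \<delta>: "\<delta> > 0" "d * \<delta> \<le> 1/2" "\<delta> \<le> e / (4 * d * (1 + d))"
    using d by auto
  show ?thesis
  proof (rule that[of "2 * real N1 + 1" \<delta>])
    fix s :: "nat ^ 'n" assume "near r (2 * real N1 + 1) \<delta> (ivec s)"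
    then obtain n where n: "n \<ge> 2 * real N1 + 1" "\<forall>i. \<bar>real (s $ i) - n * r $ i\<bar> \<le> \<delta> * n" by (auto simp: near_def)
    have 1: "\<bar>real (multi_size s) - n\<bar> \<le> d * \<delta> * n" using isum_near[of "ivec s" n \<delta>] n(2) by (simp add: isum_ivec d_def)
    have "d * \<delta> * n \<le> 1/2 * n" using \<delta> n by (intro mult_right_mono) auto
    then have 2: "real (multi_size s) \<ge> n / 2" using 1 by linarith
    have "\<bar>real (s $ i) / real (multi_size s) - r $ i\<bar> \<le> 2 * \<delta> * (1 + d)" for i
    proof -
      have r1: "r $ i \<le> 1" using member_le_sum[of i UNIV "\<lambda>i. r $ i"] r_sum r_pos by (auto intro: less_imp_le)
      have p: "real (multi_size s) > 0" using 2 n by linarith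
      have "r $ i * \<bar>n - real (multi_size s)\<bar> \<le> 1 * (d * \<delta> * n)"
        using 1 r1 r_pos[of i] by (intro mult_mono) (auto simp: abs_minus_commute)
      moreover have "\<bar>real (s $ i) - r $ i * real (multi_size s)\<bar> \<le> \<bar>real (s $ i) - n * r $ i\<bar> + \<bar>r $ i * (n - real (multi_size s))\<bar>"
      proof -
        have "real (s $ i) - r $ i * real (multi_size s) = (real (s $ i) - n * r $ i) + r $ i * (n - real (multi_size s))"
          by (simp add: algebra_simps)
        then show ?thesis by (simp only: abs_triangle_ineq)
      qed
      moreover have "\<bar>r $ i * (n - real (multi_size s))\<bar> = r $ i * \<bar>n - real (multi_size s)\<bar>"
        using r_pos[of i] by (simp add: abs_mult)
      ultimately have "\<bar>real (s $ i) - r $ i * real (multi_size s)\<bar> \<le> \<delta> * n + 1 * (d * \<delta> * n)"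
        using n(2)[rule_format, of i] by linarith
      also have "\<dots> = \<delta> * (1 + d) * n" by (simp add: algebra_simps)
      also have "\<delta> * (1 + d) * n \<le> \<delta> * (1 + d) * (2 * real (multi_size s))" using 2 \<delta> d by (intro mult_left_mono) auto
      finally have "\<bar>real (s $ i) - r $ i * real (multi_size s)\<bar> / real (multi_size s) \<le> 2 * \<delta> * (1 + d)"
        using p by (simp add: field_simps)
      moreover have "real (s $ i) / real (multi_size s) - r $ i = (real (s $ i) - r $ i * real (multi_size s)) / real (multi_size s)"
        using p by (simp add: field_simps)
      ultimately show ?thesis using p by simp
    qed
    then have "(\<Sum>i\<in>UNIV. \<bar>((\<chi> i. real (s $ i) / real (multi_size s)) - r) $ i\<bar>) \<le> (\<Sum>i\<in>(UNIV :: 'n set). 2 * \<delta> * (1 + d))"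
      by (intro sum_mono) simp
    also have "\<dots> = d * (2 * \<delta> * (1 + d))" by (simp add: d_def)
    also have "\<dots> \<le> d * (2 * (e / (4 * d * (1 + d))) * (1 + d))" using \<delta> d by (intro mult_left_mono mult_right_mono) auto
    also have "\<dots> = e / 2"
    proof -
      have "d \<noteq> 0" "1 + d \<noteq> 0" using d by auto
      then have "d * (2 * (e / (4 * d * D)) * D) = e / 2" if "D = 1 + d" for D using that by simp
      then show ?thesis by blast
    qed
    also have "\<dots> < e" using e by simp
    finally have "dist (\<chi> i. real (s $ i) / real (multi_size s)) r < e"
      unfolding dist_norm using norm_le_l1_cart order_le_less_trans by blast
    moreover have "multi_size s \<ge> N1" using 2 n by linarith
    ultimately show "P s" using Q(3) N1 e(2) by blast
  qed (use \<delta> in auto)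
qed

lemma eventually_direction_filterI:
  assumes "N > 0" "\<delta> > 0" "\<And>s. near r N \<delta> (ivec s) \<Longrightarrow> P s"
  shows "eventually P (direction_filter r)"
  unfolding direction_filter_def eventually_inf
proof (intro exI conjI allI impI)
  show "eventually (\<lambda>s. multi_size s \<ge> nat \<lceil>N\<rceil>) (filtercomap multi_size at_top)"
    unfolding eventually_filtercomap eventually_at_top_linorder by blast
  show "eventually (\<lambda>s. dist (\<chi> i. real (s $ i) / real (multi_size s)) r < \<delta>) (filtercomap (\<lambda>s. \<chi> i. real (s $ i) / real (multi_size s)) (nhds r))"
    unfolding eventually_filtercomap eventually_nhds_metric
    by (rule exI[of _ "\<lambda>y. dist y r < \<delta>"]) (use assms(2) in auto)
  fix s :: "nat ^ 'n" assume s: "multi_size s \<ge> nat \<lceil>N\<rceil> \<and> dist (\<chi> i. real (s $ i) / real (multi_size s)) r < \<delta>"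
  then have n: "real (multi_size s) \<ge> N" by linarith
  then have p: "real (multi_size s) > 0" using assms(1) by linarith
  have "\<bar>real (s $ i) - real (multi_size s) * r $ i\<bar> \<le> \<delta> * real (multi_size s)" for i
  proof -
    have "\<bar>real (s $ i) / real (multi_size s) - r $ i\<bar> \<le> dist (\<chi> i. real (s $ i) / real (multi_size s)) r"
      using component_le_norm_cart[of "(\<chi> i. real (s $ i) / real (multi_size s)) - r" i] by (simp add: dist_norm)
    then have "\<bar>real (s $ i) / real (multi_size s) - r $ i\<bar> * real (multi_size s) \<le> \<delta> * real (multi_size s)"
      using s p by (intro mult_right_mono) auto
    moreover have "\<bar>real (s $ i) / real (multi_size s) - r $ i\<bar> * real (multi_size s) = \<bar>(real (s $ i) / real (multi_size s) - r $ i) * real (multi_size s)\<bar>"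
      using p by (simp add: abs_mult)
    moreover have "(real (s $ i) / real (multi_size s) - r $ i) * real (multi_size s) = real (s $ i) - real (multi_size s) * r $ i"
      using p by (simp add: field_simps)
    ultimately show ?thesis by simp
  qed
  then have "near r N \<delta> (ivec s)" using n by (auto simp: near_def)
  then show "P s" by (rule assms(3))
qed

lemma rate_bound_iff:
  assumes "multi_size s > 0"
  shows "(if c s = 0 then - \<infinity> else ereal (ln (cmod (c s)) / real (multi_size s))) \<le> ereal h \<longleftrightarrow>
    cmod (c s) \<le> exp (h * real (multi_size s))"
proof (cases "c s = 0")
  case False
  then have "ln (cmod (c s)) \<le> h * real (multi_size s) \<longleftrightarrow> cmod (c s) \<le> exp (h * real (multi_size s))"
    by (metis exp_le_cancel_iff exp_ln zero_less_norm_iff)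
  then show ?thesis using False assms by (simp add: divide_le_eq)
qed simp

lemma nbhd_rate_less_iff_decays: "nbhd_rate r (\<lambda>s. c (ivec s)) < ereal h \<longleftrightarrow> decays r h c"
proof
  let ?f = "\<lambda>s. if c (ivec s) = 0 then - \<infinity> else ereal (ln (cmod (c (ivec s))) / real (multi_size s))"
  obtain N0 \<delta>0 where N0: "N0 > 0" "\<delta>0 > 0"
    "\<And>N \<delta> s. N0 \<le> N \<Longrightarrow> \<delta> \<le> \<delta>0 \<Longrightarrow> near r N \<delta> s \<Longrightarrow> (\<forall>i. s $ i \<ge> 1) \<and> isum s \<ge> N / 2"
    by (rule near_large[of 1]) blast
  {
    assume "nbhd_rate r (\<lambda>s. c (ivec s)) < ereal h"
    then obtain h' where h': "nbhd_rate r (\<lambda>s. c (ivec s)) < ereal h'" "ereal h' < ereal h"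
      using ereal_dense2 by blast
    have "eventually (\<lambda>s. ?f s < ereal h') (direction_filter r)"
      using h'(1) unfolding nbhd_rate_def by (rule Limsup_lessD)
    then obtain N \<delta> where *: "N > 0" "\<delta> > 0" "\<And>s. near r N \<delta> (ivec s) \<Longrightarrow> ?f s < ereal h'"
      by (rule eventually_direction_filter) blast
    show "decays r h c"
    proof (rule decays_intro[of "max N N0" "min \<delta> \<delta>0" h'])
      fix s assume s: "near r (max N N0) (min \<delta> \<delta>0) s"
      have l: "\<forall>i. s $ i \<ge> 1" "isum s \<ge> max N N0 / 2" using N0(3)[OF _ _ s] by auto
      define s' where "s' = (\<chi> i. nat (s $ i))"
      have s': "ivec s' = s" using l(1) by (auto simp: vec_eq_iff s'_def) (metis dual_order.trans nat_0_le zero_le_one)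
      have "near r N \<delta> (ivec s')" unfolding s' by (rule near_mono[OF s]) (use * N0 in auto)
      then have "?f s' \<le> ereal h'" using *(3) by (simp add: less_imp_le)
      moreover have "isum s > 0" using l(2) N0 by linarith
      then have "multi_size s' > 0" using isum_ivec[of s'] s' by simp
      ultimately have "cmod (c (ivec s')) \<le> exp (h' * real (multi_size s'))"
        using rate_bound_iff[of s' "\<lambda>s. c (ivec s)" h'] by blast
      then show "cmod (c s) \<le> exp (h' * isum s)" using isum_ivec[of s'] s' by simp
    qed (use * N0 h' in auto)
  }
  {
    assume "decays r h c"
    then obtain N \<delta> h' where *: "N > 0" "\<delta> > 0" "h' < h" "\<And>s. near r N \<delta> s \<Longrightarrow> cmod (c s) \<le> exp (h' * isum s)"
      by (auto simp: decays_def)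
    have "eventually (\<lambda>s. ?f s \<le> ereal h') (direction_filter r)"
    proof (rule eventually_direction_filterI[of "max N N0" "min \<delta> \<delta>0"])
      fix s :: "nat ^ 'n" assume s: "near r (max N N0) (min \<delta> \<delta>0) (ivec s)"
      have "isum (ivec s) \<ge> max N N0 / 2" using N0(3)[OF _ _ s] by auto
      then have "multi_size s > 0" using N0 by (simp add: isum_ivec)
      moreover have "near r N \<delta> (ivec s)" by (rule near_mono[OF s]) (use * N0 in auto)
      then have "cmod (c (ivec s)) \<le> exp (h' * real (multi_size s))" using *(4)[of "ivec s"] by (simp only: isum_ivec)
      ultimately show "?f s \<le> ereal h'" using rate_bound_iff[of s "\<lambda>s. c (ivec s)" h'] by blast
    qed (use * N0 in auto)
    then have "nbhd_rate r (\<lambda>s. c (ivec s)) \<le> ereal h'"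
      unfolding nbhd_rate_def by (rule Limsup_bounded)
    then show "nbhd_rate r (\<lambda>s. c (ivec s)) < ereal h" using *(3) by (simp add: le_less_trans)
  }
qed

end

section \<open>Polynomials acting on arrays by shifts\<close>

definition pmvec :: "('n \<Rightarrow>\<^sub>0 nat) \<Rightarrow> int ^ 'n::finite" where
  "pmvec \<mu> = (\<chi> i. int (Poly_Mapping.lookup \<mu> i))"

text \<open>If \<open>c\<close> collects the coefficients of a function then \<open>poly_act P c\<close> collects those of its product with \<open>P\<close>; on
  fibre integrals, \<open>poly_act P\<close> multiplies the integrand by \<open>P\<close>.\<close>

definition poly_act :: "'n cpoly \<Rightarrow> (int ^ 'n \<Rightarrow> complex) \<Rightarrow> int ^ 'n::finite \<Rightarrow> complex" where
  "poly_act P c s = (\<Sum>\<mu>\<in>Poly_Mapping.keys P. Poly_Mapping.lookup P \<mu> * c (s - pmvec \<mu>))"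

lemma pmvec_add: "pmvec (\<mu> + \<nu>) = pmvec \<mu> + pmvec \<nu>"
  by (simp add: pmvec_def vec_eq_iff lookup_add)

lemma pmvec_zero [simp]: "pmvec 0 = 0"
  by (simp add: pmvec_def vec_eq_iff)

lemma pmvec_single [simp]: "pmvec (Poly_Mapping.single i 1) = axis i 1"
  by (simp add: pmvec_def vec_eq_iff axis_def lookup_single when_def)

lemma pmvec_single_Suc [simp]: "pmvec (Poly_Mapping.single i (Suc 0)) = axis i 1"
  using pmvec_single[of i] by simp

lemma poly_act_superset:
  assumes "finite A" "Poly_Mapping.keys P \<subseteq> A"
  shows "poly_act P c s = (\<Sum>\<mu>\<in>A. Poly_Mapping.lookup P \<mu> * c (s - pmvec \<mu>))"
  unfolding poly_act_def using assms
  by (intro sum.mono_neutral_left) (auto simp: in_keys_iff)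

lemma poly_act_add: "poly_act (P + Q) c s = poly_act P c s + poly_act Q c s"
proof -
  let ?A = "Poly_Mapping.keys P \<union> Poly_Mapping.keys Q"
  have "Poly_Mapping.keys (P + Q) \<subseteq> ?A" by (rule Poly_Mapping.keys_add)
  then show ?thesis
    by (simp add: poly_act_superset[of ?A] lookup_add distrib_right sum.distrib)
qed

lemma poly_act_zero [simp]: "poly_act 0 c s = 0"
  by (simp add: poly_act_def)

lemma poly_act_single [simp]: "poly_act (Poly_Mapping.single \<mu> a) c s = a * c (s - pmvec \<mu>)"
  by (cases "a = 0") (simp_all add: poly_act_def)

lemma poly_act_one [simp]: "poly_act 1 c s = c s"
  using poly_act_single[of 0 1 c s] by (simp only: single_one pmvec_zero diff_zero mult_1_left)

lemma poly_act_diff: "poly_act (P - Q) c s = poly_act P c s - poly_act Q c s"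
  using poly_act_add[of "P - Q" Q c s] by simp

lemma poly_act_sum: "poly_act (\<Sum>k\<in>A. P k) c s = (\<Sum>k\<in>A. poly_act (P k) c s)"
  by (induction A rule: infinite_finite_induct) (simp_all add: poly_act_add)

lemma poly_mapping_decomp:
  "P = (\<Sum>\<mu>\<in>Poly_Mapping.keys P. Poly_Mapping.single \<mu> (Poly_Mapping.lookup P \<mu>))"
  by (rule poly_mapping_eqI)
    (simp add: lookup_sum lookup_single when_def in_keys_iff)

lemma poly_act_mult: "poly_act (P * Q) c s = poly_act P (poly_act Q c) s"
proof -
  let ?p = "Poly_Mapping.lookup P" and ?q = "Poly_Mapping.lookup Q"
  have "P * Q = (\<Sum>\<mu>\<in>Poly_Mapping.keys P. Poly_Mapping.single \<mu> (?p \<mu>)) * (\<Sum>\<nu>\<in>Poly_Mapping.keys Q. Poly_Mapping.single \<nu> (?q \<nu>))"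
    using poly_mapping_decomp[of P] poly_mapping_decomp[of Q] by simp
  also have "\<dots> = (\<Sum>\<mu>\<in>Poly_Mapping.keys P. \<Sum>\<nu>\<in>Poly_Mapping.keys Q. Poly_Mapping.single (\<mu> + \<nu>) (?p \<mu> * ?q \<nu>))"
    by (simp add: sum_product mult_single)
  finally have "poly_act (P * Q) c s = (\<Sum>\<mu>\<in>Poly_Mapping.keys P. \<Sum>\<nu>\<in>Poly_Mapping.keys Q. ?p \<mu> * ?q \<nu> * c (s - pmvec (\<mu> + \<nu>)))"
    by (simp only: poly_act_sum poly_act_single)
  then show ?thesis
    by (simp add: poly_act_def sum_distrib_left pmvec_add mult.assoc diff_diff_eq)
qed

lemma poly_act_linear:
  "poly_act P (\<lambda>s. c s + c' s) s = poly_act P c s + poly_act P c' s"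
  "poly_act P (\<lambda>s. a * c s) s = a * poly_act P c s"
  "poly_act P (\<lambda>s. 0) s = 0"
  by (simp_all add: poly_act_def distrib_left sum.distrib sum_distrib_left mult_ac)

lemma poly_act_sum_right: "poly_act P (\<lambda>s. \<Sum>k\<in>A. c k s) s = (\<Sum>k\<in>A. poly_act P (c k) s)"
  by (induction A rule: infinite_finite_induct) (simp_all add: poly_act_linear)

lemma poly_act_ell:
  "poly_act (ell_poly v) c s = c s - (\<Sum>i\<in>UNIV. of_real (v $ i) * c (s - axis i 1))"
  by (simp add: ell_poly_def poly_act_diff poly_act_sum)

text \<open>Fibre integrals converge absolutely only for large exponents, and identities between them hold from some bound on.\<close>

definition ev_eq :: "(int ^ 'n::finite \<Rightarrow> complex) \<Rightarrow> (int ^ 'n \<Rightarrow> complex) \<Rightarrow> bool" where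
  "ev_eq c c' \<longleftrightarrow> (\<exists>M. \<forall>s. (\<forall>i. s $ i \<ge> M) \<longrightarrow> c s = c' s)"

lemma ev_eqI: "(\<And>s. (\<forall>i. s $ i \<ge> M) \<Longrightarrow> c s = c' s) \<Longrightarrow> ev_eq c c'"
  unfolding ev_eq_def by blast

lemma ev_eq_refl [simp]: "ev_eq c c" by (simp add: ev_eq_def)

lemma ev_eq_sym: "ev_eq c c' \<Longrightarrow> ev_eq c' c" unfolding ev_eq_def by metis

lemma ev_eq_trans [trans]: assumes "ev_eq a b" "ev_eq b c" shows "ev_eq a c"
proof -
  obtain M N where "\<And>s. (\<forall>i. s $ i \<ge> M) \<Longrightarrow> a s = b s" "\<And>s. (\<forall>i. s $ i \<ge> N) \<Longrightarrow> b s = c s"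
    using assms unfolding ev_eq_def by blast
  then show ?thesis by (intro ev_eqI[of "max M N"]) simp
qed

lemma ev_eq_add: assumes "ev_eq a b" "ev_eq c d" shows "ev_eq (\<lambda>s. a s + c s) (\<lambda>s. b s + d s)"
proof -
  obtain M N where "\<And>s. (\<forall>i. s $ i \<ge> M) \<Longrightarrow> a s = b s" "\<And>s. (\<forall>i. s $ i \<ge> N) \<Longrightarrow> c s = d s"
    using assms unfolding ev_eq_def by blast
  then show ?thesis by (intro ev_eqI[of "max M N"]) simp
qed

lemma ev_eq_cmult: "ev_eq a b \<Longrightarrow> ev_eq (\<lambda>s. k * a s) (\<lambda>s. k * b s)"
  unfolding ev_eq_def by metis

lemma ev_eq_sum: "(\<And>k. k \<in> A \<Longrightarrow> ev_eq (a k) (b k)) \<Longrightarrow> ev_eq (\<lambda>s. \<Sum>k\<in>A. a k s) (\<lambda>s. \<Sum>k\<in>A. b k s)"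
  by (induction A rule: infinite_finite_induct) (simp_all add: ev_eq_add)

lemma ev_eq_shift:
  fixes a b :: "int ^ 'n::finite \<Rightarrow> complex" and v :: "int ^ 'n"
  assumes "ev_eq a b" shows "ev_eq (\<lambda>s. a (s - v)) (\<lambda>s. b (s - v))"
proof -
  obtain M where M: "\<And>s. (\<forall>i. s $ i \<ge> M) \<Longrightarrow> a s = b s"
    using assms unfolding ev_eq_def by blast
  define m where "m = Max (range (\<lambda>i. v $ i))"
  have v: "v $ i \<le> m" for i unfolding m_def by simp
  show ?thesis
  proof (rule ev_eqI[of "M + m"])
    fix s :: "int ^ 'n" assume s: "\<forall>i. s $ i \<ge> M + m"
    have "(s - v) $ i \<ge> M" for i using s[rule_format, of i] v[of i] by simp
    then show "a (s - v) = b (s - v)" using M by blast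
  qed
qed

lemma ev_eq_poly_act: "ev_eq a b \<Longrightarrow> ev_eq (poly_act P a) (poly_act P b)"
  unfolding poly_act_def[abs_def] by (intro ev_eq_sum ev_eq_cmult ev_eq_shift)

text \<open>If an array collects the coefficients of a function then \<open>diffop w\<close> collects those of its
  derivative in direction \<open>w\<close>.\<close>

definition diffop :: "real ^ 'n \<Rightarrow> (int ^ 'n \<Rightarrow> complex) \<Rightarrow> int ^ 'n::finite \<Rightarrow> complex" where
  "diffop w c s = (\<Sum>i\<in>UNIV. of_real (w $ i) * (of_int (s $ i + 1) * c (s + axis i 1)))"

lemma diffop_linear:
  "diffop w (\<lambda>s. c s + c' s) s = diffop w c s + diffop w c' s"
  "diffop w (\<lambda>s. a * c s) s = a * diffop w c s"
  "diffop w (\<lambda>s. 0) s = 0"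
  by (simp_all add: diffop_def distrib_left sum.distrib sum_distrib_left mult_ac)

lemma diffop_sum_right: "diffop w (\<lambda>s. \<Sum>k\<in>A. c k s) s = (\<Sum>k\<in>A. diffop w (c k) s)"
  by (induction A rule: infinite_finite_induct) (simp_all add: diffop_linear)

text \<open>The Leibniz rule, as a relation between a polynomial and its derivative in direction \<open>w\<close>: only the products of
  linear forms that occur below have to be differentiated.\<close>

definition derivation_of :: "real ^ 'n \<Rightarrow> 'n::finite cpoly \<Rightarrow> 'n cpoly \<Rightarrow> bool" where
  "derivation_of w P P' \<longleftrightarrow> (\<forall>c s. diffop w (poly_act P c) s = poly_act P (diffop w c) s + poly_act P' c s)"

lemma derivation_of_ell: "derivation_of w (ell_poly v) (Poly_Mapping.single 0 (- of_real (v \<bullet> w)))"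
  unfolding derivation_of_def
proof (intro allI)
  fix c :: "int ^ 'a \<Rightarrow> complex" and s
  let ?t = "\<lambda>i k. of_real (w $ i) * (of_int (s $ i + 1) * (of_real (v $ k) * c (s + axis i 1 - axis k 1)))"
  have "diffop w (poly_act (ell_poly v) c) s = diffop w c s - (\<Sum>i\<in>UNIV. \<Sum>k\<in>UNIV. ?t i k)"
    by (simp add: diffop_def poly_act_ell right_diff_distrib sum_subtractf sum_distrib_left)
  moreover have "poly_act (ell_poly v) (diffop w c) s = diffop w c s -
      (\<Sum>k\<in>UNIV. \<Sum>i\<in>UNIV. of_real (v $ k) * (of_real (w $ i) * (of_int ((s - axis k 1) $ i + 1) * c (s - axis k 1 + axis i 1))))"
    by (simp add: diffop_def poly_act_ell sum_distrib_left)
  moreover have "(\<Sum>k\<in>UNIV. \<Sum>i\<in>UNIV. of_real (v $ k) * (of_real (w $ i) * (of_int ((s - axis k 1) $ i + 1) * c (s - axis k 1 + axis i 1)))) =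
     (\<Sum>k\<in>UNIV. \<Sum>i\<in>UNIV. ?t i k - (if i = k then of_real (v $ k) * of_real (w $ k) * c s else 0))"
  proof (intro sum.cong refl)
    fix k i
    have "s - axis k 1 + axis i 1 = s + axis i 1 - axis k 1" by simp
    then show "of_real (v $ k) * (of_real (w $ i) * (of_int ((s - axis k 1) $ i + 1) * c (s - axis k 1 + axis i 1))) =
      ?t i k - (if i = k then of_real (v $ k) * of_real (w $ k) * c s else 0)"
      by (cases "i = k") (auto simp: axis_def algebra_simps)
  qed
  moreover have "(\<Sum>k\<in>UNIV. \<Sum>i\<in>UNIV. ?t i k - (if i = k then of_real (v $ k) * of_real (w $ k) * c s else 0)) =
     (\<Sum>i\<in>UNIV. \<Sum>k\<in>UNIV. ?t i k) - of_real (v \<bullet> w) * c s"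
    by (subst (2) sum.swap) (simp add: sum_subtractf inner_vec_def sum_distrib_right)
  ultimately show "diffop w (poly_act (ell_poly v) c) s = poly_act (ell_poly v) (diffop w c) s + poly_act (Poly_Mapping.single 0 (- of_real (v \<bullet> w))) c s"
    by simp
qed

lemma derivation_of_one: "derivation_of w 1 0"
  by (simp add: derivation_of_def diffop_def poly_act_one)

lemma derivation_of_mult:
  assumes "derivation_of w P P'" "derivation_of w Q Q'"
  shows "derivation_of w (P * Q) (P' * Q + P * Q')"
proof -
  have e: "diffop w (poly_act Q c) = (\<lambda>s. poly_act Q (diffop w c) s + poly_act Q' c s)" for c
    using assms(2) by (auto simp: derivation_of_def)
  have m: "poly_act (P * Q) c = poly_act P (poly_act Q c)" for P Q :: "'a cpoly" and c
    by (rule ext) (rule poly_act_mult)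
  show ?thesis using assms(1) unfolding derivation_of_def
    by (simp add: m e poly_act_linear poly_act_add)
qed

lemma derivation_of_power:
  assumes "derivation_of w P P'"
  shows "derivation_of w (P ^ n) (of_nat n * P ^ (n - 1) * P')"
proof (induction n)
  case (Suc n)
  have "P' * P ^ n + P * (of_nat n * P ^ (n - 1) * P') = of_nat (Suc n) * P ^ (Suc n - 1) * P'"
    by (cases n) (simp_all add: algebra_simps)
  then show ?case using derivation_of_mult[OF assms Suc] by simp
qed (simp add: derivation_of_one)

lemma derivation_of_zero_prod:
  "(\<And>v. v \<in> A \<Longrightarrow> derivation_of w (P v) 0) \<Longrightarrow> derivation_of w (\<Prod>v\<in>A. P v) 0"
proof (induction A rule: infinite_finite_induct)
  case (insert v A)
  then show ?case using derivation_of_mult[of w "P v" 0 "prod P A" 0] by simp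
qed (simp_all add: derivation_of_one)

section \<open>Monomials in the linear forms of a basis\<close>

definition ell_mon :: "(real ^ 'n) set \<Rightarrow> (real ^ 'n \<Rightarrow> nat) \<Rightarrow> 'n::finite cpoly" where
  "ell_mon B \<alpha> = (\<Prod>v\<in>B. ell_poly v ^ \<alpha> v)"

text \<open>Linear combinations of the monomials. Exponents vanish outside \<open>B\<close>, so that different exponent functions differ
  at some element of \<open>B\<close>.\<close>

inductive_set ell_span :: "(real ^ 'n) set \<Rightarrow> 'n::finite cpoly set" for B where
  zero: "0 \<in> ell_span B"
| add: "P \<in> ell_span B \<Longrightarrow> (\<And>v. v \<notin> B \<Longrightarrow> \<alpha> v = 0) \<Longrightarrow> P + Poly_Mapping.single 0 a * ell_mon B \<alpha> \<in> ell_span B"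

lemma ell_span_add: "Q \<in> ell_span B \<Longrightarrow> P \<in> ell_span B \<Longrightarrow> P + Q \<in> ell_span B"
  by (induction rule: ell_span.induct) (auto simp: add.assoc[symmetric] intro: ell_span.intros)

lemma ell_span_cmult: "P \<in> ell_span B \<Longrightarrow> Poly_Mapping.single 0 a * P \<in> ell_span B"
proof (induction rule: ell_span.induct)
  case (add P \<alpha> a')
  have "Poly_Mapping.single 0 a * (P + Poly_Mapping.single 0 a' * ell_mon B \<alpha>) =
    Poly_Mapping.single 0 a * P + Poly_Mapping.single 0 (a * a') * ell_mon B \<alpha>"
    by (simp add: distrib_left mult.assoc[symmetric] mult_single)
  then show ?case using ell_span.add[OF add.IH, of \<alpha> "a * a'"] add.hyps by simp
qed (simp add: ell_span.zero)

lemma ell_span_mult_ell: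
  assumes "finite B" "v \<in> B" "P \<in> ell_span B"
  shows "ell_poly v * P \<in> ell_span B"
  using assms(3)
proof (induction rule: ell_span.induct)
  case (add P \<alpha> a')
  have "ell_poly v * ell_mon B \<alpha> = ell_mon B (\<alpha>(v := Suc (\<alpha> v)))"
    unfolding ell_mon_def prod.remove[OF assms(1,2)] by (simp add: mult.assoc)
  then have "ell_poly v * (P + Poly_Mapping.single 0 a' * ell_mon B \<alpha>) =
    ell_poly v * P + Poly_Mapping.single 0 a' * ell_mon B (\<alpha>(v := Suc (\<alpha> v)))"
    by (simp only: distrib_left) (metis mult.left_commute)
  moreover have "(\<alpha>(v := Suc (\<alpha> v))) u = 0" if "u \<notin> B" for u
    using that add.hyps assms(2) by auto
  ultimately show ?case using ell_span.add[OF add.IH, of "\<alpha>(v := Suc (\<alpha> v))" a'] by simp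
qed (simp add: ell_span.zero)

lemma ell_span_sum: "(\<And>k. k \<in> A \<Longrightarrow> P k \<in> ell_span B) \<Longrightarrow> (\<Sum>k\<in>A. P k) \<in> ell_span B"
  by (induction A rule: infinite_finite_induct) (auto intro: ell_span_add ell_span.zero)

text \<open>The coordinates are linear combinations of the affine functions \<open>1 - ell v\<close> with \<open>v\<close> in a spanning set, so every
  polynomial is a polynomial in these forms.\<close>

lemma ell_span_UNIV:
  fixes B :: "(real ^ 'n::finite) set"
  assumes fin: "finite B" and sp: "span B = UNIV"
  shows "P \<in> ell_span B"
proof -
  let ?Z = "\<lambda>i. Poly_Mapping.single (Poly_Mapping.single i 1) 1 :: 'n cpoly"
  let ?C = "\<lambda>a. Poly_Mapping.single 0 a :: 'n cpoly"
  have Z: "\<exists>a. ?Z i = (\<Sum>v\<in>B. ?C (a v) * (1 - ell_poly v))" for i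
  proof -
    have "axis i 1 \<in> span B" using sp by simp
    then obtain a where a: "axis i 1 = (\<Sum>v\<in>B. a v *\<^sub>R v)" using span_finite[OF fin] by auto
    have "(\<Sum>v\<in>B. ?C (of_real (a v)) * (1 - ell_poly v)) =
      (\<Sum>v\<in>B. \<Sum>k\<in>UNIV. Poly_Mapping.single (Poly_Mapping.single k 1) (of_real (a v * v $ k)))"
      by (simp add: ell_poly_def sum_distrib_left mult_single)
    also have "\<dots> = (\<Sum>k\<in>UNIV. Poly_Mapping.single (Poly_Mapping.single k 1) (of_real (\<Sum>v\<in>B. a v * v $ k)))"
    proof (subst sum.swap, intro sum.cong refl)
      fix k
      have s: "Poly_Mapping.single \<mu> (\<Sum>v\<in>B. f v) = (\<Sum>v\<in>B. Poly_Mapping.single \<mu> (f v :: complex))" for \<mu> :: "'n \<Rightarrow>\<^sub>0 nat" and f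
        by (induction B rule: infinite_finite_induct) (simp_all add: single_add)
      show "(\<Sum>v\<in>B. Poly_Mapping.single (Poly_Mapping.single k 1) (complex_of_real (a v * v $ k)) :: 'n cpoly) =
        Poly_Mapping.single (Poly_Mapping.single k 1) (complex_of_real (\<Sum>v\<in>B. a v * v $ k))"
        unfolding of_real_sum by (rule s[symmetric])
    qed
    also have "\<dots> = (\<Sum>k\<in>UNIV. if k = i then ?Z i else 0)"
    proof (intro sum.cong refl)
      fix k
      have "(\<Sum>v\<in>B. a v * v $ k) = axis i 1 $ k" unfolding a by simp
      then show "Poly_Mapping.single (Poly_Mapping.single k 1) (complex_of_real (\<Sum>v\<in>B. a v * v $ k)) = (if k = i then ?Z i else 0)"
        by (simp add: axis_def)
    qed
    also have "\<dots> = ?Z i" by simp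
    finally show ?thesis by metis
  qed
  have multZ: "?Z i * P \<in> ell_span B" if "P \<in> ell_span B" for i P
  proof -
    obtain a where a: "?Z i = (\<Sum>v\<in>B. ?C (a v) * (1 - ell_poly v))" using Z by blast
    have "?C (a v) * (1 - ell_poly v) * P = ?C (a v) * P + ?C (- a v) * (ell_poly v * P)" for v
      by (simp add: algebra_simps single_uminus)
    then show ?thesis unfolding a sum_distrib_right
      using that by (auto intro!: ell_span_sum ell_span_add ell_span_cmult ell_span_mult_ell fin)
  qed
  have one: "1 \<in> ell_span B"
    using ell_span.add[OF ell_span.zero, of B "\<lambda>_. 0" 1] by (simp add: ell_mon_def)
  have pow: "?Z i ^ n * P \<in> ell_span B" if "P \<in> ell_span B" for i n P
    using that by (induction n) (simp_all add: mult.assoc multZ del: One_nat_def)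
  have pr: "(\<Prod>i\<in>A. ?Z i ^ f i) \<in> ell_span B" if "finite A" for A f
    using that by (induction A rule: finite_induct) (simp_all add: one pow del: One_nat_def)
  have Zp: "?Z i ^ n = Poly_Mapping.single (Poly_Mapping.single i n) 1" for i n
    by (induction n) (simp_all add: mult_single flip: single_add)
  have Zpr: "(\<Prod>i\<in>A. Poly_Mapping.single (f i) (1::complex)) = Poly_Mapping.single (\<Sum>i\<in>A. f i) 1" if "finite A" for A :: "'n set" and f :: "'n \<Rightarrow> 'n \<Rightarrow>\<^sub>0 nat"
    using that by (induction A rule: finite_induct) (simp_all add: mult_single)
  have mon: "Poly_Mapping.single \<mu> a \<in> ell_span B" for \<mu> :: "'n \<Rightarrow>\<^sub>0 nat" and a
  proof -
    have "(\<Sum>i\<in>UNIV. Poly_Mapping.single i (Poly_Mapping.lookup \<mu> i)) = \<mu>"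
      by (rule poly_mapping_eqI) (simp add: lookup_sum lookup_single when_def)
    then have "(\<Prod>i\<in>UNIV. ?Z i ^ Poly_Mapping.lookup \<mu> i) = Poly_Mapping.single \<mu> 1"
      by (simp add: Zp Zpr del: One_nat_def)
    then have "Poly_Mapping.single \<mu> 1 \<in> ell_span B" using pr[of UNIV "Poly_Mapping.lookup \<mu>"] by simp
    from ell_span_cmult[OF this, of a] show ?thesis by (simp add: mult_single)
  qed
  show ?thesis by (subst poly_mapping_decomp) (intro ell_span_sum mon)
qed

lemma ell_span_expand:
  assumes "P \<in> ell_span B"
  shows "\<exists>A cf. finite A \<and> (\<forall>\<alpha>\<in>A. \<forall>v. v \<notin> B \<longrightarrow> \<alpha> v = 0) \<and> P = (\<Sum>\<alpha>\<in>A. Poly_Mapping.single 0 (cf \<alpha>) * ell_mon B \<alpha>)"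
  using assms
proof (induction rule: ell_span.induct)
  case zero
  show ?case by (rule exI[of _ "{}"]) simp
next
  case (add P \<alpha> a)
  then obtain A cf where A: "finite A" "\<forall>\<alpha>\<in>A. \<forall>v. v \<notin> B \<longrightarrow> \<alpha> v = 0" "P = (\<Sum>\<alpha>\<in>A. Poly_Mapping.single 0 (cf \<alpha>) * ell_mon B \<alpha>)"
    by blast
  let ?cf = "\<lambda>\<beta>. (if \<beta> \<in> A then cf \<beta> else 0) + (if \<beta> = \<alpha> then a else 0)"
  have "(\<Sum>\<beta>\<in>insert \<alpha> A. Poly_Mapping.single 0 (?cf \<beta>) * ell_mon B \<beta>) =
    (\<Sum>\<beta>\<in>insert \<alpha> A. Poly_Mapping.single 0 (if \<beta> \<in> A then cf \<beta> else 0) * ell_mon B \<beta>) +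
    (\<Sum>\<beta>\<in>insert \<alpha> A. Poly_Mapping.single 0 (if \<beta> = \<alpha> then a else 0) * ell_mon B \<beta>)"
    by (simp only: single_add distrib_right sum.distrib)
  also have "(\<Sum>\<beta>\<in>insert \<alpha> A. Poly_Mapping.single 0 (if \<beta> \<in> A then cf \<beta> else 0) * ell_mon B \<beta>) = P"
    unfolding A(3) using A(1) by (intro sum.mono_neutral_cong_right) auto
  also have "(\<Sum>\<beta>\<in>insert \<alpha> A. Poly_Mapping.single 0 (if \<beta> = \<alpha> then a else 0) * ell_mon B \<beta>) =
      (\<Sum>\<beta>\<in>{\<alpha>}. Poly_Mapping.single 0 a * ell_mon B \<beta>)"
    using A(1) by (intro sum.mono_neutral_cong_right) auto
  finally have "P + Poly_Mapping.single 0 a * ell_mon B \<alpha> = (\<Sum>\<beta>\<in>insert \<alpha> A. Poly_Mapping.single 0 (?cf \<beta>) * ell_mon B \<beta>)"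
    by simp
  then show ?case using A add.hyps by (intro exI[of _ "insert \<alpha> A"] exI[of _ ?cf]) auto
qed

section \<open>Relations between fibre integrals\<close>

lemma powi_inverse: "0 \<le> k \<Longrightarrow> z powi (- k - 1) = inverse z ^ Suc (nat k)" for z :: complex
proof -
  assume "0 \<le> k"
  then have "- k - 1 = - int (Suc (nat k))" by simp
  then show ?thesis by (simp only: power_int_minus power_int_of_nat power_inverse)
qed

lemma ell_cpt_nonzero: "ell v x \<noteq> 0 \<Longrightarrow> ell v (cpt x y) \<noteq> 0"
  using Re_ell_cpt[of v x y] by auto

text \<open>On the fibre, every form and every coordinate is at least as large in modulus as its real part, the value at the
  base point.\<close>

lemma fibre_term_bound:
  fixes x :: "real ^ 'n::finite"
  assumes S: "finite S" and l: "\<And>j. j \<in> S \<Longrightarrow> ell (b j) x \<noteq> 0" and x: "\<And>i. x $ i \<noteq> 0" and s: "\<And>i. s $ i \<ge> 1"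
  shows "integrable lborel (\<lambda>y. fibre_term b S q s (cpt x y))"
    and "cmod (fibre b S q x s) \<le> (\<Prod>j\<in>S. inverse \<bar>ell (b j) x\<bar> ^ q j) * exp (- (\<Sum>i\<in>UNIV. real_of_int (s $ i) * ln \<bar>x $ i\<bar>))"
proof -
  let ?k = "\<lambda>i. nat (s $ i)"
  have k: "?k i \<ge> 1" "s $ i \<ge> 0" for i using s[of i] by auto
  let ?C = "\<Prod>j\<in>S. inverse \<bar>ell (b j) x\<bar> ^ q j"
  let ?g = "\<lambda>i y. complex_of_real (cmod (inverse (Complex (x $ i) y) ^ Suc (?k i)))"
  have nz: "Complex (x $ i) y \<noteq> 0" for i y using x[of i] by (simp add: complex_eq_iff)
  have e: "fibre_term b S q s (cpt x y) = (\<Prod>j\<in>S. inverse (ell (b j) (cpt x y)) ^ q j) * (\<Prod>i\<in>UNIV. inverse (Complex (x $ i) (y $ i)) ^ Suc (?k i))" for y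
    unfolding fibre_term_def cpt_nth powi_inverse[OF k(2)] ..
  have gi: "integrable lborel (?g i)" for i
    by (intro integrable_of_real integrable_norm inverse_power_integrable x) (use k[of i] in simp)
  note P = integral_vec_prod[of ?g, OF gi]
  have Re_P: "Re (\<Prod>i\<in>UNIV. ?g i (y $ i)) = (\<Prod>i\<in>UNIV. cmod (inverse (Complex (x $ i) (y $ i)) ^ Suc (?k i)))" for y :: "real ^ 'n"
    by (simp only: of_real_prod[symmetric] Re_complex_of_real)
  have bound: "cmod (fibre_term b S q s (cpt x y)) \<le> ?C * Re (\<Prod>i\<in>UNIV. ?g i (y $ i))" for y
    unfolding e norm_mult Re_P prod_norm[symmetric]
  proof (rule mult_right_mono)
    show "(\<Prod>j\<in>S. cmod (inverse (ell (b j) (cpt x y)) ^ q j)) \<le> ?C"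
    proof (rule prod_mono, intro conjI)
      fix j assume j: "j \<in> S"
      have "\<bar>ell (b j) x\<bar> \<le> cmod (ell (b j) (cpt x y))" using abs_Re_le_cmod[of "ell (b j) (cpt x y)"] by (simp add: Re_ell_cpt)
      then show "cmod (inverse (ell (b j) (cpt x y)) ^ q j) \<le> inverse \<bar>ell (b j) x\<bar> ^ q j"
        unfolding norm_power norm_inverse using l[OF j] by (intro power_mono le_imp_inverse_le) auto
    qed simp
  qed (intro prod_nonneg ballI norm_ge_zero)
  have meas: "(\<lambda>y. fibre_term b S q s (cpt x y)) \<in> borel_measurable lborel"
    unfolding measurable_lborel2 e
    by (intro borel_measurable_continuous_onI continuous_intros continuous_on_Complex ballI nz ell_cpt_nonzero l)
      (auto simp: ell_def intro!: continuous_intros continuous_on_Complex)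
  have I: "integrable lborel (\<lambda>y. ?C * Re (\<Prod>i\<in>UNIV. ?g i (y $ i)))"
    by (intro integrable_mult_right integrable_Re P)
  show int: "integrable lborel (\<lambda>y. fibre_term b S q s (cpt x y))"
    by (rule Bochner_Integration.integrable_bound[OF I meas])
      (auto intro!: AE_I2 order_trans[OF bound])
  have "cmod (\<integral>y. fibre_term b S q s (cpt x y) \<partial>lborel) \<le> (\<integral>y. cmod (fibre_term b S q s (cpt x y)) \<partial>lborel)"
    by (rule integral_norm_bound)
  also have "\<dots> \<le> (\<integral>y. ?C * Re (\<Prod>i\<in>UNIV. ?g i (y $ i)) \<partial>lborel)"
    by (rule integral_mono[OF integrable_norm[OF int] I bound])
  also have "\<dots> = ?C * Re (\<Prod>i\<in>UNIV. integral\<^sup>L lborel (?g i))"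
    unfolding integral_mult_right_zero P(2)[symmetric] by (subst integral_Re[OF P(1)]) (rule refl)
  also have "Re (\<Prod>i\<in>UNIV. integral\<^sup>L lborel (?g i)) = (\<Prod>i\<in>UNIV. \<integral>y. cmod (inverse (Complex (x $ i) y) ^ Suc (?k i)) \<partial>lborel)"
    by (simp only: integral_complex_of_real of_real_prod[symmetric] Re_complex_of_real)
  also have "\<dots> \<le> (\<Prod>i\<in>UNIV. pi * inverse \<bar>x $ i\<bar> ^ ?k i)"
  proof (rule prod_mono, intro conjI)
    fix i
    show "(\<integral>y. cmod (inverse (Complex (x $ i) y) ^ Suc (?k i)) \<partial>lborel) \<le> pi * inverse \<bar>x $ i\<bar> ^ ?k i"
      using inverse_power_integrable(2)[OF x[of i], of "Suc (?k i)"] k[of i] by simp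
  qed (intro integral_nonneg_AE AE_I2 norm_ge_zero)
  also have "\<dots> = pi ^ CARD('n) * exp (- (\<Sum>i\<in>UNIV. real_of_int (s $ i) * ln \<bar>x $ i\<bar>))"
  proof -
    have "inverse \<bar>x $ i\<bar> ^ ?k i = exp (- (real_of_int (s $ i) * ln \<bar>x $ i\<bar>))" for i
    proof -
      have "exp (- (real_of_int (s $ i) * ln \<bar>x $ i\<bar>)) = exp (real (?k i) * (- ln \<bar>x $ i\<bar>))" using k[of i] by simp
      also have "\<dots> = exp (- ln \<bar>x $ i\<bar>) ^ ?k i" by (rule exp_of_nat_mult)
      finally show ?thesis using x[of i] by (simp add: exp_minus)
    qed
    then show ?thesis by (simp add: prod.distrib exp_sum flip: sum_negf)
  qed
  finally have "cmod (\<integral>y. fibre_term b S q s (cpt x y) \<partial>lborel) \<le> ?C * (pi ^ CARD('n) * exp (- (\<Sum>i\<in>UNIV. real_of_int (s $ i) * ln \<bar>x $ i\<bar>)))"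
    by (simp add: mult_left_mono prod_nonneg)
  then have "cmod (fibre b S q x s) \<le> 1 / (2 * pi) ^ CARD('n) * (?C * (pi ^ CARD('n) * exp (- (\<Sum>i\<in>UNIV. real_of_int (s $ i) * ln \<bar>x $ i\<bar>))))"
    unfolding fibre_def norm_mult norm_of_real by (intro mult_mono) auto
  also have "\<dots> = (1 / 2 ^ CARD('n)) * (?C * exp (- (\<Sum>i\<in>UNIV. real_of_int (s $ i) * ln \<bar>x $ i\<bar>)))"
    by (simp add: power_mult_distrib)
  also have "\<dots> \<le> 1 * (?C * exp (- (\<Sum>i\<in>UNIV. real_of_int (s $ i) * ln \<bar>x $ i\<bar>)))"
    by (intro mult_right_mono mult_nonneg_nonneg prod_nonneg) auto
  finally show "cmod (fibre b S q x s) \<le> ?C * exp (- (\<Sum>i\<in>UNIV. real_of_int (s $ i) * ln \<bar>x $ i\<bar>))" by simp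
qed

lemma poly_act_fibre:
  fixes x :: "real ^ 'n::finite"
  assumes S: "finite S" and l: "\<And>j. j \<in> S \<Longrightarrow> ell (b j) x \<noteq> 0" and x: "\<And>i. x $ i \<noteq> 0"
  shows "\<exists>M. \<forall>s. (\<forall>i. s $ i \<ge> M) \<longrightarrow>
    integrable lborel (\<lambda>y. poly_eval P (cpt x y) * fibre_term b S q s (cpt x y)) \<and>
    poly_act P (fibre b S q x) s = of_real (1 / (2 * pi) ^ CARD('n)) * (\<integral>y. poly_eval P (cpt x y) * fibre_term b S q s (cpt x y) \<partial>lborel)"
proof -
  have shift: "(\<Prod>i\<in>UNIV. cpt x y $ i ^ Poly_Mapping.lookup \<mu> i) * fibre_term b S q s (cpt x y) = fibre_term b S q (s - pmvec \<mu>) (cpt x y)" for y s \<mu>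
  proof -
    have nz: "Complex (x $ i) (y $ i) \<noteq> 0" for i using x[of i] by (simp add: complex_eq_iff)
    have "z ^ k * z powi (- a - 1) = z powi (- (a - int k) - 1)" if "z \<noteq> 0" for z :: complex and k a
      using that by (simp flip: power_int_of_nat power_int_add add: algebra_simps)
    then show ?thesis
      unfolding fibre_term_def by (simp add: pmvec_def nz mult.left_commute flip: prod.distrib)
  qed
  have pe: "poly_eval P (cpt x y) * fibre_term b S q s (cpt x y) =
      (\<Sum>\<mu>\<in>Poly_Mapping.keys P. Poly_Mapping.lookup P \<mu> * fibre_term b S q (s - pmvec \<mu>) (cpt x y))" for s y
    unfolding poly_eval_def sum_distrib_right mult.assoc shift ..
  let ?M = "1 + Max (insert 0 (\<Union>\<mu>\<in>Poly_Mapping.keys P. range (\<lambda>i. pmvec \<mu> $ i)))"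
  show ?thesis
  proof (intro exI[of _ ?M] allI impI)
    fix s :: "int ^ 'n" assume s: "\<forall>i. s $ i \<ge> ?M"
    have "pmvec \<mu> $ i \<le> ?M - 1" if "\<mu> \<in> Poly_Mapping.keys P" for \<mu> i
      using that by (auto intro!: Max_ge)
    then have "(s - pmvec \<mu>) $ i \<ge> 1" if "\<mu> \<in> Poly_Mapping.keys P" for \<mu> i
      using s[rule_format, of i] that by (simp add: le_diff_eq) (smt (verit))
    then have int: "integrable lborel (\<lambda>y. fibre_term b S q (s - pmvec \<mu>) (cpt x y))" if "\<mu> \<in> Poly_Mapping.keys P" for \<mu>
      using that by (intro fibre_term_bound S l x)
    have "integrable lborel (\<lambda>y. poly_eval P (cpt x y) * fibre_term b S q s (cpt x y))"
      unfolding pe by (intro Bochner_Integration.integrable_sum integrable_mult_right int)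
    moreover have "(\<integral>y. poly_eval P (cpt x y) * fibre_term b S q s (cpt x y) \<partial>lborel) =
       (\<Sum>\<mu>\<in>Poly_Mapping.keys P. Poly_Mapping.lookup P \<mu> * (\<integral>y. fibre_term b S q (s - pmvec \<mu>) (cpt x y) \<partial>lborel))"
      unfolding pe by (subst Bochner_Integration.integral_sum) (auto intro!: integrable_mult_right int simp: integral_mult_right_zero)
    ultimately show "integrable lborel (\<lambda>y. poly_eval P (cpt x y) * fibre_term b S q s (cpt x y)) \<and>
      poly_act P (fibre b S q x) s = of_real (1 / (2 * pi) ^ CARD('n)) * (\<integral>y. poly_eval P (cpt x y) * fibre_term b S q s (cpt x y) \<partial>lborel)"
      by (simp add: poly_act_def fibre_def sum_distrib_left mult_ac)
  qed
qed

lemma poly_eval_superset: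
  assumes "finite A" "Poly_Mapping.keys P \<subseteq> A"
  shows "poly_eval P z = (\<Sum>\<mu>\<in>A. Poly_Mapping.lookup P \<mu> * (\<Prod>i\<in>UNIV. (z $ i) ^ Poly_Mapping.lookup \<mu> i))"
  unfolding poly_eval_def using assms
  by (intro sum.mono_neutral_left) (auto simp: in_keys_iff)

lemma poly_eval_add: "poly_eval (P + Q) z = poly_eval P z + poly_eval Q z"
proof -
  let ?A = "Poly_Mapping.keys P \<union> Poly_Mapping.keys Q"
  have "Poly_Mapping.keys (P + Q) \<subseteq> ?A" by (rule Poly_Mapping.keys_add)
  then show ?thesis
    by (simp add: poly_eval_superset[of ?A] lookup_add distrib_right sum.distrib)
qed

lemma poly_eval_single: "poly_eval (Poly_Mapping.single \<mu> a) z = a * (\<Prod>i\<in>UNIV. (z $ i) ^ Poly_Mapping.lookup \<mu> i)"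
  by (cases "a = 0") (simp_all add: poly_eval_def)

lemma poly_eval_zero: "poly_eval 0 z = 0"
  by (simp add: poly_eval_def)

lemma poly_eval_sum: "poly_eval (\<Sum>k\<in>A. P k) z = (\<Sum>k\<in>A. poly_eval (P k) z)"
  by (induction A rule: infinite_finite_induct) (simp_all add: poly_eval_add poly_eval_zero)

lemma poly_eval_ell: "poly_eval (ell_poly v) z = ell v z"
proof -
  have 1: "poly_eval 1 z = 1" using poly_eval_single[of 0 1 z] by (simp only: single_one) simp
  have "(\<Prod>k\<in>UNIV. z $ k ^ Poly_Mapping.lookup (Poly_Mapping.single i (1::nat)) k) = z $ i" for i
  proof -
    have "(\<Prod>k\<in>UNIV. z $ k ^ Poly_Mapping.lookup (Poly_Mapping.single i (1::nat)) k) = (\<Prod>k\<in>UNIV. if k = i then z $ k else 1)"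
      by (intro prod.cong) (auto simp: lookup_single when_def)
    then show ?thesis by simp
  qed
  then have 2: "poly_eval (\<Sum>i\<in>UNIV. Poly_Mapping.single (Poly_Mapping.single i 1) (complex_of_real (v $ i))) z = (\<Sum>i\<in>UNIV. of_real (v $ i) * z $ i)"
    by (simp only: poly_eval_sum poly_eval_single)
  have "ell_poly v + (\<Sum>i\<in>UNIV. Poly_Mapping.single (Poly_Mapping.single i 1) (complex_of_real (v $ i))) = 1"
    by (simp add: ell_poly_def)
  then have "poly_eval (ell_poly v) z + (\<Sum>i\<in>UNIV. of_real (v $ i) * z $ i) = 1"
    using poly_eval_add[of "ell_poly v" _ z] 1 2 by metis
  then show ?thesis by (simp add: ell_def algebra_simps)
qed

text \<open>Multiplying the integrand by a form lowers its exponent.\<close>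

lemma ell_act_fibre:
  fixes x :: "real ^ 'n::finite"
  assumes S: "finite S" and l: "\<And>j. j \<in> S \<Longrightarrow> ell (b j) x \<noteq> 0" and x: "\<And>i. x $ i \<noteq> 0"
    and j: "j \<in> S" "q j \<ge> 1"
  shows "ev_eq (poly_act (ell_poly (b j)) (fibre b S q x)) (fibre b S (q(j := q j - 1)) x)"
proof -
  obtain M where M: "\<And>s. (\<forall>i. s $ i \<ge> M) \<Longrightarrow> poly_act (ell_poly (b j)) (fibre b S q x) s =
     of_real (1 / (2 * pi) ^ CARD('n)) * (\<integral>y. poly_eval (ell_poly (b j)) (cpt x y) * fibre_term b S q s (cpt x y) \<partial>lborel)"
    using poly_act_fibre[where b=b and P="ell_poly (b j)" and q=q, OF S l x] by blast
  have "ell (b j) (cpt x y) * fibre_term b S q s (cpt x y) = fibre_term b S (q(j := q j - 1)) s (cpt x y)" for s y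
  proof -
    have "ell (b j) (cpt x y) * inverse (ell (b j) (cpt x y)) ^ q j = inverse (ell (b j) (cpt x y)) ^ (q j - 1)"
      using ell_cpt_nonzero[OF l[OF j(1)], of y] j(2) by (cases "q j") auto
    then show ?thesis
      unfolding fibre_term_def prod.remove[OF S j(1)] by (simp add: mult.assoc[symmetric])
  qed
  then show ?thesis
    by (intro ev_eqI[of M]) (simp add: M poly_eval_ell fibre_def)
qed

lemma fibre_drop:
  assumes "finite S" "S' \<subseteq> S" "\<And>j. j \<in> S - S' \<Longrightarrow> q j = 0"
  shows "fibre b S q x = fibre b S' q x"
proof -
  have "(\<Prod>j\<in>S. inverse (ell (b j) z) ^ q j) = (\<Prod>j\<in>S'. inverse (ell (b j) z) ^ q j)" for z :: "complex ^ 'a"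
    using assms by (intro prod.mono_neutral_right) auto
  then show ?thesis by (simp add: fibre_def[abs_def] fibre_term_def)
qed

lemma fibre_cong: "(\<And>j. j \<in> S \<Longrightarrow> q j = q' j) \<Longrightarrow> fibre b S q x = fibre b S q' x"
  by (simp add: fibre_def[abs_def] fibre_term_def cong: prod.cong)

text \<open>The real integral sees the base point only through the signs of its coordinates and of the forms.\<close>

lemma fibre_same_signs:
  fixes x :: "real ^ 'n::finite"
  assumes S: "finite S" and q: "\<And>j. j \<in> S \<Longrightarrow> q j \<ge> 1"
    and l: "\<And>j. j \<in> S \<Longrightarrow> ell (b j) x \<noteq> 0" and x: "\<And>i. x $ i \<noteq> 0"
    and e: "\<And>j. j \<in> S \<Longrightarrow> sgn (ell (b j) x) = sgn (ell (b j) x')" "\<And>i. sgn (x $ i) = sgn (x' $ i)"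
  shows "ev_eq (fibre b S q x) (fibre b S q x')"
proof (rule ev_eqI[of 1])
  fix s :: "int ^ 'n" assume s: "\<forall>i. s $ i \<ge> 1"
  have l': "ell (b j) x' \<noteq> 0" if "j \<in> S" for j using l[OF that] e(1)[OF that] by (metis sgn_0_0)
  have x': "x' $ i \<noteq> 0" for i using x[of i] e(2)[of i] by (metis sgn_0_0)
  have g: "(a * t > 0) = (a' * t > 0)" "(t * a > 0) = (t * a' > 0)" if "sgn a = sgn a'" for a a' t :: real
    using that by (auto simp: sgn_if zero_less_mult_iff split: if_splits)
  have "dual_region b S x = dual_region b S x'"
    unfolding dual_region_def by (intro Collect_cong arg_cong2[where f="(\<and>)"] ball_cong refl arg_cong[where f=All] ext g e)
  then have "dual_integral b S q x s = dual_integral b S q x' s" by (simp add: dual_integral_def)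
  then show "fibre b S q x s = fibre b S q x' s"
    using fibre_eq_dual_integral(2)[where b=b and q=q, OF S q l x] fibre_eq_dual_integral(2)[where b=b and q=q, OF S q l' x'] s
    by (simp add: e cong: prod.cong)
qed

text \<open>Differentiating under the integral, read off from the real integral: in the Gamma variables
  the derivative of the power of \<open>u\<close> brings down a factor \<open>t j\<close> for every form.\<close>

lemma diffop_fibre:
  fixes x :: "real ^ 'n::finite"
  assumes S: "finite S" and q: "\<And>j. j \<in> S \<Longrightarrow> q j \<ge> 1"
    and l: "\<And>j. j \<in> S \<Longrightarrow> ell (b j) x \<noteq> 0" and x: "\<And>i. x $ i \<noteq> 0"
  shows "ev_eq (diffop w (fibre b S q x)) (\<lambda>s. \<Sum>j\<in>S. of_real (b j \<bullet> w * real (q j)) * fibre b S (q(j := q j + 1)) x s)"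
proof (rule ev_eqI[of 1])
  fix s :: "int ^ 'n" assume s: "\<forall>i. s $ i \<ge> 1"
  let ?N = "\<Pi>\<^sub>M j\<in>S. (lborel :: real measure)"
  let ?R = "indicator (dual_region b S x) :: (nat \<Rightarrow> real) \<Rightarrow> real"
  let ?e = "(\<Prod>i\<in>UNIV. sgn (x $ i)) * (\<Prod>j\<in>S. sgn (ell (b j) x))"
  have s1: "1 \<le> (s + axis i 1) $ k" for i k using s[rule_format, of k] by (cases "k = i") (auto simp: axis_def)
  have q1: "1 \<le> (q(j := q j + 1)) k" if "k \<in> S" for j k using q[OF that] by simp
  note F = fibre_eq_dual_integral[where b=b and q=q, OF S q l x]
  note F1 = fibre_eq_dual_integral[where b=b, OF S q1 l x]
  have up: "real_of_int (s $ i + 1) * dual_density b S q (s + axis i 1) t = dual_sum b S t $ i * dual_density b S q s t" for i t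
  proof -
    have "nat ((s + axis i 1) $ i) = Suc (nat (s $ i))" using s[rule_format, of i] by (simp add: axis_def nat_add_distrib)
    moreover have "(s + axis i 1) $ k = s $ k" if "k \<noteq> i" for k using that by (simp add: axis_def)
    moreover have "real_of_int (s $ i + 1) = real (Suc (nat (s $ i)))" using s[rule_format, of i] by simp
    ultimately have A: "real_of_int (s $ i + 1) * (u ^ nat ((s + axis i 1) $ i) / fact (nat ((s + axis i 1) $ i))) = u * (u ^ nat (s $ i) / fact (nat (s $ i)))" for u :: real
      by (simp add: fact_Suc del: of_nat_Suc)
    have B: "(\<Prod>k\<in>UNIV - {i}. dual_sum b S t $ k ^ nat ((s + axis i 1) $ k) / fact (nat ((s + axis i 1) $ k))) =
      (\<Prod>k\<in>UNIV - {i}. dual_sum b S t $ k ^ nat (s $ k) / fact (nat (s $ k)))"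
      by (intro prod.cong) (auto simp: axis_def)
    have C: "r * (P * (X * Y)) = P * ((r * X) * Y)" for r P X Y :: real by simp
    have fU: "finite (UNIV :: 'n set)" by simp
    show ?thesis
      unfolding dual_density_def prod.remove[OF fU UNIV_I[of i]] C A B ..
  qed
  have tj: "t j * dual_density b S q s t = real (q j) * dual_density b S (q(j := q j + 1)) s t" if j: "j \<in> S" for j t
  proof -
    obtain n where n: "q j = Suc n" using q[OF j] by (cases "q j") auto
    have A: "real (q j) * (t j ^ ((q(j := q j + 1)) j - 1) / fact ((q(j := q j + 1)) j - 1) * exp (- t j)) =
        t j * (t j ^ (q j - 1) / fact (q j - 1) * exp (- t j))"
      by (simp add: n fact_Suc del: of_nat_Suc)
    have B: "(\<Prod>k\<in>S - {j}. t k ^ ((q(j := q j + 1)) k - 1) / fact ((q(j := q j + 1)) k - 1) * exp (- t k)) =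
      (\<Prod>k\<in>S - {j}. t k ^ (q k - 1) / fact (q k - 1) * exp (- t k))"
      by (intro prod.cong) auto
    have C: "r * (X * Y * Z) = (r * X) * Y * Z" for r X Y Z :: real by simp
    show ?thesis
      unfolding dual_density_def prod.remove[OF S j] C A B ..
  qed
  have "(\<Sum>i\<in>UNIV. w $ i * (real_of_int (s $ i + 1) * dual_integral b S q x (s + axis i 1))) =
     (\<Sum>i\<in>UNIV. \<integral>t. w $ i * (real_of_int (s $ i + 1) * (?R t * dual_density b S q (s + axis i 1) t)) \<partial>?N)"
    by (simp add: dual_integral_def)
  also have "\<dots> = (\<integral>t. (\<Sum>i\<in>UNIV. w $ i * (real_of_int (s $ i + 1) * (?R t * dual_density b S q (s + axis i 1) t))) \<partial>?N)"
    by (subst Bochner_Integration.integral_sum) (auto intro!: F(1) s1)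
  also have "\<dots> = (\<integral>t. (\<Sum>j\<in>S. (b j \<bullet> w * real (q j)) * (?R t * dual_density b S (q(j := q j + 1)) s t)) \<partial>?N)"
  proof (intro Bochner_Integration.integral_cong refl)
    fix t :: "nat \<Rightarrow> real"
    have "(\<Sum>i\<in>UNIV. w $ i * (real_of_int (s $ i + 1) * (?R t * dual_density b S q (s + axis i 1) t))) =
      (\<Sum>i\<in>UNIV. w $ i * (?R t * (dual_sum b S t $ i * dual_density b S q s t)))"
      by (intro sum.cong refl) (simp only: up[symmetric] mult_ac)
    also have "\<dots> = ?R t * dual_density b S q s t * (w \<bullet> dual_sum b S t)"
      by (simp add: inner_vec_def sum_distrib_left mult_ac)
    also have "w \<bullet> dual_sum b S t = (\<Sum>j\<in>S. t j * (b j \<bullet> w))"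
      by (simp add: dual_sum_def inner_sum_right inner_commute)
    also have "?R t * dual_density b S q s t * (\<Sum>j\<in>S. t j * (b j \<bullet> w)) = (\<Sum>j\<in>S. ?R t * (b j \<bullet> w) * (t j * dual_density b S q s t))"
      by (simp add: sum_distrib_left mult_ac)
    also have "\<dots> = (\<Sum>j\<in>S. (b j \<bullet> w * real (q j)) * (?R t * dual_density b S (q(j := q j + 1)) s t))"
      by (intro sum.cong refl) (simp add: tj)
    finally show "(\<Sum>i\<in>UNIV. w $ i * (real_of_int (s $ i + 1) * (?R t * dual_density b S q (s + axis i 1) t))) = \<dots>" .
  qed
  also have "\<dots> = (\<Sum>j\<in>S. \<integral>t. (b j \<bullet> w * real (q j)) * (?R t * dual_density b S (q(j := q j + 1)) s t) \<partial>?N)"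
  proof (rule Bochner_Integration.integral_sum)
    fix j
    show "integrable ?N (\<lambda>t. (b j \<bullet> w * real (q j)) * (?R t * dual_density b S (q(j := q j + 1)) s t))"
      by (intro integrable_mult_right F1(1)) (use s in auto)
  qed
  also have "\<dots> = (\<Sum>j\<in>S. (b j \<bullet> w * real (q j)) * dual_integral b S (q(j := q j + 1)) x s)"
    by (simp add: dual_integral_def)
  finally have main: "(\<Sum>i\<in>UNIV. w $ i * (real_of_int (s $ i + 1) * dual_integral b S q x (s + axis i 1))) =
    (\<Sum>j\<in>S. (b j \<bullet> w * real (q j)) * dual_integral b S (q(j := q j + 1)) x s)" .
  have "diffop w (fibre b S q x) s = of_real (?e * (\<Sum>i\<in>UNIV. w $ i * (real_of_int (s $ i + 1) * dual_integral b S q x (s + axis i 1))))"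
    unfolding diffop_def sum_distrib_left of_real_sum by (intro sum.cong refl) (simp add: F(2) s1 del: vector_add_component)
  also have "\<dots> = (\<Sum>j\<in>S. of_real (b j \<bullet> w * real (q j)) * fibre b S (q(j := q j + 1)) x s)"
  proof -
    have f1: "fibre b S (q(j := q j + 1)) x s = of_real (?e * dual_integral b S (q(j := q j + 1)) x s)" for j
      by (rule F1(2)) (use s in auto)
    show ?thesis
      unfolding main sum_distrib_left of_real_sum f1
      by (intro sum.cong refl) (simp only: of_real_mult[symmetric] mult_ac)
  qed
  finally show "diffop w (fibre b S q x) s = (\<Sum>j\<in>S. of_real (b j \<bullet> w * real (q j)) * fibre b S (q(j := q j + 1)) x s)" .
qed

section \<open>Reduction to simple poles\<close>

text \<open>The vector \<open>w\<close> is dual to \<open>v\<close>, so it differentiates only the factor of \<open>v\<close>; the sign comes from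
  \<open>ell v = 1 - v \<bullet> z\<close>.\<close>

lemma ell_mon_derivation:
  assumes "finite B" "v \<in> B" and w: "\<And>u. u \<in> B \<Longrightarrow> u \<bullet> w = (if u = v then 1 else 0)"
  shows "derivation_of w (ell_mon B \<alpha>) (Poly_Mapping.single 0 (- of_nat (\<alpha> v)) * ell_mon B (\<alpha>(v := \<alpha> v - 1)))"
proof -
  let ?R = "\<Prod>u\<in>B - {v}. ell_poly u ^ \<alpha> u"
  have one: "Poly_Mapping.single 0 (- of_real 1) = (- 1 :: 'a cpoly)" by (simp add: single_uminus)
  have "derivation_of w (ell_poly u ^ \<alpha> u) 0" if "u \<in> B - {v}" for u
    using derivation_of_power[OF derivation_of_ell[of w u], of "\<alpha> u"] w[of u] that by simp
  then have R: "derivation_of w ?R 0" by (rule derivation_of_zero_prod)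
  have "derivation_of w (ell_poly v ^ \<alpha> v) (of_nat (\<alpha> v) * ell_poly v ^ (\<alpha> v - 1) * (- 1))"
    using derivation_of_power[OF derivation_of_ell[of w v], of "\<alpha> v"] w[of v] assms(2) one by simp
  from derivation_of_mult[OF this R]
  have "derivation_of w (ell_mon B \<alpha>) (of_nat (\<alpha> v) * ell_poly v ^ (\<alpha> v - 1) * (- 1) * ?R)"
    unfolding ell_mon_def prod.remove[OF assms(1,2)] by simp
  moreover have "of_nat (\<alpha> v) * ell_poly v ^ (\<alpha> v - 1) * (- 1) * ?R = Poly_Mapping.single 0 (- of_nat (\<alpha> v)) * ell_mon B (\<alpha>(v := \<alpha> v - 1))"
    unfolding ell_mon_def prod.remove[OF assms(1,2)] by (simp add: single_uminus mult.assoc)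
  ultimately show ?thesis by simp
qed

lemma sum_in_power_ideal:
  assumes "finite K" "\<And>x. x \<in> A \<Longrightarrow> f x \<in> power_ideal b p K"
  shows "(\<Sum>x\<in>A. f x) \<in> power_ideal b p K"
  using assms(2)
proof (induction A rule: infinite_finite_induct)
  case (insert x A)
  have "f x \<in> power_ideal b p K" "sum f A \<in> power_ideal b p K" using insert by auto
  then obtain q q' where "f x = (\<Sum>j\<in>K. q j * ell_poly (b j) ^ p j)" "sum f A = (\<Sum>j\<in>K. q' j * ell_poly (b j) ^ p j)"
    unfolding power_ideal_def by blast
  then have "sum f (insert x A) = (\<Sum>j\<in>K. (q j + q' j) * ell_poly (b j) ^ p j)"
    using insert by (simp add: distrib_right sum.distrib)
  then show ?case by (auto simp: power_ideal_def)
qed (auto simp: power_ideal_def intro!: exI[of _ "\<lambda>_. 0"])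

lemma multiple_in_power_ideal:
  assumes "finite K" "k \<in> K"
  shows "Q * ell_poly (b k) ^ p k \<in> power_ideal b p K"
proof -
  have "(\<Sum>j\<in>K. (if j = k then Q else 0) * ell_poly (b j) ^ p j) = (\<Sum>j\<in>K. if j = k then Q * ell_poly (b k) ^ p k else 0)"
    by (intro sum.cong) auto
  also have "\<dots> = Q * ell_poly (b k) ^ p k" using assms by simp
  finally show ?thesis unfolding power_ideal_def by (auto intro!: exI[of _ "\<lambda>j. if j = k then Q else 0"])
qed

text \<open>A system of linear equations with independent left-hand sides is solvable. Such vectors move the forms
  independently of each other and pick out single coefficients of linear combinations.\<close>

lemma dual_vector_exists:
  fixes B :: "(real ^ 'n::finite) set"
  assumes "independent B"
  shows "\<exists>w. \<forall>u\<in>B. u \<bullet> w = f u"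
proof -
  obtain g where g: "linear g" "\<forall>u\<in>B. g u = (f u :: real)"
    using linear_independent_extend[OF assms] by blast
  have "u \<bullet> adjoint g 1 = g u" for u using adjoint_works[OF g(1), of u 1] by simp
  then show ?thesis using g(2) by (intro exI[of _ "adjoint g 1"]) simp
qed

context direction begin

lemma decays_ev_eq: "decays r h c \<Longrightarrow> ev_eq c c' \<Longrightarrow> decays r h c'"
  unfolding ev_eq_def using decays_eventually_eq by metis

lemma decays_poly_act: "decays r h c \<Longrightarrow> decays r h (poly_act P c)"
  unfolding poly_act_def[abs_def] by (intro decays_sum decays_cmult decays_shift)

lemma decays_diffop: "decays r h c \<Longrightarrow> decays r h (diffop w c)"
  unfolding diffop_def[abs_def]
  by (intro decays_sum decays_cmult decays_linear decays_shift[where v="- axis _ 1", simplified])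

text \<open>Eigenvectors of commuting operators that preserve decay can be separated from each other, because
  distinct exponents differ in some eigenvalue.\<close>

lemma decays_separate:
  assumes fin: "finite A" and "\<alpha> \<in> A" "cf \<alpha> \<noteq> 0"
    and dist: "\<And>\<beta> \<gamma>. \<beta> \<in> A \<Longrightarrow> \<gamma> \<in> A \<Longrightarrow> \<beta> \<noteq> \<gamma> \<Longrightarrow> \<exists>v\<in>B. \<beta> v \<noteq> \<gamma> v"
    and eig: "\<And>v \<beta>. v \<in> B \<Longrightarrow> \<beta> \<in> A \<Longrightarrow> ev_eq (poly_act (ell_poly v) (diffop (w v) (e \<beta>))) (\<lambda>s. (\<kappa> v - of_nat (\<beta> v)) * e \<beta> s)"
    and dec: "decays r h (\<lambda>s. \<Sum>\<beta>\<in>A. cf \<beta> * e \<beta> s)"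
  shows "decays r h (e \<alpha>)"
  using assms
proof (induction "card A" arbitrary: A cf rule: less_induct)
  case less
  show ?case
  proof (cases "A = {\<alpha>}")
    case True
    have "decays r h (\<lambda>s. inverse (cf \<alpha>) * (\<Sum>\<beta>\<in>A. cf \<beta> * e \<beta> s))" by (rule decays_cmult[OF less.prems(6)])
    then show ?thesis using True less.prems(3) by (simp add: mult.assoc[symmetric])
  next
    case False
    then obtain \<beta> where \<beta>: "\<beta> \<in> A" "\<beta> \<noteq> \<alpha>" using less.prems(2) by blast
    obtain v where v: "v \<in> B" "\<alpha> v \<noteq> \<beta> v" using less.prems(4)[OF less.prems(2) \<beta>(1)] \<beta>(2) by metis
    let ?x = "\<lambda>s. \<Sum>\<gamma>\<in>A. cf \<gamma> * e \<gamma> s"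
    let ?cf = "\<lambda>\<gamma>. cf \<gamma> * (of_nat (\<beta> v) - of_nat (\<gamma> v))"
    have T: "poly_act (ell_poly v) (diffop (w v) ?x) = (\<lambda>s. \<Sum>\<gamma>\<in>A. cf \<gamma> * poly_act (ell_poly v) (diffop (w v) (e \<gamma>)) s)"
    proof -
      have "diffop (w v) ?x = (\<lambda>s. \<Sum>\<gamma>\<in>A. cf \<gamma> * diffop (w v) (e \<gamma>) s)"
        by (rule ext) (simp add: diffop_sum_right diffop_linear)
      then show ?thesis by (auto simp: poly_act_sum_right poly_act_linear)
    qed
    have d1: "decays r h (\<lambda>s. poly_act (ell_poly v) (diffop (w v) ?x) s + (- (\<kappa> v - of_nat (\<beta> v))) * ?x s)"
      by (intro decays_add decays_cmult decays_poly_act decays_diffop less.prems)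
    have d2: "ev_eq (\<lambda>s. poly_act (ell_poly v) (diffop (w v) ?x) s + (- (\<kappa> v - of_nat (\<beta> v))) * ?x s)
       (\<lambda>s. (\<Sum>\<gamma>\<in>A. cf \<gamma> * ((\<kappa> v - of_nat (\<gamma> v)) * e \<gamma> s)) + (- (\<kappa> v - of_nat (\<beta> v))) * ?x s)"
      unfolding T by (intro ev_eq_add ev_eq_sum ev_eq_cmult ev_eq_refl less.prems(5) v(1))
    have d3: "(\<lambda>s. (\<Sum>\<gamma>\<in>A. cf \<gamma> * ((\<kappa> v - of_nat (\<gamma> v)) * e \<gamma> s)) + (- (\<kappa> v - of_nat (\<beta> v))) * ?x s) =
       (\<lambda>s. \<Sum>\<gamma>\<in>A. ?cf \<gamma> * e \<gamma> s)"
      by (rule ext) (simp add: sum_distrib_left algebra_simps flip: sum.distrib sum_negf)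
    have d4: "(\<lambda>s. \<Sum>\<gamma>\<in>A. ?cf \<gamma> * e \<gamma> s) = (\<lambda>s. \<Sum>\<gamma>\<in>A - {\<beta>}. ?cf \<gamma> * e \<gamma> s)"
      using less.prems(1) \<beta>(1) by (auto simp: sum.remove[of A \<beta>])
    have d: "decays r h (\<lambda>s. \<Sum>\<gamma>\<in>A - {\<beta>}. ?cf \<gamma> * e \<gamma> s)"
      using decays_ev_eq[OF d1 d2] unfolding d3 d4 .
    have "card (A - {\<beta>}) < card A" using less.prems(1) \<beta>(1) by (rule card_Diff1_less)
    moreover have "?cf \<alpha> \<noteq> 0" using less.prems(3) v(2) by simp
    ultimately show ?thesis
      using less.prems \<beta> d by (intro less.hyps[of "A - {\<beta>}" ?cf]) auto
  qed
qed

text \<open>The numerators with a decaying coefficient array form an ideal that is stable under differentiation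
  along the flat and under the Euler derivations transversal to it. Such an ideal that is not contained in
  the power ideal contains the numerator that leaves a simple pole along every hyperplane.\<close>

lemma decays_simple_poles:
  fixes b :: "nat \<Rightarrow> real ^ 'n"
  assumes K: "finite K" "inj_on b K" "independent (b ` K)" and p: "\<And>k. k \<in> K \<Longrightarrow> p k \<ge> 1"
    and normal: "\<And>k w. k \<in> K \<Longrightarrow> (\<And>j. j \<in> K \<Longrightarrow> b j \<bullet> w = (if j = k then 1 else 0)) \<Longrightarrow>
       ev_eq (poly_act (ell_poly (b k)) (diffop w c0)) (\<lambda>s. of_nat (p k) * c0 s)"
    and tangent: "\<And>w. (\<And>k. k \<in> K \<Longrightarrow> b k \<bullet> w = 0) \<Longrightarrow> ev_eq (diffop w c0) (\<lambda>s. 0)"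
    and G: "G \<notin> power_ideal b p K" and dec: "decays r h (poly_act G c0)"
  shows "decays r h (poly_act (\<Prod>k\<in>K. ell_poly (b k) ^ (p k - 1)) c0)"
proof -
  define B where "B = extend_basis (b ` K)"
  have ind: "independent B" and sp: "span B = UNIV" and sub: "b ` K \<subseteq> B"
    using K(3) by (auto simp: B_def independent_extend_basis span_extend_basis extend_basis_superset)
  have fin: "finite B" using ind by (rule independent_imp_finite)
  have "\<forall>v. \<exists>w. \<forall>u\<in>B. u \<bullet> w = (if u = v then 1 else 0)" by (intro allI dual_vector_exists ind)
  then obtain w where w: "\<And>u v. u \<in> B \<Longrightarrow> u \<bullet> w v = (if u = v then 1 else 0)" by metis
  define e where "e = (\<lambda>\<alpha>. poly_act (ell_mon B \<alpha>) c0)"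
  \<comment> \<open>the eigenvalue of the Euler operator of \<open>v\<close> on \<open>c0\<close>: the order of the pole along a hyperplane, zero along the flat\<close>
  define \<kappa> where "\<kappa> = (\<lambda>v. if v \<in> b ` K then of_nat (p (the_inv_into K b v)) else (0::complex))"
  have mm: "poly_act (P * Q) c = poly_act P (poly_act Q c)" for P Q :: "'n cpoly" and c
    by (rule ext) (rule poly_act_mult)
  have D: "diffop (w v) (e \<alpha>) = (\<lambda>s. poly_act (ell_mon B \<alpha>) (diffop (w v) c0) s + - of_nat (\<alpha> v) * e (\<alpha>(v := \<alpha> v - 1)) s)"
    if "v \<in> B" for v \<alpha>
    using ell_mon_derivation[OF fin that, of "w v" \<alpha>] w
    by (auto simp: derivation_of_def e_def mm)
  have \<kappa>: "ev_eq (poly_act (ell_poly v) (diffop (w v) c0)) (\<lambda>s. \<kappa> v * c0 s)" if "v \<in> B" for v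
  proof (cases "v \<in> b ` K")
    case True
    then obtain k where k: "k \<in> K" "v = b k" by auto
    have "\<kappa> v = of_nat (p k)" using k K(2) by (simp add: \<kappa>_def the_inv_into_f_f)
    moreover have "b j \<bullet> w v = (if j = k then 1 else 0)" if "j \<in> K" for j
      using w[of "b j" v] that k sub by (auto simp: inj_on_eq_iff[OF K(2)])
    ultimately show ?thesis using normal[OF k(1), of "w v"] k(2) by simp
  next
    case False
    have "b k \<bullet> w v = 0" if "k \<in> K" for k
    proof -
      have "b k \<in> B" "b k \<noteq> v" using sub that False by blast+
      then show ?thesis using w by simp
    qed
    from tangent[OF this] have "ev_eq (diffop (w v) c0) (\<lambda>s. 0)" .
    from ev_eq_poly_act[OF this, of "ell_poly v"] show ?thesis
      using False by (simp add: \<kappa>_def poly_act_linear(3)[abs_def])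
  qed
  have eig: "ev_eq (poly_act (ell_poly v) (diffop (w v) (e \<alpha>))) (\<lambda>s. (\<kappa> v - of_nat (\<alpha> v)) * e \<alpha> s)" if v: "v \<in> B" for v \<alpha>
  proof -
    have 1: "poly_act (ell_poly v) (diffop (w v) (e \<alpha>)) =
      (\<lambda>s. poly_act (ell_mon B \<alpha>) (poly_act (ell_poly v) (diffop (w v) c0)) s + - of_nat (\<alpha> v) * poly_act (ell_poly v) (e (\<alpha>(v := \<alpha> v - 1))) s)"
    proof (rule ext)
      fix s
      have comm: "poly_act (ell_poly v) (poly_act Q c) s = poly_act Q (poly_act (ell_poly v) c) s" for Q c
        by (simp only: poly_act_mult[symmetric] mult.commute)
      show "poly_act (ell_poly v) (diffop (w v) (e \<alpha>)) s =
        poly_act (ell_mon B \<alpha>) (poly_act (ell_poly v) (diffop (w v) c0)) s + - of_nat (\<alpha> v) * poly_act (ell_poly v) (e (\<alpha>(v := \<alpha> v - 1))) s"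
        unfolding D[OF v] by (simp only: poly_act_linear comm)
    qed
    have 2: "of_nat (\<alpha> v) * poly_act (ell_poly v) (e (\<alpha>(v := \<alpha> v - 1))) s = of_nat (\<alpha> v) * e \<alpha> s" for s
    proof (cases "\<alpha> v")
      case (Suc n)
      have "ell_poly v * ell_mon B (\<alpha>(v := \<alpha> v - 1)) = ell_mon B \<alpha>"
        unfolding ell_mon_def prod.remove[OF fin v] by (simp add: Suc mult.assoc[symmetric])
      then show ?thesis by (simp add: e_def mm[symmetric])
    qed simp
    have "ev_eq (\<lambda>s. poly_act (ell_mon B \<alpha>) (poly_act (ell_poly v) (diffop (w v) c0)) s + - (of_nat (\<alpha> v) * e \<alpha> s))
       (\<lambda>s. poly_act (ell_mon B \<alpha>) (\<lambda>s. \<kappa> v * c0 s) s + - (of_nat (\<alpha> v) * e \<alpha> s))"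
      by (intro ev_eq_add ev_eq_poly_act \<kappa> v ev_eq_refl)
    moreover have "poly_act (ell_poly v) (diffop (w v) (e \<alpha>)) =
       (\<lambda>s. poly_act (ell_mon B \<alpha>) (poly_act (ell_poly v) (diffop (w v) c0)) s + - (of_nat (\<alpha> v) * e \<alpha> s))"
      unfolding 1 by (rule ext) (simp only: mult_minus_left 2)
    moreover have "(\<lambda>s. poly_act (ell_mon B \<alpha>) (\<lambda>s. \<kappa> v * c0 s) s + - (of_nat (\<alpha> v) * e \<alpha> s)) =
       (\<lambda>s. (\<kappa> v - of_nat (\<alpha> v)) * e \<alpha> s)"
      by (rule ext) (simp add: poly_act_linear e_def algebra_simps)
    ultimately show ?thesis by simp
  qed
  obtain A cf where A: "finite A" "\<forall>\<alpha>\<in>A. \<forall>v. v \<notin> B \<longrightarrow> \<alpha> v = 0" "G = (\<Sum>\<alpha>\<in>A. Poly_Mapping.single 0 (cf \<alpha>) * ell_mon B \<alpha>)"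
    using ell_span_expand[OF ell_span_UNIV[OF fin sp, of G]] by blast
  \<comment> \<open>a monomial that is divisible by some full power lies in the ideal, and \<open>G\<close> does not\<close>
  have "\<exists>\<alpha>\<in>A. cf \<alpha> \<noteq> 0 \<and> (\<forall>k\<in>K. \<alpha> (b k) < p k)"
  proof (rule ccontr)
    assume neg: "\<not> ?thesis"
    have "Poly_Mapping.single 0 (cf \<alpha>) * ell_mon B \<alpha> \<in> power_ideal b p K" if \<alpha>: "\<alpha> \<in> A" for \<alpha>
    proof (cases "cf \<alpha> = 0")
      case True
      then show ?thesis using sum_in_power_ideal[of K "{}"] K(1) by simp
    next
      case False
      then obtain k where k: "k \<in> K" "p k \<le> \<alpha> (b k)" using neg \<alpha> by force
      have "ell_mon B \<alpha> = ell_poly (b k) ^ (\<alpha> (b k) - p k + p k) * (\<Prod>u\<in>B - {b k}. ell_poly u ^ \<alpha> u)"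
        unfolding ell_mon_def using k sub by (subst prod.remove[OF fin, of "b k"]) auto
      then have eq: "Poly_Mapping.single 0 (cf \<alpha>) * ell_mon B \<alpha> =
        (Poly_Mapping.single 0 (cf \<alpha>) * ell_poly (b k) ^ (\<alpha> (b k) - p k) * (\<Prod>u\<in>B - {b k}. ell_poly u ^ \<alpha> u)) * ell_poly (b k) ^ p k"
        by (simp only: power_add mult_ac)
      show ?thesis unfolding eq by (rule multiple_in_power_ideal[OF K(1) k(1)])
    qed
    then have "G \<in> power_ideal b p K" unfolding A(3) by (intro sum_in_power_ideal K(1))
    then show False using G by simp
  qed
  then obtain \<alpha> where \<alpha>: "\<alpha> \<in> A" "cf \<alpha> \<noteq> 0" "\<And>k. k \<in> K \<Longrightarrow> \<alpha> (b k) < p k" by blast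
  have "poly_act G c0 = (\<lambda>s. \<Sum>\<beta>\<in>A. cf \<beta> * e \<beta> s)"
    by (rule ext) (simp add: A(3) poly_act_sum mm e_def)
  then have dA: "decays r h (\<lambda>s. \<Sum>\<beta>\<in>A. cf \<beta> * e \<beta> s)" using dec by simp
  have dist: "\<exists>v\<in>B. \<beta> v \<noteq> \<gamma> v" if "\<beta> \<in> A" "\<gamma> \<in> A" "\<beta> \<noteq> \<gamma>" for \<beta> \<gamma>
  proof (rule ccontr)
    assume "\<not> ?thesis"
    then have "\<beta> v = \<gamma> v" for v
      using A(2)[rule_format, OF that(1), of v] A(2)[rule_format, OF that(2), of v] by (cases "v \<in> B") auto
    then show False using that(3) by auto
  qed
  have "decays r h (e \<alpha>)"
    by (rule decays_separate[where A=A and cf=cf and B=B and w=w and \<kappa>=\<kappa>, OF A(1) \<alpha>(1,2) dist eig dA])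
  \<comment> \<open>differentiate along the flat until no tangential variable is left\<close>
  then have "decays r h (e (\<lambda>v. if v \<in> b ` K then \<alpha> v else 0))" using \<alpha>(3) A(2)[rule_format, OF \<alpha>(1)]
  proof (induction "\<Sum>v\<in>B - b ` K. \<alpha> v" arbitrary: \<alpha> rule: less_induct)
    case less
    show ?case
    proof (cases "\<exists>v\<in>B - b ` K. \<alpha> v \<noteq> 0")
      case True
      then obtain v where v: "v \<in> B" "v \<notin> b ` K" "\<alpha> v \<noteq> 0" by blast
      let ?\<beta> = "\<alpha>(v := \<alpha> v - 1)"
      have "b k \<bullet> w v = 0" if "k \<in> K" for k
      proof -
        have "b k \<in> B" "b k \<noteq> v" using sub that v(2) by blast+
        then show ?thesis using w by simp
      qed
      from ev_eq_poly_act[OF tangent[OF this], of "ell_mon B \<alpha>"]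
      have t: "ev_eq (poly_act (ell_mon B \<alpha>) (diffop (w v) c0)) (\<lambda>s. 0)"
        by (simp add: poly_act_linear(3)[abs_def])
      have "decays r h (diffop (w v) (e \<alpha>))" by (rule decays_diffop[OF less.prems(1)])
      moreover have "ev_eq (diffop (w v) (e \<alpha>)) (\<lambda>s. 0 + - of_nat (\<alpha> v) * e ?\<beta> s)"
        unfolding D[OF v(1)] by (intro ev_eq_add t ev_eq_refl)
      ultimately have "decays r h (\<lambda>s. 0 + - of_nat (\<alpha> v) * e ?\<beta> s)" by (rule decays_ev_eq)
      from decays_cmult[OF this, of "- inverse (of_nat (\<alpha> v))"] have d: "decays r h (e ?\<beta>)"
        using v(3) by (simp add: mult.assoc[symmetric])
      have lt: "(\<Sum>u\<in>B - b ` K. ?\<beta> u) < (\<Sum>u\<in>B - b ` K. \<alpha> u)"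
        using v fin by (intro sum_strict_mono_ex1) auto
      have "?\<beta> (b k) < p k" if "k \<in> K" for k using less.prems(2)[OF that] by auto
      moreover have "?\<beta> u = 0" if "u \<notin> B" for u using less.prems(3)[OF that] by auto
      ultimately have "decays r h (e (\<lambda>u. if u \<in> b ` K then ?\<beta> u else 0))"
        by (rule less.hyps[OF lt d])
      moreover have "(\<lambda>u. if u \<in> b ` K then ?\<beta> u else 0) = (\<lambda>u. if u \<in> b ` K then \<alpha> u else 0)"
        using v(2) by auto
      ultimately show ?thesis by simp
    next
      case False
      have "(if v \<in> b ` K then \<alpha> v else 0) = \<alpha> v" for v
        using False less.prems(3)[of v] by (cases "v \<in> B") auto
      then have "(\<lambda>v. if v \<in> b ` K then \<alpha> v else 0) = \<alpha>" by (rule ext)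
      then show ?thesis using less.prems(1) by simp
    qed
  qed
  then have "decays r h (poly_act (\<Prod>k\<in>K. ell_poly (b k) ^ (p k - 1 - \<alpha> (b k))) (e (\<lambda>v. if v \<in> b ` K then \<alpha> v else 0)))"
    by (rule decays_poly_act)
  moreover have "ell_mon B (\<lambda>v. if v \<in> b ` K then \<alpha> v else 0) = (\<Prod>k\<in>K. ell_poly (b k) ^ \<alpha> (b k))"
  proof -
    have "ell_mon B (\<lambda>v. if v \<in> b ` K then \<alpha> v else 0) = (\<Prod>v\<in>b ` K. ell_poly v ^ \<alpha> v)"
      unfolding ell_mon_def using fin sub by (intro prod.mono_neutral_cong_right) auto
    then show ?thesis by (simp add: prod.reindex[OF K(2)])
  qed
  moreover have "(\<Prod>k\<in>K. ell_poly (b k) ^ (p k - 1 - \<alpha> (b k))) * (\<Prod>k\<in>K. ell_poly (b k) ^ \<alpha> (b k)) = (\<Prod>k\<in>K. ell_poly (b k) ^ (p k - 1))"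
    unfolding prod.distrib[symmetric] power_add[symmetric]
  proof (intro prod.cong refl arg_cong2[where f="(^)"])
    show "p k - 1 - \<alpha> (b k) + \<alpha> (b k) = p k - 1" if "k \<in> K" for k using \<alpha>(3)[OF that] by simp
  qed
  ultimately show ?thesis by (simp add: e_def mm[symmetric])
qed

end

section \<open>The lower bound for simple poles\<close>

text \<open>A form of Stirling's upper bound that loses only a factor linear in \<open>k\<close>.\<close>

lemma fact_le_power: "k \<ge> 1 \<Longrightarrow> fact k * exp (real k) \<le> exp 1 * real k ^ Suc k"
proof (induction k rule: nat_induct_at_least)
  case base
  show ?case by simp
next
  case (Suc k)
  have k: "real k > 0" using Suc.hyps by simp
  have "exp 1 * real k ^ Suc k \<le> real (Suc k) ^ Suc k"
  proof -
    have "ln (real k / real (Suc k)) \<le> real k / real (Suc k) - 1" using k by (intro ln_le_minus_one) simp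
    then have "ln (real k / real (Suc k)) \<le> - 1 / real (Suc k)" by (simp add: field_simps)
    then have "real (Suc k) * ln (real k / real (Suc k)) \<le> real (Suc k) * (- 1 / real (Suc k))"
      by (intro mult_left_mono) auto
    then have "real (Suc k) * ln (real k / real (Suc k)) \<le> - 1" by simp
    then have "exp (real (Suc k) * ln (real k / real (Suc k))) \<le> exp (- 1)" by simp
    then have "(real k / real (Suc k)) ^ Suc k \<le> exp (- 1)"
      using k by (subst (asm) exp_of_nat_mult) simp
    moreover have "real (Suc k) ^ Suc k > 0" by (rule zero_less_power) simp
    ultimately have "real k ^ Suc k \<le> exp (- 1) * real (Suc k) ^ Suc k"
      by (simp only: power_divide pos_divide_le_eq)
    then have "exp 1 * real k ^ Suc k \<le> exp 1 * (exp (- 1) * real (Suc k) ^ Suc k)"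
      by (rule mult_left_mono) simp
    also have "\<dots> = real (Suc k) ^ Suc k" by (simp only: mult.assoc[symmetric] exp_add[symmetric]) simp
    finally show ?thesis .
  qed
  have "fact (Suc k) * exp (real (Suc k)) = real (Suc k) * exp 1 * (fact k * exp (real k))"
    by (simp add: exp_add algebra_simps)
  also have "\<dots> \<le> real (Suc k) * exp 1 * (exp 1 * real k ^ Suc k)" by (intro mult_left_mono Suc.IH) auto
  also have "\<dots> \<le> real (Suc k) * exp 1 * (real (Suc k) ^ Suc k)"
    using \<open>exp 1 * real k ^ Suc k \<le> real (Suc k) ^ Suc k\<close> by (intro mult_left_mono) auto
  finally show ?case by (simp add: mult_ac)
qed

text \<open>Along even exponents all powers $u_i^{s_i}$ are nonnegative, whatever the signs of the $u_i$.\<close>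

definition even_below :: "real \<Rightarrow> nat" where
  "even_below a = 2 * nat \<lfloor>a / 2\<rfloor>"

lemma even_below_bounds: "a \<ge> 0 \<Longrightarrow> real (even_below a) \<le> a" "a - 2 \<le> real (even_below a)"
  unfolding even_below_def by linarith+

text \<open>With $k \approx n\rho$ and base $n\rho/\xi$, Stirling's formula gives $e^{n\rho}\xi^{-n\rho}$. The bounded
  perturbation \<open>D\<close> of the base changes the power by a bounded factor, since $(1-\delta)^k$ with $k\delta \le D\xi$ stays
  away from zero.\<close>

lemma power_over_fact_lower_bound:
  fixes \<rho> \<xi> D :: real
  assumes \<rho>: "0 < \<rho>" "\<rho> \<le> 1" and \<xi>: "\<xi> > 0" and D: "D \<ge> 0"
  shows "\<exists>C>0. \<exists>n0. \<forall>n\<ge>n0. real n * \<rho> / \<xi> - D > 0 \<and>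
    C / (real n + 1) * exp (real n * (\<rho> - \<rho> * ln \<xi>)) \<le> (real n * \<rho> / \<xi> - D) ^ even_below (real n * \<rho>) / fact (even_below (real n * \<rho>))"
proof -
  define C where "C = exp (- 2 * D * \<xi>) * exp (- 1) * exp (- 2 * \<bar>1 - ln \<xi>\<bar>)"
  define n0 where "n0 = nat \<lceil>max (2 * D * \<xi> / \<rho>) (4 / \<rho>)\<rceil> + 1"
  have main: "real n * \<rho> / \<xi> - D > 0 \<and>
    C / (real n + 1) * exp (real n * (\<rho> - \<rho> * ln \<xi>)) \<le> (real n * \<rho> / \<xi> - D) ^ even_below (real n * \<rho>) / fact (even_below (real n * \<rho>))"
    if n: "n \<ge> n0" for n
  proof -
    have n': "real n \<ge> 2 * D * \<xi> / \<rho>" "real n \<ge> 4 / \<rho>" "real n > 0" using n unfolding n0_def by linarith+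
    define k where "k = even_below (real n * \<rho>)"
    define \<delta> where "\<delta> = D * \<xi> / (real n * \<rho>)"
    have np: "real n * \<rho> > 0" using n' \<rho> by simp
    have k: "real k \<le> real n * \<rho>" "real n * \<rho> - 2 \<le> real k" using even_below_bounds[of "real n * \<rho>"] np by (auto simp: k_def)
    have "real n * \<rho> \<ge> 4" using n'(2) \<rho> by (simp add: field_simps)
    then have k2: "real k \<ge> 2" using k by linarith
    have kn: "real k \<le> real n" using k(1) mult_left_mono[OF \<rho>(2), of "real n"] by simp
    have \<delta>: "0 \<le> \<delta>" "\<delta> \<le> 1/2" using D \<xi> np n'(1) \<rho> by (auto simp: \<delta>_def field_simps)
    have a: "real n * \<rho> / \<xi> - D = (real n * \<rho> / \<xi>) * (1 - \<delta>)" using np \<xi> n' \<rho> by (simp add: \<delta>_def field_simps)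
    have pos: "real n * \<rho> / \<xi> - D > 0" unfolding a using np \<xi> \<delta> by simp
    have "- \<delta> - 2 * \<delta>\<^sup>2 \<le> ln (1 - \<delta>)" using \<delta> by (intro ln_one_minus_pos_lower_bound) auto
    moreover have "2 * \<delta>\<^sup>2 \<le> \<delta>" using \<delta> mult_left_mono[OF \<delta>(2,1)] by (simp add: power2_eq_square)
    ultimately have "- 2 * \<delta> \<le> ln (1 - \<delta>)" by simp
    then have "exp (- 2 * \<delta>) \<le> 1 - \<delta>" using \<delta> by (simp add: ln_ge_iff)
    then have "exp (- 2 * \<delta>) ^ k \<le> (1 - \<delta>) ^ k" by (intro power_mono) auto
    moreover have "exp (- 2 * D * \<xi>) \<le> exp (- 2 * \<delta>) ^ k"
    proof -
      have "\<delta> * real k \<le> \<delta> * (real n * \<rho>)" using k \<delta> by (intro mult_left_mono) auto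
      also have "\<dots> = D * \<xi>" using n' \<rho> by (simp add: \<delta>_def)
      finally have "- 2 * D * \<xi> \<le> real k * (- 2 * \<delta>)" by (simp add: mult.commute)
      then have "exp (- 2 * D * \<xi>) \<le> exp (real k * (- 2 * \<delta>))" by simp
      then show ?thesis by (subst (asm) exp_of_nat_mult)
    qed
    ultimately have 1: "exp (- 2 * D * \<xi>) \<le> (1 - \<delta>) ^ k" by linarith
    have 2: "exp (- 1) / (real n + 1) * exp (real k) \<le> real k ^ k / fact k"
    proof -
      have "fact k * exp (real k) \<le> exp 1 * (real k * real k ^ k)" using fact_le_power[of k] k2 by simp
      also have "\<dots> \<le> exp 1 * ((real n + 1) * real k ^ k)" using kn by (intro mult_left_mono mult_right_mono) auto
      finally have *: "fact k * exp (real k) \<le> exp 1 * ((real n + 1) * real k ^ k)" .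
      have "exp (- 1) / (real n + 1) * exp (real k) = (fact k * exp (real k)) / (exp 1 * (real n + 1) * fact k)"
        by (simp add: exp_minus divide_inverse)
      also have "\<dots> \<le> (exp 1 * ((real n + 1) * real k ^ k)) / (exp 1 * (real n + 1) * fact k)"
        by (intro divide_right_mono *) simp
      also have "\<dots> = real k ^ k / fact k"
      proof -
        have "real n + 1 \<noteq> 0" by linarith
        then have "E * (N * X) / (E * N * F) = X / F" if "E \<noteq> 0" "N = real n + 1" for E N X F :: real using that by simp
        then show ?thesis by simp
      qed
      finally show ?thesis .
    qed
    have 3: "exp (- 2 * \<bar>1 - ln \<xi>\<bar>) * exp (real n * (\<rho> - \<rho> * ln \<xi>)) \<le> exp (real k) * inverse \<xi> ^ k"
    proof -
      have "real n * \<rho> * (1 - ln \<xi>) - 2 * \<bar>1 - ln \<xi>\<bar> \<le> real k * (1 - ln \<xi>)"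
      proof -
        have "(real n * \<rho> - real k) * (1 - ln \<xi>) \<le> (real n * \<rho> - real k) * \<bar>1 - ln \<xi>\<bar>" using k by (intro mult_left_mono) auto
        also have "\<dots> \<le> 2 * \<bar>1 - ln \<xi>\<bar>" using k by (intro mult_right_mono) auto
        finally show ?thesis by (simp add: algebra_simps)
      qed
      then have "exp (real n * \<rho> * (1 - ln \<xi>) - 2 * \<bar>1 - ln \<xi>\<bar>) \<le> exp (real k * (1 - ln \<xi>))" by simp
      also have "real k * (1 - ln \<xi>) = real k + real k * (- ln \<xi>)" by (simp add: algebra_simps)
      also have "exp (real k + real k * (- ln \<xi>)) = exp (real k) * exp (- ln \<xi>) ^ k" by (simp only: exp_add exp_of_nat_mult)
      also have "exp (- ln \<xi>) = inverse \<xi>" using \<xi> by (simp add: exp_minus)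
      also have "exp (real n * \<rho> * (1 - ln \<xi>) - 2 * \<bar>1 - ln \<xi>\<bar>) = exp (- 2 * \<bar>1 - ln \<xi>\<bar>) * exp (real n * (\<rho> - \<rho> * ln \<xi>))"
        by (simp add: algebra_simps flip: exp_add)
      finally show ?thesis .
    qed
    have "C / (real n + 1) * exp (real n * (\<rho> - \<rho> * ln \<xi>)) =
      exp (- 2 * D * \<xi>) * ((exp (- 1) / (real n + 1)) * (exp (- 2 * \<bar>1 - ln \<xi>\<bar>) * exp (real n * (\<rho> - \<rho> * ln \<xi>))))"
      by (simp add: C_def)
    also have "\<dots> \<le> (1 - \<delta>) ^ k * ((exp (- 1) / (real n + 1)) * (exp (real k) * inverse \<xi> ^ k))"
      by (intro mult_mono[OF 1] mult_left_mono[OF 3]) (use \<delta> in auto)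
    also have "\<dots> = (1 - \<delta>) ^ k * inverse \<xi> ^ k * (exp (- 1) / (real n + 1) * exp (real k))" by simp
    also have "\<dots> \<le> (1 - \<delta>) ^ k * inverse \<xi> ^ k * (real k ^ k / fact k)"
      using 2 \<delta> \<xi> by (intro mult_left_mono) auto
    also have "\<dots> \<le> (1 - \<delta>) ^ k * inverse \<xi> ^ k * ((real n * \<rho>) ^ k / fact k)"
      using k(1) \<delta> \<xi> by (intro mult_left_mono divide_right_mono power_mono) auto
    also have "\<dots> = (real n * \<rho> / \<xi> - D) ^ k / fact k"
      unfolding a by (simp only: divide_inverse power_mult_distrib mult_ac)
    finally show ?thesis using pos by (simp add: k_def)
  qed
  have "C > 0" by (simp add: C_def)
  then show ?thesis using main by blast
qed

lemma ell_prod_act_fibre: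
  fixes x :: "real ^ 'n::finite"
  assumes S: "finite S" and l: "\<And>j. j \<in> S \<Longrightarrow> ell (b j) x \<noteq> 0" and x: "\<And>i. x $ i \<noteq> 0"
    and A: "A \<subseteq> S" and e: "\<And>j. j \<in> A \<Longrightarrow> e j \<le> q j"
  shows "ev_eq (poly_act (\<Prod>j\<in>A. ell_poly (b j) ^ e j) (fibre b S q x)) (fibre b S (\<lambda>j. if j \<in> A then q j - e j else q j) x)"
proof -
  have mm: "poly_act (P * Q) c = poly_act P (poly_act Q c)" for P Q :: "'n cpoly" and c
    by (rule ext) (rule poly_act_mult)
  have pow: "ev_eq (poly_act (ell_poly (b j) ^ n) (fibre b S q x)) (fibre b S (q(j := q j - n)) x)"
    if j: "j \<in> S" and n: "n \<le> q j" for j n q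
    using n
  proof (induction n)
    case 0
    then show ?case by (simp add: poly_act_one[abs_def])
  next
    case (Suc n)
    have "ev_eq (poly_act (ell_poly (b j)) (poly_act (ell_poly (b j) ^ n) (fibre b S q x))) (poly_act (ell_poly (b j)) (fibre b S (q(j := q j - n)) x))"
      by (intro ev_eq_poly_act Suc.IH) (use Suc.prems in simp)
    also have "ev_eq \<dots> (fibre b S ((q(j := q j - n))(j := (q(j := q j - n)) j - 1)) x)"
      using Suc.prems by (intro ell_act_fibre S l x j) auto
    also have "(q(j := q j - n))(j := (q(j := q j - n)) j - 1) = q(j := q j - Suc n)" by auto
    finally show ?case by (simp add: mm)
  qed
  have "finite A" using A S by (rule finite_subset)
  then show ?thesis using A e
  proof (induction A rule: finite_induct)
    case empty
    then show ?case by (simp add: poly_act_one[abs_def])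
  next
    case (insert j A)
    let ?q = "\<lambda>k. if k \<in> A then q k - e k else q k"
    have "ev_eq (poly_act (ell_poly (b j) ^ e j) (poly_act (\<Prod>j\<in>A. ell_poly (b j) ^ e j) (fibre b S q x))) (poly_act (ell_poly (b j) ^ e j) (fibre b S ?q x))"
      using insert by (intro ev_eq_poly_act) auto
    also have "ev_eq \<dots> (fibre b S (?q(j := ?q j - e j)) x)"
      using insert by (intro pow) auto
    also have "?q(j := ?q j - e j) = (\<lambda>k. if k \<in> insert j A then q k - e k else q k)"
      using insert by auto
    finally show ?case using insert by (simp add: mm)
  qed
qed

context direction begin

lemma r_le_1: "r $ i \<le> 1"
  using member_le_sum[of i UNIV "\<lambda>i. r $ i"] r_sum r_pos by (auto intro: less_imp_le)

text \<open>The Laplace lower bound. At an even exponent the integrand is nonnegative, so the integral is at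
  least its part over the unit box with corner \<open>n c\<close>, where \<open>c\<close> are the coefficients of the contributing
  point in the normal cone; there \<open>u\<close> is within a bounded distance of \<open>n r / x\<close>.\<close>

lemma dual_integral_lower_bound:
  fixes x y :: "real ^ 'n"
  assumes K: "finite K" and x: "\<And>i. x $ i \<noteq> 0" and flat: "\<And>j. j \<in> K \<Longrightarrow> ell (b j) x = 0"
    and c: "\<And>j. j \<in> K \<Longrightarrow> c j > 0" and crit: "\<And>i. r $ i / x $ i = dual_sum b K c $ i"
    and y: "\<And>i. sgn (y $ i) = sgn (x $ i)" "\<And>j. j \<in> K \<Longrightarrow> ell (b j) y > 0"
  shows "\<exists>C>0. \<exists>n0. \<forall>n\<ge>n0. \<forall>s. (\<forall>i. s $ i = int (even_below (real n * r $ i))) \<longrightarrow>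
    C / (real n + 1) ^ CARD('n) * exp (real n * - (\<Sum>i\<in>UNIV. r $ i * ln \<bar>x $ i\<bar>)) \<le> dual_integral b K (\<lambda>_. 1) y s"
proof -
  interpret PS: finite_product_sigma_finite "\<lambda>_::nat. lborel :: real measure" K by standard (rule K)
  let ?N = "\<Pi>\<^sub>M j\<in>K. (lborel :: real measure)"
  define D where "D = (\<lambda>i. \<Sum>j\<in>K. \<bar>b j $ i\<bar>)"
  have D: "D i \<ge> 0" for i by (simp add: D_def sum_nonneg)
  have ax: "\<bar>x $ i\<bar> > 0" for i using x[of i] by simp
  have "\<exists>C n0. C > 0 \<and> (\<forall>n\<ge>n0. real n * r $ i / \<bar>x $ i\<bar> - D i > 0 \<and>
    C / (real n + 1) * exp (real n * (r $ i - r $ i * ln \<bar>x $ i\<bar>)) \<le> (real n * r $ i / \<bar>x $ i\<bar> - D i) ^ even_below (real n * r $ i) / fact (even_below (real n * r $ i)))" for i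
    using power_over_fact_lower_bound[OF r_pos r_le_1 ax D, of i i i] by blast
  then obtain C n0 where C: "\<And>i. C i > 0" "\<And>i n. n \<ge> n0 i \<Longrightarrow> real n * r $ i / \<bar>x $ i\<bar> - D i > 0 \<and>
    C i / (real n + 1) * exp (real n * (r $ i - r $ i * ln \<bar>x $ i\<bar>)) \<le> (real n * r $ i / \<bar>x $ i\<bar> - D i) ^ even_below (real n * r $ i) / fact (even_below (real n * r $ i))"
    by metis
  define n1 where "n1 = Max (range n0)"
  have n1: "n0 i \<le> n1" for i by (simp add: n1_def)
  define n2 where "n2 = max n1 (nat \<lceil>Max (range (\<lambda>i. 4 / r $ i))\<rceil>)"
  \<comment> \<open>pairing the critical equation with \<open>x\<close>, where every \<open>b j \<bullet> x\<close> is one; hence the factor $e^{-n}$ of the density on the box cancels the $e^{n}$ of Stirling's formula\<close>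
  have sumc: "(\<Sum>j\<in>K. c j) = 1"
  proof -
    have "(\<Sum>j\<in>K. c j) = (\<Sum>j\<in>K. c j * (b j \<bullet> x))" using flat by (intro sum.cong) (auto simp: ell_eq_inner)
    also have "\<dots> = dual_sum b K c \<bullet> x" by (simp add: dual_sum_def inner_sum_left)
    also have "\<dots> = (\<Sum>i\<in>UNIV. r $ i / x $ i * x $ i)" by (simp add: inner_vec_def crit)
    also have "\<dots> = 1" using x r_sum by simp
    finally show ?thesis .
  qed
  show ?thesis
  proof (intro exI[of _ "exp (- real (card K)) * (\<Prod>i\<in>UNIV. C i)"] conjI exI[of _ n2] allI impI)
    show "exp (- real (card K)) * (\<Prod>i\<in>UNIV. C i) > 0" using C(1) by (simp add: prod_pos)
    fix n and s :: "int ^ 'n" assume n: "n \<ge> n2" and s: "\<forall>i. s $ i = int (even_below (real n * r $ i))"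
    let ?k = "\<lambda>i. even_below (real n * r $ i)"
    have nn: "n \<ge> n0 i" for i using n n1[of i] by (simp add: n2_def)
    have k1: "s $ i \<ge> 1" for i
    proof -
      have "4 / r $ i \<le> Max (range (\<lambda>i. 4 / r $ i))" by simp
      also have "\<dots> \<le> real n" using n unfolding n2_def by linarith
      finally have "4 \<le> real n * r $ i" using r_pos[of i] by (simp add: field_simps)
      then have "real (?k i) \<ge> 2" using even_below_bounds(2)[of "real n * r $ i"] by linarith
      then show ?thesis using s by simp
    qed
    have ks: "nat (s $ i) = ?k i" for i using s by simp
    define L where "L = exp (- real n - real (card K)) * (\<Prod>i\<in>UNIV. (real n * r $ i / \<bar>x $ i\<bar> - D i) ^ ?k i / fact (?k i))"
    define Bx where "Bx = (\<Pi>\<^sub>E j\<in>K. {real n * c j .. real n * c j + 1})"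
    have yn: "y $ i \<noteq> 0" for i using y(1)[of i] x[of i] by (metis sgn_0_0)
    have yl: "ell (b j) y \<noteq> 0" if "j \<in> K" for j using y(2)[OF that] by simp
    have int: "integrable ?N (\<lambda>t. indicator (dual_region b K y) t * dual_density b K (\<lambda>_. 1) s t)"
      by (rule fibre_eq_dual_integral(1)) (use K yl yn k1 in auto)
    have Bs: "Bx \<in> sets ?N" unfolding Bx_def by (intro sets_PiM_I_finite K) auto
    have "emeasure ?N Bx = (\<Prod>j\<in>K. emeasure lborel {real n * c j .. real n * c j + 1})"
      unfolding Bx_def by (rule PS.measure_times) auto
    then have mB: "emeasure ?N Bx = 1" by simp
    have even: "even (?k i)" for i by (simp add: even_below_def)
    have nonneg: "dual_density b K (\<lambda>_. 1) s t \<ge> 0" for t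
      unfolding dual_density_def ks
      by (intro mult_nonneg_nonneg prod_nonneg ballI divide_nonneg_nonneg zero_le_even_power even) simp_all
    have box: "indicator Bx t * L \<le> indicator (dual_region b K y) t * dual_density b K (\<lambda>_. 1) s t" for t
    proof (cases "t \<in> Bx")
      case True
      then have t: "real n * c j \<le> t j" "t j \<le> real n * c j + 1" if "j \<in> K" for j using that by (auto simp: Bx_def)
      define u where "u = dual_sum b K t"
      have ui: "\<bar>u $ i - real n * r $ i / x $ i\<bar> \<le> D i" for i
      proof -
        have "u $ i - real n * r $ i / x $ i = (\<Sum>j\<in>K. (t j - real n * c j) * b j $ i)"
          using crit[of i] by (simp add: u_def dual_sum_def sum_subtractf left_diff_distrib sum_distrib_left mult.assoc flip: times_divide_eq_right)
        also have "\<bar>\<dots>\<bar> \<le> (\<Sum>j\<in>K. \<bar>(t j - real n * c j) * b j $ i\<bar>)" by (rule sum_abs)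
        also have "\<dots> \<le> (\<Sum>j\<in>K. 1 * \<bar>b j $ i\<bar>)" unfolding abs_mult using t by (intro sum_mono mult_right_mono) force+
        finally show ?thesis by (simp add: D_def)
      qed
      have P: "real n * r $ i / \<bar>x $ i\<bar> - D i > 0" for i using C(2)[OF nn] by blast
      have abs: "real n * r $ i / \<bar>x $ i\<bar> - D i \<le> \<bar>u $ i\<bar>" for i
      proof -
        have "\<bar>real n * r $ i / x $ i\<bar> = real n * r $ i / \<bar>x $ i\<bar>" using r_pos[of i] by (simp add: abs_mult)
        moreover have "p - d \<le> \<bar>a\<bar>" if "\<bar>q\<bar> = p" "\<bar>a - q\<bar> \<le> d" for p q d a :: real using that by linarith
        ultimately show ?thesis using ui[of i] by blast
      qed
      have pn: "0 < a" if "0 < p - d" "\<bar>a - p\<bar> \<le> d" for a p d :: real using that by linarith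
      have nn': "a < 0" if "0 < - p - d" "\<bar>a - p\<bar> \<le> d" for a p d :: real using that by linarith
      have sg: "u $ i * y $ i > 0" for i
      proof (cases "x $ i > 0")
        case True
        then have "u $ i > 0" using pn[OF _ ui[of i]] P[of i] by simp
        moreover have "y $ i > 0" using y(1)[of i] True by (simp add: sgn_if split: if_splits)
        ultimately show ?thesis by simp
      next
        case False
        then have neg: "x $ i < 0" using x[of i] by linarith
        then have "u $ i < 0" using nn'[OF _ ui[of i]] P[of i] by simp
        moreover have "y $ i < 0" using y(1)[of i] neg by (simp add: sgn_if split: if_splits)
        ultimately show ?thesis by (simp add: mult_neg_neg)
      qed
      have tp: "ell (b j) y * t j > 0" if "j \<in> K" for j
      proof -
        have "t j > 0"
        proof (cases "n = 0")
          case True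
          then show ?thesis using P[of undefined] D[of undefined] by simp
        next
          case False
          then have "real n * c j > 0" using c[OF that] by simp
          then show ?thesis using t(1)[OF that] by linarith
        qed
        then show ?thesis using y(2)[OF that] by simp
      qed
      have reg: "t \<in> dual_region b K y" using sg tp by (simp add: dual_region_def u_def)
      have m1: "exp (- real n - real (card K)) \<le> (\<Prod>j\<in>K. exp (- t j))"
      proof -
        have "(\<Sum>j\<in>K. t j) \<le> (\<Sum>j\<in>K. real n * c j + 1)" using t by (intro sum_mono) auto
        also have "\<dots> = real n + real (card K)" using sumc by (simp add: sum.distrib flip: sum_distrib_left)
        finally show ?thesis using K by (simp flip: exp_sum add: sum_negf)
      qed
      have m2: "(\<Prod>i\<in>UNIV. (real n * r $ i / \<bar>x $ i\<bar> - D i) ^ ?k i / fact (?k i)) \<le> (\<Prod>i\<in>UNIV. u $ i ^ ?k i / fact (?k i))"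
      proof (rule prod_mono, intro conjI)
        fix i
        show "0 \<le> (real n * r $ i / \<bar>x $ i\<bar> - D i) ^ ?k i / fact (?k i)" using P[of i] by simp
        have "(real n * r $ i / \<bar>x $ i\<bar> - D i) ^ ?k i \<le> \<bar>u $ i\<bar> ^ ?k i" using abs[of i] P[of i] by (intro power_mono) auto
        also have "\<dots> = u $ i ^ ?k i" using even[of i] by (rule power_even_abs)
        finally show "(real n * r $ i / \<bar>x $ i\<bar> - D i) ^ ?k i / fact (?k i) \<le> u $ i ^ ?k i / fact (?k i)" by (intro divide_right_mono) auto
      qed
      have m3: "0 \<le> (\<Prod>i\<in>UNIV. (real n * r $ i / \<bar>x $ i\<bar> - D i) ^ ?k i / fact (?k i))"
        using P by (intro prod_nonneg ballI divide_nonneg_nonneg zero_le_power) (auto intro: less_imp_le)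
      have "L \<le> (\<Prod>j\<in>K. exp (- t j)) * (\<Prod>i\<in>UNIV. u $ i ^ ?k i / fact (?k i))"
        unfolding L_def by (rule mult_mono[OF m1 m2 _ m3]) (intro prod_nonneg ballI exp_ge_zero)
      then show ?thesis using reg True by (simp add: dual_density_def ks u_def)
    qed (use nonneg in simp)
    have Bint: "integrable ?N (\<lambda>t. indicator Bx t * L)"
      using Bs mB by (intro integrable_mult_left integrable_real_indicator) auto
    have "L = (\<integral>t. indicator Bx t * L \<partial>?N)"
      using Bs mB by (simp add: measure_def sets.Int_space_eq2)
    also have "\<dots> \<le> dual_integral b K (\<lambda>_. 1) y s"
      unfolding dual_integral_def by (rule integral_mono[OF Bint int box])
    finally have L: "L \<le> dual_integral b K (\<lambda>_. 1) y s" .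
    have "(exp (- real (card K)) * (\<Prod>i\<in>UNIV. C i)) / (real n + 1) ^ CARD('n) * exp (real n * - (\<Sum>i\<in>UNIV. r $ i * ln \<bar>x $ i\<bar>)) =
      exp (- real n - real (card K)) * (\<Prod>i\<in>UNIV. C i / (real n + 1) * exp (real n * (r $ i - r $ i * ln \<bar>x $ i\<bar>)))"
    proof -
      have "(\<Prod>i\<in>UNIV. exp (real n * (r $ i - r $ i * ln \<bar>x $ i\<bar>))) = exp (real n) * exp (real n * - (\<Sum>i\<in>UNIV. r $ i * ln \<bar>x $ i\<bar>))"
      proof -
        have "(\<Sum>i\<in>UNIV. real n * (r $ i - r $ i * ln \<bar>x $ i\<bar>)) = real n * 1 + real n * - (\<Sum>i\<in>UNIV. r $ i * ln \<bar>x $ i\<bar>)"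
          unfolding r_sum[symmetric] by (simp add: sum_distrib_left sum_subtractf algebra_simps)
        then show ?thesis by (simp flip: exp_sum exp_add)
      qed
      note e = this
      have g: "a * p / q * e' = z * (p / q * (w * e'))" if "z * w = a" for a p q e' z w :: real
        using that by auto
      have "exp (- real n - real (card K)) * exp (real n) = exp (- real (card K))" by (simp flip: exp_add)
      then show ?thesis unfolding prod.distrib prod_dividef prod_constant e by (rule g)
    qed
    also have "\<dots> \<le> L" unfolding L_def using C(1) C(2)[OF nn]
      by (intro mult_left_mono prod_mono conjI mult_nonneg_nonneg divide_nonneg_nonneg) (auto intro: less_imp_le)
    finally show "(exp (- real (card K)) * (\<Prod>i\<in>UNIV. C i)) / (real n + 1) ^ CARD('n) * exp (real n * - (\<Sum>i\<in>UNIV. r $ i * ln \<bar>x $ i\<bar>)) \<le> dual_integral b K (\<lambda>_. 1) y s"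
      using L by simp
  qed
qed

lemma near_even_below:
  assumes "N > 0" "\<delta> > 0"
  shows "\<exists>n0. \<forall>n\<ge>n0. near r N \<delta> (\<chi> i. int (even_below (real n * r $ i)))"
proof -
  obtain n0 where n0: "real n0 \<ge> max N (2 / \<delta>)" using real_arch_simple by blast
  have "near r N \<delta> (\<chi> i. int (even_below (real n * r $ i)))" if "n \<ge> n0" for n
    unfolding near_def
  proof (intro exI[of _ "real n"] conjI allI)
    show "N \<le> real n" using n0 that by linarith
    fix i
    have "2 / \<delta> \<le> real n" using n0 that by linarith
    then have "2 \<le> \<delta> * real n" using assms(2) by (simp add: field_simps)
    then show "\<bar>real_of_int ((\<chi> i. int (even_below (real n * r $ i))) $ i) - real n * r $ i\<bar> \<le> \<delta> * real n"
      using even_below_bounds[of "real n * r $ i"] r_pos[of i] by simp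
  qed
  then show ?thesis by blast
qed

text \<open>The weights cancel the signs in \<open>fibre_eq_dual_integral\<close>, so every term becomes equal to its real integral.\<close>

definition signed_fibres ::
    "(nat \<Rightarrow> real ^ 'n) \<Rightarrow> nat set \<Rightarrow> 'b set \<Rightarrow> ('b \<Rightarrow> real ^ 'n) \<Rightarrow> (nat \<Rightarrow> nat) \<Rightarrow> int ^ 'n \<Rightarrow> complex" where
  "signed_fibres b K X y q s = (\<Sum>B\<in>X. of_real ((\<Prod>i\<in>UNIV. sgn (y B $ i)) * (\<Prod>j\<in>K. sgn (ell (b j) (y B)))) * fibre b K q (y B) s)"

text \<open>For even exponents all terms are nonnegative, so no cancellation can occur and the term in the chamber of
  \<open>dual_integral_lower_bound\<close> bounds the sum from below. Its loss against the rate of \<open>x\<close> is only polynomial.\<close>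

lemma signed_fibres_simple_lower_bound:
  fixes x :: "real ^ 'n"
  assumes K: "finite K" and X: "finite X" and yn: "\<And>B i. B \<in> X \<Longrightarrow> y B $ i \<noteq> 0" and yl: "\<And>B j. B \<in> X \<Longrightarrow> j \<in> K \<Longrightarrow> ell (b j) (y B) \<noteq> 0"
    and x: "\<And>i. x $ i \<noteq> 0" and flat: "\<And>j. j \<in> K \<Longrightarrow> ell (b j) x = 0"
    and c: "\<And>j. j \<in> K \<Longrightarrow> c j > 0" and crit: "\<And>i. r $ i / x $ i = dual_sum b K c $ i"
    and B0: "B0 \<in> X" "\<And>i. sgn (y B0 $ i) = sgn (x $ i)" "\<And>j. j \<in> K \<Longrightarrow> ell (b j) (y B0) > 0"
  shows "\<not> decays r (- (\<Sum>i\<in>UNIV. r $ i * ln \<bar>x $ i\<bar>)) (signed_fibres b K X y (\<lambda>_. 1))"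
proof
  let ?H = "- (\<Sum>i\<in>UNIV. r $ i * ln \<bar>x $ i\<bar>)"
  let ?F = "signed_fibres b K X y (\<lambda>_. 1)"
  assume "decays r ?H ?F"
  then obtain N \<delta> h' where d: "N > 0" "\<delta> > 0" "h' < ?H" "\<And>s. near r N \<delta> s \<Longrightarrow> cmod (?F s) \<le> exp (h' * isum s)"
    by (auto simp: decays_def)
  obtain C n1 where C: "C > 0" "\<And>n s. n \<ge> n1 \<Longrightarrow> (\<forall>i. s $ i = int (even_below (real n * r $ i))) \<Longrightarrow>
    C / (real n + 1) ^ CARD('n) * exp (real n * ?H) \<le> dual_integral b K (\<lambda>_. 1) (y B0) s"
    using dual_integral_lower_bound[where b=b and c=c, OF K x flat c crit B0(2,3)] by blast
  obtain n2 where n2: "\<And>n. n \<ge> n2 \<Longrightarrow> near r N \<delta> (\<chi> i. int (even_below (real n * r $ i)))"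
    using near_even_below[OF d(1,2)] by blast
  obtain N3 \<delta>3 where N3: "N3 > 0" "\<delta>3 > 0" "\<And>N \<delta> s. N3 \<le> N \<Longrightarrow> \<delta> \<le> \<delta>3 \<Longrightarrow> near r N \<delta> s \<Longrightarrow> (\<forall>i. s $ i \<ge> 1) \<and> isum s \<ge> N / 2"
    by (rule near_large[of 1]) blast
  obtain n3 where n3: "\<And>n. n \<ge> n3 \<Longrightarrow> near r N3 \<delta>3 (\<chi> i. int (even_below (real n * r $ i)))"
    using near_even_below[OF N3(1,2)] by blast
  have key: "C / (real n + 1) ^ CARD('n) * exp (real n * ?H) \<le> exp (h' * real n + \<bar>h'\<bar> * (2 * real CARD('n)))"
    if n: "n \<ge> max n1 (max n2 n3)" for n
  proof -
    define s :: "int ^ 'n" where "s = (\<chi> i. int (even_below (real n * r $ i)))"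
    have s: "\<forall>i. s $ i = int (even_below (real n * r $ i))" by (simp add: s_def)
    have s1: "s $ i \<ge> 1" for i using N3(3)[OF _ _ n3[of n]] n by (simp add: s_def)
    have ks: "even (nat (s $ i))" for i
    proof -
      have "nat (s $ i) = even_below (real n * r $ i)" by (simp add: s)
      then show ?thesis by (simp only: even_below_def dvd_triv_left)
    qed
    have nonneg: "dual_density b K (\<lambda>_. 1) s t \<ge> 0" for t
      unfolding dual_density_def
      by (intro mult_nonneg_nonneg prod_nonneg ballI divide_nonneg_nonneg zero_le_even_power ks) simp_all
    have di: "dual_integral b K (\<lambda>_. 1) z s \<ge> 0" for z
      unfolding dual_integral_def using nonneg by (intro integral_nonneg_AE AE_I2) simp
    have "?F s = (\<Sum>B\<in>X. of_real (dual_integral b K (\<lambda>_. 1) (y B) s))"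
      unfolding signed_fibres_def
    proof (intro sum.cong refl)
      fix B assume B: "B \<in> X"
      let ?w = "(\<Prod>i\<in>UNIV. sgn (y B $ i)) * (\<Prod>j\<in>K. sgn (ell (b j) (y B)))"
      have "(\<Prod>i\<in>UNIV. sgn (y B $ i)) * (\<Prod>i\<in>UNIV. sgn (y B $ i)) = 1"
        unfolding prod.distrib[symmetric] using yn[OF B] by (intro prod.neutral) (simp add: sgn_if)
      moreover have "(\<Prod>j\<in>K. sgn (ell (b j) (y B))) * (\<Prod>j\<in>K. sgn (ell (b j) (y B))) = 1"
        unfolding prod.distrib[symmetric] using yl[OF B] by (intro prod.neutral) (simp add: sgn_if)
      moreover have "(a * c) * (a * c) = (a * a) * (c * c)" for a c :: real by simp
      ultimately have "?w * ?w = 1" by (simp only: mult_1_left)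
      moreover have "fibre b K (\<lambda>_. 1) (y B) s = of_real (?w * dual_integral b K (\<lambda>_. 1) (y B) s)"
        by (rule fibre_eq_dual_integral(2)) (use K yl[OF B] yn[OF B] s1 in auto)
      ultimately show "of_real ?w * fibre b K (\<lambda>_. 1) (y B) s = complex_of_real (dual_integral b K (\<lambda>_. 1) (y B) s)"
        by (simp only: of_real_mult[symmetric] mult.assoc[symmetric] mult_1_left)
    qed
    then have "cmod (?F s) = \<bar>\<Sum>B\<in>X. dual_integral b K (\<lambda>_. 1) (y B) s\<bar>"
      by (simp only: of_real_sum[symmetric] norm_of_real)
    then have "dual_integral b K (\<lambda>_. 1) (y B0) s \<le> cmod (?F s)"
      using member_le_sum[of B0 X "\<lambda>B. dual_integral b K (\<lambda>_. 1) (y B) s"] B0(1) X di by auto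
    then have "C / (real n + 1) ^ CARD('n) * exp (real n * ?H) \<le> cmod (?F s)" using C(2)[OF _ s] n by force
    also have "\<dots> \<le> exp (h' * isum s)" using d(4) n2[of n] n by (simp add: s_def)
    also have "h' * isum s \<le> h' * real n + \<bar>h'\<bar> * (2 * real CARD('n))"
    proof -
      have "\<bar>isum s - real n\<bar> \<le> 2 * real CARD('n)"
      proof -
        have "isum s - real n = (\<Sum>i\<in>UNIV. real (even_below (real n * r $ i)) - real n * r $ i)"
          by (simp add: isum_def s sum_subtractf r_sum flip: sum_distrib_left)
        also have "\<bar>\<dots>\<bar> \<le> (\<Sum>i\<in>(UNIV :: 'n set). 2)"
        proof (intro order_trans[OF sum_abs] sum_mono)
          fix i
          show "\<bar>real (even_below (real n * r $ i)) - real n * r $ i\<bar> \<le> 2"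
            using even_below_bounds[of "real n * r $ i"] r_pos[of i] by simp
        qed
        finally show ?thesis by simp
      qed
      then have "\<bar>h' * (isum s - real n)\<bar> \<le> \<bar>h'\<bar> * (2 * real CARD('n))"
        unfolding abs_mult by (intro mult_left_mono) auto
      then show ?thesis by (simp add: algebra_simps abs_le_iff)
    qed
    finally show ?thesis by simp
  qed
  define \<epsilon> where "\<epsilon> = ?H - h'"
  have \<epsilon>: "\<epsilon> > 0" using d(3) by (simp add: \<epsilon>_def)
  have key2: "C * exp (- \<bar>h'\<bar> * (2 * real CARD('n))) \<le> (real n + 1) ^ CARD('n) / exp (\<epsilon> * real n)" if n: "n \<ge> max n1 (max n2 n3)" for n
  proof -
    have n0: "(real n + 1) ^ CARD('n) > 0" by (rule zero_less_power) simp
    have e: "exp (real n * ?H) = exp (\<epsilon> * real n) * exp (h' * real n)" by (simp add: \<epsilon>_def algebra_simps flip: exp_add)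
    have "C * (exp (\<epsilon> * real n) * exp (h' * real n)) \<le> exp (h' * real n) * exp (\<bar>h'\<bar> * (2 * real CARD('n))) * (real n + 1) ^ CARD('n)"
      using key[OF n] n0 unfolding e exp_add by (simp add: field_simps)
    then have "exp (h' * real n) * (C * exp (\<epsilon> * real n)) \<le> exp (h' * real n) * (exp (\<bar>h'\<bar> * (2 * real CARD('n))) * (real n + 1) ^ CARD('n))"
      by (simp only: mult_ac)
    then have "C * exp (\<epsilon> * real n) \<le> exp (\<bar>h'\<bar> * (2 * real CARD('n))) * (real n + 1) ^ CARD('n)" by simp
    then show ?thesis by (simp add: exp_minus field_simps)
  qed
  have "filterlim (\<lambda>x::real. x + 1) at_top at_top"
    using filterlim_tendsto_add_at_top[OF tendsto_const[of "1::real"] filterlim_ident] by (simp add: add.commute)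
  then have "filterlim (\<lambda>x. \<epsilon> * (x + 1)) at_top at_top"
    by (rule filterlim_tendsto_pos_mult_at_top[OF tendsto_const \<epsilon>])
  then have "((\<lambda>x. exp \<epsilon> * inverse (\<epsilon> ^ CARD('n)) * ((\<epsilon> * (x + 1)) ^ CARD('n) / exp (\<epsilon> * (x + 1)))) \<longlongrightarrow> 0) at_top"
    by (intro tendsto_mult_right_zero filterlim_compose[OF tendsto_power_div_exp_0])
  moreover have "exp \<epsilon> * inverse (\<epsilon> ^ CARD('n)) * ((\<epsilon> * (x + 1)) ^ CARD('n) / exp (\<epsilon> * (x + 1))) = (x + 1) ^ CARD('n) / exp (\<epsilon> * x)" for x
  proof -
    have "exp (\<epsilon> * (x + 1)) = exp (\<epsilon> * x) * exp \<epsilon>" by (simp add: distrib_left exp_add)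
    moreover have "E * inverse Q * (Q * Z / (Y * E)) = Z / Y" if "E \<noteq> 0" "Q \<noteq> 0" for E Q Z Y :: real
      using that by simp
    ultimately show ?thesis using \<epsilon> by (simp only: power_mult_distrib) simp
  qed
  ultimately have "((\<lambda>x. (x + 1) ^ CARD('n) / exp (\<epsilon> * x)) \<longlongrightarrow> 0) at_top" by simp
  then have "(\<lambda>n. (real n + 1) ^ CARD('n) / exp (\<epsilon> * real n)) \<longlonglongrightarrow> 0"
    by (rule filterlim_compose[OF _ filterlim_real_sequentially])
  then have "C * exp (- \<bar>h'\<bar> * (2 * real CARD('n))) \<le> 0"
    using key2 by (intro LIMSEQ_le_const) blast+
  then show False using C(1) by (simp add: mult_le_0_iff)
qed

text \<open>Differentiation raises and multiplication by a form lowers one exponent, hence signed sums of fibres satisfy the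
  relations that are required for the reduction to simple poles.\<close>

lemma signed_fibres_lower_bound:
  fixes x :: "real ^ 'n"
  assumes K: "finite K" "inj_on b K" "independent (b ` K)" and p: "\<And>k. k \<in> K \<Longrightarrow> p k \<ge> 1"
    and X: "finite X" and yn: "\<And>B i. B \<in> X \<Longrightarrow> y B $ i \<noteq> 0" and yl: "\<And>B j. B \<in> X \<Longrightarrow> j \<in> K \<Longrightarrow> ell (b j) (y B) \<noteq> 0"
    and x: "\<And>i. x $ i \<noteq> 0" and flat: "\<And>j. j \<in> K \<Longrightarrow> ell (b j) x = 0"
    and c: "\<And>j. j \<in> K \<Longrightarrow> c j > 0" and crit: "\<And>i. r $ i / x $ i = dual_sum b K c $ i"
    and B0: "B0 \<in> X" "\<And>i. sgn (y B0 $ i) = sgn (x $ i)" "\<And>j. j \<in> K \<Longrightarrow> ell (b j) (y B0) > 0"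
    and G: "G \<notin> power_ideal b p K"
  shows "\<not> decays r (- (\<Sum>i\<in>UNIV. r $ i * ln \<bar>x $ i\<bar>)) (poly_act G (signed_fibres b K X y p))"
proof
  let ?H = "- (\<Sum>i\<in>UNIV. r $ i * ln \<bar>x $ i\<bar>)"
  let ?w = "\<lambda>B. complex_of_real ((\<Prod>i\<in>UNIV. sgn (y B $ i)) * (\<Prod>j\<in>K. sgn (ell (b j) (y B))))"
  let ?F = "signed_fibres b K X y"
  assume dec: "decays r ?H (poly_act G (?F p))"
  have F: "?F q = (\<lambda>s. \<Sum>B\<in>X. ?w B * fibre b K q (y B) s)" for q
    by (rule ext) (simp add: signed_fibres_def)
  have act: "ev_eq (poly_act P (?F q)) (?F q')" if "\<And>B. B \<in> X \<Longrightarrow> ev_eq (poly_act P (fibre b K q (y B))) (fibre b K q' (y B))" for P q q'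
    unfolding F poly_act_sum_right[abs_def] poly_act_linear by (intro ev_eq_sum ev_eq_cmult that)
  have dif: "ev_eq (diffop w (?F p)) (\<lambda>s. \<Sum>j\<in>K. of_real (b j \<bullet> w * real (p j)) * ?F (p(j := p j + 1)) s)" for w
  proof -
    have "ev_eq (diffop w (?F p)) (\<lambda>s. \<Sum>B\<in>X. ?w B * (\<Sum>j\<in>K. of_real (b j \<bullet> w * real (p j)) * fibre b K (p(j := p j + 1)) (y B) s))"
      unfolding F diffop_sum_right[abs_def] diffop_linear
      by (intro ev_eq_sum ev_eq_cmult diffop_fibre K p yl yn)
    also have "(\<lambda>s. \<Sum>B\<in>X. ?w B * (\<Sum>j\<in>K. of_real (b j \<bullet> w * real (p j)) * fibre b K (p(j := p j + 1)) (y B) s)) =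
      (\<lambda>s. \<Sum>j\<in>K. of_real (b j \<bullet> w * real (p j)) * ?F (p(j := p j + 1)) s)"
      unfolding F sum_distrib_left by (rule ext, subst sum.swap) (simp add: mult_ac)
    finally show ?thesis .
  qed
  have "decays r ?H (poly_act (\<Prod>k\<in>K. ell_poly (b k) ^ (p k - 1)) (?F p))"
  proof (rule decays_simple_poles[OF K p _ _ G dec])
    fix k w assume k: "k \<in> K" and w: "\<And>j. j \<in> K \<Longrightarrow> b j \<bullet> w = (if j = k then 1 else 0)"
    have "(\<Sum>j\<in>K. of_real (b j \<bullet> w * real (p j)) * ?F (p(j := p j + 1)) s) = of_nat (p k) * ?F (p(k := p k + 1)) s" for s
    proof -
      have "(\<Sum>j\<in>K. of_real (b j \<bullet> w * real (p j)) * ?F (p(j := p j + 1)) s) = (\<Sum>j\<in>K. if j = k then of_nat (p k) * ?F (p(k := p k + 1)) s else 0)"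
        by (intro sum.cong refl) (simp add: w)
      then show ?thesis using K k by simp
    qed
    then have fe: "(\<lambda>s. \<Sum>j\<in>K. of_real (b j \<bullet> w * real (p j)) * ?F (p(j := p j + 1)) s) = (\<lambda>s. of_nat (p k) * ?F (p(k := p k + 1)) s)"
      by (rule ext)
    have "ev_eq (poly_act (ell_poly (b k)) (diffop w (?F p))) (poly_act (ell_poly (b k)) (\<lambda>s. of_nat (p k) * ?F (p(k := p k + 1)) s))"
      using ev_eq_poly_act[OF dif[of w], of "ell_poly (b k)"] unfolding fe .
    also have "poly_act (ell_poly (b k)) (\<lambda>s. of_nat (p k) * ?F (p(k := p k + 1)) s) = (\<lambda>s. of_nat (p k) * poly_act (ell_poly (b k)) (?F (p(k := p k + 1))) s)"
      by (rule ext) (simp add: poly_act_linear)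
    also have "ev_eq \<dots> (\<lambda>s. of_nat (p k) * ?F p s)"
    proof (intro ev_eq_cmult act)
      fix B assume B: "B \<in> X"
      have "ev_eq (poly_act (ell_poly (b k)) (fibre b K (p(k := p k + 1)) (y B))) (fibre b K ((p(k := p k + 1))(k := (p(k := p k + 1)) k - 1)) (y B))"
        by (rule ell_act_fibre) (use K yl[OF B] yn[OF B] k in auto)
      then show "ev_eq (poly_act (ell_poly (b k)) (fibre b K (p(k := p k + 1)) (y B))) (fibre b K p (y B))" by simp
    qed
    finally show "ev_eq (poly_act (ell_poly (b k)) (diffop w (?F p))) (\<lambda>s. of_nat (p k) * ?F p s)" .
  next
    fix w assume "\<And>k. k \<in> K \<Longrightarrow> b k \<bullet> w = 0"
    then show "ev_eq (diffop w (?F p)) (\<lambda>s. 0)" using dif[of w] by simp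
  qed
  moreover have "ev_eq (poly_act (\<Prod>k\<in>K. ell_poly (b k) ^ (p k - 1)) (?F p)) (?F (\<lambda>_. 1))"
  proof (rule act)
    fix B assume B: "B \<in> X"
    have "ev_eq (poly_act (\<Prod>k\<in>K. ell_poly (b k) ^ (p k - 1)) (fibre b K p (y B))) (fibre b K (\<lambda>j. if j \<in> K then p j - (p j - 1) else p j) (y B))"
      by (rule ell_prod_act_fibre) (use K yl[OF B] yn[OF B] in auto)
    also have "fibre b K (\<lambda>j. if j \<in> K then p j - (p j - 1) else p j) (y B) = fibre b K (\<lambda>_. 1) (y B)"
      by (rule fibre_cong) (use p in force)
    finally show "ev_eq (poly_act (\<Prod>k\<in>K. ell_poly (b k) ^ (p k - 1)) (fibre b K p (y B))) (fibre b K (\<lambda>_. 1) (y B))" .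
  qed
  ultimately have "decays r ?H (?F (\<lambda>_. 1))" by (rule decays_ev_eq)
  then show False
    using signed_fibres_simple_lower_bound[where b=b and c=c and y=y, OF K(1) X yn yl x flat c crit B0] by blast
qed

end

section \<open>The power series coefficients as real integrals\<close>

lemma vec_lambda_bij: "bij_betw (vec_lambda :: ('n \<Rightarrow> 'a) \<Rightarrow> 'a ^ 'n::finite) UNIV UNIV"
  by (rule bij_betw_byWitness[where f'=vec_nth]) auto

lemma exp_has_sum:
  fixes a :: "'a::{banach, real_normed_field}"
  shows "((\<lambda>k. a ^ k / fact k) has_sum exp a) UNIV" and "(\<lambda>k. norm (a ^ k / fact k)) summable_on UNIV"
proof -
  have e: "a ^ k /\<^sub>R fact k = a ^ k / fact k" for k by (simp add: divide_inverse scaleR_conv_of_real mult.commute)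
  have n: "summable (\<lambda>k. norm (a ^ k / fact k))" using summable_norm_exp[of a] by (simp add: e)
  show "((\<lambda>k. a ^ k / fact k) has_sum exp a) UNIV"
    by (rule norm_summable_imp_has_sum[OF n]) (use exp_converges[of a] in \<open>simp add: e\<close>)
  show "(\<lambda>k. norm (a ^ k / fact k)) summable_on UNIV"
    by (rule summable_nonneg_imp_summable_on[OF n]) simp
qed

lemma exp_multi_has_sum:
  fixes a :: "'n::finite \<Rightarrow> 'a::{banach, real_normed_field}"
  shows "((\<lambda>s::nat ^ 'n. \<Prod>i\<in>UNIV. a i ^ (s $ i) / fact (s $ i)) has_sum (\<Prod>i\<in>UNIV. exp (a i))) UNIV"
proof -
  let ?f = "\<lambda>i k. a i ^ k / fact k"
  have abs: "(\<lambda>g. norm (\<Prod>i\<in>UNIV. ?f i (g i))) summable_on (UNIV :: ('n \<Rightarrow> nat) set)"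
  proof (rule nonneg_bdd_above_summable_on)
    show "bdd_above (sum (\<lambda>g. norm (\<Prod>i\<in>UNIV. ?f i (g i))) ` {F. F \<subseteq> UNIV \<and> finite F})"
    proof (rule bdd_aboveI2)
      fix F :: "('n \<Rightarrow> nat) set" assume F: "F \<in> {F. F \<subseteq> UNIV \<and> finite F}"
      define M where "M = (\<lambda>i. (\<lambda>g. g i) ` F)"
      have M: "finite (M i)" for i using F by (simp add: M_def)
      have "(\<Sum>g\<in>F. norm (\<Prod>i\<in>UNIV. ?f i (g i))) \<le> (\<Sum>g\<in>PiE UNIV M. norm (\<Prod>i\<in>UNIV. ?f i (g i)))"
        using M by (intro sum_mono2) (auto simp: M_def intro!: finite_PiE)
      also have "\<dots> = (\<Prod>i\<in>UNIV. \<Sum>k\<in>M i. norm (?f i k))"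
        using M by (simp add: prod_sum_PiE prod_norm)
      also have "\<dots> \<le> (\<Prod>i\<in>UNIV. infsum (\<lambda>k. norm (?f i k)) UNIV)"
        using M by (intro prod_mono conjI sum_nonneg finite_sum_le_infsum exp_has_sum(2)) auto
      finally show "(\<Sum>g\<in>F. norm (\<Prod>i\<in>UNIV. ?f i (g i))) \<le> (\<Prod>i\<in>UNIV. infsum (\<lambda>k. norm (?f i k)) UNIV)" .
    qed
  qed simp
  have "infsum (\<lambda>g. \<Prod>i\<in>UNIV. ?f i (g i)) (PiE UNIV (\<lambda>_. UNIV)) = (\<Prod>i\<in>UNIV. infsum (?f i) UNIV)"
    by (rule infsum_prod_PiE_abs) (simp_all add: exp_has_sum(2))
  also have "\<dots> = (\<Prod>i\<in>UNIV. exp (a i))" by (simp only: infsumI[OF exp_has_sum(1)])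
  finally have "infsum (\<lambda>g. \<Prod>i\<in>UNIV. ?f i (g i)) UNIV = (\<Prod>i\<in>UNIV. exp (a i))" by (simp add: PiE_UNIV_domain)
  moreover have "(\<lambda>g. \<Prod>i\<in>UNIV. ?f i (g i)) summable_on UNIV"
    using abs by (rule abs_summable_summable)
  ultimately have "((\<lambda>g. \<Prod>i\<in>UNIV. ?f i (g i)) has_sum (\<Prod>i\<in>UNIV. exp (a i))) UNIV"
    by (simp add: has_sum_iff)
  then show ?thesis
    using has_sum_reindex_bij_betw[OF vec_lambda_bij, of "\<lambda>s. \<Prod>i\<in>UNIV. ?f i (s $ i)"] by simp
qed

text \<open>Dominated convergence along an enumeration of the index type.\<close>

lemma has_sum_integral:
  fixes f :: "'a::countable \<Rightarrow> 'b \<Rightarrow> complex"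
  assumes int: "\<And>s. integrable M (f s)"
    and norms: "\<And>t. t \<in> space M \<Longrightarrow> ((\<lambda>s. norm (f s t)) has_sum g t) UNIV" and g: "integrable M g"
    and sums: "\<And>t. t \<in> space M \<Longrightarrow> ((\<lambda>s. f s t) has_sum F t) UNIV"
  shows "((\<lambda>s. integral\<^sup>L M (f s)) has_sum integral\<^sup>L M F) UNIV"
proof -
  define h where "h = (\<lambda>n t. if n \<in> range (to_nat :: 'a \<Rightarrow> nat) then f (from_nat n) t else 0)"
  have conv: "(\<phi> has_sum l) UNIV \<longleftrightarrow> ((\<lambda>n. if n \<in> range (to_nat :: 'a \<Rightarrow> nat) then \<phi> (from_nat n) else 0) has_sum l) UNIV"
    for \<phi> :: "'a \<Rightarrow> 'c::{topological_comm_monoid_add,t2_space}" and l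
  proof -
    have "(\<phi> has_sum l) UNIV \<longleftrightarrow> ((\<lambda>n. \<phi> (from_nat n)) has_sum l) (range (to_nat :: 'a \<Rightarrow> nat))"
      by (subst has_sum_reindex) (simp_all add: o_def)
    also have "\<dots> \<longleftrightarrow> ((\<lambda>n. if n \<in> range (to_nat :: 'a \<Rightarrow> nat) then \<phi> (from_nat n) else 0) has_sum l) UNIV"
      by (rule has_sum_cong_neutral) auto
    finally show ?thesis .
  qed
  have hn: "(\<lambda>n. norm (h n t)) sums g t" if "t \<in> space M" for t
  proof -
    have "((\<lambda>n. norm (h n t)) has_sum g t) UNIV"
      using norms[OF that] unfolding conv[of "\<lambda>s. norm (f s t)"] h_def by (simp add: if_distrib cong: if_cong)
    then show ?thesis by (rule has_sum_imp_sums)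
  qed
  have hs: "(\<lambda>n. h n t) sums F t" if "t \<in> space M" for t
    using sums[OF that] unfolding conv[of "\<lambda>s. f s t"] h_def by (rule has_sum_imp_sums)
  have hi: "integrable M (h n)" for n by (cases "n \<in> range (to_nat :: 'a \<Rightarrow> nat)") (simp_all add: h_def int)
  have sn: "summable (\<lambda>n. \<integral>t. norm (h n t) \<partial>M)"
  proof (rule bounded_imp_summable)
    show "0 \<le> (\<integral>t. norm (h n t) \<partial>M)" for n by simp
    fix n
    have "(\<Sum>k\<le>n. \<integral>t. norm (h k t) \<partial>M) = (\<integral>t. (\<Sum>k\<le>n. norm (h k t)) \<partial>M)"
      using hi by (subst Bochner_Integration.integral_sum) auto
    also have "\<dots> \<le> integral\<^sup>L M g"
    proof (rule integral_mono[OF _ g])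
      show "integrable M (\<lambda>t. \<Sum>k\<le>n. norm (h k t))" using hi by auto
      fix t assume "t \<in> space M"
      from hn[OF this] show "(\<Sum>k\<le>n. norm (h k t)) \<le> g t"
        by (intro sum_le_suminf[where f="\<lambda>k. norm (h k t)", THEN order_trans]) (auto simp: sums_iff)
    qed
    finally show "(\<Sum>k\<le>n. \<integral>t. norm (h k t) \<partial>M) \<le> integral\<^sup>L M g" .
  qed
  have "(\<lambda>n. integral\<^sup>L M (h n)) sums (\<integral>t. suminf (\<lambda>n. h n t) \<partial>M)"
    using hn by (intro sums_integral hi sn AE_I2) (auto simp: sums_iff)
  also have "(\<integral>t. suminf (\<lambda>n. h n t) \<partial>M) = integral\<^sup>L M F"
    using hs by (intro Bochner_Integration.integral_cong refl) (auto simp: sums_iff)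
  finally have s: "(\<lambda>n. integral\<^sup>L M (h n)) sums integral\<^sup>L M F" .
  have "summable (\<lambda>n. norm (integral\<^sup>L M (h n)))"
    by (rule summable_comparison_test'[OF sn, of 0]) simp
  from norm_summable_imp_has_sum[OF this s]
  have "((\<lambda>n. integral\<^sup>L M (h n)) has_sum integral\<^sup>L M F) UNIV" .
  moreover have "integral\<^sup>L M (h n) = (if n \<in> range (to_nat :: 'a \<Rightarrow> nat) then integral\<^sup>L M (f (from_nat n)) else 0)" for n
    by (simp add: h_def)
  ultimately show ?thesis by (simp only: conv)
qed

text \<open>The coefficient at \<open>s\<close> that results from expanding $e^{u \cdot z}$ in the Gamma integrals of the linear forms near
  the origin, where all forms have positive real part.\<close>

definition gamma_coeff :: "(nat \<Rightarrow> real ^ 'n) \<Rightarrow> nat set \<Rightarrow> (nat \<Rightarrow> nat) \<Rightarrow> nat ^ 'n::finite \<Rightarrow> real" where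
  "gamma_coeff b S q s =
     (\<integral>t. (if \<forall>j\<in>S. t j > 0 then 1 else 0) * dual_density b S q (ivec s) t \<partial>(\<Pi>\<^sub>M j\<in>S. lborel))"

text \<open>On a small polydisc $|u\cdot z|$ is at most half the sum of the $t_j$, which leaves an integrable majorant
  for the expanded integrand.\<close>

lemma gamma_coeff_has_sum:
  fixes b :: "nat \<Rightarrow> real ^ 'n::finite"
  assumes S: "finite S" and q: "\<And>j. j \<in> S \<Longrightarrow> q j \<ge> 1"
  obtains \<epsilon> where "\<epsilon> > 0" "\<And>j. j \<in> S \<Longrightarrow> (\<Sum>i\<in>UNIV. \<bar>b j $ i\<bar>) * \<epsilon> \<le> 1/2"
    "\<And>z. (\<forall>i. cmod (z $ i) < \<epsilon>) \<Longrightarrow>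
      ((\<lambda>s. of_real (gamma_coeff b S q s) * (\<Prod>i\<in>UNIV. z $ i ^ (s $ i))) has_sum (\<Prod>j\<in>S. inverse (ell (b j) z) ^ q j)) UNIV"
proof -
  let ?N = "\<Pi>\<^sub>M j\<in>S. (lborel :: real measure)"
  define \<beta> where "\<beta> = (\<lambda>j. \<Sum>i\<in>UNIV. \<bar>b j $ i\<bar>)"
  have \<beta>0: "\<beta> j \<ge> 0" for j by (simp add: \<beta>_def sum_nonneg)
  define \<epsilon> where "\<epsilon> = 1 / (2 * (1 + (\<Sum>j\<in>S. \<beta> j)))"
  have pos: "1 + (\<Sum>j\<in>S. \<beta> j) > 0" using \<beta>0 by (simp add: sum_nonneg add_pos_nonneg)
  have \<epsilon>: "\<epsilon> > 0" using pos by (simp add: \<epsilon>_def)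
  have \<beta>\<epsilon>: "\<beta> j * \<epsilon> \<le> 1/2" if "j \<in> S" for j
  proof -
    have "\<beta> j \<le> (\<Sum>j\<in>S. \<beta> j)" by (rule member_le_sum) (use that S \<beta>0 in auto)
    then have "\<beta> j * \<epsilon> \<le> (1 + (\<Sum>j\<in>S. \<beta> j)) * \<epsilon>" using \<epsilon> by (intro mult_right_mono) auto
    also have "\<dots> = 1/2" using pos by (simp add: \<epsilon>_def)
    finally show ?thesis .
  qed
  let ?G = "\<lambda>j t. indicator {0<..} t * (t ^ (q j - 1) / fact (q j - 1)) :: real"
  let ?P = "\<lambda>t. \<Prod>j\<in>S. ?G j (t j) * exp (- t j)"
  have P0: "?P t \<ge> 0" for t by (intro prod_nonneg ballI) (auto simp: indicator_def)
  have comp: "(\<lambda>t. t j) \<in> borel_measurable ?N" if "j \<in> S" for j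
    using measurable_component_singleton[OF that, of "\<lambda>_. lborel :: real measure"] by simp
  have P_meas: "?P \<in> borel_measurable ?N"
  proof (intro borel_measurable_prod)
    fix j assume "j \<in> S"
    have "(\<lambda>t. ?G j t * exp (- t)) \<in> borel_measurable borel" by measurable
    from measurable_compose[OF comp[OF \<open>j \<in> S\<close>] this] show "(\<lambda>t. ?G j (t j) * exp (- t j)) \<in> borel_measurable ?N" .
  qed
  have u_meas: "(\<lambda>t. dual_sum b S t $ i) \<in> borel_measurable ?N" for i
    unfolding dual_sum_def by (simp add: comp borel_measurable_sum borel_measurable_times)
  have Pz: "(\<Prod>j\<in>S. ?G j (t j) * e j) = 0" if neg: "\<not> (\<forall>j\<in>S. t j > 0)" for t e :: "nat \<Rightarrow> real"
  proof -
    obtain j where "j \<in> S" "\<not> t j > 0" using neg by blast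
    then show ?thesis by (intro prod_zero[OF S] bexI[of _ j]) simp_all
  qed
  have ind: "(if \<forall>j\<in>S. t j > 0 then 1 else 0) * (\<Prod>j\<in>S. t j ^ (q j - 1) / fact (q j - 1) * exp (- t j)) = ?P t" for t :: "nat \<Rightarrow> real"
  proof (cases "\<forall>j\<in>S. t j > 0")
    case True
    then show ?thesis by (simp cong: prod.cong)
  next
    case False
    have "?P t = 0" by (rule Pz[OF False])
    then show ?thesis using False by (simp only: if_False mult_zero_left)
  qed
  show ?thesis
  proof (rule that[OF \<epsilon>])
    show "(\<Sum>i\<in>UNIV. \<bar>b j $ i\<bar>) * \<epsilon> \<le> 1/2" if "j \<in> S" for j using \<beta>\<epsilon>[OF that] by (simp add: \<beta>_def)
    fix z :: "complex ^ 'n" assume z: "\<forall>i. cmod (z $ i) < \<epsilon>"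
    let ?f = "\<lambda>s t. of_real (?P t) * (\<Prod>i\<in>UNIV. (of_real (dual_sum b S t $ i) * z $ i) ^ (s $ i) / fact (s $ i))"
    let ?g = "\<lambda>t. ?P t * (\<Prod>i\<in>UNIV. exp (\<bar>dual_sum b S t $ i\<bar> * cmod (z $ i)))"
    let ?F = "\<lambda>t. of_real (?P t) * (\<Prod>i\<in>UNIV. exp (of_real (dual_sum b S t $ i) * z $ i))"
    have norms: "((\<lambda>s. norm (?f s t)) has_sum ?g t) UNIV" for t
    proof -
      have "norm (?f s t) = ?P t * (\<Prod>i\<in>UNIV. (\<bar>dual_sum b S t $ i\<bar> * cmod (z $ i)) ^ (s $ i) / fact (s $ i))" for s
      proof -
        have "norm (complex_of_real P * (\<Prod>i\<in>UNIV. (of_real (u i) * z $ i) ^ (s $ i) / fact (s $ i)))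
          = P * (\<Prod>i\<in>UNIV. (\<bar>u i\<bar> * cmod (z $ i)) ^ (s $ i) / fact (s $ i))" if "P \<ge> 0" for P and u :: "'n \<Rightarrow> real"
          using that by (simp add: norm_mult norm_divide norm_power prod_norm[symmetric])
        then show ?thesis using P0[of t] by (simp only:)
      qed
      then show ?thesis by (simp only:) (intro has_sum_cmult_right exp_multi_has_sum)
    qed
    have sums: "((\<lambda>s. ?f s t) has_sum ?F t) UNIV" for t
      by (intro has_sum_cmult_right exp_multi_has_sum)
    \<comment> \<open>half of the decay of \<open>exp (- t j)\<close> pays for the exponential series\<close>
    have uz: "(\<Sum>i\<in>UNIV. \<bar>dual_sum b S t $ i\<bar> * cmod (z $ i)) \<le> (\<Sum>j\<in>S. t j / 2)" if t: "\<forall>j\<in>S. t j > 0" for t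
    proof -
      have "(\<Sum>i\<in>UNIV. \<bar>dual_sum b S t $ i\<bar> * cmod (z $ i)) \<le> (\<Sum>i\<in>UNIV. (\<Sum>j\<in>S. t j * \<bar>b j $ i\<bar>) * \<epsilon>)"
      proof (intro sum_mono mult_mono)
        fix i
        have "\<bar>dual_sum b S t $ i\<bar> \<le> (\<Sum>j\<in>S. \<bar>t j * b j $ i\<bar>)" unfolding dual_sum_def by (simp add: sum_abs)
        also have "\<dots> = (\<Sum>j\<in>S. t j * \<bar>b j $ i\<bar>)" using t by (intro sum.cong) (auto simp: abs_mult)
        finally show "\<bar>dual_sum b S t $ i\<bar> \<le> (\<Sum>j\<in>S. t j * \<bar>b j $ i\<bar>)" .
        show "0 \<le> (\<Sum>j\<in>S. t j * \<bar>b j $ i\<bar>)" using t by (intro sum_nonneg mult_nonneg_nonneg) (auto intro: less_imp_le)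
      qed (use z in \<open>auto intro: less_imp_le\<close>)
      also have "\<dots> = (\<Sum>j\<in>S. t j * (\<beta> j * \<epsilon>))"
        unfolding \<beta>_def sum_distrib_right by (subst sum.swap) (simp add: sum_distrib_left mult_ac)
      also have "\<dots> \<le> (\<Sum>j\<in>S. t j / 2)"
      proof (intro sum_mono)
        fix j assume "j \<in> S"
        then have "t j * (\<beta> j * \<epsilon>) \<le> t j * (1/2)" using t \<beta>\<epsilon> by (intro mult_left_mono) (auto intro: less_imp_le)
        then show "t j * (\<beta> j * \<epsilon>) \<le> t j / 2" by simp
      qed
      finally show ?thesis .
    qed
    have gP: "?g t \<le> (\<Prod>j\<in>S. ?G j (t j) * exp (- (1/2) * t j))" for t
    proof (cases "\<forall>j\<in>S. t j > 0")
      case True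
      have "?g t = (\<Prod>j\<in>S. ?G j (t j)) * (exp (\<Sum>j\<in>S. - t j) * exp (\<Sum>i\<in>UNIV. \<bar>dual_sum b S t $ i\<bar> * cmod (z $ i)))"
        by (simp only: prod.distrib exp_sum[OF S] exp_sum[OF finite] mult.assoc)
      also have "\<dots> \<le> (\<Prod>j\<in>S. ?G j (t j)) * exp (\<Sum>j\<in>S. - (1/2) * t j)"
      proof (intro mult_left_mono prod_nonneg ballI)
        have "(\<Sum>j\<in>S. - t j) + (\<Sum>j\<in>S. t j / 2) = (\<Sum>j\<in>S. - (1/2) * t j)"
          by (simp flip: sum.distrib)
        then show "exp (\<Sum>j\<in>S. - t j) * exp (\<Sum>i\<in>UNIV. \<bar>dual_sum b S t $ i\<bar> * cmod (z $ i)) \<le> exp (\<Sum>j\<in>S. - (1/2) * t j)"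
          using uz[OF True] by (simp flip: exp_add)
      qed (auto simp: indicator_def)
      also have "\<dots> = (\<Prod>j\<in>S. ?G j (t j) * exp (- (1/2) * t j))" by (simp only: prod.distrib exp_sum[OF S])
      finally show ?thesis .
    next
      case False
      show ?thesis unfolding Pz[OF False] by simp
    qed
    have dom: "integrable ?N (\<lambda>t. \<Prod>j\<in>S. ?G j (t j) * exp (- (1/2) * t j))"
    proof (rule lborel_PiM.product_integrable_prod[OF S])
      fix j
      show "integrable lborel (\<lambda>t. ?G j t * exp (- (1/2) * t))"
        using gamma_integral_pos_real[of "1/2" "q j - 1"] by (simp add: mult.assoc)
    qed
    have g: "integrable ?N ?g"
    proof (rule Bochner_Integration.integrable_bound[OF dom])
      show "?g \<in> borel_measurable ?N"
        by (intro borel_measurable_times P_meas borel_measurable_prod measurable_compose[OF _ borel_measurable_exp] borel_measurable_abs u_meas borel_measurable_const)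
      have "norm (?g t) \<le> norm (\<Prod>j\<in>S. ?G j (t j) * exp (- (1/2) * t j))" for t
      proof -
        have "?g t \<ge> 0" by (intro mult_nonneg_nonneg P0 prod_nonneg) auto
        then have "norm (?g t) = ?g t" by simp
        also have "\<dots> \<le> \<bar>\<Prod>j\<in>S. ?G j (t j) * exp (- (1/2) * t j)\<bar>" using gP[of t] by linarith
        finally show ?thesis by simp
      qed
      then show "AE t in ?N. norm (?g t) \<le> norm (\<Prod>j\<in>S. ?G j (t j) * exp (- (1/2) * t j))" by simp
    qed
    have f: "integrable ?N (?f s)" for s
    proof (rule Bochner_Integration.integrable_bound[OF g])
      show "?f s \<in> borel_measurable ?N"
        by (intro borel_measurable_times borel_measurable_prod borel_measurable_divide borel_measurable_power borel_measurable_const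
             measurable_compose[OF P_meas borel_measurable_of_real] measurable_compose[OF u_meas borel_measurable_of_real])
      have nb: "norm (?f s t) \<le> ?g t" for t
        using finite_sum_le_has_sum[OF norms[of t], of "{s}"] by simp
      have "norm (?f s t) \<le> norm (?g t)" for t
        by (rule order_trans[OF nb[of t]]) (simp only: real_norm_def abs_ge_self)
      then show "AE t in ?N. norm (?f s t) \<le> norm (?g t)" by (rule AE_I2)
    qed
    have "((\<lambda>s. integral\<^sup>L ?N (?f s)) has_sum integral\<^sup>L ?N ?F) UNIV"
      by (rule has_sum_integral[OF f norms g sums])
    moreover have "integral\<^sup>L ?N (?f s) = of_real (gamma_coeff b S q s) * (\<Prod>i\<in>UNIV. z $ i ^ (s $ i))" for s
    proof -
      have "?f s t = of_real ((if \<forall>j\<in>S. t j > 0 then 1 else 0) * dual_density b S q (ivec s) t) * (\<Prod>i\<in>UNIV. z $ i ^ (s $ i))" for t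
      proof -
        have "?f s t = of_real (?P t) * (of_real (\<Prod>i\<in>UNIV. dual_sum b S t $ i ^ (s $ i) / fact (s $ i)) * (\<Prod>i\<in>UNIV. z $ i ^ (s $ i)))"
        proof -
          have "complex_of_real P * (\<Prod>i\<in>UNIV. (of_real (u i) * z $ i) ^ (s $ i) / fact (s $ i))
            = of_real P * (of_real (\<Prod>i\<in>UNIV. u i ^ (s $ i) / fact (s $ i)) * (\<Prod>i\<in>UNIV. z $ i ^ (s $ i)))" for P and u :: "'n \<Rightarrow> real"
            by (simp add: power_mult_distrib flip: prod.distrib)
          then show ?thesis by (simp only:)
        qed
        moreover have "?P t * (\<Prod>i\<in>UNIV. dual_sum b S t $ i ^ (s $ i) / fact (s $ i))
            = (if \<forall>j\<in>S. t j > 0 then 1 else 0) * dual_density b S q (ivec s) t"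
          unfolding dual_density_def ind[symmetric] by (simp add: mult.assoc)
        ultimately show ?thesis by (simp only: of_real_mult[symmetric] mult.assoc[symmetric])
      qed
      then show ?thesis by (simp only: integral_mult_left_zero integral_complex_of_real gamma_coeff_def)
    qed
    moreover have "integral\<^sup>L ?N ?F = (\<Prod>j\<in>S. inverse (ell (b j) z) ^ q j)"
    proof -
      have Re: "Re (ell (b j) z) > 0" if "j \<in> S" for j
      proof -
        have "cmod (\<Sum>i\<in>UNIV. of_real (b j $ i) * z $ i) \<le> (\<Sum>i\<in>UNIV. \<bar>b j $ i\<bar> * \<epsilon>)"
          using z by (intro sum_norm_le) (simp add: norm_mult mult_left_mono less_imp_le)
        also have "\<dots> \<le> 1/2" using \<beta>\<epsilon>[OF that] by (simp add: \<beta>_def sum_distrib_right)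
        finally have "Re (\<Sum>i\<in>UNIV. of_real (b j $ i) * z $ i) \<le> 1/2" using complex_Re_le_cmod order_trans by blast
        then show ?thesis by (simp add: ell_def)
      qed
      have "?F t = (\<Prod>j\<in>S. indicator {0<..} (t j) *\<^sub>R ((of_real (t j)) ^ (q j - 1) / fact (q j - 1) * exp (- ell (b j) z * of_real (t j))))" for t
      proof -
        have "?F t = of_real (\<Prod>j\<in>S. ?G j (t j)) * ((\<Prod>j\<in>S. exp (- of_real (t j))) * (\<Prod>i\<in>UNIV. exp (of_real (dual_sum b S t $ i) * z $ i)))"
          by (simp only: prod.distrib of_real_mult of_real_prod exp_of_real[symmetric] of_real_minus mult.assoc)
        also have "\<dots> = of_real (\<Prod>j\<in>S. ?G j (t j)) * (\<Prod>j\<in>S. exp (- (ell (b j) z) * of_real (t j)))"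
          by (simp only: exp_dual[OF S])
        also have "\<dots> = (\<Prod>j\<in>S. indicator {0<..} (t j) *\<^sub>R ((of_real (t j)) ^ (q j - 1) / fact (q j - 1) * exp (- ell (b j) z * of_real (t j))))"
          unfolding of_real_prod prod.distrib[symmetric]
          by (intro prod.cong refl) (simp add: scaleR_conv_of_real indicator_def)
        finally show ?thesis .
      qed
      then have "integral\<^sup>L ?N ?F = (\<integral>t. (\<Prod>j\<in>S. indicator {0<..} (t j) *\<^sub>R ((of_real (t j)) ^ (q j - 1) / fact (q j - 1) * exp (- ell (b j) z * of_real (t j)))) \<partial>?N)"
        by (simp only:)
      also have "\<dots> = (\<Prod>j\<in>S. \<integral>t. indicator {0<..} t *\<^sub>R ((of_real t) ^ (q j - 1) / fact (q j - 1) * exp (- ell (b j) z * of_real t)) \<partial>lborel)"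
        by (rule lborel_PiM.product_integral_prod[OF S gamma_integral_pos(1)[OF Re]])
      also have "\<dots> = (\<Prod>j\<in>S. inverse (ell (b j) z) ^ q j)"
      proof (intro prod.cong refl)
        fix j assume j: "j \<in> S"
        show "(\<integral>t. indicator {0<..} t *\<^sub>R ((of_real t) ^ (q j - 1) / fact (q j - 1) * exp (- ell (b j) z * of_real t)) \<partial>lborel) = inverse (ell (b j) z) ^ q j"
          using gamma_integral_pos(2)[OF Re[OF j], of "q j - 1"] q[OF j] by simp
      qed
      finally show ?thesis .
    qed
    ultimately show "((\<lambda>s. of_real (gamma_coeff b S q s) * (\<Prod>i\<in>UNIV. z $ i ^ (s $ i))) has_sum (\<Prod>j\<in>S. inverse (ell (b j) z) ^ q j)) UNIV"
      by simp
  qed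
qed

text \<open>Uniqueness of the coefficients, one variable at a time.\<close>

lemma powser_zero_unique:
  fixes c :: "nat \<Rightarrow> complex"
  assumes "\<epsilon> > 0" and s: "\<And>w. cmod w < \<epsilon> \<Longrightarrow> (\<lambda>n. c n * w ^ n) sums 0"
  shows "c n = 0"
proof -
  have "Abs_fps c = 0"
  proof (rule eval_fps_eqD)
    have "norm (of_real (\<epsilon>/2) :: complex) \<le> conv_radius c"
      by (rule conv_radius_geI) (use s[of "of_real (\<epsilon>/2)"] assms(1) in \<open>auto simp: sums_iff\<close>)
    then have "ereal (\<epsilon>/2) \<le> conv_radius c" using assms(1) by simp
    then show "fps_conv_radius (Abs_fps c) > 0"
      using assms(1) by (auto simp: fps_conv_radius_def intro: less_le_trans[of 0 "ereal (\<epsilon>/2)"])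
    show "eventually (\<lambda>z. eval_fps (Abs_fps c) z = eval_fps 0 z) (nhds 0)"
      unfolding eventually_nhds_metric using assms
      by (intro exI[of _ \<epsilon>]) (auto simp: eval_fps_def sums_iff)
  qed auto
  then show ?thesis by (metis fps_nth_Abs_fps fps_zero_nth)
qed

lemma multi_powser_zero_unique:
  fixes d :: "nat ^ 'n::finite \<Rightarrow> complex"
  assumes \<epsilon>: "\<epsilon> > 0" and s: "\<And>z. (\<forall>i. cmod (z $ i) < \<epsilon>) \<Longrightarrow> ((\<lambda>s. d s * (\<Prod>i\<in>UNIV. z $ i ^ (s $ i))) has_sum 0) UNIV"
  shows "d s0 = 0"
proof -
  have "((\<lambda>s. d s * (\<Prod>i\<in>UNIV - I. z $ i ^ (s $ i))) has_sum 0) {s. \<forall>i\<in>I. s $ i = s0 $ i}"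
    if "finite I" "\<forall>i. cmod (z $ i) < \<epsilon>" for I z
    using that
  proof (induction I arbitrary: z rule: finite_induct)
    case empty
    then show ?case using s by simp
  next
    case (insert k I)
    let ?A = "{s. \<forall>i\<in>I. s $ i = s0 $ i}"
    let ?An = "\<lambda>n. {s \<in> ?A. s $ k = n}"
    let ?f = "\<lambda>s. d s * (\<Prod>i\<in>UNIV - insert k I. z $ i ^ (s $ i))"
    have w: "((\<lambda>s. ?f s * w ^ (s $ k)) has_sum 0) ?A" if "cmod w < \<epsilon>" for w
    proof -
      define z' where "z' = (\<chi> i. if i = k then w else z $ i)"
      have "d s * (\<Prod>i\<in>UNIV - I. z' $ i ^ (s $ i)) = ?f s * w ^ (s $ k)" for s
      proof -
        have "UNIV - I = insert k (UNIV - insert k I)" using insert.hyps by auto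
        then have "(\<Prod>i\<in>UNIV - I. z' $ i ^ (s $ i)) = z' $ k ^ (s $ k) * (\<Prod>i\<in>UNIV - insert k I. z' $ i ^ (s $ i))" by simp
        also have "(\<Prod>i\<in>UNIV - insert k I. z' $ i ^ (s $ i)) = (\<Prod>i\<in>UNIV - insert k I. z $ i ^ (s $ i))"
          by (intro prod.cong) (auto simp: z'_def)
        finally show ?thesis by (simp add: z'_def)
      qed
      moreover have "\<forall>i. cmod (z' $ i) < \<epsilon>" using insert.prems that by (simp add: z'_def)
      ultimately show ?thesis using insert.IH[of z'] by presburger
    qed
    define w0 :: complex where "w0 = of_real (\<epsilon>/2)"
    have w0: "cmod w0 < \<epsilon>" "w0 \<noteq> 0" using \<epsilon> by (auto simp: w0_def)
    have sumn: "?f summable_on ?An n" for n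
    proof -
      have "(\<lambda>s. ?f s * w0 ^ (s $ k)) summable_on ?An n"
        by (rule summable_on_subset_banach[OF has_sum_imp_summable[OF w[OF w0(1)]]]) auto
      then have "(\<lambda>s. ?f s * w0 ^ n) summable_on ?An n" by (rule summable_on_cong[THEN iffD1, rotated]) auto
      then have "(\<lambda>s. ?f s * w0 ^ n * inverse (w0 ^ n)) summable_on ?An n" by (rule summable_on_cmult_left)
      then show ?thesis using w0(2) by (simp add: mult.assoc)
    qed
    let ?c = "\<lambda>n. infsum ?f (?An n)"
    have "(\<lambda>n. ?c n * w ^ n) sums 0" if "cmod w < \<epsilon>" for w
    proof -
      have "((\<lambda>(n, s). ?f s * w ^ n) has_sum 0) (Sigma UNIV ?An)"
        using w[OF that]
        by (subst has_sum_reindex_bij_witness[where i="\<lambda>s. (s $ k, s)" and j=snd and T="?A" and h="\<lambda>s. ?f s * w ^ (s $ k)" and s'=0]) auto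
      then have "((\<lambda>n. ?c n * w ^ n) has_sum 0) UNIV"
        by (rule has_sum_SigmaD) (simp only: prod.case, intro has_sum_cmult_left has_sum_infsum sumn)
      then show ?thesis by (rule has_sum_imp_sums)
    qed
    then have "?c (s0 $ k) = 0" by (rule powser_zero_unique[OF \<epsilon>])
    then have "(?f has_sum 0) (?An (s0 $ k))" using has_sum_infsum[OF sumn[of "s0 $ k"]] by simp
    moreover have "?An (s0 $ k) = {s. \<forall>i\<in>insert k I. s $ i = s0 $ i}" by auto
    ultimately show ?case by simp
  qed
  from this[of UNIV 0] have "((\<lambda>s. d s) has_sum 0) {s. \<forall>i. s $ i = s0 $ i}" using \<epsilon> by simp
  moreover have "{s. \<forall>i. s $ i = s0 $ i} = {s0}" by (auto simp: vec_eq_iff)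
  ultimately have "((\<lambda>s. d s) has_sum 0) {s0}" by simp
  moreover have "((\<lambda>s. d s) has_sum d s0) {s0}" by (rule has_sum_finiteI) auto
  ultimately show ?thesis using has_sum_unique by blast
qed

text \<open>The extension by zero makes the shift action agree with the multiplication of power series at all exponents,
  including those from which the shifts lead to negative exponents.\<close>

definition zext :: "(nat ^ 'n \<Rightarrow> complex) \<Rightarrow> int ^ 'n::finite \<Rightarrow> complex" where
  "zext c s = (if \<forall>i. s $ i \<ge> 0 then c (\<chi> i. nat (s $ i)) else 0)"

lemma zext_ivec [simp]: "zext c (ivec s) = c s"
  by (simp add: zext_def ivec_def vec_eq_iff)

lemma has_sum_finite_sum:
  fixes f :: "'a \<Rightarrow> 'b \<Rightarrow> complex"
  shows "(\<And>k. k \<in> A \<Longrightarrow> (f k has_sum g k) B) \<Longrightarrow> ((\<lambda>s. \<Sum>k\<in>A. f k s) has_sum (\<Sum>k\<in>A. g k)) B"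
  by (induction A rule: infinite_finite_induct) (simp_all add: has_sum_add)

lemma poly_act_has_sum:
  fixes z :: "complex ^ 'n::finite"
  assumes "((\<lambda>s. c s * (\<Prod>i\<in>UNIV. z $ i ^ (s $ i))) has_sum A) UNIV"
  shows "((\<lambda>s. poly_act P (zext c) (ivec s) * (\<Prod>i\<in>UNIV. z $ i ^ (s $ i))) has_sum (poly_eval P z * A)) UNIV"
proof -
  have shift: "((\<lambda>s. zext c (ivec s - pmvec \<mu>) * (\<Prod>i\<in>UNIV. z $ i ^ (s $ i))) has_sum ((\<Prod>i\<in>UNIV. z $ i ^ Poly_Mapping.lookup \<mu> i) * A)) UNIV" for \<mu>
  proof -
    let ?h = "\<lambda>s :: nat ^ 'n. s + (\<chi> i. Poly_Mapping.lookup \<mu> i)"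
    let ?g = "\<lambda>s. zext c (ivec s - pmvec \<mu>) * (\<Prod>i\<in>UNIV. z $ i ^ (s $ i))"
    have "?g (?h s) = (\<Prod>i\<in>UNIV. z $ i ^ Poly_Mapping.lookup \<mu> i) * (c s * (\<Prod>i\<in>UNIV. z $ i ^ (s $ i)))" for s
    proof -
      have "ivec (?h s) - pmvec \<mu> = ivec s" by (simp add: vec_eq_iff pmvec_def)
      then show ?thesis by (simp add: power_add prod.distrib)
    qed
    then have "(?g \<circ> ?h has_sum ((\<Prod>i\<in>UNIV. z $ i ^ Poly_Mapping.lookup \<mu> i) * A)) UNIV"
      using has_sum_cmult_right[OF assms, of "\<Prod>i\<in>UNIV. z $ i ^ Poly_Mapping.lookup \<mu> i"] by (simp add: o_def)
    then have "(?g has_sum ((\<Prod>i\<in>UNIV. z $ i ^ Poly_Mapping.lookup \<mu> i) * A)) (range ?h)"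
      by (subst has_sum_reindex) auto
    moreover have "?g s = 0" if "s \<notin> range ?h" for s
    proof -
      have "\<exists>i. s $ i < Poly_Mapping.lookup \<mu> i"
      proof (rule ccontr)
        assume "\<not> ?thesis"
        then have "s = ?h (\<chi> i. s $ i - Poly_Mapping.lookup \<mu> i)" by (auto simp: vec_eq_iff not_less)
        then show False using that by blast
      qed
      then obtain i where "s $ i < Poly_Mapping.lookup \<mu> i" ..
      then have "\<not> (ivec s - pmvec \<mu>) $ i \<ge> 0" by (simp add: pmvec_def)
      then show ?thesis by (auto simp: zext_def)
    qed
    ultimately show ?thesis by (subst has_sum_cong_neutral[where S=UNIV and T="range ?h" and g="?g"]) auto
  qed
  have "((\<lambda>s. \<Sum>\<mu>\<in>Poly_Mapping.keys P. Poly_Mapping.lookup P \<mu> * (zext c (ivec s - pmvec \<mu>) * (\<Prod>i\<in>UNIV. z $ i ^ (s $ i)))) has_sum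
     (\<Sum>\<mu>\<in>Poly_Mapping.keys P. Poly_Mapping.lookup P \<mu> * ((\<Prod>i\<in>UNIV. z $ i ^ Poly_Mapping.lookup \<mu> i) * A))) UNIV"
    by (intro has_sum_finite_sum has_sum_cmult_right shift)
  then show ?thesis by (simp add: poly_act_def poly_eval_def sum_distrib_right mult.assoc)
qed

definition orthant_point :: "real \<Rightarrow> 'n set \<Rightarrow> real ^ 'n::finite" where
  "orthant_point \<delta> E = (\<chi> i. if i \<in> E then \<delta> else - \<delta>)"

text \<open>Near the origin all forms are positive, and the positive orthant of the Gamma variables splits
  according to the signs of the coordinates of \<open>u\<close>. This is the classical expansion of the Cauchy torus in
  imaginary fibres, with one fibre in every orthant.\<close>

theorem coefficients_signed_fibres:
  fixes b :: "nat \<Rightarrow> real ^ 'n::finite"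
  assumes a: "has_power_series_at_0 (ratfun m b p G) a" and p: "\<And>j. j \<in> {1..m} \<Longrightarrow> p j \<ge> 1"
  obtains \<delta> where "\<delta> > 0" "\<And>j E. j \<in> {1..m} \<Longrightarrow> ell (b j) (orthant_point \<delta> E) > 0"
    "ev_eq (zext a) (poly_act G (\<lambda>s. \<Sum>E\<in>Pow UNIV. of_real (\<Prod>i\<in>UNIV. sgn (orthant_point \<delta> E $ i)) * fibre b {1..m} p (orthant_point \<delta> E) s))"
proof -
  let ?S = "{1..m}"
  let ?N = "\<Pi>\<^sub>M j\<in>?S. (lborel :: real measure)"
  obtain \<epsilon> where \<epsilon>: "\<epsilon> > 0" "\<And>j. j \<in> ?S \<Longrightarrow> (\<Sum>i\<in>UNIV. \<bar>b j $ i\<bar>) * \<epsilon> \<le> 1/2"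
    "\<And>z. (\<forall>i. cmod (z $ i) < \<epsilon>) \<Longrightarrow>
      ((\<lambda>s. of_real (gamma_coeff b ?S p s) * (\<Prod>i\<in>UNIV. z $ i ^ (s $ i))) has_sum (\<Prod>j\<in>?S. inverse (ell (b j) z) ^ p j)) UNIV"
    using gamma_coeff_has_sum[of "{1..m}" p b, OF finite_atLeastAtMost p] by blast
  let ?\<alpha> = "\<lambda>s. complex_of_real (gamma_coeff b ?S p s)"
  obtain \<epsilon>' where \<epsilon>': "\<epsilon>' > 0" "\<And>z. (\<forall>i. cmod (z $ i) < \<epsilon>') \<Longrightarrow> ((\<lambda>s. a s * (\<Prod>i\<in>UNIV. z $ i ^ (s $ i))) has_sum ratfun m b p G z) UNIV"
    using a unfolding has_power_series_at_0_def by blast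
  have "a s - poly_act G (zext ?\<alpha>) (ivec s) = 0" for s
  proof (rule multi_powser_zero_unique[where \<epsilon>="min \<epsilon> \<epsilon>'" and d="\<lambda>s. a s - poly_act G (zext ?\<alpha>) (ivec s)"])
    show "min \<epsilon> \<epsilon>' > 0" using \<epsilon>(1) \<epsilon>'(1) by simp
    fix z :: "complex ^ 'n" assume z: "\<forall>i. cmod (z $ i) < min \<epsilon> \<epsilon>'"
    have "((\<lambda>s. a s * (\<Prod>i\<in>UNIV. z $ i ^ (s $ i))) has_sum ratfun m b p G z) UNIV" using \<epsilon>'(2) z by simp
    moreover have "((\<lambda>s. poly_act G (zext ?\<alpha>) (ivec s) * (\<Prod>i\<in>UNIV. z $ i ^ (s $ i))) has_sum ratfun m b p G z) UNIV"
    proof -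
      have "(\<Prod>j\<in>?S. inverse (ell (b j) z) ^ p j) = inverse (\<Prod>j\<in>?S. ell (b j) z ^ p j)"
        unfolding prod_inversef[symmetric] o_def power_inverse ..
      then have "ratfun m b p G z = poly_eval G z * (\<Prod>j\<in>?S. inverse (ell (b j) z) ^ p j)"
        by (simp only: ratfun_def divide_inverse)
      then show ?thesis using poly_act_has_sum[OF \<epsilon>(3)[of z], of G] z by simp
    qed
    ultimately have "((\<lambda>s. a s * (\<Prod>i\<in>UNIV. z $ i ^ (s $ i)) + - (poly_act G (zext ?\<alpha>) (ivec s) * (\<Prod>i\<in>UNIV. z $ i ^ (s $ i)))) has_sum (ratfun m b p G z + - ratfun m b p G z)) UNIV"
      by (intro has_sum_add has_sum_uminusI)
    then show "((\<lambda>s. (a s - poly_act G (zext ?\<alpha>) (ivec s)) * (\<Prod>i\<in>UNIV. z $ i ^ (s $ i))) has_sum 0) UNIV"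
      by (simp add: left_diff_distrib)
  qed
  then have aG: "a s = poly_act G (zext ?\<alpha>) (ivec s)" for s by simp
  define \<delta> where "\<delta> = \<epsilon>"
  have op: "orthant_point \<delta> E $ i \<noteq> 0" for E and i :: 'n using \<epsilon>(1) by (simp add: orthant_point_def \<delta>_def)
  have lpos: "ell (b j) (orthant_point \<delta> E) > 0" if "j \<in> ?S" for j E
  proof -
    have "b j \<bullet> orthant_point \<delta> E \<le> (\<Sum>i\<in>UNIV. \<bar>b j $ i\<bar> * \<epsilon>)"
      unfolding inner_vec_def
    proof (rule sum_mono)
      fix i
      have "b j $ i * orthant_point \<delta> E $ i \<le> \<bar>b j $ i * orthant_point \<delta> E $ i\<bar>" by simp
      also have "\<dots> = \<bar>b j $ i\<bar> * \<epsilon>" using \<epsilon>(1) by (simp add: abs_mult orthant_point_def \<delta>_def)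
      finally show "b j $ i \<bullet> orthant_point \<delta> E $ i \<le> \<bar>b j $ i\<bar> * \<epsilon>" by simp
    qed
    moreover have "(\<Sum>i\<in>UNIV. \<bar>b j $ i\<bar> * \<epsilon>) = (\<Sum>i\<in>UNIV. \<bar>b j $ i\<bar>) * \<epsilon>" by (simp only: sum_distrib_right)
    ultimately have "b j \<bullet> orthant_point \<delta> E < 1" using \<epsilon>(2)[OF that] by linarith
    then show ?thesis by (simp add: ell_eq_inner)
  qed
  have ev: "ev_eq (zext ?\<alpha>) (\<lambda>s. \<Sum>E\<in>Pow UNIV. of_real (\<Prod>i\<in>UNIV. sgn (orthant_point \<delta> E $ i)) * fibre b ?S p (orthant_point \<delta> E) s)"
  proof (rule ev_eqI[of 1])
    fix s :: "int ^ 'n" assume s: "\<forall>i. s $ i \<ge> 1"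
    define s' where "s' = (\<chi> i. nat (s $ i))"
    have s': "ivec s' = s" using s by (auto simp: vec_eq_iff s'_def) (metis dual_order.trans nat_0_le zero_le_one)
    have F: "integrable ?N (\<lambda>t. indicator (dual_region b ?S (orthant_point \<delta> E)) t * dual_density b ?S p s t)"
      "fibre b ?S p (orthant_point \<delta> E) s = of_real ((\<Prod>i\<in>UNIV. sgn (orthant_point \<delta> E $ i)) * (\<Prod>j\<in>?S. sgn (ell (b j) (orthant_point \<delta> E))) * dual_integral b ?S p (orthant_point \<delta> E) s)" for E
      by (rule fibre_eq_dual_integral; use p op lpos s in \<open>force simp: less_imp_neq[THEN not_sym]\<close>)+
    have "(if \<forall>j\<in>?S. t j > 0 then 1 else 0) * dual_density b ?S p s t = (\<Sum>E\<in>Pow UNIV. indicator (dual_region b ?S (orthant_point \<delta> E)) t * dual_density b ?S p s t)" for t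
    proof (cases "\<exists>i. dual_sum b ?S t $ i = 0")
      case True
      then obtain i where i: "dual_sum b ?S t $ i = 0" ..
      have "nat (s $ i) > 0" using s[rule_format, of i] by simp
      \<comment> \<open>exponents are positive, so the hyperplanes \<open>u i = 0\<close>, which belong to none of the orthants, carry no mass\<close>
      then have "dual_density b ?S p s t = 0" unfolding dual_density_def using i by (auto intro!: prod_zero bexI[of _ i])
      then show ?thesis by simp
    next
      case False
      define E0 where "E0 = {i. dual_sum b ?S t $ i > 0}"
      have reg: "t \<in> dual_region b ?S (orthant_point \<delta> E) \<longleftrightarrow> (\<forall>j\<in>?S. t j > 0) \<and> E = E0" for E
      proof -
        have "(\<forall>i. dual_sum b ?S t $ i * orthant_point \<delta> E $ i > 0) \<longleftrightarrow> E = E0"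
        proof -
          have "dual_sum b ?S t $ i * orthant_point \<delta> E $ i > 0 \<longleftrightarrow> (i \<in> E \<longleftrightarrow> i \<in> E0)" for i
          proof -
            have "u * (if i \<in> E then \<delta> else - \<delta>) > 0 \<longleftrightarrow> (i \<in> E \<longleftrightarrow> u > 0)" if "u \<noteq> 0" for u :: real
              using that \<epsilon>(1) by (cases "u > 0") (auto simp: zero_less_mult_iff mult_less_0_iff \<delta>_def)
            then show ?thesis using False by (simp add: orthant_point_def E0_def)
          qed
          then show ?thesis by (simp add: set_eq_iff)
        qed
        moreover have "(\<forall>j\<in>?S. ell (b j) (orthant_point \<delta> E) * t j > 0) \<longleftrightarrow> (\<forall>j\<in>?S. t j > 0)"
          using mult_less_cancel_left_pos[OF lpos, of _ E 0] by (intro ball_cong refl) simp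
        ultimately show ?thesis by (simp add: dual_region_def)
      qed
      have "(\<Sum>E\<in>Pow UNIV. indicator (dual_region b ?S (orthant_point \<delta> E)) t * dual_density b ?S p s t) =
        (\<Sum>E\<in>Pow UNIV. if E = E0 then (if \<forall>j\<in>?S. t j > 0 then 1 else 0) * dual_density b ?S p s t else 0)"
        by (intro sum.cong refl) (simp add: indicator_def reg del: One_nat_def)
      also have "\<dots> = (if \<forall>j\<in>?S. t j > 0 then 1 else 0) * dual_density b ?S p s t"
        by (subst sum.delta) simp_all
      finally show ?thesis by (rule sym)
    qed
    then have "gamma_coeff b ?S p s' = (\<integral>t. (\<Sum>E\<in>Pow UNIV. indicator (dual_region b ?S (orthant_point \<delta> E)) t * dual_density b ?S p s t) \<partial>?N)"
      unfolding gamma_coeff_def s' by (simp only:)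
    also have "\<dots> = (\<Sum>E\<in>Pow UNIV. dual_integral b ?S p (orthant_point \<delta> E) s)"
      unfolding dual_integral_def by (rule Bochner_Integration.integral_sum) (rule F(1))
    finally have g: "gamma_coeff b ?S p s' = (\<Sum>E\<in>Pow UNIV. dual_integral b ?S p (orthant_point \<delta> E) s)" .
    have "zext ?\<alpha> s = ?\<alpha> s'" using zext_ivec[of ?\<alpha> s'] by (simp add: s')
    also have "\<dots> = (\<Sum>E\<in>Pow UNIV. of_real (dual_integral b ?S p (orthant_point \<delta> E) s))" unfolding g of_real_sum ..
    also have "\<dots> = (\<Sum>E\<in>Pow UNIV. of_real (\<Prod>i\<in>UNIV. sgn (orthant_point \<delta> E $ i)) * fibre b ?S p (orthant_point \<delta> E) s)"
    proof (intro sum.cong refl)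
      fix E :: "'n set"
      have "(\<Prod>i\<in>UNIV. sgn (orthant_point \<delta> E $ i)) * (\<Prod>i\<in>UNIV. sgn (orthant_point \<delta> E $ i)) = 1"
        unfolding prod.distrib[symmetric] by (intro prod.neutral ballI) (simp add: op)
      moreover have "(\<Prod>j\<in>?S. sgn (ell (b j) (orthant_point \<delta> E))) = 1"
        using lpos by (intro prod.neutral) auto
      ultimately show "of_real (dual_integral b ?S p (orthant_point \<delta> E) s) = complex_of_real (\<Prod>i\<in>UNIV. sgn (orthant_point \<delta> E $ i)) * fibre b ?S p (orthant_point \<delta> E) s"
        unfolding F(2) by (simp only: of_real_mult[symmetric] mult.assoc[symmetric] mult_1_left mult_1_right)
    qed
    finally show "zext ?\<alpha> s = (\<Sum>E\<in>Pow UNIV. of_real (\<Prod>i\<in>UNIV. sgn (orthant_point \<delta> E $ i)) * fibre b ?S p (orthant_point \<delta> E) s)" .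
  qed
  show ?thesis
  proof (rule that[of \<delta>])
    show "\<delta> > 0" using \<epsilon>(1) by (simp add: \<delta>_def)
    show "ell (b j) (orthant_point \<delta> E) > 0" if "j \<in> ?S" for j E by (rule lpos[OF that])
    have "ev_eq (zext a) (poly_act G (zext ?\<alpha>))"
    proof (rule ev_eqI[of 0])
      fix s :: "int ^ 'n" assume s: "\<forall>i. s $ i \<ge> 0"
      define s' where "s' = (\<chi> i. nat (s $ i))"
      have "ivec s' = s" using s by (auto simp: vec_eq_iff s'_def)
      then show "zext a s = poly_act G (zext ?\<alpha>) s" using aG[of s'] zext_ivec[of a s'] by simp
    qed
    then show "ev_eq (zext a) (poly_act G (\<lambda>s. \<Sum>E\<in>Pow UNIV. of_real (\<Prod>i\<in>UNIV. sgn (orthant_point \<delta> E $ i)) * fibre b {1..m} p (orthant_point \<delta> E) s))"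
      by (rule ev_eq_trans[OF _ ev_eq_poly_act[OF ev]])
  qed
qed

section \<open>Chambers around a real point\<close>

definition rheight :: "real ^ 'n \<Rightarrow> real ^ 'n::finite \<Rightarrow> real" where
  "rheight r x = - (\<Sum>i\<in>UNIV. r $ i * ln \<bar>x $ i\<bar>)"

lemma height_cvec: "height r (cvec x) = rheight r x"
  by (simp add: height_def cvec_def rheight_def)

lemma ell_cvec: "ell v (cvec x) = complex_of_real (ell v x)"
  by (simp add: ell_def cvec_def)

lemma dist_cvec: "dist (cvec x) (cvec y) = dist x y"
  by (simp add: dist_vec_def cvec_def dist_of_real)

lemma ell_add_scaleR: "ell v (x + t *\<^sub>R w) = ell v x - t * (v \<bullet> w)" for x :: "real ^ 'n::finite"
  by (simp add: ell_eq_inner inner_add_right)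

definition off_walls :: "(nat \<Rightarrow> real ^ 'n) \<Rightarrow> nat set \<Rightarrow> real ^ 'n::finite \<Rightarrow> bool" where
  "off_walls b S x \<longleftrightarrow> (\<forall>i. x $ i \<noteq> 0) \<and> (\<forall>j\<in>S. ell (b j) x \<noteq> 0)"

definition same_chamber :: "(nat \<Rightarrow> real ^ 'n) \<Rightarrow> nat set \<Rightarrow> real ^ 'n::finite \<Rightarrow> real ^ 'n \<Rightarrow> bool" where
  "same_chamber b S x x' \<longleftrightarrow> (\<forall>i. sgn (x $ i) = sgn (x' $ i)) \<and> (\<forall>j\<in>S. sgn (ell (b j) x) = sgn (ell (b j) x'))"

lemma real_complement_iff: "x \<in> real_complement m b \<longleftrightarrow> off_walls b {1..m} x"
  by (simp add: real_complement_def off_walls_def)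

lemma fibre_same_chamber:
  assumes "finite S" "\<And>j. j \<in> S \<Longrightarrow> q j \<ge> 1" "off_walls b S x" "same_chamber b S x x'"
  shows "ev_eq (fibre b S q x) (fibre b S q x')"
  using assms by (intro fibre_same_signs) (auto simp: off_walls_def same_chamber_def)

lemma eventually_sgn_eq:
  fixes f :: "'a \<Rightarrow> real"
  assumes "(f \<longlongrightarrow> l) F" "l \<noteq> 0"
  shows "eventually (\<lambda>t. sgn (f t) = sgn l) F"
proof (cases "l > 0")
  case True
  from order_tendstoD(1)[OF assms(1) True] show ?thesis by (rule eventually_mono) (use True in simp)
next
  case False
  then have "l < 0" using assms(2) by simp
  from order_tendstoD(2)[OF assms(1) this] show ?thesis by (rule eventually_mono) (use \<open>l < 0\<close> in simp)
qed

text \<open>Close to a point where the vanishing forms are independent, every choice of signs of these forms occurs: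
  move in a direction on which the forms take the prescribed values.\<close>

lemma star_points:
  fixes x :: "real ^ 'n::finite"
  assumes S: "finite S" and x: "\<And>i. x $ i \<noteq> 0" and A: "A = {j \<in> S. ell (b j) x = 0}"
    and ind: "inj_on b A" "independent (b ` A)" and \<epsilon>: "\<epsilon> > 0"
  obtains y where "\<And>Q. dist (y Q) x < \<epsilon>" "\<And>Q i. sgn (y Q $ i) = sgn (x $ i)"
    "\<And>Q j. j \<in> S - A \<Longrightarrow> sgn (ell (b j) (y Q)) = sgn (ell (b j) x)"
    "\<And>Q j. j \<in> A \<Longrightarrow> sgn (ell (b j) (y Q)) = (if j \<in> Q then 1 else - 1)"
proof -
  have "\<exists>y. dist y x < \<epsilon> \<and> (\<forall>i. sgn (y $ i) = sgn (x $ i)) \<and> (\<forall>j\<in>S - A. sgn (ell (b j) y) = sgn (ell (b j) x))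
     \<and> (\<forall>j\<in>A. sgn (ell (b j) y) = (if j \<in> Q then 1 else - 1))" for Q
  proof -
    obtain w where w: "\<forall>u\<in>b ` A. u \<bullet> w = (if inv_into A b u \<in> Q then - 1 else 1)"
      using dual_vector_exists[OF ind(2), of "\<lambda>u. if inv_into A b u \<in> Q then - 1 else 1"] by blast
    have w': "b j \<bullet> w = (if j \<in> Q then - 1 else 1)" if "j \<in> A" for j
      using w that ind(1) by simp
    let ?y = "\<lambda>t. x + t *\<^sub>R w"
    have lim: "((\<lambda>t. ?y t) \<longlongrightarrow> x) (at_right 0)"
    proof -
      have "((\<lambda>t. ?y t) \<longlongrightarrow> x + 0 *\<^sub>R w) (at_right 0)" by (intro tendsto_intros)
      then show ?thesis by simp
    qed
    have "eventually (\<lambda>t. sgn (?y t $ i) = sgn (x $ i)) (at_right 0)" for i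
      by (rule eventually_sgn_eq[OF tendsto_vec_nth[OF lim] x])
    then have e1: "eventually (\<lambda>t. \<forall>i\<in>UNIV. sgn (?y t $ i) = sgn (x $ i)) (at_right 0)"
      by (intro eventually_ball_finite) auto
    have "eventually (\<lambda>t. sgn (ell (b j) (?y t)) = sgn (ell (b j) x)) (at_right 0)" if "j \<in> S - A" for j
    proof (rule eventually_sgn_eq)
      have "((\<lambda>t. ell (b j) x - t * (b j \<bullet> w)) \<longlongrightarrow> ell (b j) x - 0 * (b j \<bullet> w)) (at_right 0)" by (intro tendsto_intros)
      then show "((\<lambda>t. ell (b j) (?y t)) \<longlongrightarrow> ell (b j) x) (at_right 0)" by (simp add: ell_add_scaleR)
      show "ell (b j) x \<noteq> 0" using that A by simp
    qed
    then have e2: "eventually (\<lambda>t. \<forall>j\<in>S - A. sgn (ell (b j) (?y t)) = sgn (ell (b j) x)) (at_right 0)"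
      using S by (intro eventually_ball_finite) auto
    have e3: "eventually (\<lambda>t. dist (?y t) x < \<epsilon>) (at_right 0)" by (rule tendstoD[OF lim \<epsilon>])
    have e4: "eventually (\<lambda>t::real. t > 0) (at_right 0)" by (rule eventually_at_right_less)
    obtain t where t: "\<forall>i\<in>UNIV. sgn (?y t $ i) = sgn (x $ i)" "\<forall>j\<in>S - A. sgn (ell (b j) (?y t)) = sgn (ell (b j) x)"
      "dist (?y t) x < \<epsilon>" "t > 0"
      using eventually_happens'[OF trivial_limit_at_right_real eventually_conj[OF e1 eventually_conj[OF e2 eventually_conj[OF e3 e4]]]]
      by blast
    have "\<forall>j\<in>A. sgn (ell (b j) (?y t)) = (if j \<in> Q then 1 else - 1)"
      using t(4) A by (auto simp: ell_add_scaleR w')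
    then show ?thesis using t by blast
  qed
  then obtain y where "\<forall>Q. dist (y Q) x < \<epsilon> \<and> (\<forall>i. sgn (y Q $ i) = sgn (x $ i)) \<and> (\<forall>j\<in>S - A. sgn (ell (b j) (y Q)) = sgn (ell (b j) x))
     \<and> (\<forall>j\<in>A. sgn (ell (b j) (y Q)) = (if j \<in> Q then 1 else - 1))" by metis
  then show ?thesis by (intro that[of y]) auto
qed

lemma sum_Pow_insert:
  assumes "finite K" "k \<notin> K"
  shows "(\<Sum>Q\<in>Pow (insert k K). f Q) = (\<Sum>Q\<in>Pow K. f Q + f (insert k Q))"
proof -
  have inj: "inj_on (insert k) (Pow K)" using assms(2) by (auto simp: inj_on_def)
  have "(\<Sum>Q\<in>Pow (insert k K). f Q) = (\<Sum>Q\<in>Pow K. f Q) + (\<Sum>Q\<in>insert k ` Pow K. f Q)"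
    unfolding Pow_insert using assms by (intro sum.union_disjoint) auto
  then show ?thesis by (simp add: sum.reindex[OF inj] sum.distrib)
qed

text \<open>If \<open>G\<close> lies in the ideal then each of its summands removes one of the forms \<open>ell (b k)\<close> from the
  denominator; the fibres on the two sides of that wall then become equal, and they enter with opposite signs.\<close>

lemma star_vanishing:
  fixes y :: "nat set \<Rightarrow> real ^ 'n::finite"
  assumes S: "finite S" "K \<subseteq> S" and p: "\<And>j. j \<in> S \<Longrightarrow> p j \<ge> 1"
    and off: "\<And>Q. Q \<subseteq> K \<Longrightarrow> off_walls b S (y Q)"
    and sc: "\<And>Q i. Q \<subseteq> K \<Longrightarrow> sgn (y Q $ i) = sgn (y {} $ i)"
    and so: "\<And>Q j. Q \<subseteq> K \<Longrightarrow> j \<in> S - K \<Longrightarrow> sgn (ell (b j) (y Q)) = sgn (ell (b j) (y {}))"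
    and sk: "\<And>Q j. Q \<subseteq> K \<Longrightarrow> j \<in> K \<Longrightarrow> sgn (ell (b j) (y Q)) = (if j \<in> Q then 1 else - 1)"
    and G: "G \<in> power_ideal b p K"
  shows "ev_eq (poly_act G (\<lambda>s. \<Sum>Q\<in>Pow K. (- 1) ^ card (K - Q) * fibre b S p (y Q) s)) (\<lambda>_. 0)"
proof -
  let ?F = "\<lambda>s. \<Sum>Q\<in>Pow K. (- 1) ^ card (K - Q) * fibre b S p (y Q) s"
  have finK: "finite K" using S finite_subset by blast
  obtain q where q: "G = (\<Sum>k\<in>K. q k * ell_poly (b k) ^ p k)" using G unfolding power_ideal_def by blast
  have one: "ev_eq (poly_act (ell_poly (b k) ^ p k) ?F) (\<lambda>_. 0)" if k: "k \<in> K" for k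
  proof -
    let ?K = "K - {k}"
    have K: "K = insert k ?K" using k by blast
    let ?g = "\<lambda>Q. fibre b (S - {k}) p (y Q)"
    have act: "ev_eq (poly_act (ell_poly (b k) ^ p k) (fibre b S p (y Q))) (?g Q)" if Q: "Q \<subseteq> K" for Q
    proof -
      have "ev_eq (poly_act (\<Prod>j\<in>{k}. ell_poly (b j) ^ p j) (fibre b S p (y Q))) (fibre b S (\<lambda>j. if j \<in> {k} then p j - p j else p j) (y Q))"
        using off[OF Q] S k by (intro ell_prod_act_fibre) (auto simp: off_walls_def)
      also have "fibre b S (\<lambda>j. if j \<in> {k} then p j - p j else p j) (y Q) = fibre b (S - {k}) (\<lambda>j. if j \<in> {k} then p j - p j else p j) (y Q)"
        using S by (intro fibre_drop) auto
      also have "\<dots> = ?g Q" by (intro fibre_cong) auto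
      finally show ?thesis by simp
    qed
    have swap: "ev_eq (?g (insert k Q)) (?g Q)" if Q: "Q \<subseteq> ?K" for Q
    proof (rule fibre_same_chamber)
      have Q': "Q \<subseteq> K" "insert k Q \<subseteq> K" using Q k by auto
      show "off_walls b (S - {k}) (y (insert k Q))" using off[OF Q'(2)] by (auto simp: off_walls_def)
      have "sgn (ell (b j) (y (insert k Q))) = sgn (ell (b j) (y Q))" if "j \<in> S - {k}" for j
        using that sk[OF Q'(1), of j] sk[OF Q'(2), of j] so[OF Q'(1), of j] so[OF Q'(2), of j] by (cases "j \<in> K") auto
      then show "same_chamber b (S - {k}) (y (insert k Q)) (y Q)"
        using sc[OF Q'(1)] sc[OF Q'(2)] by (auto simp: same_chamber_def)
    qed (use S p in auto)
    have "ev_eq (poly_act (ell_poly (b k) ^ p k) ?F) (\<lambda>s. \<Sum>Q\<in>Pow K. (- 1) ^ card (K - Q) * ?g Q s)"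
      unfolding poly_act_sum_right[abs_def] poly_act_linear by (intro ev_eq_sum ev_eq_cmult act) auto
    also have "(\<lambda>s. \<Sum>Q\<in>Pow K. (- 1) ^ card (K - Q) * ?g Q s) = (\<lambda>s. \<Sum>Q\<in>Pow ?K. (- 1) ^ card (?K - Q) * (?g (insert k Q) s + (- 1) * ?g Q s))"
    proof
      fix s
      have "(\<Sum>Q\<in>Pow (insert k ?K). (- 1) ^ card (K - Q) * ?g Q s) = (\<Sum>Q\<in>Pow ?K. (- 1) ^ card (K - Q) * ?g Q s + (- 1) ^ card (K - insert k Q) * ?g (insert k Q) s)"
        using finK by (intro sum_Pow_insert) auto
      also have "\<dots> = (\<Sum>Q\<in>Pow ?K. (- 1) ^ card (?K - Q) * (?g (insert k Q) s + (- 1) * ?g Q s))"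
      proof (intro sum.cong refl)
        fix Q assume Q: "Q \<in> Pow ?K"
        have "K - Q = insert k (?K - Q)" "K - insert k Q = ?K - Q" using Q k by auto
        moreover have "card (insert k (?K - Q)) = Suc (card (?K - Q))" using finK by (intro card_insert_disjoint) auto
        ultimately show "(- 1) ^ card (K - Q) * ?g Q s + (- 1) ^ card (K - insert k Q) * ?g (insert k Q) s = (- 1) ^ card (?K - Q) * (?g (insert k Q) s + (- 1) * ?g Q s)"
          by (simp add: algebra_simps)
      qed
      finally show "(\<Sum>Q\<in>Pow K. (- 1) ^ card (K - Q) * ?g Q s) = (\<Sum>Q\<in>Pow ?K. (- 1) ^ card (?K - Q) * (?g (insert k Q) s + (- 1) * ?g Q s))"
        using K by (simp only:)
    qed
    also have "ev_eq \<dots> (\<lambda>s. \<Sum>Q\<in>Pow ?K. (- 1) ^ card (?K - Q) * (?g Q s + (- 1) * ?g Q s))"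
      by (intro ev_eq_sum ev_eq_cmult ev_eq_add ev_eq_refl swap) auto
    finally show ?thesis by simp
  qed
  have e: "poly_act G ?F = (\<lambda>s. \<Sum>k\<in>K. poly_act (q k) (poly_act (ell_poly (b k) ^ p k) ?F) s)"
    unfolding q poly_act_sum[abs_def] poly_act_mult ..
  have "ev_eq (\<lambda>s. \<Sum>k\<in>K. poly_act (q k) (poly_act (ell_poly (b k) ^ p k) ?F) s) (\<lambda>s. \<Sum>k\<in>K. poly_act (q k) (\<lambda>_. 0) s)"
    by (intro ev_eq_sum ev_eq_poly_act one)
  then show ?thesis unfolding e poly_act_linear by simp
qed

section \<open>The contribution as a signed sum of fibres\<close>

lemma sgn_prod_real: "sgn (\<Prod>k\<in>A. f k) = (\<Prod>k\<in>A. sgn (f k))" for f :: "'a \<Rightarrow> real"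
  by (induction A rule: infinite_finite_induct) (simp_all add: sgn_mult)

text \<open>This is the intermediate value theorem.\<close>

lemma connected_sgn_eq:
  fixes f :: "'a::topological_space \<Rightarrow> real"
  assumes "connected B" "continuous_on B f" "\<And>x. x \<in> B \<Longrightarrow> f x \<noteq> 0" "u \<in> B" "v \<in> B"
  shows "sgn (f u) = sgn (f v)"
proof (rule ccontr)
  assume ne: "sgn (f u) \<noteq> sgn (f v)"
  have "connected (f ` B)" using assms by (intro connected_continuous_image)
  note ivt = connectedD_interval[OF this]
  have "0 \<in> f ` B"
  proof (cases "f u < 0")
    case True
    have "f v \<ge> 0" using True ne sgn_neg[of "f v"] sgn_neg[of "f u"] by linarith
    show ?thesis by (rule ivt[of "f u" "f v"]) (use True \<open>f v \<ge> 0\<close> assms(4,5) in auto)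
  next
    case False
    then have "f u > 0" using assms(3)[OF assms(4)] by simp
    have "f v \<le> 0" using \<open>f u > 0\<close> ne sgn_pos[of "f v"] sgn_pos[of "f u"] by linarith
    show ?thesis by (rule ivt[of "f v" "f u"]) (use False \<open>f v \<le> 0\<close> assms(4,5) in auto)
  qed
  then show False using assms(3) by auto
qed

lemma continuous_on_ell: "continuous_on B (\<lambda>x::real ^ 'n::finite. ell v x)"
  unfolding ell_eq_inner by (intro continuous_intros)

lemma component_same_chamber:
  assumes B: "B \<in> components (real_complement m b)" and "u \<in> B" "v \<in> B"
  shows "same_chamber b {1..m} u v"
proof -
  have off: "off_walls b {1..m} x" if "x \<in> B" for x
    using in_components_subset[OF B] that real_complement_iff by blast
  have con: "connected B" by (rule in_components_connected[OF B])
  show ?thesis unfolding same_chamber_def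
  proof (intro conjI allI ballI)
    show "sgn (u $ i) = sgn (v $ i)" for i
      by (rule connected_sgn_eq[OF con _ _ assms(2,3), of "\<lambda>x. x $ i"]) (use off in \<open>auto simp: off_walls_def intro!: continuous_intros\<close>)
    show "sgn (ell (b j) u) = sgn (ell (b j) v)" if "j \<in> {1..m}" for j
      by (rule connected_sgn_eq[OF con _ _ assms(2,3), of "ell (b j)"]) (use off that in \<open>auto simp: off_walls_def intro!: continuous_on_ell\<close>)
  qed
qed

lemma convex_combination_nonzero:
  fixes \<alpha> \<beta> :: real
  assumes "sgn \<alpha> = sgn \<beta>" "\<alpha> \<noteq> 0" "0 \<le> t" "t \<le> 1"
  shows "(1 - t) * \<alpha> + t * \<beta> \<noteq> 0"
proof (cases "\<alpha> > 0")
  case True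
  then have "\<beta> > 0" using assms(1) by (metis sgn_greater)
  then have "(1 - t) * \<alpha> + t * \<beta> > 0"
    using True assms(3,4) by (cases "t = 0") (auto intro!: add_nonneg_pos mult_nonneg_nonneg)
  then show ?thesis by simp
next
  case False
  then have a: "\<alpha> < 0" using assms(2) by simp
  then have "\<beta> < 0" using assms(1) by (metis sgn_less)
  show ?thesis
  proof (cases "t = 0")
    case False
    have "t * \<beta> < 0" using False assms(3) \<open>\<beta> < 0\<close> by (intro mult_pos_neg) auto
    moreover have "(1 - t) * \<alpha> \<le> 0" using a assms(4) by (intro mult_nonneg_nonpos) auto
    ultimately show ?thesis by linarith
  qed (use a in simp)
qed

text \<open>A chamber is an intersection of open half spaces, hence convex; so points with the same signs lie in the same
  component of the complement.\<close>

lemma same_chamber_segment: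
  assumes "off_walls b {1..m} u" "same_chamber b {1..m} u v"
  shows "closed_segment u v \<subseteq> real_complement m b"
proof
  fix z assume "z \<in> closed_segment u v"
  then obtain t where t: "0 \<le> t" "t \<le> 1" "z = (1 - t) *\<^sub>R u + t *\<^sub>R v" by (auto simp: in_segment)
  have "z $ i \<noteq> 0" for i
    using convex_combination_nonzero[OF _ _ t(1,2), of "u $ i" "v $ i"] assms by (simp add: off_walls_def same_chamber_def t(3))
  moreover have "ell (b j) z \<noteq> 0" if "j \<in> {1..m}" for j
  proof -
    have "ell (b j) z = (1 - t) * ell (b j) u + t * ell (b j) v"
      by (simp add: ell_eq_inner t(3) inner_add_right algebra_simps)
    then show ?thesis using convex_combination_nonzero[OF _ _ t(1,2), of "ell (b j) u" "ell (b j) v"] assms that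
      by (simp add: off_walls_def same_chamber_def)
  qed
  ultimately show "z \<in> real_complement m b" by (simp add: real_complement_iff off_walls_def)
qed

definition chambers_at :: "nat \<Rightarrow> (nat \<Rightarrow> real ^ 'n) \<Rightarrow> complex ^ 'n::finite \<Rightarrow> (real ^ 'n) set set" where
  "chambers_at m b \<sigma> = {B \<in> components (real_complement m b). \<sigma> \<in> closure (cvec ` B)}"

text \<open>Near the point, the coordinates and the other forms keep their signs, so a component adjacent to it is determined by
  the signs of the forms that vanish there. By independence all sign patterns occur.\<close>

lemma chambers_at_point:
  fixes x :: "real ^ 'n::finite"
  assumes x: "\<And>i. x $ i \<noteq> 0" and K: "K = {j \<in> {1..m}. ell (b j) x = 0}"
    and ind: "inj_on b K" "independent (b ` K)" and base: "\<forall>B\<in>components (real_complement m b). \<xi> B \<in> B"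
  shows "B \<in> chambers_at m b (cvec x) \<Longrightarrow> off_walls b {1..m} (\<xi> B)"
    and "B \<in> chambers_at m b (cvec x) \<Longrightarrow> sgn (\<xi> B $ i) = sgn (x $ i)"
    and "B \<in> chambers_at m b (cvec x) \<Longrightarrow> j \<in> {1..m} - K \<Longrightarrow> sgn (ell (b j) (\<xi> B)) = sgn (ell (b j) x)"
    and "bij_betw (\<lambda>B. {j \<in> K. ell (b j) (\<xi> B) > 0}) (chambers_at m b (cvec x)) (Pow K)"
proof -
  let ?M = "real_complement m b"
  have \<xi>: "\<xi> B \<in> B" if "B \<in> components ?M" for B using base that by blast
  let ?C = "chambers_at m b (cvec x)"
  have comp: "B \<in> components ?M" if "B \<in> ?C" for B using that by (simp add: chambers_at_def)
  show off: "off_walls b {1..m} (\<xi> B)" if "B \<in> ?C" for B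
    using \<xi>[OF comp[OF that]] in_components_subset[OF comp[OF that]] real_complement_iff by blast
  have near: "\<exists>u\<in>B. dist u x < \<epsilon>" if "B \<in> ?C" "\<epsilon> > 0" for B \<epsilon>
    using that by (auto simp: chambers_at_def closure_approachable dist_cvec)
  have signs: "sgn (f (\<xi> B)) = sgn (f x)" if B: "B \<in> ?C" and f: "continuous_on UNIV f" "f x \<noteq> 0" and
     sb: "\<And>u. u \<in> B \<Longrightarrow> sgn (f (\<xi> B)) = sgn (f u)" for B and f :: "real ^ 'n \<Rightarrow> real"
  proof -
    have "eventually (\<lambda>u. sgn (f u) = sgn (f x)) (nhds x)"
      by (rule eventually_sgn_eq[where f=f and l="f x"]) (use f in \<open>auto simp: continuous_on_eq_continuous_at isCont_def tendsto_at_iff_tendsto_nhds\<close>)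
    then obtain \<epsilon> where "\<epsilon> > 0" "\<And>u. dist u x < \<epsilon> \<Longrightarrow> sgn (f u) = sgn (f x)" by (auto simp: eventually_nhds_metric)
    then show ?thesis using near[OF B] sb by metis
  qed
  show sc: "sgn (\<xi> B $ i) = sgn (x $ i)" if B: "B \<in> ?C" for B i
  proof (rule signs[OF B, of "\<lambda>x. x $ i"])
    show "sgn (\<xi> B $ i) = sgn (u $ i)" if "u \<in> B" for u
      using component_same_chamber[OF comp[OF B] \<xi>[OF comp[OF B]] that] by (simp add: same_chamber_def)
  qed (use x in \<open>auto intro!: continuous_intros\<close>)
  show so: "sgn (ell (b j) (\<xi> B)) = sgn (ell (b j) x)" if B: "B \<in> ?C" and j: "j \<in> {1..m} - K" for B j
  proof (rule signs[OF B, of "ell (b j)"])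
    show "sgn (ell (b j) (\<xi> B)) = sgn (ell (b j) u)" if "u \<in> B" for u
      using component_same_chamber[OF comp[OF B] \<xi>[OF comp[OF B]] that] j by (simp add: same_chamber_def)
  qed (use j K in \<open>auto intro!: continuous_on_ell\<close>)
  show "bij_betw (\<lambda>B. {j \<in> K. ell (b j) (\<xi> B) > 0}) ?C (Pow K)"
    unfolding bij_betw_def
  proof
    show "inj_on (\<lambda>B. {j \<in> K. ell (b j) (\<xi> B) > 0}) ?C"
    proof (rule inj_onI)
      fix B B' assume B: "B \<in> ?C" "B' \<in> ?C" and e: "{j \<in> K. ell (b j) (\<xi> B) > 0} = {j \<in> K. ell (b j) (\<xi> B') > 0}"
      have "sgn (ell (b j) (\<xi> B)) = sgn (ell (b j) (\<xi> B'))" if j: "j \<in> {1..m}" for j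
      proof (cases "j \<in> K")
        case True
        then have "ell (b j) (\<xi> B) > 0 \<longleftrightarrow> ell (b j) (\<xi> B') > 0" using e by blast
        moreover have "ell (b j) (\<xi> B) \<noteq> 0" "ell (b j) (\<xi> B') \<noteq> 0" using off B j by (auto simp: off_walls_def)
        ultimately show ?thesis by (cases "ell (b j) (\<xi> B) > 0") auto
      next
        case False
        then show ?thesis using so B j by simp
      qed
      then have "same_chamber b {1..m} (\<xi> B) (\<xi> B')" using sc B by (simp add: same_chamber_def)
      from same_chamber_segment[OF off[OF B(1)] this]
      show "B = B'"
        using comp B \<xi> by (intro joinable_components_eq[of "closed_segment (\<xi> B) (\<xi> B')" ?M]) auto
    qed
    show "(\<lambda>B. {j \<in> K. ell (b j) (\<xi> B) > 0}) ` ?C = Pow K"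
    proof
      show "Pow K \<subseteq> (\<lambda>B. {j \<in> K. ell (b j) (\<xi> B) > 0}) ` ?C"
      proof
        fix Q assume Q: "Q \<in> Pow K"
        \<comment> \<open>points of the chamber with pattern \<open>Q\<close> arbitrarily close to \<open>x\<close>; all of them lie in one component\<close>
        have pts: "\<exists>y. dist y x < \<epsilon> \<and> (\<forall>i. sgn (y $ i) = sgn (x $ i)) \<and> (\<forall>j\<in>{1..m}. sgn (ell (b j) y) = (if j \<in> K then if j \<in> Q then 1 else - 1 else sgn (ell (b j) x)))"
          if \<epsilon>: "\<epsilon> > 0" for \<epsilon>
        proof -
          obtain y where "\<And>Q. dist (y Q) x < \<epsilon>" "\<And>Q i. sgn (y Q $ i) = sgn (x $ i)"
            "\<And>Q j. j \<in> {1..m} - K \<Longrightarrow> sgn (ell (b j) (y Q)) = sgn (ell (b j) x)"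
            "\<And>Q j. j \<in> K \<Longrightarrow> sgn (ell (b j) (y Q)) = (if j \<in> Q then 1 else - 1)"
            using star_points[OF finite_atLeastAtMost x K ind \<epsilon>] by blast
          then show ?thesis by (intro exI[of _ "y Q"]) auto
        qed
        obtain y where y: "\<forall>i. sgn (y $ i) = sgn (x $ i)" "\<forall>j\<in>{1..m}. sgn (ell (b j) y) = (if j \<in> K then if j \<in> Q then 1 else - 1 else sgn (ell (b j) x))"
          using pts[of 1] by auto
        have offy: "off_walls b {1..m} y"
          unfolding off_walls_def
        proof (intro conjI allI ballI)
          show "y $ i \<noteq> 0" for i using y(1)[rule_format, of i] x[of i] by (auto simp: sgn_zero_iff)
          show "ell (b j) y \<noteq> 0" if "j \<in> {1..m}" for j
          proof
            assume "ell (b j) y = 0"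
            then have "(if j \<in> K then if j \<in> Q then 1 else - 1 else sgn (ell (b j) x)) = 0"
              using bspec[OF y(2) that] by (simp only: sgn_zero)
            then show False using that K by (cases "j \<in> K"; cases "j \<in> Q") (simp_all add: sgn_zero_iff)
          qed
        qed
        define B where "B = connected_component_set ?M y"
        have yM: "y \<in> ?M" using offy by (simp add: real_complement_iff)
        have BC: "B \<in> components ?M" unfolding B_def by (rule componentsI[OF yM])
        have inB: "u \<in> B" if "same_chamber b {1..m} y u" for u
          using same_chamber_segment[OF offy that] unfolding B_def connected_component_def mem_Collect_eq
          by (intro exI[of _ "closed_segment y u"]) auto
        have "cvec x \<in> closure (cvec ` B)"
          unfolding closure_approachable
        proof (intro allI impI)
          fix \<epsilon> :: real assume "\<epsilon> > 0"
          then obtain u where u: "dist u x < \<epsilon>" "\<forall>i. sgn (u $ i) = sgn (x $ i)"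
            "\<forall>j\<in>{1..m}. sgn (ell (b j) u) = (if j \<in> K then if j \<in> Q then 1 else - 1 else sgn (ell (b j) x))" using pts by blast
          then have "u \<in> B" using y by (intro inB) (auto simp: same_chamber_def)
          then show "\<exists>z\<in>cvec ` B. dist z (cvec x) < \<epsilon>" using u(1) by (intro bexI[of _ "cvec u"]) (auto simp: dist_cvec)
        qed
        then have B: "B \<in> ?C" using BC by (simp add: chambers_at_def)
        have "y \<in> B" by (rule inB) (simp add: same_chamber_def)
        from component_same_chamber[OF BC \<xi>[OF BC] this]
        have s: "sgn (ell (b j) (\<xi> B)) = (if j \<in> Q then 1 else - 1)" if "j \<in> K" for j
          using that y(2) K by (auto simp: same_chamber_def)
        have "{j \<in> K. ell (b j) (\<xi> B) > 0} = Q"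
        proof (rule set_eqI)
          fix j
          show "j \<in> {j \<in> K. ell (b j) (\<xi> B) > 0} \<longleftrightarrow> j \<in> Q"
            using s[of j] Q by (cases "j \<in> Q") (auto simp: sgn_1_pos sgn_1_neg)
        qed
        then show "Q \<in> (\<lambda>B. {j \<in> K. ell (b j) (\<xi> B) > 0}) ` ?C" using B by blast
      qed
    qed auto
  qed
qed

text \<open>Parametrising the fibre turns $i^d/(2\pi i)^d$ into $(2\pi)^{-d}$, and the polynomial factor of the integrand
  becomes a shift of the exponent.\<close>

lemma contribution_eq_fibres:
  fixes b :: "nat \<Rightarrow> real ^ 'n::finite"
  assumes off: "\<And>B. B \<in> chambers_at m b \<sigma> \<Longrightarrow> off_walls b {1..m} (\<xi> B)"
  shows "ev_eq (zext (contribution m b p G \<xi> \<sigma>)) (poly_act G (\<lambda>s. \<Sum>B\<in>chambers_at m b \<sigma>.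
    of_real ((\<Prod>i\<in>UNIV. sgn (\<xi> B $ i)) * (\<Prod>j\<in>active_set m b \<sigma>. sgn (ell (b j) (\<xi> B)))) * fibre b {1..m} p (\<xi> B) s))"
proof -
  let ?C = "chambers_at m b \<sigma>"
  let ?w = "\<lambda>B. complex_of_real ((\<Prod>i\<in>UNIV. sgn (\<xi> B $ i)) * (\<Prod>j\<in>active_set m b \<sigma>. sgn (ell (b j) (\<xi> B))))"
  let ?I = "\<lambda>B s. \<integral>y. poly_eval G (cpt (\<xi> B) y) * fibre_term b {1..m} p s (cpt (\<xi> B) y) \<partial>lborel"
  let ?g = "\<lambda>B s. of_real (1 / (2 * pi) ^ CARD('n)) * ?I B s"
  have g: "ev_eq (poly_act G (fibre b {1..m} p (\<xi> B))) (?g B)" if "B \<in> ?C" for B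
  proof -
    have "\<exists>M. \<forall>s. (\<forall>i. s $ i \<ge> M) \<longrightarrow> integrable lborel (\<lambda>y. poly_eval G (cpt (\<xi> B) y) * fibre_term b {1..m} p s (cpt (\<xi> B) y)) \<and>
      poly_act G (fibre b {1..m} p (\<xi> B)) s = ?g B s"
      using off[OF that] by (intro poly_act_fibre) (auto simp: off_walls_def)
    then show ?thesis unfolding ev_eq_def by blast
  qed
  have "zext (contribution m b p G \<xi> \<sigma>) s = (\<Sum>B\<in>?C. ?w B * ?g B s)" if s: "\<forall>i. s $ i \<ge> 0" for s
  proof -
    define s' where "s' = (\<chi> i. nat (s $ i))"
    have s': "ivec s' = s" using s by (auto simp: vec_eq_iff s'_def)
    have si: "int (s' $ i) = s $ i" for i using s' by (metis ivec_nth)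
    have integrand: "ratfun m b p G z * (\<Prod>i\<in>UNIV. (z $ i) powi (- int (s' $ i) - 1)) = poly_eval G z * fibre_term b {1..m} p s z" for z
    proof -
      have "(\<Prod>j\<in>{1..m}. inverse (ell (b j) z) ^ p j) = inverse (\<Prod>j\<in>{1..m}. ell (b j) z ^ p j)"
        unfolding prod_inversef[symmetric] o_def power_inverse ..
      then show ?thesis unfolding ratfun_def fibre_term_def si divide_inverse by (simp only: mult.assoc)
    qed
    have im: "imaginary_fibre_integral (\<xi> B) (\<lambda>z. ratfun m b p G z * (\<Prod>i\<in>UNIV. (z $ i) powi (- int (s' $ i) - 1))) = \<i> ^ CARD('n) * ?I B s" for B
      unfolding imaginary_fibre_integral_def integrand cpt_def ..
    have const: "1 / (2 * complex_of_real pi * \<i>) ^ CARD('n) * \<i> ^ CARD('n) = of_real (1 / (2 * pi) ^ CARD('n))"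
      by (simp add: power_mult_distrib)
    have "zext (contribution m b p G \<xi> \<sigma>) s = contribution m b p G \<xi> \<sigma> s'"
      using zext_ivec[of "contribution m b p G \<xi> \<sigma>" s'] by (simp only: s')
    also have "\<dots> = (\<Sum>B\<in>?C. ?w B * ((1 / (2 * complex_of_real pi * \<i>) ^ CARD('n) * \<i> ^ CARD('n)) * ?I B s))"
      unfolding contribution_def im sgn_prod_real chambers_at_def[symmetric] sum_distrib_left
      by (intro sum.cong refl) (simp only: of_real_mult mult_ac)
    finally show ?thesis unfolding const .
  qed
  then have "ev_eq (zext (contribution m b p G \<xi> \<sigma>)) (\<lambda>s. \<Sum>B\<in>?C. ?w B * ?g B s)" by (intro ev_eqI[of 0])
  also have "ev_eq \<dots> (\<lambda>s. \<Sum>B\<in>?C. ?w B * poly_act G (fibre b {1..m} p (\<xi> B)) s)"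
    by (intro ev_eq_sum ev_eq_cmult ev_eq_sym[OF g])
  finally show ?thesis unfolding poly_act_sum_right[abs_def] poly_act_linear .
qed

text \<open>Multiplying the array by the remaining forms, to their full powers, preserves decay and leaves only the forms in
  \<open>K\<close> in the denominator.\<close>

context direction
begin

lemma full_fibres_lower_bound:
  fixes x :: "real ^ 'n"
  assumes S: "finite S" "K \<subseteq> S" "inj_on b K" "independent (b ` K)" and p: "\<And>k. k \<in> S \<Longrightarrow> p k \<ge> 1"
    and X: "finite X" and off: "\<And>B. B \<in> X \<Longrightarrow> off_walls b S (y B)"
    and x: "\<And>i. x $ i \<noteq> 0" and flat: "\<And>j. j \<in> K \<Longrightarrow> ell (b j) x = 0"
    and c: "\<And>j. j \<in> K \<Longrightarrow> c j > 0" and crit: "\<And>i. r $ i / x $ i = dual_sum b K c $ i"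
    and B0: "B0 \<in> X" "\<And>i. sgn (y B0 $ i) = sgn (x $ i)" "\<And>j. j \<in> K \<Longrightarrow> ell (b j) (y B0) > 0"
    and G: "G \<notin> power_ideal b p K"
  shows "\<not> decays r (rheight r x) (poly_act G (\<lambda>s. \<Sum>B\<in>X. of_real ((\<Prod>i\<in>UNIV. sgn (y B $ i)) * (\<Prod>j\<in>K. sgn (ell (b j) (y B)))) * fibre b S p (y B) s))"
proof
  let ?w = "\<lambda>B. complex_of_real ((\<Prod>i\<in>UNIV. sgn (y B $ i)) * (\<Prod>j\<in>K. sgn (ell (b j) (y B))))"
  let ?F = "\<lambda>s. \<Sum>B\<in>X. ?w B * fibre b S p (y B) s"
  let ?Q = "\<Prod>j\<in>S - K. ell_poly (b j) ^ p j"
  have finK: "finite K" using S(1,2) finite_subset by blast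
  assume "decays r (rheight r x) (poly_act G ?F)"
  then have "decays r (rheight r x) (poly_act ?Q (poly_act G ?F))" by (rule decays_poly_act)
  also have "poly_act ?Q (poly_act G ?F) = poly_act G (poly_act ?Q ?F)"
    by (rule ext) (simp only: poly_act_mult[symmetric] mult.commute)
  finally have d: "decays r (rheight r x) (poly_act G (poly_act ?Q ?F))" .
  have act: "ev_eq (poly_act ?Q (fibre b S p (y B))) (fibre b K p (y B))" if "B \<in> X" for B
  proof -
    have "ev_eq (poly_act ?Q (fibre b S p (y B))) (fibre b S (\<lambda>j. if j \<in> S - K then p j - p j else p j) (y B))"
      using off[OF that] S by (intro ell_prod_act_fibre) (auto simp: off_walls_def)
    also have "fibre b S (\<lambda>j. if j \<in> S - K then p j - p j else p j) (y B) = fibre b K (\<lambda>j. if j \<in> S - K then p j - p j else p j) (y B)"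
      using S by (intro fibre_drop) auto
    also have "\<dots> = fibre b K p (y B)" by (intro fibre_cong) auto
    finally show ?thesis .
  qed
  have sf: "signed_fibres b K X y p = (\<lambda>s. \<Sum>B\<in>X. ?w B * fibre b K p (y B) s)"
    by (rule ext) (simp only: signed_fibres_def)
  have "ev_eq (poly_act ?Q ?F) (signed_fibres b K X y p)"
    unfolding sf poly_act_sum_right[abs_def] poly_act_linear by (intro ev_eq_sum ev_eq_cmult act)
  from decays_ev_eq[OF d ev_eq_poly_act[OF this]]
  have "decays r (rheight r x) (poly_act G (signed_fibres b K X y p))" .
  moreover have "\<not> decays r (- (\<Sum>i\<in>UNIV. r $ i * ln \<bar>x $ i\<bar>)) (poly_act G (signed_fibres b K X y p))"
    by (rule signed_fibres_lower_bound[where c=c and x=x and y=y and b=b and K=K and p=p, OF finK S(3,4) _ X _ _ x flat c crit B0 G])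
      (use p S(2) off in \<open>auto simp: off_walls_def\<close>)
  ultimately show False by (simp add: rheight_def)
qed

end

section \<open>Moebius inversion over intervals of sets\<close>

text \<open>Each element of \<open>D\<close> can be added to or left out of the index set, and the two alternating sums cancel except for the
  terms containing it. For empty \<open>K\<close> this is Moebius inversion.\<close>

lemma interval_moebius:
  fixes f :: "'a set \<Rightarrow> 'c::comm_ring_1"
  assumes "finite D" "finite K" "K \<inter> D = {}"
  shows "(\<Sum>A\<in>Pow D. \<Sum>P\<in>Pow (K \<union> A). (- 1) ^ card (K \<union> A - P) * f P) = (\<Sum>Q\<in>Pow K. (- 1) ^ card (K - Q) * f (Q \<union> D))"
  using assms(1,3)
proof (induction D arbitrary: f rule: finite_induct)
  case (insert x D)
  let ?W = "\<lambda>f T. \<Sum>P\<in>Pow T. (- 1) ^ card (T - P) * f P"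
  have step: "?W f T + ?W f (insert x T) = ?W (\<lambda>P. f (insert x P)) T" if T: "finite T" "x \<notin> T" for T
  proof -
    have "?W f (insert x T) = (\<Sum>P\<in>Pow T. (- 1) ^ card (insert x T - P) * f P + (- 1) ^ card (insert x T - insert x P) * f (insert x P))"
      using T by (rule sum_Pow_insert)
    also have "\<dots> = (\<Sum>P\<in>Pow T. (- 1) ^ card (T - P) * f (insert x P) - (- 1) ^ card (T - P) * f P)"
    proof (intro sum.cong refl)
      fix P assume P: "P \<in> Pow T"
      have "insert x T - P = insert x (T - P)" "insert x T - insert x P = T - P" using P T(2) by auto
      moreover have "card (insert x (T - P)) = Suc (card (T - P))" using T by (intro card_insert_disjoint) auto
      ultimately show "(- 1) ^ card (insert x T - P) * f P + (- 1) ^ card (insert x T - insert x P) * f (insert x P) =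
        (- 1) ^ card (T - P) * f (insert x P) - (- 1) ^ card (T - P) * f P" by simp
    qed
    finally show ?thesis by (simp add: sum_subtractf)
  qed
  have "(\<Sum>A\<in>Pow (insert x D). ?W f (K \<union> A)) = (\<Sum>A\<in>Pow D. ?W f (K \<union> A) + ?W f (K \<union> insert x A))"
    using insert.hyps by (rule sum_Pow_insert)
  also have "\<dots> = (\<Sum>A\<in>Pow D. ?W (\<lambda>P. f (insert x P)) (K \<union> A))"
  proof (intro sum.cong refl)
    fix A assume A: "A \<in> Pow D"
    have "finite (K \<union> A)" "x \<notin> K \<union> A" using A insert.hyps insert.prems assms(2) finite_subset by auto
    from step[OF this] show "?W f (K \<union> A) + ?W f (K \<union> insert x A) = ?W (\<lambda>P. f (insert x P)) (K \<union> A)" by (simp only: Un_insert_right)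
  qed
  also have "\<dots> = (\<Sum>Q\<in>Pow K. (- 1) ^ card (K - Q) * f (insert x (Q \<union> D)))"
    using insert.prems by (intro insert.IH) auto
  finally show ?case by (simp only: Un_insert_right)
qed simp

lemma sum_set_interval:
  assumes "K \<subseteq> L"
  shows "(\<Sum>T | K \<subseteq> T \<and> T \<subseteq> L. f T) = (\<Sum>A\<in>Pow (L - K). f (K \<union> A))"
  by (rule sum.reindex_bij_witness[where i="\<lambda>A. K \<union> A" and j="\<lambda>T. T - K"]) (use assms in \<open>auto simp: Un_absorb1\<close>)

section \<open>Minimising the height over polyhedra in an orthant\<close>

text \<open>The point \<open>e\<close> selects an orthant and lies on the positive side of every hyperplane.\<close>

locale orthant = direction r for r :: "real ^ 'n::finite" +
  fixes b :: "nat \<Rightarrow> real ^ 'n" and S :: "nat set" and e :: "real ^ 'n"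
  assumes fin: "finite S" and e_nz: "e $ i \<noteq> 0" and e_pos: "j \<in> S \<Longrightarrow> ell (b j) e > 0"
    and indep: "inj_on b {j \<in> S. ell (b j) (x :: real ^ 'n) = 0}" "independent (b ` {j \<in> S. ell (b j) x = 0})"
begin

definition orth :: "(real ^ 'n) set" where
  "orth = {x. \<forall>i. sgn (x $ i) = sgn (e $ i)}"

definition cell :: "nat set \<Rightarrow> (real ^ 'n) set" where
  "cell T = {x \<in> orth. \<forall>j\<in>T. ell (b j) x \<ge> 0}"

definition wall :: "real ^ 'n \<Rightarrow> nat set" where
  "wall x = {j \<in> S. ell (b j) x = 0}"

text \<open>The quadratic term makes the objective proper on the polyhedra on which the height is unbounded below.\<close>

definition obj :: "real \<Rightarrow> real ^ 'n \<Rightarrow> real" where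
  "obj \<theta> x = rheight r x + \<theta> * (x \<bullet> x)"

text \<open>The negative gradient of the objective.\<close>

definition descent :: "real \<Rightarrow> real ^ 'n \<Rightarrow> real ^ 'n" where
  "descent \<theta> x = (\<chi> i. r $ i / x $ i - 2 * \<theta> * x $ i)"

definition minimises :: "real \<Rightarrow> nat set \<Rightarrow> real ^ 'n \<Rightarrow> bool" where
  "minimises \<theta> T y \<longleftrightarrow> y \<in> cell T \<and> (\<forall>x\<in>cell T. obj \<theta> y \<le> obj \<theta> x)"

lemma orth_nz: "x \<in> orth \<Longrightarrow> x $ i \<noteq> 0"
  using e_nz[of i] by (auto simp: orth_def) (metis sgn_zero sgn_zero_iff)

lemma e_cell: "T \<subseteq> S \<Longrightarrow> e \<in> cell T"
  using e_pos by (auto simp: cell_def orth_def intro: less_imp_le)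

lemma wall_indep: "inj_on b (wall x)" "independent (b ` wall x)"
  using indep[of x] by (simp_all add: wall_def)

lemma finite_wall: "finite (wall x)"
  using fin by (simp add: wall_def)

lemma ln_tangent:
  fixes u v :: real
  assumes "sgn u = sgn v" "v \<noteq> 0"
  shows "ln \<bar>u\<bar> \<le> ln \<bar>v\<bar> + (u - v) / v" and "u \<noteq> v \<Longrightarrow> ln \<bar>u\<bar> < ln \<bar>v\<bar> + (u - v) / v"
proof -
  have u: "u \<noteq> 0" using assms by (metis sgn_zero sgn_zero_iff)
  have q: "u / v > 0"
  proof (cases "v > 0")
    case True
    then have "u > 0" using assms(1) by (metis sgn_greater)
    then show ?thesis using True by simp
  next
    case False
    then have "v < 0" using assms(2) by simp
    then have "u < 0" using assms(1) by (metis sgn_less)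
    then show ?thesis using \<open>v < 0\<close> by (simp add: divide_neg_neg)
  qed
  have "\<bar>u\<bar> / \<bar>v\<bar> = u / v" using q by (simp flip: abs_divide)
  then have l: "ln (u / v) = ln \<bar>u\<bar> - ln \<bar>v\<bar>" using ln_div[of "\<bar>u\<bar>" "\<bar>v\<bar>"] u assms(2) by simp
  have "u / v - 1 = (u - v) / v" using assms(2) by (simp add: diff_divide_distrib)
  then show "ln \<bar>u\<bar> \<le> ln \<bar>v\<bar> + (u - v) / v" using ln_le_minus_one[OF q] l by linarith
  assume "u \<noteq> v"
  then have "u / v \<noteq> 1" using assms(2) by simp
  then have "ln (u / v) \<noteq> u / v - 1" using ln_eq_minus_one[OF q] by blast
  then show "ln \<bar>u\<bar> < ln \<bar>v\<bar> + (u - v) / v" using ln_le_minus_one[OF q] l \<open>u / v - 1 = (u - v) / v\<close> by linarith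
qed

text \<open>Strict convexity of $-\ln$ on each half line, coordinate by coordinate.\<close>

lemma obj_tangent:
  assumes x: "x \<in> orth" and y: "y \<in> orth" and \<theta>: "\<theta> \<ge> 0"
  shows "obj \<theta> x \<ge> obj \<theta> y - descent \<theta> y \<bullet> (x - y)" and "x \<noteq> y \<Longrightarrow> obj \<theta> x > obj \<theta> y - descent \<theta> y \<bullet> (x - y)"
proof -
  let ?t = "\<lambda>x i. - (r $ i * ln \<bar>x $ i\<bar>) + \<theta> * (x $ i * x $ i)"
  let ?u = "\<lambda>i. ?t y i - (r $ i / y $ i - 2 * \<theta> * y $ i) * (x $ i - y $ i)"
  have obj: "obj \<theta> x = (\<Sum>i\<in>UNIV. ?t x i)" for x
    by (simp add: obj_def rheight_def inner_vec_def sum_subtractf sum_distrib_left)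
  have rhs: "obj \<theta> y - descent \<theta> y \<bullet> (x - y) = (\<Sum>i\<in>UNIV. ?u i)"
    unfolding obj by (simp add: descent_def inner_vec_def sum_subtractf)
  have sg: "sgn (x $ i) = sgn (y $ i)" for i using x y by (simp add: orth_def)
  have sq: "\<theta> * (x $ i * x $ i) \<ge> \<theta> * (y $ i * y $ i) + 2 * \<theta> * y $ i * (x $ i - y $ i)" for i
  proof -
    have "\<theta> * (x $ i * x $ i) - (\<theta> * (y $ i * y $ i) + 2 * \<theta> * y $ i * (x $ i - y $ i)) = \<theta> * (x $ i - y $ i)^2"
      by (simp add: power2_eq_square algebra_simps)
    then show ?thesis using \<theta> by (smt (verit) mult_nonneg_nonneg zero_le_power2)
  qed
  have lin: "(r $ i / y $ i - 2 * \<theta> * y $ i) * (x $ i - y $ i) = r $ i * ((x $ i - y $ i) / y $ i) - 2 * \<theta> * y $ i * (x $ i - y $ i)" for i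
    by (simp add: algebra_simps)
  have le: "?u i \<le> ?t x i" for i
  proof -
    have "r $ i * ln \<bar>x $ i\<bar> \<le> r $ i * (ln \<bar>y $ i\<bar> + (x $ i - y $ i) / y $ i)"
      using r_pos[of i] by (intro mult_left_mono ln_tangent(1)[OF sg orth_nz[OF y]]) auto
    then show ?thesis using sq[of i] lin[of i] by (simp add: distrib_left)
  qed
  show "obj \<theta> x \<ge> obj \<theta> y - descent \<theta> y \<bullet> (x - y)" unfolding rhs unfolding obj[of x] by (intro sum_mono le)
  assume "x \<noteq> y"
  then obtain i where i: "x $ i \<noteq> y $ i" by (auto simp: vec_eq_iff)
  have "r $ i * ln \<bar>x $ i\<bar> < r $ i * (ln \<bar>y $ i\<bar> + (x $ i - y $ i) / y $ i)"
    using r_pos[of i] by (intro mult_strict_left_mono ln_tangent(2)[OF sg orth_nz[OF y] i])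
  then have "?u i < ?t x i" using sq[of i] lin[of i] by (simp add: distrib_left)
  then show "obj \<theta> x > obj \<theta> y - descent \<theta> y \<bullet> (x - y)"
    unfolding rhs unfolding obj[of x] by (intro sum_strict_mono_ex1) (use le in auto)
qed

text \<open>A bound on the norm bounds every logarithm from above, so a bound on the height bounds every logarithm from
  below: sublevel sets stay away from the coordinate hyperplanes.\<close>

lemma rheight_lower: assumes "x \<in> orth" "norm x \<le> R" "R \<ge> 1" shows "r $ i * ln \<bar>x $ i\<bar> \<ge> - rheight r x - ln R"
proof -
  have "r $ k * ln \<bar>x $ k\<bar> \<le> r $ k * ln R" for k
  proof -
    have "\<bar>x $ k\<bar> \<le> R" using component_le_norm_cart[of x k] assms(2) by linarith
    then show ?thesis using orth_nz[OF assms(1), of k] assms(3) r_pos[of k] by (intro mult_left_mono) auto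
  qed
  then have "(\<Sum>k\<in>UNIV - {i}. r $ k * ln \<bar>x $ k\<bar>) \<le> (\<Sum>k\<in>UNIV - {i}. r $ k * ln R)" by (intro sum_mono)
  also have "\<dots> \<le> (\<Sum>k\<in>UNIV. r $ k * ln R)" using less_imp_le[OF r_pos] assms(3) by (intro sum_mono2) (auto intro!: mult_nonneg_nonneg)
  also have "\<dots> = ln R" using r_sum by (simp add: sum_distrib_right[symmetric])
  finally have "(\<Sum>k\<in>UNIV - {i}. r $ k * ln \<bar>x $ k\<bar>) \<le> ln R" .
  moreover have "rheight r x = - (r $ i * ln \<bar>x $ i\<bar>) - (\<Sum>k\<in>UNIV - {i}. r $ k * ln \<bar>x $ k\<bar>)"
    unfolding rheight_def by (subst sum.remove[of UNIV i]) auto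
  ultimately show ?thesis by linarith
qed

lemma isCont_rheight: "(\<And>i. x $ i \<noteq> 0) \<Longrightarrow> isCont (rheight r) x"
  unfolding rheight_def[abs_def] by (intro continuous_intros) auto

text \<open>A sublevel set that is bounded is contained in a compact subset of the open orthant.\<close>

lemma minimises_exists:
  assumes T: "T \<subseteq> S" and \<theta>: "\<theta> \<ge> 0" and R: "\<And>x. x \<in> cell T \<Longrightarrow> obj \<theta> x \<le> obj \<theta> e \<Longrightarrow> norm x \<le> R"
  shows "\<exists>y. minimises \<theta> T y"
proof -
  define R' where "R' = max R 1"
  define \<eta> where "\<eta> = (\<lambda>i. exp ((- obj \<theta> e - ln R') / r $ i))"
  define W where "W = cball 0 R' \<inter> (\<Inter>i. {x. \<eta> i \<le> sgn (e $ i) * x $ i}) \<inter> (\<Inter>j\<in>T. {x. 0 \<le> ell (b j) x})"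
  have W_orth: "x \<in> orth" if "x \<in> W" for x
  proof -
    have "sgn (x $ i) = sgn (e $ i)" for i
    proof -
      have "0 < \<eta> i" by (simp add: \<eta>_def)
      also have "\<eta> i \<le> sgn (e $ i) * x $ i" using that by (simp add: W_def)
      finally show ?thesis using e_nz[of i] by (cases "e $ i > 0") (auto simp: zero_less_mult_iff)
    qed
    then show ?thesis by (simp add: orth_def)
  qed
  have W_cell: "W \<subseteq> cell T" using W_orth by (auto simp: cell_def) (simp add: W_def)
  have in_W: "x \<in> W" if x: "x \<in> cell T" "obj \<theta> x \<le> obj \<theta> e" for x
  proof -
    have xo: "x \<in> orth" using x by (simp add: cell_def)
    have n: "norm x \<le> R'" using R[OF x] by (simp add: R'_def)
    have "\<eta> i \<le> sgn (e $ i) * x $ i" for i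
    proof -
      have "rheight r x \<le> obj \<theta> e" using x(2) \<theta> by (simp add: obj_def) (smt (verit) inner_ge_zero mult_nonneg_nonneg)
      then have "r $ i * ln \<bar>x $ i\<bar> \<ge> - obj \<theta> e - ln R'" using rheight_lower[OF xo n, of i] by (simp add: R'_def)
      then have "(- obj \<theta> e - ln R') / r $ i \<le> ln \<bar>x $ i\<bar>" using r_pos[of i] by (simp add: pos_divide_le_eq mult.commute)
      then have "\<eta> i \<le> \<bar>x $ i\<bar>" unfolding \<eta>_def using orth_nz[OF xo, of i] by (metis exp_le_cancel_iff exp_ln zero_less_abs_iff)
      also have "\<bar>x $ i\<bar> = sgn (e $ i) * x $ i" using xo by (simp add: orth_def abs_sgn mult.commute)
      finally show ?thesis .
    qed
    then show ?thesis using x n by (simp add: W_def cell_def)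
  qed
  have "compact W" unfolding W_def
    by (intro compact_Int_closed compact_cball closed_INT ballI closed_Collect_le continuous_intros continuous_on_ell)
  moreover have "e \<in> W" using in_W[OF e_cell[OF T]] by simp
  moreover have "continuous_on W (obj \<theta>)"
    unfolding obj_def[abs_def]
    by (intro continuous_intros continuous_at_imp_continuous_on ballI isCont_rheight orth_nz W_orth)
  ultimately obtain y where y: "y \<in> W" "\<And>x. x \<in> W \<Longrightarrow> obj \<theta> y \<le> obj \<theta> x"
    using continuous_attains_inf[of W "obj \<theta>"] by auto
  have "obj \<theta> y \<le> obj \<theta> x" if "x \<in> cell T" for x
    using y(2)[of x] y(2)[OF \<open>e \<in> W\<close>] in_W[OF that] by linarith
  then show ?thesis using y(1) W_cell by (auto simp: minimises_def)
qed

text \<open>The height decreases at most linearly in the norm, because the logarithm grows at most linearly.\<close>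

lemma minimises_exists_quadratic:
  assumes T: "T \<subseteq> S" and \<theta>: "\<theta> > 0"
  shows "\<exists>y. minimises \<theta> T y"
proof (rule minimises_exists[OF T])
  let ?C = "obj \<theta> e"
  fix x assume x: "x \<in> cell T" "obj \<theta> x \<le> ?C"
  have xo: "x \<in> orth" using x by (simp add: cell_def)
  let ?N = "norm x"
  have "(\<Sum>i\<in>UNIV. r $ i * ln \<bar>x $ i\<bar>) \<le> (\<Sum>i\<in>UNIV. r $ i * ?N)"
  proof (intro sum_mono mult_left_mono)
    fix i
    have "ln \<bar>x $ i\<bar> \<le> \<bar>x $ i\<bar>" using orth_nz[OF xo, of i] by (intro ln_bound) simp
    also have "\<dots> \<le> ?N" by (rule component_le_norm_cart)
    finally show "ln \<bar>x $ i\<bar> \<le> ?N" .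
  qed (use r_pos in \<open>auto intro: less_imp_le\<close>)
  also have "\<dots> = ?N" using r_sum by (simp add: sum_distrib_right[symmetric])
  finally have h: "rheight r x \<ge> - ?N" by (simp add: rheight_def)
  have key: "\<theta> * (?N * ?N) - ?N \<le> ?C" using x(2) h by (simp add: obj_def dot_square_norm power2_eq_square)
  show "?N \<le> (1 + \<bar>?C\<bar>) / \<theta> + 1"
  proof (rule ccontr)
    assume "\<not> ?thesis"
    then have a: "?N > (1 + \<bar>?C\<bar>) / \<theta> + 1" by simp
    moreover have "(1 + \<bar>?C\<bar>) / \<theta> \<ge> 0" using \<theta> by simp
    ultimately have N1: "?N \<ge> 1" and "(1 + \<bar>?C\<bar>) / \<theta> < ?N" by linarith+
    then have "1 + \<bar>?C\<bar> < \<theta> * ?N" using \<theta> by (simp add: pos_divide_less_eq mult.commute)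
    then have "1 * \<bar>?C\<bar> < ?N * (\<theta> * ?N - 1)" using N1
      by (smt (verit) mult_right_mono mult_le_cancel_right1)
    then show False using key by (simp add: algebra_simps)
  qed
qed (use \<theta> in simp)

text \<open>If the height is bounded below on a cell then the cell is bounded: otherwise it contains a ray from \<open>e\<close>
  in a direction of recession, along which no coordinate shrinks and at least one grows.\<close>

lemma cell_bounded:
  assumes T: "T \<subseteq> S" and M: "\<And>x. x \<in> cell T \<Longrightarrow> rheight r x \<ge> - M"
  shows "\<exists>R. \<forall>x\<in>cell T. norm x \<le> R"
proof (rule ccontr)
  assume "\<not> ?thesis"
  then have "\<forall>n::nat. \<exists>x\<in>cell T. norm x > real n + 1" by (auto simp: not_le)
  then obtain X where X: "\<And>n. X n \<in> cell T" "\<And>n::nat. norm (X n) > real n + 1" by metis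
  define D where "D n = (1 / norm (X n)) *\<^sub>R X n" for n
  have Np: "norm (X n) > 0" for n using X(2)[of n] by linarith
  have "D n \<in> sphere 0 1" for n using Np[of n] by (simp add: D_def)
  then obtain d \<phi> where d: "d \<in> sphere 0 1" "strict_mono (\<phi> :: nat \<Rightarrow> nat)" "(D \<circ> \<phi>) \<longlonglongrightarrow> d"
    using compact_sphere[of 0 1] unfolding compact_def by (metis (no_types, lifting))
  have d_coord: "e $ i * d $ i \<ge> 0" for i
  proof (rule LIMSEQ_le_const)
    show "(\<lambda>n. e $ i * (D \<circ> \<phi>) n $ i) \<longlonglongrightarrow> e $ i * d $ i" by (intro tendsto_intros d(3))
    have "e $ i * D n $ i \<ge> 0" for n
    proof -
      have "sgn (X n $ i) = sgn (e $ i)" using X(1)[of n] by (simp add: cell_def orth_def)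
      then have "sgn (e $ i * X n $ i) \<ge> 0" by (simp add: sgn_mult)
      then show ?thesis using Np[of n] by (simp add: D_def zero_le_mult_iff zero_le_divide_iff)
    qed
    then show "\<exists>N. \<forall>n\<ge>N. 0 \<le> e $ i * (D \<circ> \<phi>) n $ i" by simp
  qed
  have d_ell: "b j \<bullet> d \<le> 0" if j: "j \<in> T" for j
  proof (rule LIMSEQ_le)
    show "(\<lambda>n. b j \<bullet> (D \<circ> \<phi>) n) \<longlonglongrightarrow> b j \<bullet> d" by (intro tendsto_intros d(3))
    show "((\<lambda>n. 1 / (real n + 1)) \<circ> \<phi>) \<longlonglongrightarrow> 0"
      by (rule LIMSEQ_subseq_LIMSEQ[OF _ d(2)]) (use LIMSEQ_inverse_real_of_nat in \<open>simp add: inverse_eq_divide add.commute\<close>)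
    have "b j \<bullet> D n \<le> 1 / (real n + 1)" for n
    proof -
      have "b j \<bullet> X n \<le> 1" using X(1)[of n] j by (simp add: cell_def ell_eq_inner)
      then have "b j \<bullet> D n \<le> 1 / norm (X n)" using Np[of n] by (simp add: D_def divide_right_mono)
      also have "\<dots> \<le> 1 / (real n + 1)" using X(2)[of n] by (intro divide_left_mono) (auto intro!: mult_pos_pos Np)
      finally show ?thesis .
    qed
    then show "\<exists>N. \<forall>n\<ge>N. b j \<bullet> (D \<circ> \<phi>) n \<le> ((\<lambda>n. 1 / (real n + 1)) \<circ> \<phi>) n" by simp
  qed
  have "d \<noteq> 0" using d(1) by auto
  then obtain i where i: "d $ i \<noteq> 0" by (auto simp: vec_eq_iff)
  have grow: "\<bar>e $ k + t * d $ k\<bar> = \<bar>e $ k\<bar> + t * \<bar>d $ k\<bar>" "sgn (e $ k + t * d $ k) = sgn (e $ k)" if t: "t \<ge> 0" for t k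
  proof -
    consider "e $ k > 0" "d $ k \<ge> 0" | "e $ k < 0" "d $ k \<le> 0"
      using d_coord[of k] e_nz[of k] by (auto simp: zero_le_mult_iff)
    then have "\<bar>e $ k + t * d $ k\<bar> = \<bar>e $ k\<bar> + t * \<bar>d $ k\<bar> \<and> sgn (e $ k + t * d $ k) = sgn (e $ k)"
    proof cases
      case 1
      then have "t * d $ k \<ge> 0" using t by simp
      then show ?thesis using 1 by (auto simp: abs_if)
    next
      case 2
      then have "t * d $ k \<le> 0" using t by (simp add: mult_nonneg_nonpos)
      then show ?thesis using 2 by (auto simp: abs_if)
    qed
    then show "\<bar>e $ k + t * d $ k\<bar> = \<bar>e $ k\<bar> + t * \<bar>d $ k\<bar>" "sgn (e $ k + t * d $ k) = sgn (e $ k)" by auto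
  qed
  have ray: "e + t *\<^sub>R d \<in> cell T" if t: "t \<ge> 0" for t
  proof -
    have "ell (b j) (e + t *\<^sub>R d) \<ge> 0" if j: "j \<in> T" for j
    proof -
      have "t * (b j \<bullet> d) \<le> 0" using t d_ell[OF j] by (simp add: mult_nonneg_nonpos)
      then show ?thesis using e_pos[of j] j T by (auto simp: ell_add_scaleR)
    qed
    then show ?thesis using grow(2)[OF t] by (simp add: cell_def orth_def)
  qed
  define c where "c = (\<Sum>k\<in>UNIV - {i}. r $ k * ln \<bar>e $ k\<bar>)"
  define t where "t = exp ((M + 1 - c) / r $ i) / \<bar>d $ i\<bar>"
  have t0: "t \<ge> 0" by (simp add: t_def)
  have "c \<le> (\<Sum>k\<in>UNIV - {i}. r $ k * ln \<bar>(e + t *\<^sub>R d) $ k\<bar>)"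
    unfolding c_def
  proof (intro sum_mono mult_left_mono)
    fix k
    have "\<bar>e $ k\<bar> \<le> \<bar>(e + t *\<^sub>R d) $ k\<bar>" using grow(1)[OF t0, of k] t0 by simp
    then show "ln \<bar>e $ k\<bar> \<le> ln \<bar>(e + t *\<^sub>R d) $ k\<bar>" using e_nz[of k] by simp
  qed (use r_pos in \<open>auto intro: less_imp_le\<close>)
  moreover have "M + 1 - c \<le> r $ i * ln \<bar>(e + t *\<^sub>R d) $ i\<bar>"
  proof -
    have "exp ((M + 1 - c) / r $ i) = t * \<bar>d $ i\<bar>" using i by (simp add: t_def)
    also have "\<dots> \<le> \<bar>(e + t *\<^sub>R d) $ i\<bar>" using grow(1)[OF t0, of i] by simp
    finally have "(M + 1 - c) / r $ i \<le> ln \<bar>(e + t *\<^sub>R d) $ i\<bar>"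
      by (metis exp_gt_zero ln_exp ln_mono order_less_le_trans)
    then show ?thesis using r_pos[of i] by (simp add: pos_divide_le_eq mult.commute)
  qed
  moreover have "rheight r (e + t *\<^sub>R d) = - (r $ i * ln \<bar>(e + t *\<^sub>R d) $ i\<bar>) - (\<Sum>k\<in>UNIV - {i}. r $ k * ln \<bar>(e + t *\<^sub>R d) $ k\<bar>)"
    unfolding rheight_def by (subst sum.remove[of UNIV i]) auto
  ultimately show False using M[OF ray[OF t0]] by linarith
qed

text \<open>First order conditions. The active forms are independent, so every descent direction that does not leave the
  cell can be tested separately: directions orthogonal to the active forms show that the gradient is a combination
  of these, and dual directions show that the coefficients are nonnegative. The tangent inequality at nearby points of
  the cell, passed to the limit, takes the place of differentiating the objective.\<close>

lemma minimises_multipliers: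
  assumes T: "T \<subseteq> S" and \<theta>: "\<theta> \<ge> 0" and y: "minimises \<theta> T y"
  obtains c where "\<And>j. c j \<ge> 0" "\<And>j. c j > 0 \<Longrightarrow> j \<in> T \<and> ell (b j) y = 0" "descent \<theta> y = dual_sum b (wall y) c"
proof -
  have yc: "y \<in> cell T" and yo: "y \<in> orth" using y by (auto simp: minimises_def cell_def)
  define A where "A = {j \<in> T. ell (b j) y = 0}"
  have A: "A \<subseteq> wall y" using T by (auto simp: A_def wall_def)
  have finA: "finite A" using finite_subset[OF A finite_wall] .
  have injA: "inj_on b A" using inj_on_subset[OF wall_indep(1) A] .
  have indA: "independent (b ` A)" using independent_mono[OF wall_indep(2) image_mono[OF A]] .
  have dirs: "descent \<theta> y \<bullet> v \<le> 0" if v: "\<And>j. j \<in> A \<Longrightarrow> b j \<bullet> v \<le> 0" for v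
  proof -
    let ?y = "\<lambda>t. y + t *\<^sub>R v"
    have lim: "(?y \<longlongrightarrow> y) (at_right 0)"
    proof -
      have "(?y \<longlongrightarrow> y + 0 *\<^sub>R v) (at_right 0)" by (intro tendsto_intros)
      then show ?thesis by simp
    qed
    have comp: "((\<lambda>t. ?y t $ i) \<longlongrightarrow> y $ i) (at_right 0)" for i by (rule tendsto_vec_nth[OF lim])
    have "eventually (\<lambda>t. \<forall>i\<in>UNIV. sgn (?y t $ i) = sgn (y $ i)) (at_right 0)"
      by (intro eventually_ball_finite finite ballI eventually_sgn_eq comp orth_nz[OF yo])
    then have e1: "eventually (\<lambda>t. ?y t \<in> orth) (at_right 0)"
      by (rule eventually_mono) (use yo in \<open>simp add: orth_def\<close>)
    have "eventually (\<lambda>t. sgn (ell (b j) (?y t)) = sgn (ell (b j) y)) (at_right 0)" if "j \<in> T - A" for j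
    proof (rule eventually_sgn_eq)
      have "((\<lambda>t. ell (b j) y - t * (b j \<bullet> v)) \<longlongrightarrow> ell (b j) y - 0 * (b j \<bullet> v)) (at_right 0)" by (intro tendsto_intros)
      then show "((\<lambda>t. ell (b j) (?y t)) \<longlongrightarrow> ell (b j) y) (at_right 0)" by (simp add: ell_add_scaleR)
      show "ell (b j) y \<noteq> 0" using that by (simp add: A_def)
    qed
    then have e2: "eventually (\<lambda>t. \<forall>j\<in>T - A. sgn (ell (b j) (?y t)) = sgn (ell (b j) y)) (at_right 0)"
      using finite_subset[OF T fin] by (intro eventually_ball_finite) auto
    have e3: "eventually (\<lambda>t::real. t > 0) (at_right 0)" by (rule eventually_at_right_less)
    have ev: "eventually (\<lambda>t. descent \<theta> (?y t) \<bullet> v \<le> 0) (at_right 0)"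
      using eventually_conj[OF e1 eventually_conj[OF e2 e3]]
    proof (rule eventually_mono, elim conjE)
      fix t :: real assume t: "?y t \<in> orth" "\<forall>j\<in>T - A. sgn (ell (b j) (?y t)) = sgn (ell (b j) y)" "t > 0"
      have "ell (b j) (?y t) \<ge> 0" if j: "j \<in> T" for j
      proof (cases "j \<in> A")
        case True
        then have "t * (b j \<bullet> v) \<le> 0" using t(3) v by (simp add: mult_nonneg_nonpos)
        then show ?thesis using True by (simp add: ell_add_scaleR A_def)
      next
        case False
        have "ell (b j) y > 0" using False j yc by (auto simp: A_def cell_def less_le)
        then show ?thesis using bspec[OF t(2), of j] False j by (metis DiffI less_imp_le sgn_greater)
      qed
      then have "?y t \<in> cell T" using t(1) by (simp add: cell_def)
      then have "obj \<theta> y \<le> obj \<theta> (?y t)" using y by (simp add: minimises_def)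
      moreover have "obj \<theta> y \<ge> obj \<theta> (?y t) - descent \<theta> (?y t) \<bullet> (y - ?y t)" by (rule obj_tangent(1)[OF yo t(1) \<theta>])
      moreover have "descent \<theta> (?y t) \<bullet> (y - ?y t) = - (t * (descent \<theta> (?y t) \<bullet> v))" by simp
      ultimately have "t * (descent \<theta> (?y t) \<bullet> v) \<le> 0" by linarith
      then show "descent \<theta> (?y t) \<bullet> v \<le> 0" using t(3) by (simp add: mult_le_0_iff)
    qed
    have "((\<lambda>t. descent \<theta> (?y t) \<bullet> v) \<longlongrightarrow> descent \<theta> y \<bullet> v) (at_right 0)"
      unfolding descent_def by (intro tendsto_inner tendsto_const tendsto_vec_lambda tendsto_diff tendsto_divide tendsto_mult comp orth_nz[OF yo])
    then show ?thesis by (rule tendsto_upperbound[OF _ ev trivial_limit_at_right_real])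
  qed
  obtain u z where uz: "u \<in> span (b ` A)" "\<And>w. w \<in> span (b ` A) \<Longrightarrow> orthogonal z w" "descent \<theta> y = u + z"
    using orthogonal_subspace_decomp_exists[of "b ` A" "descent \<theta> y"] by blast
  have "b j \<bullet> z \<le> 0" if "j \<in> A" for j
    using uz(2)[OF span_base[of "b j"]] that by (simp add: orthogonal_def inner_commute)
  from dirs[OF this] have "u \<bullet> z + z \<bullet> z \<le> 0" by (simp add: uz(3) inner_add_left)
  moreover have "u \<bullet> z = 0" using uz(2)[OF uz(1)] by (simp add: orthogonal_def inner_commute)
  ultimately have "z = 0" by (metis add_0 inner_ge_zero inner_eq_zero_iff antisym)
  then have "descent \<theta> y \<in> span (b ` A)" using uz by simp
  then obtain g where "descent \<theta> y = (\<Sum>v\<in>b ` A. g v *\<^sub>R v)"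
    using span_finite[of "b ` A"] finA by auto
  then have g: "descent \<theta> y = (\<Sum>j\<in>A. g (b j) *\<^sub>R b j)" by (simp add: sum.reindex[OF injA])
  have gpos: "g (b k) \<ge> 0" if k: "k \<in> A" for k
  proof -
    obtain w where w: "\<forall>u\<in>b ` A. u \<bullet> w = (if u = b k then - 1 else 0)"
      using dual_vector_exists[OF indA, of "\<lambda>u. if u = b k then - 1 else 0"] by blast
    have "descent \<theta> y \<bullet> w = (\<Sum>j\<in>A. if j = k then - g (b j) else 0)"
      unfolding g inner_sum_left using w k injA by (intro sum.cong refl) (auto simp: inj_on_eq_iff)
    then have "descent \<theta> y \<bullet> w = - g (b k)" using k finA by simp
    moreover have "descent \<theta> y \<bullet> w \<le> 0" using w by (intro dirs) auto
    ultimately show ?thesis by simp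
  qed
  show ?thesis
  proof (rule that[of "\<lambda>j. if j \<in> A then g (b j) else 0"])
    show "(if j \<in> A then g (b j) else 0) \<ge> 0" for j using gpos by simp
    show "j \<in> T \<and> ell (b j) y = 0" if "(if j \<in> A then g (b j) else 0) > 0" for j
      using that by (auto simp: A_def split: if_splits)
    have "(\<Sum>j\<in>wall y. (if j \<in> A then g (b j) else 0) *\<^sub>R b j) = (\<Sum>j\<in>A. g (b j) *\<^sub>R b j)"
      using A finite_wall by (intro sum.mono_neutral_cong_right) auto
    then show "descent \<theta> y = dual_sum b (wall y) (\<lambda>j. if j \<in> A then g (b j) else 0)" by (simp add: g dual_sum_def)
  qed
qed

lemma multipliers_unique:
  assumes "dual_sum b (wall y) c = dual_sum b (wall y) c'" and k: "k \<in> wall y"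
  shows "c k = c' k"
proof -
  obtain w where w: "\<forall>u\<in>b ` wall y. u \<bullet> w = (if u = b k then 1 else 0)"
    using dual_vector_exists[OF wall_indep(2)[of y], of "\<lambda>u. if u = b k then 1 else 0"] by blast
  have "dual_sum b (wall y) c \<bullet> w = c k" for c
  proof -
    have "dual_sum b (wall y) c \<bullet> w = (\<Sum>j\<in>wall y. if j = k then c j else 0)"
      unfolding dual_sum_def inner_sum_left using w k by (intro sum.cong refl) (auto dest: inj_onD[OF wall_indep(1)])
    then show ?thesis using k finite_wall by simp
  qed
  then show ?thesis using assms(1) by metis
qed

text \<open>First order conditions are sufficient by convexity; strictness gives uniqueness of the minimiser.\<close>

lemma multipliers_minimise:
  assumes yo: "y \<in> orth" and \<theta>: "\<theta> \<ge> 0" and c: "\<And>j. c j \<ge> 0" "descent \<theta> y = dual_sum b (wall y) c"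
    and T: "{j \<in> wall y. c j > 0} \<subseteq> T" "\<And>j. j \<in> T \<Longrightarrow> ell (b j) y \<ge> 0" and x: "x \<in> cell T"
  shows "obj \<theta> y \<le> obj \<theta> x" and "x \<noteq> y \<Longrightarrow> obj \<theta> y < obj \<theta> x"
proof -
  have xo: "x \<in> orth" using x by (simp add: cell_def)
  have "descent \<theta> y \<bullet> (x - y) = (\<Sum>j\<in>wall y. c j * (b j \<bullet> (x - y)))"
    unfolding c(2) dual_sum_def inner_sum_left by simp
  also have "\<dots> \<le> 0"
  proof (rule sum_nonpos)
    fix j assume j: "j \<in> wall y"
    have e: "b j \<bullet> (x - y) = - ell (b j) x" using j by (simp add: wall_def ell_eq_inner inner_diff_right)
    show "c j * (b j \<bullet> (x - y)) \<le> 0"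
    proof (cases "c j > 0")
      case True
      then have "ell (b j) x \<ge> 0" using T(1) x j by (auto simp: cell_def)
      then show ?thesis unfolding e using c(1)[of j] by (simp add: mult_nonneg_nonpos)
    next
      case False
      then have "c j = 0" using c(1)[of j] by simp
      then show ?thesis by simp
    qed
  qed
  finally have d: "descent \<theta> y \<bullet> (x - y) \<le> 0" .
  show "obj \<theta> y \<le> obj \<theta> x" using obj_tangent(1)[OF xo yo \<theta>] d by linarith
  show "obj \<theta> y < obj \<theta> x" if "x \<noteq> y" using obj_tangent(2)[OF xo yo \<theta> that] d by linarith
qed

lemma minimiser_unique:
  assumes T: "T \<subseteq> S" and \<theta>: "\<theta> \<ge> 0" and y: "minimises \<theta> T y" "minimises \<theta> T x"
  shows "x = y"
proof (rule ccontr)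
  assume ne: "x \<noteq> y"
  obtain c where c: "\<And>j. c j \<ge> 0" "\<And>j. c j > 0 \<Longrightarrow> j \<in> T \<and> ell (b j) y = 0" "descent \<theta> y = dual_sum b (wall y) c"
    using minimises_multipliers[OF T \<theta> y(1)] by blast
  have "obj \<theta> y < obj \<theta> x"
    by (rule multipliers_minimise(2)[OF _ \<theta> c(1,3) _ _ _ ne, of T]) (use y c(2) in \<open>auto simp: minimises_def cell_def\<close>)
  then show False using y by (auto simp: minimises_def not_less)
qed

text \<open>The index sets with a given minimiser form an interval, from the support of the multipliers to the set of
  all forms that are nonnegative at the minimiser.\<close>

lemma minimises_interval:
  assumes T0: "T0 \<subseteq> S" and \<theta>: "\<theta> \<ge> 0" and y: "minimises \<theta> T0 y"
  obtains c where "\<And>j. c j \<ge> 0" "descent \<theta> y = dual_sum b (wall y) c"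
    "\<And>T. T \<subseteq> S \<and> minimises \<theta> T y \<longleftrightarrow> {j \<in> wall y. c j > 0} \<subseteq> T \<and> T \<subseteq> {j \<in> S. ell (b j) y \<ge> 0}"
proof -
  obtain c where c: "\<And>j. c j \<ge> 0" "\<And>j. c j > 0 \<Longrightarrow> j \<in> T0 \<and> ell (b j) y = 0" "descent \<theta> y = dual_sum b (wall y) c"
    using minimises_multipliers[OF T0 \<theta> y] by blast
  have yo: "y \<in> orth" using y by (simp add: minimises_def cell_def)
  show ?thesis
  proof (rule that[OF c(1,3)], rule iffI)
    fix T assume T: "T \<subseteq> S \<and> minimises \<theta> T y"
    then obtain c' where c': "\<And>j. c' j \<ge> 0" "\<And>j. c' j > 0 \<Longrightarrow> j \<in> T \<and> ell (b j) y = 0" "descent \<theta> y = dual_sum b (wall y) c'"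
      using minimises_multipliers[of T, OF _ \<theta>] by blast
    have "c j = c' j" if "j \<in> wall y" for j by (rule multipliers_unique[OF _ that]) (use c c' in simp)
    then show "{j \<in> wall y. c j > 0} \<subseteq> T \<and> T \<subseteq> {j \<in> S. ell (b j) y \<ge> 0}"
      using c'(2) T by (auto simp: minimises_def cell_def)
  next
    fix T assume T: "{j \<in> wall y. c j > 0} \<subseteq> T \<and> T \<subseteq> {j \<in> S. ell (b j) y \<ge> 0}"
    then have "obj \<theta> y \<le> obj \<theta> x" if "x \<in> cell T" for x
      by (intro multipliers_minimise(1)[OF yo \<theta> c(1,3) _ _ that]) auto
    then show "T \<subseteq> S \<and> minimises \<theta> T y" using T yo by (auto simp: minimises_def cell_def)
  qed
qed

end

section \<open>Growth of the fibres\<close>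

lemma (in direction) fibre_decays:
  assumes "finite S" "off_walls b S x" "rheight r x < h"
  shows "decays r h (fibre b S q x)"
proof (rule decays_of_point_bound)
  show "cmod (fibre b S q x s) \<le> (\<Prod>j\<in>S. inverse \<bar>ell (b j) x\<bar> ^ q j) * exp (- (\<Sum>i\<in>UNIV. real_of_int (s $ i) * ln \<bar>x $ i\<bar>))"
    if "\<forall>i. s $ i \<ge> 1" for s
    using assms that by (intro fibre_term_bound(2)) (auto simp: off_walls_def)
  show "- (\<Sum>i\<in>UNIV. r $ i * ln \<bar>x $ i\<bar>) < h" using assms(3) by (simp add: rheight_def)
qed

context orthant
begin

definition region :: "nat set \<Rightarrow> (real ^ 'n) set" where
  "region P = {x \<in> orth. \<forall>j\<in>S. sgn (ell (b j) x) = (if j \<in> P then 1 else - 1)}"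

text \<open>An index set whose region is empty gets the zero array. With this convention Moebius inversion runs over all index
  sets, although only the regions that occur carry fibre integrals.\<close>

definition region_fibre :: "(nat \<Rightarrow> nat) \<Rightarrow> nat set \<Rightarrow> int ^ 'n \<Rightarrow> complex" where
  "region_fibre p P s = (if region P = {} then 0 else fibre b S p (SOME x. x \<in> region P) s)"

definition moebius_part :: "(nat \<Rightarrow> nat) \<Rightarrow> nat set \<Rightarrow> int ^ 'n \<Rightarrow> complex" where
  "moebius_part p T s = (\<Sum>P\<in>Pow T. (- 1) ^ card (T - P) * region_fibre p P s)"

text \<open>The alternating sum over the chambers around \<open>y\<close> whose signs are prescribed off \<open>K\<close>: positive for forms that vanish
  at \<open>y\<close>, and the sign at \<open>y\<close> for all others.\<close>

definition star_part :: "(nat \<Rightarrow> nat) \<Rightarrow> real ^ 'n \<Rightarrow> nat set \<Rightarrow> int ^ 'n \<Rightarrow> complex" where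
  "star_part p y K s = (\<Sum>Q\<in>Pow K. (- 1) ^ card (K - Q) * region_fibre p (Q \<union> ({j \<in> S. ell (b j) y \<ge> 0} - K)) s)"

lemma region_off_walls:
  assumes "x \<in> region P" shows "off_walls b S x"
proof -
  have "ell (b j) x \<noteq> 0" if "j \<in> S" for j
  proof
    assume "ell (b j) x = 0"
    moreover have "sgn (ell (b j) x) = (if j \<in> P then 1 else - 1)" using assms that by (simp add: region_def)
    ultimately show False by (cases "j \<in> P") simp_all
  qed
  then show ?thesis using assms orth_nz by (auto simp: off_walls_def region_def)
qed

lemma region_fibre_eq:
  assumes p: "\<And>j. j \<in> S \<Longrightarrow> p j \<ge> 1" and x: "x \<in> region P"
  shows "ev_eq (region_fibre p P) (fibre b S p x)"
proof -
  define x' where "x' = (SOME x. x \<in> region P)"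
  have x': "x' \<in> region P" unfolding x'_def using x by (rule someI)
  have "region_fibre p P = fibre b S p x'" using x by (auto simp: region_fibre_def x'_def fun_eq_iff)
  moreover have "same_chamber b S x' x" using x x' by (auto simp: same_chamber_def region_def orth_def)
  ultimately show ?thesis using fibre_same_chamber[OF fin p region_off_walls[OF x']] by simp
qed

lemma star_in_regions:
  assumes yo: "y \<in> orth" and K: "K \<subseteq> wall y" and \<epsilon>: "\<epsilon> > 0"
  obtains x where "\<And>Q. dist (x Q) y < \<epsilon>" "\<And>Q. Q \<subseteq> K \<Longrightarrow> x Q \<in> region (Q \<union> ({j \<in> S. ell (b j) y \<ge> 0} - K))"
proof -
  obtain x where x: "\<And>Q. dist (x Q) y < \<epsilon>" "\<And>Q i. sgn (x Q $ i) = sgn (y $ i)"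
    "\<And>Q j. j \<in> S - wall y \<Longrightarrow> sgn (ell (b j) (x Q)) = sgn (ell (b j) y)"
    "\<And>Q j. j \<in> wall y \<Longrightarrow> sgn (ell (b j) (x Q)) = (if j \<in> Q then 1 else - 1)"
    using star_points[OF fin orth_nz[OF yo] wall_def wall_indep \<epsilon>] by blast
  show ?thesis
  proof (rule that[of "\<lambda>Q. x (Q \<union> (wall y - K))"])
    show "dist (x (Q \<union> (wall y - K))) y < \<epsilon>" for Q by (rule x(1))
    fix Q assume Q: "Q \<subseteq> K"
    let ?P = "Q \<union> ({j \<in> S. ell (b j) y \<ge> 0} - K)"
    have "sgn (ell (b j) (x (Q \<union> (wall y - K)))) = (if j \<in> ?P then 1 else - 1)" if j: "j \<in> S" for j
    proof (cases "j \<in> wall y")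
      case True
      then have "j \<in> ?P \<longleftrightarrow> j \<in> Q \<union> (wall y - K)" by (auto simp: wall_def)
      then show ?thesis using x(4)[OF True] by simp
    next
      case False
      then have "j \<in> ?P \<longleftrightarrow> ell (b j) y > 0" "ell (b j) y \<noteq> 0" using j K Q by (auto simp: wall_def less_le)
      then show ?thesis using x(3)[of j] False j by (cases "ell (b j) y > 0") auto
    qed
    then show "x (Q \<union> (wall y - K)) \<in> region ?P" using x(2) yo by (auto simp: region_def orth_def)
  qed
qed

text \<open>All these chambers have \<open>y\<close> in their closure, so their fibres can be moved close to \<open>y\<close>.\<close>

lemma star_part_decays:
  assumes p: "\<And>j. j \<in> S \<Longrightarrow> p j \<ge> 1" and yo: "y \<in> orth" and K: "K \<subseteq> wall y" and h: "rheight r y < h"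
  shows "decays r h (star_part p y K)"
proof -
  have "(rheight r \<longlongrightarrow> rheight r y) (nhds y)"
    using isCont_rheight[OF orth_nz[OF yo]] by (simp add: isCont_def tendsto_at_iff_tendsto_nhds)
  from order_tendstoD(2)[OF this h] obtain \<epsilon> where \<epsilon>: "\<epsilon> > 0" "\<And>x. dist x y < \<epsilon> \<Longrightarrow> rheight r x < h"
    by (auto simp: eventually_nhds_metric)
  obtain x where x: "\<And>Q. dist (x Q) y < \<epsilon>" "\<And>Q. Q \<subseteq> K \<Longrightarrow> x Q \<in> region (Q \<union> ({j \<in> S. ell (b j) y \<ge> 0} - K))"
    using star_in_regions[OF yo K \<epsilon>(1)] by blast
  show ?thesis unfolding star_part_def[abs_def]
  proof (intro decays_sum decays_cmult)
    fix Q assume Q: "Q \<in> Pow K"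
    have "decays r h (fibre b S p (x Q))"
      using Q by (intro fibre_decays fin region_off_walls[OF x(2)] \<epsilon>(2) x(1)) auto
    then show "decays r h (region_fibre p (Q \<union> ({j \<in> S. ell (b j) y \<ge> 0} - K)))"
      by (rule decays_ev_eq[OF _ ev_eq_sym[OF region_fibre_eq[OF p x(2)]]]) (use Q in auto)
  qed
qed

lemma star_part_vanishes:
  assumes p: "\<And>j. j \<in> S \<Longrightarrow> p j \<ge> 1" and yo: "y \<in> orth" and K: "K \<subseteq> wall y" and G: "G \<in> power_ideal b p K"
  shows "ev_eq (poly_act G (star_part p y K)) (\<lambda>_. 0)"
proof -
  let ?P = "\<lambda>Q. Q \<union> ({j \<in> S. ell (b j) y \<ge> 0} - K)"
  obtain x where x: "\<And>Q. Q \<subseteq> K \<Longrightarrow> x Q \<in> region (?P Q)"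
    using star_in_regions[OF yo K zero_less_one] by metis
  have KS: "K \<subseteq> S" using K by (auto simp: wall_def)
  have "ev_eq (star_part p y K) (\<lambda>s. \<Sum>Q\<in>Pow K. (- 1) ^ card (K - Q) * fibre b S p (x Q) s)"
    unfolding star_part_def[abs_def] by (intro ev_eq_sum ev_eq_cmult region_fibre_eq p x) auto
  from ev_eq_poly_act[OF this]
  have "ev_eq (poly_act G (star_part p y K)) (poly_act G (\<lambda>s. \<Sum>Q\<in>Pow K. (- 1) ^ card (K - Q) * fibre b S p (x Q) s))" .
  also have "ev_eq \<dots> (\<lambda>_. 0)"
  proof (rule star_vanishing[OF fin KS p _ _ _ _ G])
    fix Q assume Q: "Q \<subseteq> K"
    show "off_walls b S (x Q)" by (rule region_off_walls[OF x[OF Q]])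
    show "sgn (x Q $ i) = sgn (x {} $ i)" for i using x[OF Q] x[of "{}"] by (simp add: region_def orth_def)
    have s: "sgn (ell (b j) (x Q)) = (if j \<in> ?P Q then 1 else - 1)" if "j \<in> S" "Q \<subseteq> K" for j Q
      using x[OF that(2)] that(1) unfolding region_def by blast
    show "sgn (ell (b j) (x Q)) = sgn (ell (b j) (x {}))" if j: "j \<in> S - K" for j
    proof -
      have "j \<in> ?P Q \<longleftrightarrow> j \<in> ?P {}" using j Q by auto
      then show ?thesis using s[of j Q] s[of j "{}"] j Q by simp
    qed
    show "sgn (ell (b j) (x Q)) = (if j \<in> Q then 1 else - 1)" if j: "j \<in> K" for j
    proof -
      have "j \<in> ?P Q \<longleftrightarrow> j \<in> Q" using j by auto
      then show ?thesis using s[of j Q] j Q KS by auto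
    qed
  qed
  finally show ?thesis .
qed

lemma sum_moebius_part:
  assumes K: "K \<subseteq> wall y"
  shows "(\<Sum>T | K \<subseteq> T \<and> T \<subseteq> {j \<in> S. ell (b j) y \<ge> 0}. moebius_part p T s) = star_part p y K s"
proof -
  let ?L = "{j \<in> S. ell (b j) y \<ge> 0}"
  have KL: "K \<subseteq> ?L" using K by (auto simp: wall_def)
  have "finite K" "finite (?L - K)" using fin finite_subset[OF K finite_wall] by auto
  then show ?thesis
    unfolding sum_set_interval[OF KL] moebius_part_def star_part_def by (intro interval_moebius) auto
qed

text \<open>The fibre at \<open>e\<close> splits into the Moebius parts of all index sets, which are grouped according to the
  minimiser of the height over the corresponding cell. A group with a low minimiser is small because its fibres can
  be based near the minimiser; a group with a high minimiser is annihilated. Cells on which the height is unbounded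
  below are treated with a small quadratic term, which keeps their minimisers low.\<close>

theorem fibre_decays_by_minimisers:
  assumes p: "\<And>j. j \<in> S \<Longrightarrow> p j \<ge> 1"
    and crit: "\<And>y K c. y \<in> orth \<Longrightarrow> K \<subseteq> wall y \<Longrightarrow> (\<And>j. j \<in> K \<Longrightarrow> c j > 0) \<Longrightarrow>
      (\<And>i. r $ i / y $ i = dual_sum b K c $ i) \<Longrightarrow> h0 \<le> rheight r y \<Longrightarrow> G \<in> power_ideal b p K"
  shows "decays r h0 (poly_act G (fibre b S p e))"
proof -
  define low where "low T \<longleftrightarrow> (\<exists>M. \<forall>x\<in>cell T. rheight r x \<ge> - M)" for T
  have "\<forall>T. \<exists>M. low T \<longrightarrow> (\<forall>x\<in>cell T. rheight r x \<ge> - M)" unfolding low_def by blast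
  then obtain f where f: "\<And>T x. low T \<Longrightarrow> x \<in> cell T \<Longrightarrow> rheight r x \<ge> - f T" by metis
  have finP: "finite (Pow S)" using fin by simp
  \<comment> \<open>one bound for all cells with height bounded below; it also separates their minimisers from the very low ones of the other cells\<close>
  define M where "M = (\<Sum>T\<in>Pow S. \<bar>f T\<bar>) + \<bar>h0\<bar>"
  have M: "rheight r x \<ge> - M" if "T \<subseteq> S" "low T" "x \<in> cell T" for T x
  proof -
    have "\<bar>f T\<bar> \<le> (\<Sum>T\<in>Pow S. \<bar>f T\<bar>)" using that(1) finP by (intro member_le_sum) auto
    then show ?thesis using f[OF that(2,3)] by (simp add: M_def)
  qed
  have Mh: "- M \<le> h0"
  proof -
    have "(\<Sum>T\<in>Pow S. \<bar>f T\<bar>) \<ge> 0" by (intro sum_nonneg) simp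
    then show ?thesis unfolding M_def by linarith
  qed
  have "\<forall>T. \<exists>w. \<not> low T \<longrightarrow> w \<in> cell T \<and> rheight r w < - (M + 1)" unfolding low_def by (metis not_le)
  then obtain g where g: "\<And>T. \<not> low T \<Longrightarrow> g T \<in> cell T \<and> rheight r (g T) < - (M + 1)" by metis
  \<comment> \<open>so small that the quadratic term is at most one at the low points \<open>g T\<close>\<close>
  define \<theta> where "\<theta> = 1 / (1 + (\<Sum>T\<in>Pow S. g T \<bullet> g T))"
  have den: "1 + (\<Sum>T\<in>Pow S. g T \<bullet> g T) > 0" by (intro add_pos_nonneg sum_nonneg) auto
  have \<theta>: "\<theta> > 0" using den by (simp add: \<theta>_def)
  have \<theta>g: "\<theta> * (g T \<bullet> g T) \<le> 1" if "T \<subseteq> S" for T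
  proof -
    have "g T \<bullet> g T \<le> (\<Sum>T\<in>Pow S. g T \<bullet> g T)" using that finP by (intro member_le_sum) auto
    then show ?thesis using den by (simp add: \<theta>_def divide_le_eq)
  qed
  have ex1: "\<exists>y. minimises 0 T y" if T: "T \<subseteq> S" "low T" for T
  proof -
    obtain R where R: "\<And>x. x \<in> cell T \<Longrightarrow> norm x \<le> R" using cell_bounded[OF T(1) M[OF T]] by blast
    show ?thesis by (rule minimises_exists[OF T(1) order_refl R])
  qed
  have ex2: "\<exists>y. minimises \<theta> T y" if "T \<subseteq> S" for T by (rule minimises_exists_quadratic[OF that \<theta>])
  define Y where "Y T = (if low T then SOME y. minimises 0 T y else SOME y. minimises \<theta> T y)" for T
  have Y1: "minimises 0 T (Y T)" if "T \<subseteq> S" "low T" for T using someI_ex[OF ex1[OF that]] that by (simp add: Y_def)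
  have Y2: "minimises \<theta> T (Y T)" if "T \<subseteq> S" "\<not> low T" for T using someI_ex[OF ex2[OF that(1)]] that by (simp add: Y_def)
  have cellY: "y \<in> cell T" if "minimises t T y" for t T y using that by (simp add: minimises_def)
  have high: "rheight r (Y T) \<ge> - M" if "T \<subseteq> S" "low T" for T by (rule M[OF that cellY[OF Y1[OF that]]])
  have deep: "rheight r (Y T) < - M" if T: "T \<subseteq> S" "\<not> low T" for T
  proof -
    have "obj \<theta> (Y T) \<le> obj \<theta> (g T)" using Y2[OF T] g[OF T(2)] by (simp add: minimises_def)
    moreover have "rheight r (Y T) \<le> obj \<theta> (Y T)" using \<theta> by (simp add: obj_def)
    moreover have "obj \<theta> (g T) < - M" using g[OF T(2)] \<theta>g[OF T(1)] by (simp add: obj_def)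
    ultimately show ?thesis by linarith
  qed
  have low0: "low T" if "minimises 0 T y" for T y
    using that unfolding low_def minimises_def obj_def by (intro exI[of _ "- rheight r y"]) simp
  \<comment> \<open>minimisers of the two kinds of cells never coincide, since their heights lie on different sides of \<open>- M\<close>\<close>
  have group: "\<exists>t\<ge>0. minimises t T0 (Y T0) \<and> (\<forall>T\<in>Pow S. Y T = Y T0 \<longleftrightarrow> minimises t T (Y T0)) \<and> (rheight r (Y T0) < h0 \<or> t = 0)"
    if T0: "T0 \<subseteq> S" for T0
  proof (cases "low T0")
    case True
    have "Y T = Y T0 \<longleftrightarrow> minimises 0 T (Y T0)" if T: "T \<in> Pow S" for T
    proof
      assume eq: "Y T = Y T0"
      have "low T" using deep[of T] high[OF T0 True] eq T by fastforce
      then show "minimises 0 T (Y T0)" using Y1[of T] T eq by simp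
    next
      assume m: "minimises 0 T (Y T0)"
      show "Y T = Y T0" using minimiser_unique[OF _ order_refl m Y1[OF _ low0[OF m]]] T by simp
    qed
    then show ?thesis using Y1[OF T0 True] by (intro exI[of _ 0]) simp
  next
    case False
    have "Y T = Y T0 \<longleftrightarrow> minimises \<theta> T (Y T0)" if T: "T \<in> Pow S" for T
    proof
      assume eq: "Y T = Y T0"
      have "\<not> low T" using high[of T] deep[OF T0 False] eq T by fastforce
      then show "minimises \<theta> T (Y T0)" using Y2[of T] T eq by simp
    next
      assume m: "minimises \<theta> T (Y T0)"
      have "\<not> low T" using M[of T, OF _ _ cellY[OF m]] deep[OF T0 False] T by fastforce
      then show "Y T = Y T0" using minimiser_unique[OF _ less_imp_le[OF \<theta>] m Y2[of T]] T by simp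
    qed
    then show ?thesis using Y2[OF T0 False] deep[OF T0 False] Mh less_imp_le[OF \<theta>] by (intro exI[of _ \<theta>]) auto
  qed
  have part: "decays r h0 (poly_act G (\<lambda>s. \<Sum>T | T \<in> Pow S \<and> Y T = Y T0. moebius_part p T s))" if T0: "T0 \<subseteq> S" for T0
  proof -
    let ?y = "Y T0"
    obtain t where t: "t \<ge> 0" "minimises t T0 ?y" "\<forall>T\<in>Pow S. Y T = ?y \<longleftrightarrow> minimises t T ?y" "rheight r ?y < h0 \<or> t = 0"
      using group[OF T0] by (elim exE conjE) (rule that)
    have yo: "?y \<in> orth" using t(2) by (simp add: minimises_def cell_def)
    obtain c where c: "\<And>j. c j \<ge> 0" "descent t ?y = dual_sum b (wall ?y) c"
      "\<And>T. T \<subseteq> S \<and> minimises t T ?y \<longleftrightarrow> {j \<in> wall ?y. c j > 0} \<subseteq> T \<and> T \<subseteq> {j \<in> S. ell (b j) ?y \<ge> 0}"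
      using minimises_interval[OF T0 t(1,2)] by blast
    define K where "K = {j \<in> wall ?y. c j > 0}"
    have K: "K \<subseteq> wall ?y" by (auto simp: K_def)
    have "{T. T \<in> Pow S \<and> Y T = ?y} = {T. K \<subseteq> T \<and> T \<subseteq> {j \<in> S. ell (b j) ?y \<ge> 0}}"
    proof (intro Collect_cong)
      fix T
      have "T \<in> Pow S \<and> Y T = ?y \<longleftrightarrow> T \<subseteq> S \<and> minimises t T ?y" using t(3) by (metis PowD PowI)
      then show "T \<in> Pow S \<and> Y T = ?y \<longleftrightarrow> K \<subseteq> T \<and> T \<subseteq> {j \<in> S. ell (b j) ?y \<ge> 0}" using c(3)[of T] by (simp only: K_def)
    qed
    then have eq: "(\<lambda>s. \<Sum>T | T \<in> Pow S \<and> Y T = ?y. moebius_part p T s) = star_part p ?y K"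
      using sum_moebius_part[OF K, of p] by (simp only: fun_eq_iff) simp
    show ?thesis unfolding eq
    proof (cases "rheight r ?y < h0")
      case True
      show "decays r h0 (poly_act G (star_part p ?y K))" by (intro decays_poly_act star_part_decays[OF p yo K True])
    next
      case False
      then have t0: "t = 0" using t(4) by simp
      have "dual_sum b (wall ?y) c = dual_sum b K c"
        unfolding dual_sum_def using finite_wall c(1)
        by (intro sum.mono_neutral_right) (auto simp: K_def not_less intro: antisym)
      then have "r $ i / ?y $ i = dual_sum b K c $ i" for i using arg_cong[OF c(2), of "\<lambda>v. v $ i"] by (simp add: t0 descent_def)
      then have G: "G \<in> power_ideal b p K" using False by (intro crit[OF yo K, of c]) (auto simp: K_def)
      show "decays r h0 (poly_act G (star_part p ?y K))"
        by (rule decays_ev_eq[OF decays_zero[of 0 "\<lambda>_. 0"] ev_eq_sym[OF star_part_vanishes[OF p yo K G]]]) simp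
    qed
  qed
  have "e \<in> region S" using e_pos by (auto simp: region_def orth_def)
  then have "ev_eq (region_fibre p S) (fibre b S p e)" by (intro region_fibre_eq p)
  then have "ev_eq (fibre b S p e) (region_fibre p S)" by (rule ev_eq_sym)
  also have "region_fibre p S = (\<lambda>s. \<Sum>T\<in>Pow S. moebius_part p T s)"
  proof
    fix s
    show "region_fibre p S s = (\<Sum>T\<in>Pow S. moebius_part p T s)"
      using interval_moebius[OF fin finite.emptyI, of "\<lambda>P. region_fibre p P s"] by (simp add: moebius_part_def)
  qed
  also have "\<dots> = (\<lambda>s. \<Sum>y\<in>Y ` Pow S. \<Sum>T | T \<in> Pow S \<and> Y T = y. moebius_part p T s)"
    by (rule ext) (rule sum.image_gen[OF finP])
  finally have ev: "ev_eq (fibre b S p e) \<dots>" .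
  have "decays r h0 (poly_act G (\<lambda>s. \<Sum>y\<in>Y ` Pow S. \<Sum>T | T \<in> Pow S \<and> Y T = y. moebius_part p T s))"
    unfolding poly_act_sum_right[of G "\<lambda>y s. \<Sum>T | T \<in> Pow S \<and> Y T = y. moebius_part p T s" "Y ` Pow S", abs_def]
  proof (rule decays_sum)
    fix y assume "y \<in> Y ` Pow S"
    then obtain T0 where "T0 \<subseteq> S" "y = Y T0" by auto
    then show "decays r h0 (poly_act G (\<lambda>s. \<Sum>T | T \<in> Pow S \<and> Y T = y. moebius_part p T s))" using part by simp
  qed
  then show ?thesis by (rule decays_ev_eq[OF _ ev_eq_sym[OF ev_eq_poly_act[OF ev]]])
qed

end

section \<open>Critical points from multipliers\<close>

lemma active_set_cvec: "active_set m b (cvec x) = {j \<in> {1..m}. ell (b j) x = 0}"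
  by (simp add: active_set_def ell_cvec)

lemma simple_arrangement_active:
  assumes "simple_arrangement m b"
  shows "inj_on b (active_set m b \<sigma>)" "independent (b ` active_set m b \<sigma>)"
proof -
  let ?A = "active_set m b \<sigma>"
  have "inj_on b ?A \<and> independent (b ` ?A)"
  proof (cases "?A = {}")
    case True
    then show ?thesis by (simp add: independent_empty)
  next
    case False
    have "\<sigma> \<in> flat b ?A" by (simp add: flat_def active_set_def)
    moreover have "?A \<subseteq> {1..m}" by (auto simp: active_set_def)
    ultimately show ?thesis using assms False unfolding simple_arrangement_def by blast
  qed
  then show "inj_on b ?A" "independent (b ` ?A)" by auto
qed

text \<open>At a real point the derivative of $\ln|z_i|$ in direction $v$ is the real part of $v_i/y_i$.\<close>

lemma height_has_derivative:
  fixes y :: "real ^ 'n::finite"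
  assumes y: "\<And>i. y $ i \<noteq> 0"
  shows "(height r has_derivative (\<lambda>v. - (\<Sum>i\<in>UNIV. r $ i * (Re (v $ i) / y $ i)))) (at (cvec y))"
proof -
  have c: "((\<lambda>z::complex ^ 'n. ln (cmod (z $ i))) has_derivative (\<lambda>v. Re (v $ i) / y $ i)) (at (cvec y))" for i
  proof -
    have lin: "((\<lambda>z::complex ^ 'n. z $ i) has_derivative (\<lambda>v. v $ i)) (at (cvec y))"
      by (rule bounded_linear_imp_has_derivative[OF bounded_linear_vec_nth])
    have nz: "cvec y $ i \<noteq> 0" using y by (simp add: cvec_def)
    have "((\<lambda>z::complex ^ 'n. norm (z $ i)) has_derivative (\<lambda>v. inner (sgn (cvec y $ i)) (v $ i))) (at (cvec y))"
      using has_derivative_compose[OF lin has_derivative_norm[OF nz]] by (simp add: inner_commute)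
    from has_derivative_ln[OF _ this]
    have "((\<lambda>z::complex ^ 'n. ln (cmod (z $ i))) has_derivative (\<lambda>v. inner (sgn (cvec y $ i)) (v $ i) * inverse (cmod (cvec y $ i)))) (at (cvec y))"
      using nz by simp
    moreover have "inner (sgn (cvec y $ i)) w * inverse (cmod (cvec y $ i)) = Re w / y $ i" for w
      using y[of i] by (cases "y $ i > 0") (simp_all add: cvec_def sgn_div_norm inner_complex_def field_simps)
    ultimately show ?thesis by simp
  qed
  show ?thesis unfolding height_def[abs_def]
    by (intro has_derivative_minus has_derivative_sum has_derivative_mult_right c)
qed

context direction
begin

lemma critical_on_flat:
  fixes y :: "real ^ 'n"
  assumes y: "\<And>i. y $ i \<noteq> 0" and z: "cvec y \<in> flat b K'" and K: "K \<subseteq> K'"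
    and c: "\<And>i. r $ i / y $ i = dual_sum b K c $ i"
  shows "critical_on r (flat b K') (cvec y)"
proof -
  let ?D = "\<lambda>v::complex ^ 'n. - (\<Sum>i\<in>UNIV. r $ i * (Re (v $ i) / y $ i))"
  have zero: "?D (w - cvec y) = 0" if w: "w \<in> flat b K'" for w
  proof -
    have j0: "(\<Sum>i\<in>UNIV. b j $ i * Re ((w - cvec y) $ i)) = 0" if j: "j \<in> K" for j
    proof -
      have "ell (b j) w = 0" "ell (b j) (cvec y) = 0" using w z j K by (auto simp: flat_def)
      then have "(\<Sum>i\<in>UNIV. of_real (b j $ i) * w $ i) - (\<Sum>i\<in>UNIV. of_real (b j $ i) * cvec y $ i) = 0"
        by (simp add: ell_def)
      then have "(\<Sum>i\<in>UNIV. of_real (b j $ i) * (w - cvec y) $ i) = 0"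
        by (simp add: sum_subtractf right_diff_distrib)
      from arg_cong[OF this, of Re] show ?thesis by simp
    qed
    have "(\<Sum>i\<in>UNIV. r $ i * (Re ((w - cvec y) $ i) / y $ i)) = (\<Sum>i\<in>UNIV. \<Sum>j\<in>K. c j * (b j $ i * Re ((w - cvec y) $ i)))"
    proof (intro sum.cong refl)
      fix i
      have "r $ i * (Re ((w - cvec y) $ i) / y $ i) = (r $ i / y $ i) * Re ((w - cvec y) $ i)" by simp
      also have "\<dots> = (\<Sum>j\<in>K. c j * (b j $ i * Re ((w - cvec y) $ i)))"
        unfolding c dual_sum_def by (simp add: sum_distrib_right mult.assoc)
      finally show "r $ i * (Re ((w - cvec y) $ i) / y $ i) = (\<Sum>j\<in>K. c j * (b j $ i * Re ((w - cvec y) $ i)))" .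
    qed
    also have "\<dots> = (\<Sum>j\<in>K. c j * (\<Sum>i\<in>UNIV. b j $ i * Re ((w - cvec y) $ i)))"
      by (subst sum.swap) (simp add: sum_distrib_left)
    also have "\<dots> = 0" using j0 by (intro sum.neutral) auto
    finally show ?thesis by simp
  qed
  have hd: "(height r has_derivative ?D) (at (cvec y) within flat b K')"
    by (rule has_derivative_at_withinI[OF height_has_derivative[OF y]])
  have bl: "bounded_linear ?D" using has_derivative_bounded_linear[OF hd] .
  have "((\<lambda>w. ?D (w - cvec y)) has_derivative ?D) (at (cvec y) within flat b K')"
    by (rule bounded_linear.has_derivative[OF bl]) (auto intro!: derivative_eq_intros)
  from has_derivative_diff[OF hd this]
  have d0: "((\<lambda>w. height r w - ?D (w - cvec y)) has_derivative (\<lambda>_. 0)) (at (cvec y) within flat b K')" by simp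
  have "(height r has_derivative (\<lambda>_. 0)) (at (cvec y) within flat b K')"
    by (rule has_derivative_transform[OF z _ d0]) (use zero in simp)
  then show ?thesis using z y by (simp add: critical_on_def cvec_def)
qed

text \<open>Positive multipliers make a point critical on its flat and on every smaller flat through it; by genericity
  these flats coincide.\<close>

lemma multipliers_contributing:
  fixes y :: "real ^ 'n"
  assumes simple: "simple_arrangement m b" and generic: "generic_direction m b r"
    and y: "\<And>i. y $ i \<noteq> 0" and K: "K \<subseteq> active_set m b (cvec y)"
    and c: "\<And>j. j \<in> K \<Longrightarrow> c j > 0" "\<And>i. r $ i / y $ i = dual_sum b K c $ i"
  shows "K = active_set m b (cvec y)" and "contributing m b r (cvec y)"
proof -
  let ?A = "active_set m b (cvec y)"
  have AS: "?A \<subseteq> {1..m}" by (auto simp: active_set_def)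
  have K0: "K \<noteq> {}"
  proof
    assume "K = {}"
    then have "r $ i / y $ i = 0" for i using c(2)[of i] by (simp add: dual_sum_def)
    then show False using r_pos y by (metis divide_eq_0_iff less_irrefl)
  qed
  have zA: "cvec y \<in> flat b ?A" by (simp add: flat_def active_set_def)
  then have zK: "cvec y \<in> flat b K" using K by (auto simp: flat_def)
  have cA: "critical_on r (flat b ?A) (cvec y)" by (rule critical_on_flat[OF y zA K c(2)])
  have cK: "critical_on r (flat b K) (cvec y)" by (rule critical_on_flat[OF y zK order_refl c(2)])
  have fA: "flat b ?A \<in> flats m b" using AS K K0 zA unfolding flats_def by blast
  have fK: "flat b K \<in> flats m b" using AS K K0 zK unfolding flats_def by blast
  have same: "flat b K = (flat b ?A :: (complex ^ 'n) set)" using generic cA cK fA fK unfolding generic_direction_def by blast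
  show KA: "K = ?A"
  proof (rule ccontr)
    assume "K \<noteq> ?A"
    then obtain k where k: "k \<in> ?A" "k \<notin> K" using K by blast
    obtain w where w: "\<forall>u\<in>b ` ?A. u \<bullet> w = (if u = b k then 1 else 0)"
      using dual_vector_exists[OF simple_arrangement_active(2)[OF simple, of "cvec y"], of "\<lambda>u. if u = b k then 1 else 0"] by blast
    have ew: "ell (b j) (y + w) = - (if j = k then 1 else 0)" if j: "j \<in> ?A" for j
    proof -
      have "b j = b k \<longleftrightarrow> j = k" using simple_arrangement_active(1)[OF simple, of "cvec y"] j k(1) by (meson inj_onD)
      moreover have "ell (b j) y = 0" using j by (simp add: active_set_cvec)
      ultimately show ?thesis using ell_add_scaleR[of "b j" y 1 w] w j by simp
    qed
    have "cvec (y + w) \<in> flat b K" using ew k K by (auto simp: flat_def ell_cvec)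
    moreover have "cvec (y + w) \<notin> flat b ?A" using ew[OF k(1)] k(1) by (auto simp: flat_def ell_cvec intro!: bexI[of _ k])
    ultimately show False using same by blast
  qed
  have "(\<chi> i. complex_of_real (r $ i) / cvec y $ i) = cvec (\<Sum>j\<in>?A. c j *\<^sub>R b j)"
    using c(2) KA by (simp add: cvec_def dual_sum_def vec_eq_iff flip: of_real_divide)
  moreover have "(\<Sum>j\<in>?A. c j *\<^sub>R b j) \<in> normal_cone m b (cvec y)"
    using c(1) KA unfolding normal_cone_def by blast
  ultimately show "contributing m b r (cvec y)"
    using cA fA unfolding contributing_def critical_point_def by blast
qed

text \<open>The normal cone is real, so the critical equation forces real coordinates.\<close>

lemma contributing_real:
  assumes "contributing m b r \<sigma>"
  obtains x c where "\<sigma> = cvec x" "\<And>i. x $ i \<noteq> 0" "\<And>j. j \<in> active_set m b \<sigma> \<Longrightarrow> c j > 0"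
    "\<And>i. r $ i / x $ i = dual_sum b (active_set m b \<sigma>) c $ i"
proof -
  have nz: "\<sigma> $ i \<noteq> 0" for i using assms by (auto simp: contributing_def critical_point_def critical_on_def)
  obtain n where n: "n \<in> normal_cone m b \<sigma>" "(\<chi> i. complex_of_real (r $ i) / \<sigma> $ i) = cvec n"
    using assms by (auto simp: contributing_def)
  obtain c where c: "\<forall>j\<in>active_set m b \<sigma>. c j > 0" "n = (\<Sum>j\<in>active_set m b \<sigma>. c j *\<^sub>R b j)"
    using n(1) unfolding normal_cone_def by blast
  have ni: "complex_of_real (r $ i) / \<sigma> $ i = of_real (n $ i)" for i
    using arg_cong[OF n(2), of "\<lambda>v. v $ i"] by (simp add: cvec_def)
  have rn: "r $ i \<noteq> 0" for i using r_pos[of i] by simp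
  have nn: "n $ i \<noteq> 0" for i using ni[of i] nz[of i] rn[of i] by auto
  show ?thesis
  proof (rule that[of "\<chi> i. r $ i / n $ i" c])
    show "\<sigma> = cvec (\<chi> i. r $ i / n $ i)"
      using ni nz nn by (simp add: cvec_def vec_eq_iff field_simps)
    show "(\<chi> i. r $ i / n $ i) $ i \<noteq> 0" for i using rn nn by simp
    show "c j > 0" if "j \<in> active_set m b \<sigma>" for j using c(1) that by blast
    show "r $ i / (\<chi> i. r $ i / n $ i) $ i = dual_sum b (active_set m b \<sigma>) c $ i" for i
      using rn[of i] nn[of i] c(2) by (simp add: dual_sum_def)
  qed
qed

text \<open>One fibre integral for each orthant; a minimiser above \<open>h0\<close> is a contributing point, where the assumption applies.\<close>

lemma coefficients_decay:
  fixes b :: "nat \<Rightarrow> real ^ 'n"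
  assumes a: "has_power_series_at_0 (ratfun m b p G) a" and p: "\<And>j. j \<in> {1..m} \<Longrightarrow> p j \<ge> 1"
    and simple: "simple_arrangement m b" and generic: "generic_direction m b r"
    and out: "\<And>\<sigma>'. contributing m b r \<sigma>' \<Longrightarrow> h0 \<le> height r \<sigma>' \<Longrightarrow> G \<in> power_ideal b p (active_set m b \<sigma>')"
  shows "decays r h0 (zext a)"
proof -
  let ?w = "\<lambda>\<delta> E. complex_of_real (\<Prod>i\<in>UNIV. sgn (orthant_point \<delta> E $ i))"
  obtain \<delta> where \<delta>: "\<delta> > 0" "\<And>j E. j \<in> {1..m} \<Longrightarrow> ell (b j) (orthant_point \<delta> E) > 0"
    "ev_eq (zext a) (poly_act G (\<lambda>s. \<Sum>E\<in>Pow UNIV. ?w \<delta> E * fibre b {1..m} p (orthant_point \<delta> E) s))"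
    using coefficients_signed_fibres[OF a p] by blast
  have "decays r h0 (poly_act G (fibre b {1..m} p (orthant_point \<delta> E)))" for E :: "'n set"
  proof -
    interpret orthant r b "{1..m}" "orthant_point \<delta> E"
    proof
      show "orthant_point \<delta> E $ i \<noteq> 0" for i using \<delta>(1) by (simp add: orthant_point_def)
      show "inj_on b {j \<in> {1..m}. ell (b j) x = 0}" "independent (b ` {j \<in> {1..m}. ell (b j) x = 0})" for x :: "real ^ 'n"
        using simple_arrangement_active[OF simple, of "cvec x"] unfolding active_set_cvec by blast+
    qed (use \<delta>(2) in auto)
    show ?thesis
    proof (rule fibre_decays_by_minimisers[OF p])
      fix y K c assume y: "y \<in> orth" and K: "K \<subseteq> wall y" and c: "\<And>j. j \<in> K \<Longrightarrow> c j > 0" "\<And>i. r $ i / y $ i = dual_sum b K c $ i"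
        and h: "h0 \<le> rheight r y"
      have K': "K \<subseteq> active_set m b (cvec y)" using K unfolding wall_def active_set_cvec .
      note m = multipliers_contributing[OF simple generic orth_nz[OF y] K' c]
      show "G \<in> power_ideal b p K" using out[OF m(2)] h m(1) by (simp add: height_cvec)
    qed
  qed
  then have "decays r h0 (poly_act G (\<lambda>s. \<Sum>E\<in>Pow UNIV. ?w \<delta> E * fibre b {1..m} p (orthant_point \<delta> E) s))"
    unfolding poly_act_sum_right[abs_def] poly_act_linear by (intro decays_sum decays_cmult)
  then show ?thesis by (rule decays_ev_eq[OF _ ev_eq_sym[OF \<delta>(3)]])
qed

text \<open>All forms are positive at the base points near the origin, so the signs of the expansion are exactly the
  weights required for the lower bound, and the orthant of \<open>x\<close> occurs.\<close>

lemma coefficients_not_decay: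
  fixes x :: "real ^ 'n"
  assumes a: "has_power_series_at_0 (ratfun m b p G) a" and p: "\<And>j. j \<in> {1..m} \<Longrightarrow> p j \<ge> 1"
    and K: "K \<subseteq> {1..m}" "inj_on b K" "independent (b ` K)"
    and x: "\<And>i. x $ i \<noteq> 0" and flat: "\<And>j. j \<in> K \<Longrightarrow> ell (b j) x = 0"
    and c: "\<And>j. j \<in> K \<Longrightarrow> c j > 0" and crit: "\<And>i. r $ i / x $ i = dual_sum b K c $ i"
    and G: "G \<notin> power_ideal b p K"
  shows "\<not> decays r (rheight r x) (zext a)"
proof
  assume d: "decays r (rheight r x) (zext a)"
  obtain \<delta> where \<delta>: "\<delta> > 0" "\<And>j E. j \<in> {1..m} \<Longrightarrow> ell (b j) (orthant_point \<delta> E) > 0"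
    "ev_eq (zext a) (poly_act G (\<lambda>s. \<Sum>E\<in>Pow UNIV. of_real (\<Prod>i\<in>UNIV. sgn (orthant_point \<delta> E $ i)) * fibre b {1..m} p (orthant_point \<delta> E) s))"
    using coefficients_signed_fibres[OF a p] by blast
  have one: "(\<Prod>j\<in>K. sgn (ell (b j) (orthant_point \<delta> E))) = (1::real)" for E
    using \<delta>(2) K(1) by (intro prod.neutral) auto
  have off: "off_walls b {1..m} (orthant_point \<delta> E)" for E
    using \<delta>(1) less_imp_neq[OF \<delta>(2)] by (auto simp: off_walls_def orthant_point_def)
  have nd: "\<not> decays r (rheight r x) (poly_act G (\<lambda>s. \<Sum>E\<in>Pow UNIV. of_real ((\<Prod>i\<in>UNIV. sgn (orthant_point \<delta> E $ i)) * (\<Prod>j\<in>K. sgn (ell (b j) (orthant_point \<delta> E)))) * fibre b {1..m} p (orthant_point \<delta> E) s))"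
  proof (rule full_fibres_lower_bound[where c=c and x=x and ?B0.0="{i. x $ i > 0}"])
    show "sgn (orthant_point \<delta> {i. x $ i > 0} $ i) = sgn (x $ i)" for i
      using \<delta>(1) x[of i] by (cases "x $ i > 0") (auto simp: orthant_point_def)
  qed (use assms \<delta>(2) off in auto)
  show False by (rule notE[OF nd[unfolded one mult_1_right] decays_ev_eq[OF d \<delta>(3)]])
qed


text \<open>The weight of a chamber is, up to a global sign, the parity of the number of negative forms.\<close>

lemma contribution_vanishes:
  fixes x :: "real ^ 'n"
  assumes p: "\<And>j. j \<in> {1..m} \<Longrightarrow> p j \<ge> 1" and K: "K = {j \<in> {1..m}. ell (b j) x = 0}"
    and ind: "inj_on b K" "independent (b ` K)" and x: "\<And>i. x $ i \<noteq> 0"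
    and \<xi>: "\<forall>B\<in>components (real_complement m b). \<xi> B \<in> B"
    and G: "G \<in> power_ideal b p K"
  shows "ev_eq (zext (contribution m b p G \<xi> (cvec x))) (\<lambda>_. 0)"
proof -
  let ?C = "chambers_at m b (cvec x)"
  let ?f = "\<lambda>B. {j \<in> K. ell (b j) (\<xi> B) > 0}"
  let ?s = "complex_of_real (\<Prod>i\<in>UNIV. sgn (x $ i))"
  note ch = chambers_at_point[OF x K ind \<xi>]
  have KA: "active_set m b (cvec x) = K" by (simp only: active_set_cvec K)
  have finK: "finite K" by (simp add: K)
  define y where "y Q = \<xi> (inv_into ?C ?f Q)" for Q
  have bij: "bij_betw (inv_into ?C ?f) (Pow K) ?C" by (rule bij_betw_inv_into[OF ch(4)])
  have inC: "inv_into ?C ?f Q \<in> ?C" if "Q \<subseteq> K" for Q using bij_betwE[OF bij] that by blast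
  have fQ: "{j \<in> K. ell (b j) (y Q) > 0} = Q" if "Q \<subseteq> K" for Q
    using bij_betw_inv_into_right[OF ch(4), of Q] that by (simp add: y_def)
  have sk: "sgn (ell (b j) (y Q)) = (if j \<in> Q then 1 else - 1)" if Q: "Q \<subseteq> K" and j: "j \<in> K" for Q j
  proof -
    have "j \<in> Q \<longleftrightarrow> ell (b j) (y Q) > 0" using fQ[OF Q] j by blast
    moreover have "ell (b j) (y Q) \<noteq> 0" using ch(1)[OF inC[OF Q]] j K by (simp add: off_walls_def y_def)
    ultimately show ?thesis by (cases "ell (b j) (y Q) > 0") auto
  qed
  have "(\<lambda>s. \<Sum>B\<in>?C. of_real ((\<Prod>i\<in>UNIV. sgn (\<xi> B $ i)) * (\<Prod>j\<in>K. sgn (ell (b j) (\<xi> B)))) * fibre b {1..m} p (\<xi> B) s)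
      = (\<lambda>s. ?s * (\<Sum>Q\<in>Pow K. (- 1) ^ card (K - Q) * fibre b {1..m} p (y Q) s))"
  proof
    fix s
    have "(\<Sum>B\<in>?C. of_real ((\<Prod>i\<in>UNIV. sgn (\<xi> B $ i)) * (\<Prod>j\<in>K. sgn (ell (b j) (\<xi> B)))) * fibre b {1..m} p (\<xi> B) s)
      = (\<Sum>Q\<in>Pow K. of_real ((\<Prod>i\<in>UNIV. sgn (y Q $ i)) * (\<Prod>j\<in>K. sgn (ell (b j) (y Q)))) * fibre b {1..m} p (y Q) s)"
      unfolding y_def by (rule sum.reindex_bij_betw[OF bij, symmetric])
    also have "\<dots> = (\<Sum>Q\<in>Pow K. ?s * ((- 1) ^ card (K - Q) * fibre b {1..m} p (y Q) s))"
    proof (intro sum.cong refl)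
      fix Q assume "Q \<in> Pow K"
      then have Q: "Q \<subseteq> K" by simp
      have "(\<Prod>i\<in>UNIV. sgn (y Q $ i)) = (\<Prod>i\<in>UNIV. sgn (x $ i))"
        using ch(2)[OF inC[OF Q]] by (simp add: y_def)
      moreover have "(\<Prod>j\<in>K. sgn (ell (b j) (y Q))) = (- 1) ^ card (K - Q)"
      proof -
        have "(\<Prod>j\<in>K. sgn (ell (b j) (y Q))) = (\<Prod>j\<in>K - Q. - 1)"
          by (rule prod.mono_neutral_cong_right[OF finK]) (use sk[OF Q] in auto)
        then show ?thesis by simp
      qed
      ultimately show "of_real ((\<Prod>i\<in>UNIV. sgn (y Q $ i)) * (\<Prod>j\<in>K. sgn (ell (b j) (y Q)))) * fibre b {1..m} p (y Q) s
        = ?s * ((- 1) ^ card (K - Q) * fibre b {1..m} p (y Q) s)"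
        by (simp only: of_real_mult of_real_power of_real_minus of_real_1 mult.assoc)
    qed
    finally show "(\<Sum>B\<in>?C. of_real ((\<Prod>i\<in>UNIV. sgn (\<xi> B $ i)) * (\<Prod>j\<in>K. sgn (ell (b j) (\<xi> B)))) * fibre b {1..m} p (\<xi> B) s)
      = ?s * (\<Sum>Q\<in>Pow K. (- 1) ^ card (K - Q) * fibre b {1..m} p (y Q) s)"
      by (simp only: sum_distrib_left)
  qed
  note F = this
  have st: "ev_eq (poly_act G (\<lambda>s. \<Sum>Q\<in>Pow K. (- 1) ^ card (K - Q) * fibre b {1..m} p (y Q) s)) (\<lambda>_. 0)"
  proof (rule star_vanishing[OF finite_atLeastAtMost _ p _ _ _ sk G])
    fix Q assume Q: "Q \<subseteq> K"
    note Q0 = inC[OF Q] inC[OF empty_subsetI]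
    show "off_walls b {1..m} (y Q)" using ch(1)[OF Q0(1)] by (simp only: y_def)
    show "sgn (y Q $ i) = sgn (y {} $ i)" for i using ch(2)[OF Q0(1)] ch(2)[OF Q0(2)] by (simp only: y_def)
    show "sgn (ell (b j) (y Q)) = sgn (ell (b j) (y {}))" if "j \<in> {1..m} - K" for j
      using ch(3)[OF Q0(1) that] ch(3)[OF Q0(2) that] by (simp only: y_def)
  qed (use K in auto)
  have "ev_eq (zext (contribution m b p G \<xi> (cvec x))) (\<lambda>s. ?s * poly_act G (\<lambda>s. \<Sum>Q\<in>Pow K. (- 1) ^ card (K - Q) * fibre b {1..m} p (y Q) s) s)"
    using contribution_eq_fibres[of m b "cvec x" \<xi> p G, OF ch(1)] unfolding KA F poly_act_linear .
  also have "ev_eq \<dots> (\<lambda>s. ?s * 0)" by (rule ev_eq_cmult[OF st])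
  finally show ?thesis by simp
qed

lemma contribution_not_decay:
  fixes x :: "real ^ 'n"
  assumes p: "\<And>j. j \<in> {1..m} \<Longrightarrow> p j \<ge> 1" and K: "K = {j \<in> {1..m}. ell (b j) x = 0}"
    and ind: "inj_on b K" "independent (b ` K)" and x: "\<And>i. x $ i \<noteq> 0"
    and \<xi>: "\<forall>B\<in>components (real_complement m b). \<xi> B \<in> B"
    and c: "\<And>j. j \<in> K \<Longrightarrow> c j > 0" and crit: "\<And>i. r $ i / x $ i = dual_sum b K c $ i"
    and G: "G \<notin> power_ideal b p K"
  shows "\<not> decays r (rheight r x) (zext (contribution m b p G \<xi> (cvec x)))"
proof
  let ?C = "chambers_at m b (cvec x)"
  assume d: "decays r (rheight r x) (zext (contribution m b p G \<xi> (cvec x)))"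
  note ch = chambers_at_point[OF x K ind \<xi>]
  have KA: "active_set m b (cvec x) = K" by (simp only: active_set_cvec K)
  have "finite (Pow K)" by (simp add: K)
  then have finC: "finite ?C" using bij_betw_finite[OF ch(4)] by blast
  have "K \<in> (\<lambda>B. {j \<in> K. ell (b j) (\<xi> B) > 0}) ` ?C" using bij_betw_imp_surj_on[OF ch(4)] by blast
  then obtain B0 where B0: "B0 \<in> ?C" "\<And>j. j \<in> K \<Longrightarrow> ell (b j) (\<xi> B0) > 0" by blast
  have "\<not> decays r (rheight r x) (poly_act G (\<lambda>s. \<Sum>B\<in>?C. of_real ((\<Prod>i\<in>UNIV. sgn (\<xi> B $ i)) * (\<Prod>j\<in>K. sgn (ell (b j) (\<xi> B)))) * fibre b {1..m} p (\<xi> B) s))"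
    by (rule full_fibres_lower_bound[where c=c and x=x and y=\<xi>, OF finite_atLeastAtMost _ ind p finC ch(1) x _ c crit B0(1) ch(2)[OF B0(1)] B0(2) G])
      (use K in auto)
  moreover have "decays r (rheight r x) (poly_act G (\<lambda>s. \<Sum>B\<in>?C. of_real ((\<Prod>i\<in>UNIV. sgn (\<xi> B $ i)) * (\<Prod>j\<in>K. sgn (ell (b j) (\<xi> B)))) * fibre b {1..m} p (\<xi> B) s))"
    using decays_ev_eq[OF d contribution_eq_fibres[of m b "cvec x" \<xi> p G, OF ch(1)]] unfolding KA .
  ultimately show False by (rule notE)
qed

end

theorem theorem4p27:
  fixes m :: nat
    and b :: "nat \<Rightarrow> real ^ 'n::finite"
    and p :: "nat \<Rightarrow> nat"
    and G :: "'n cpoly"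
    and a :: "nat ^ 'n \<Rightarrow> complex"
    and r :: "real ^ 'n"
    and \<xi> :: "(real ^ 'n) set \<Rightarrow> real ^ 'n"
    and K :: "nat set"
    and \<sigma> :: "complex ^ 'n"
  assumes distinct: "inj_on b {1..m}"
    and nonzero: "\<forall>j\<in>{1..m}. b j \<noteq> 0"
    and exponents: "\<forall>j\<in>{1..m}. p j \<ge> 1"
    and reduced: "\<forall>j\<in>{1..m}. \<not> ell_poly (b j) dvd G"
    and coefficients: "has_power_series_at_0 (ratfun m b p G) a"
    and simple: "simple_arrangement m b"
    and direction_pos: "\<forall>i. r $ i > 0"
    and direction_sum: "(\<Sum>i\<in>UNIV. r $ i) = 1"
    and generic: "generic_direction m b r"
    and base_points: "\<forall>B\<in>components (real_complement m b). \<xi> B \<in> B"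
    and contrib: "contributing m b r \<sigma>"
    and K: "K \<noteq> {}" "K \<subseteq> {1..m}" "\<sigma> \<in> stratum m b (flat b K)" "active_set m b \<sigma> = K"
  shows "(G \<in> power_ideal b p K \<longrightarrow>
            nbhd_rate r (contribution m b p G \<xi> \<sigma>) < ereal (height r \<sigma>) \<and>
            ((\<forall>\<sigma>'. critical_point m b r \<sigma>' \<and> \<sigma>' \<noteq> \<sigma> \<and> height r \<sigma>' \<ge> height r \<sigma>
                    \<longrightarrow> ruled_out m b p G r \<sigma>')
             \<longrightarrow> nbhd_rate r a < ereal (height r \<sigma>)))
       \<and> (G \<notin> power_ideal b p K \<longrightarrow>
            nbhd_rate r (contribution m b p G \<xi> \<sigma>) \<ge> ereal (height r \<sigma>) \<and>
            ((\<forall>\<sigma>'. critical_point m b r \<sigma>' \<and> height r \<sigma>' > height r \<sigma>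
                    \<longrightarrow> ruled_out m b p G r \<sigma>')
             \<longrightarrow> nbhd_rate r a = ereal (height r \<sigma>)))"
proof -
  interpret direction r using direction_pos direction_sum by unfold_locales auto
  have p: "\<And>j. j \<in> {1..m} \<Longrightarrow> p j \<ge> 1" using exponents by blast
  obtain x c where x: "\<sigma> = cvec x" "\<And>i. x $ i \<noteq> 0" "\<And>j. j \<in> K \<Longrightarrow> c j > 0" "\<And>i. r $ i / x $ i = dual_sum b K c $ i"
    using contributing_real[OF contrib] unfolding K(4) by metis
  have Kx: "K = {j \<in> {1..m}. ell (b j) x = 0}" using K(4) by (simp only: x(1) active_set_cvec)
  have ind: "inj_on b K" "independent (b ` K)" using simple_arrangement_active[OF simple, of \<sigma>] unfolding K(4) by auto
  have H: "height r \<sigma> = rheight r x" by (simp only: x(1) height_cvec)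
  have rate: "nbhd_rate r d < ereal h \<longleftrightarrow> decays r h (zext d)" for d h
    using nbhd_rate_less_iff_decays[of "zext d" h] by simp
  have crit: "critical_point m b r \<sigma>'" if "contributing m b r \<sigma>'" for \<sigma>' using that by (simp add: contributing_def)
  show ?thesis
  proof (intro conjI impI)
    assume G: "G \<in> power_ideal b p K"
    have "decays r (height r \<sigma>) (\<lambda>_. 0)" by (rule decays_zero[of 0]) simp
    then show "nbhd_rate r (contribution m b p G \<xi> \<sigma>) < ereal (height r \<sigma>)"
      unfolding rate x(1) by (rule decays_ev_eq[OF _ ev_eq_sym[OF contribution_vanishes[OF p Kx ind x(2) base_points G]]])
    assume out: "\<forall>\<sigma>'. critical_point m b r \<sigma>' \<and> \<sigma>' \<noteq> \<sigma> \<and> height r \<sigma>' \<ge> height r \<sigma> \<longrightarrow> ruled_out m b p G r \<sigma>'"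
    show "nbhd_rate r a < ereal (height r \<sigma>)" unfolding rate
    proof (rule coefficients_decay[OF coefficients p simple generic])
      fix \<sigma>' assume "contributing m b r \<sigma>'" "height r \<sigma> \<le> height r \<sigma>'"
      then show "G \<in> power_ideal b p (active_set m b \<sigma>')"
        using out crit G K(4) unfolding ruled_out_def by (cases "\<sigma>' = \<sigma>") auto
    qed
  next
    assume G: "G \<notin> power_ideal b p K"
    show "nbhd_rate r (contribution m b p G \<xi> \<sigma>) \<ge> ereal (height r \<sigma>)"
    proof -
      have "\<not> nbhd_rate r (contribution m b p G \<xi> \<sigma>) < ereal (height r \<sigma>)"
        unfolding rate H unfolding x(1) by (rule contribution_not_decay[OF p Kx ind x(2) base_points x(3,4) G])
      then show ?thesis by simp
    qed
    assume out: "\<forall>\<sigma>'. critical_point m b r \<sigma>' \<and> height r \<sigma>' > height r \<sigma> \<longrightarrow> ruled_out m b p G r \<sigma>'"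
    show "nbhd_rate r a = ereal (height r \<sigma>)"
    proof (rule antisym)
      have "\<not> decays r (height r \<sigma>) (zext a)" unfolding H
        by (rule coefficients_not_decay[OF coefficients p K(2) ind x(2) _ x(3,4) G]) (use Kx in auto)
      then show "ereal (height r \<sigma>) \<le> nbhd_rate r a" using rate[of a] by (simp only: not_less[symmetric] not_False_eq_True)
      show "nbhd_rate r a \<le> ereal (height r \<sigma>)"
      proof (rule ccontr)
        assume "\<not> ?thesis"
        then obtain h where h: "ereal (height r \<sigma>) < ereal h" "ereal h < nbhd_rate r a" using ereal_dense2[of "ereal (height r \<sigma>)"] by (auto simp: not_le)
        have "decays r h (zext a)"
        proof (rule coefficients_decay[OF coefficients p simple generic])
          fix \<sigma>' assume "contributing m b r \<sigma>'" "h \<le> height r \<sigma>'"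
          then show "G \<in> power_ideal b p (active_set m b \<sigma>')" using out crit h(1) unfolding ruled_out_def by auto
        qed
        then have "nbhd_rate r a < ereal h" by (simp only: rate)
        then show False using h(2) by simp
      qed
    qed
  qed
qed

end
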